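(* Let $A$ be a finite-dimensional weakly symmetric indecomposable algebra over an algebraically closed field $K$, with Jacobson radical $J$ satisfying $J^3=0\ne J^2$. Let $M$ be an indecomposable non-projective $A$-module such that $\Omega^l(M)$ is not simple for all $l\ge 0$. If $M$ is ext-finite, then $\alpha_1=\beta_1$. In particular $\lambda=2$.
   Context: Modules are finite-dimensional left modules. $A$ is weakly symmetric if it is selfinjective and every indecomposable projective module $P$ has simple socle with $\mathrm{soc}(P)\cong P/\mathrm{rad}(P)$. $A$ is indecomposable if it is not a direct product of two non-zero algebras. A module $M$ is ext-finite if there is some $n\ge0$ with $\mathrm{Ext}^k_A(M,M)=0$ for all $k>n$. $\Omega(M)$ denotes the kernel of a projective cover of $M$, and $\Omega^l$ its $l$-fold iterate. Let $S_1,\dots,S_r$ be the simple $A$-modules up to isomorphism and $E=(\dim_K\mathrm{Ext}^1_A(S_i,S_j))_{i,j}$, an $r\times r$ matrix. Under these assumptions $E$ is symmetric and irreducible, with non-negative integer entries. Let $\lambda$ be the largest eigenvalue of $E$; it has multiplicity one, and there is a unique unit eigenvector $\underline{v}=(v_1,\dots,v_r)$ for $\lambda$ with all $v_i>0$. A module $M$ as in the claim satisfies $\mathrm{soc}(M)=\mathrm{rad}(M)$. Let $t_i$ be the multiplicity of $S_i$ in $M/\mathrm{rad}(M)$ and $s_i$ the multiplicity of $S_i$ in $\mathrm{soc}(M)$. Define $\alpha_1=\sum_{i=1}^r s_iv_i$ and $\beta_1=\sum_{i=1}^r t_iv_i$. *)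

theory Defs
  imports
    "HOL-Algebra.Algebraic_Closure"
    "HOL-Algebra.Ideal_Product"
    "Jordan_Normal_Form.Missing_VectorSpace"
    "Jordan_Normal_Form.Char_Poly"
begin

hide_const (open) Polynomial.smult Multiset.mult

section \<open>Finite-dimensional algebras and their left modules\<close>

locale fd_algebra =
  A?: ring A + V?: vectorspace K A for K :: "'k ring" and A :: "('k, 'a) module" +
  assumes fin_dim_carrier: "vectorspace.fin_dim K A"
    and smult_mult_left:
      "\<lbrakk>c \<in> carrier K; x \<in> carrier A; y \<in> carrier A\<rbrakk> \<Longrightarrow>
        (c \<odot>\<^bsub>A\<^esub> x) \<otimes>\<^bsub>A\<^esub> y = c \<odot>\<^bsub>A\<^esub> (x \<otimes>\<^bsub>A\<^esub> y)"
    and smult_mult_right: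
      "\<lbrakk>c \<in> carrier K; x \<in> carrier A; y \<in> carrier A\<rbrakk> \<Longrightarrow>
        x \<otimes>\<^bsub>A\<^esub> (c \<odot>\<^bsub>A\<^esub> y) = c \<odot>\<^bsub>A\<^esub> (x \<otimes>\<^bsub>A\<^esub> y)"

text \<open>
  The locale \<^locale>\<open>module\<close> asks for a commutative ring of scalars, so left modules get their own
  locale. It uses the same record type; as there, the fields \<^const>\<open>mult\<close> and \<^const>\<open>one\<close> of the
  record carry no meaning for a module.
\<close>

locale left_module =
  A?: ring A + M?: abelian_group M
  for A :: "('a, 'z) ring_scheme" and M :: "('a, 'm) module" +
  assumes lsmult_closed: "\<lbrakk>a \<in> carrier A; x \<in> carrier M\<rbrakk> \<Longrightarrow> a \<odot>\<^bsub>M\<^esub> x \<in> carrier M"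
    and lsmult_l_distr:
      "\<lbrakk>a \<in> carrier A; b \<in> carrier A; x \<in> carrier M\<rbrakk> \<Longrightarrow>
        (a \<oplus>\<^bsub>A\<^esub> b) \<odot>\<^bsub>M\<^esub> x = a \<odot>\<^bsub>M\<^esub> x \<oplus>\<^bsub>M\<^esub> b \<odot>\<^bsub>M\<^esub> x"
    and lsmult_r_distr:
      "\<lbrakk>a \<in> carrier A; x \<in> carrier M; y \<in> carrier M\<rbrakk> \<Longrightarrow>
        a \<odot>\<^bsub>M\<^esub> (x \<oplus>\<^bsub>M\<^esub> y) = a \<odot>\<^bsub>M\<^esub> x \<oplus>\<^bsub>M\<^esub> a \<odot>\<^bsub>M\<^esub> y"
    and lsmult_assoc:
      "\<lbrakk>a \<in> carrier A; b \<in> carrier A; x \<in> carrier M\<rbrakk> \<Longrightarrow>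
        (a \<otimes>\<^bsub>A\<^esub> b) \<odot>\<^bsub>M\<^esub> x = a \<odot>\<^bsub>M\<^esub> (b \<odot>\<^bsub>M\<^esub> x)"
    and lsmult_one: "x \<in> carrier M \<Longrightarrow> \<one>\<^bsub>A\<^esub> \<odot>\<^bsub>M\<^esub> x = x"

text \<open>The \<open>K\<close>-space underlying an \<open>A\<close>-module: \<open>c\<close> acts as \<open>c 1\<^sub>A\<close>.\<close>

definition scalars :: "('k, 'a) module \<Rightarrow> ('a, 'm) module \<Rightarrow> ('k, 'm) module" where
  "scalars A M =
     \<lparr>carrier = carrier M, mult = mult M, one = one M, zero = zero M, add = add M,
      smult = (\<lambda>c x. (c \<odot>\<^bsub>A\<^esub> \<one>\<^bsub>A\<^esub>) \<odot>\<^bsub>M\<^esub> x)\<rparr>"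

definition fd_module :: "'k ring \<Rightarrow> ('k, 'a) module \<Rightarrow> ('a, 'm) module \<Rightarrow> bool" where
  "fd_module K A M \<longleftrightarrow> left_module A M \<and> vectorspace.fin_dim K (scalars A M)"

definition regular_module :: "('k, 'a) module \<Rightarrow> ('a, 'a) module" where
  "regular_module A =
     \<lparr>carrier = carrier A, mult = mult A, one = one A, zero = zero A, add = add A,
      smult = mult A\<rparr>"

definition left_submodule :: "('a, 'z) ring_scheme \<Rightarrow> 'm set \<Rightarrow> ('a, 'm) module \<Rightarrow> bool" where
  "left_submodule A N M \<longleftrightarrow>
     N \<subseteq> carrier M \<and> \<zero>\<^bsub>M\<^esub> \<in> N \<and> (\<forall>x\<in>N. \<forall>y\<in>N. x \<oplus>\<^bsub>M\<^esub> y \<in> N) \<and>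
     (\<forall>a\<in>carrier A. \<forall>x\<in>N. a \<odot>\<^bsub>M\<^esub> x \<in> N)"

abbreviation submod :: "('a, 'm) module \<Rightarrow> 'm set \<Rightarrow> ('a, 'm) module" where
  "submod M N \<equiv> M\<lparr>carrier := N\<rparr>"

definition quot_module :: "('a, 'm) module \<Rightarrow> 'm set \<Rightarrow> ('a, 'm set) module" where
  "quot_module M N =
     \<lparr>carrier = a_rcosets\<^bsub>M\<^esub> N, mult = (\<lambda>C D. N), one = N, zero = N, add = set_add M,
      smult = (\<lambda>a C. \<Union>x\<in>C. N +>\<^bsub>M\<^esub> (a \<odot>\<^bsub>M\<^esub> x))\<rparr>"

definition module_iso :: "('a, 'z) ring_scheme \<Rightarrow> ('a, 'm) module \<Rightarrow> ('a, 'n) module \<Rightarrow> bool" where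
  "module_iso A M N \<longleftrightarrow> (\<exists>f\<in>module_hom A M N. bij_betw f (carrier M) (carrier N))"

definition simple_module :: "('a, 'z) ring_scheme \<Rightarrow> ('a, 'm) module \<Rightarrow> bool" where
  "simple_module A M \<longleftrightarrow>
     left_module A M \<and> carrier M \<noteq> {\<zero>\<^bsub>M\<^esub>} \<and>
     (\<forall>N. left_submodule A N M \<longrightarrow> N = {\<zero>\<^bsub>M\<^esub>} \<or> N = carrier M)"

definition indecomposable_module :: "('a, 'z) ring_scheme \<Rightarrow> ('a, 'm) module \<Rightarrow> bool" where
  "indecomposable_module A M \<longleftrightarrow>
     left_module A M \<and> carrier M \<noteq> {\<zero>\<^bsub>M\<^esub>} \<and>
     (\<forall>N L. left_submodule A N M \<longrightarrow> left_submodule A L M \<longrightarrow>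
        N \<inter> L = {\<zero>\<^bsub>M\<^esub>} \<longrightarrow> N <+>\<^bsub>M\<^esub> L = carrier M \<longrightarrow> N = {\<zero>\<^bsub>M\<^esub>} \<or> L = {\<zero>\<^bsub>M\<^esub>})"

text \<open>The sum of all simple submodules, i.e. the least submodule containing them.\<close>

definition soc :: "('a, 'z) ring_scheme \<Rightarrow> ('a, 'm) module \<Rightarrow> 'm set" where
  "soc A M =
     \<Inter>{N. left_submodule A N M \<and>
         (\<forall>U. left_submodule A U M \<longrightarrow> simple_module A (submod M U) \<longrightarrow> U \<subseteq> N)}"

definition maximal_submodule :: "('a, 'z) ring_scheme \<Rightarrow> 'm set \<Rightarrow> ('a, 'm) module \<Rightarrow> bool" where
  "maximal_submodule A N M \<longleftrightarrow>
     left_submodule A N M \<and> N \<noteq> carrier M \<and>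
     (\<forall>L. left_submodule A L M \<longrightarrow> N \<subseteq> L \<longrightarrow> L = N \<or> L = carrier M)"

definition rad :: "('a, 'z) ring_scheme \<Rightarrow> ('a, 'm) module \<Rightarrow> 'm set" where
  "rad A M = carrier M \<inter> \<Inter>{N. maximal_submodule A N M}"

definition top_module :: "('a, 'z) ring_scheme \<Rightarrow> ('a, 'm) module \<Rightarrow> ('a, 'm set) module" where
  "top_module A M = quot_module M (rad A M)"

text \<open>
  The multiplicity of the simple module \<open>S\<close> in a semisimple module \<open>N\<close>: the number of summands
  isomorphic to \<open>S\<close> in a decomposition of \<open>N\<close> as an internal direct sum
  \<open>U\<^sub>0 \<oplus> \<dots> \<oplus> U\<^sub>n\<^sub>-\<^sub>1\<close> of simple submodules.
\<close>

definition simple_decomposition ::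
    "('a, 'z) ring_scheme \<Rightarrow> ('a, 'm) module \<Rightarrow> nat \<Rightarrow> (nat \<Rightarrow> 'm set) \<Rightarrow> bool" where
  "simple_decomposition A N n U \<longleftrightarrow>
     (\<forall>i<n. left_submodule A (U i) N \<and> simple_module A (submod N (U i))) \<and>
     bij_betw (\<lambda>u. finsum N u {..<n}) (Pi\<^sub>E {..<n} U) (carrier N)"

definition simple_multiplicity ::
    "('a, 'z) ring_scheme \<Rightarrow> ('a, 's) module \<Rightarrow> ('a, 'm) module \<Rightarrow> nat" where
  "simple_multiplicity A S N =
     (THE m. \<exists>n U. simple_decomposition A N n U \<and>
        m = card {i. i < n \<and> module_iso A (submod N (U i)) S})"

section \<open>Projective and injective modules\<close>

text \<open>
  All modules are finite-dimensional over \<open>K\<close>, so every module is isomorphic to one whose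
  elements are coordinate tuples over \<open>K\<close>. HOL cannot quantify over types inside a formula; bound
  quantifiers over modules therefore range over modules with carrier type \<^typ>\<open>'k list\<close>.
\<close>

definition projective_module :: "'k ring \<Rightarrow> ('k, 'a) module \<Rightarrow> ('a, 'm) module \<Rightarrow> bool" where
  "projective_module K A P \<longleftrightarrow>
     fd_module K A P \<and>
     (\<forall>(L :: ('a, 'k list) module) (N :: ('a, 'k list) module).
        fd_module K A L \<longrightarrow> fd_module K A N \<longrightarrow>
        (\<forall>g\<in>module_hom A L N. \<forall>f\<in>module_hom A P N. g ` carrier L = carrier N \<longrightarrow>
           (\<exists>h\<in>module_hom A P L. \<forall>x\<in>carrier P. g (h x) = f x)))"

definition injective_module :: "'k ring \<Rightarrow> ('k, 'a) module \<Rightarrow> ('a, 'm) module \<Rightarrow> bool" where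
  "injective_module K A I \<longleftrightarrow>
     fd_module K A I \<and>
     (\<forall>(L :: ('a, 'k list) module) (N :: ('a, 'k list) module).
        fd_module K A L \<longrightarrow> fd_module K A N \<longrightarrow>
        (\<forall>g\<in>module_hom A L N. \<forall>f\<in>module_hom A L I. inj_on g (carrier L) \<longrightarrow>
           (\<exists>h\<in>module_hom A N I. \<forall>x\<in>carrier L. h (g x) = f x)))"

definition projective_cover ::
    "'k ring \<Rightarrow> ('k, 'a) module \<Rightarrow> ('a, 'p) module \<Rightarrow> ('p \<Rightarrow> 'm) \<Rightarrow> ('a, 'm) module \<Rightarrow> bool" where
  "projective_cover K A P \<pi> M \<longleftrightarrow>
     projective_module K A P \<and> \<pi> \<in> module_hom A P M \<and> \<pi> ` carrier P = carrier M \<and>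
     (\<forall>N. left_submodule A N P \<longrightarrow> N <+>\<^bsub>P\<^esub> a_kernel P M \<pi> = carrier P \<longrightarrow> N = carrier P)"

text \<open>
  \<open>is_Omega K A M N\<close> says that \<open>N\<close> is (isomorphic to) \<open>\<Omega>(M)\<close>, and
  \<open>is_Omega_pow K A l M N\<close> that \<open>N\<close> is (isomorphic to) \<open>\<Omega>\<^sup>l(M)\<close>.
\<close>

definition is_Omega ::
    "'k ring \<Rightarrow> ('k, 'a) module \<Rightarrow> ('a, 'm) module \<Rightarrow> ('a, 'k list) module \<Rightarrow> bool" where
  "is_Omega K A M N \<longleftrightarrow>
     fd_module K A N \<and>
     (\<exists>(P :: ('a, 'k list) module) \<pi>. projective_cover K A P \<pi> M \<and>
        module_iso A (submod P (a_kernel P M \<pi>)) N)"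

primrec is_Omega_pow ::
    "'k ring \<Rightarrow> ('k, 'a) module \<Rightarrow> nat \<Rightarrow> ('a, 'm) module \<Rightarrow> ('a, 'k list) module \<Rightarrow> bool" where
  "is_Omega_pow K A 0 M N \<longleftrightarrow> fd_module K A N \<and> module_iso A M N"
| "is_Omega_pow K A (Suc l) M N \<longleftrightarrow> (\<exists>L. is_Omega_pow K A l M L \<and> is_Omega K A L N)"

section \<open>Extension groups\<close>

definition projective_resolution ::
    "'k ring \<Rightarrow> ('k, 'a) module \<Rightarrow> ('a, 'm) module \<Rightarrow>
     (nat \<Rightarrow> ('a, 'k list) module) \<Rightarrow> (nat \<Rightarrow> 'k list \<Rightarrow> 'k list) \<Rightarrow> ('k list \<Rightarrow> 'm) \<Rightarrow> bool" where
  "projective_resolution K A M P d \<epsilon> \<longleftrightarrow>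
     (\<forall>n. projective_module K A (P n)) \<and>
     \<epsilon> \<in> module_hom A (P 0) M \<and> \<epsilon> ` carrier (P 0) = carrier M \<and>
     (\<forall>n. d n \<in> module_hom A (P (Suc n)) (P n)) \<and>
     d 0 ` carrier (P 1) = a_kernel (P 0) M \<epsilon> \<and>
     (\<forall>n. d (Suc n) ` carrier (P (Suc (Suc n))) = a_kernel (P (Suc n)) (P n) (d n))"

definition hom_space ::
    "('k, 'a) module \<Rightarrow> ('a, 'm) module \<Rightarrow> ('a, 'n) module \<Rightarrow> ('k, 'm \<Rightarrow> 'n) module" where
  "hom_space A M N =
     \<lparr>carrier = module_hom A M N \<inter> extensional (carrier M),
      mult = (\<lambda>f g. \<lambda>x\<in>carrier M. \<zero>\<^bsub>N\<^esub>), one = (\<lambda>x\<in>carrier M. \<zero>\<^bsub>N\<^esub>),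
      zero = (\<lambda>x\<in>carrier M. \<zero>\<^bsub>N\<^esub>),
      add = (\<lambda>f g. \<lambda>x\<in>carrier M. f x \<oplus>\<^bsub>N\<^esub> g x),
      smult = (\<lambda>c f. \<lambda>x\<in>carrier M. (c \<odot>\<^bsub>A\<^esub> \<one>\<^bsub>A\<^esub>) \<odot>\<^bsub>N\<^esub> f x)\<rparr>"

definition hom_cocycles ::
    "('k, 'a) module \<Rightarrow> (nat \<Rightarrow> ('a, 'p) module) \<Rightarrow> (nat \<Rightarrow> 'p \<Rightarrow> 'p) \<Rightarrow> ('a, 'n) module \<Rightarrow> nat \<Rightarrow>
     ('p \<Rightarrow> 'n) set" where
  "hom_cocycles A P d N n =
     {f \<in> carrier (hom_space A (P n) N). \<forall>x\<in>carrier (P (Suc n)). f (d n x) = \<zero>\<^bsub>N\<^esub>}"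

fun hom_coboundaries ::
    "('k, 'a) module \<Rightarrow> (nat \<Rightarrow> ('a, 'p) module) \<Rightarrow> (nat \<Rightarrow> 'p \<Rightarrow> 'p) \<Rightarrow> ('a, 'n) module \<Rightarrow> nat \<Rightarrow>
     ('p \<Rightarrow> 'n) set" where
  "hom_coboundaries A P d N 0 = {\<zero>\<^bsub>hom_space A (P 0) N\<^esub>}"
| "hom_coboundaries A P d N (Suc n) =
     (\<lambda>g. \<lambda>x\<in>carrier (P (Suc n)). g (d n x)) ` carrier (hom_space A (P n) N)"

text \<open>
  \<open>Ext\<^sup>n(M, N)\<close> is the cohomology in degree \<open>n\<close> of \<open>Hom(P, N)\<close> for a chosen projective
  resolution \<open>P\<close> of \<open>M\<close>; up to isomorphism it does not depend on the choice.
\<close>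

definition ext_space ::
    "'k ring \<Rightarrow> ('k, 'a) module \<Rightarrow> nat \<Rightarrow> ('a, 'm) module \<Rightarrow> ('a, 'n) module \<Rightarrow>
     ('k, ('k list \<Rightarrow> 'n) set) module" where
  "ext_space K A n M N =
     (let (P, d, \<epsilon>) = (SOME (P, d, \<epsilon>). projective_resolution K A M P d \<epsilon>)
      in quot_module (submod (hom_space A (P n) N) (hom_cocycles A P d N n))
           (hom_coboundaries A P d N n))"

definition ext_finite :: "'k ring \<Rightarrow> ('k, 'a) module \<Rightarrow> ('a, 'm) module \<Rightarrow> bool" where
  "ext_finite K A M \<longleftrightarrow>
     (\<exists>n::nat. \<forall>k>n. carrier (ext_space K A k M M) = {\<zero>\<^bsub>ext_space K A k M M\<^esub>})"

section \<open>Classes of algebras\<close>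

text \<open>The Jacobson radical of \<open>A\<close>: the intersection of the maximal left ideals.\<close>

definition jacobson_radical :: "('k, 'a) module \<Rightarrow> 'a set" where
  "jacobson_radical A = rad A (regular_module A)"

definition selfinjective :: "'k ring \<Rightarrow> ('k, 'a) module \<Rightarrow> bool" where
  "selfinjective K A \<longleftrightarrow> injective_module K A (regular_module A)"

definition weakly_symmetric :: "'k ring \<Rightarrow> ('k, 'a) module \<Rightarrow> bool" where
  "weakly_symmetric K A \<longleftrightarrow>
     selfinjective K A \<and>
     (\<forall>P :: ('a, 'k list) module. projective_module K A P \<longrightarrow> indecomposable_module A P \<longrightarrow>
        simple_module A (submod P (soc A P)) \<and>
        module_iso A (submod P (soc A P)) (top_module A P))"

definition algebra_prod :: "('k, 'a) module \<Rightarrow> ('k, 'b) module \<Rightarrow> ('k, 'a \<times> 'b) module" where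
  "algebra_prod B C =
     \<lparr>carrier = carrier B \<times> carrier C,
      mult = (\<lambda>x y. (fst x \<otimes>\<^bsub>B\<^esub> fst y, snd x \<otimes>\<^bsub>C\<^esub> snd y)),
      one = (\<one>\<^bsub>B\<^esub>, \<one>\<^bsub>C\<^esub>), zero = (\<zero>\<^bsub>B\<^esub>, \<zero>\<^bsub>C\<^esub>),
      add = (\<lambda>x y. (fst x \<oplus>\<^bsub>B\<^esub> fst y, snd x \<oplus>\<^bsub>C\<^esub> snd y)),
      smult = (\<lambda>c x. (c \<odot>\<^bsub>B\<^esub> fst x, c \<odot>\<^bsub>C\<^esub> snd x))\<rparr>"

definition algebra_iso :: "'k ring \<Rightarrow> ('k, 'a) module \<Rightarrow> ('k, 'b) module \<Rightarrow> bool" where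
  "algebra_iso K A B \<longleftrightarrow>
     (\<exists>f. f \<in> Ring.ring_hom A B \<and> f \<in> module_hom K A B \<and> bij_betw f (carrier A) (carrier B))"

text \<open>
  The factors of a decomposition of \<open>A\<close> embed into \<open>A\<close> as subsets, so the carrier type \<^typ>\<open>'a\<close> of
  \<open>A\<close> is large enough for them.
\<close>

definition indecomposable_algebra :: "'k ring \<Rightarrow> ('k, 'a) module \<Rightarrow> bool" where
  "indecomposable_algebra K A \<longleftrightarrow>
     \<not> (\<exists>(B :: ('k, 'a) module) (C :: ('k, 'a) module).
          fd_algebra K B \<and> fd_algebra K C \<and>
          carrier B \<noteq> {\<zero>\<^bsub>B\<^esub>} \<and> carrier C \<noteq> {\<zero>\<^bsub>C\<^esub>} \<and>
          algebra_iso K A (algebra_prod B C))"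

section \<open>The matrix of first extension groups and its Perron eigenvector\<close>

definition simple_representatives ::
    "'k ring \<Rightarrow> ('k, 'a) module \<Rightarrow> nat \<Rightarrow> (nat \<Rightarrow> ('a, 's) module) \<Rightarrow> bool" where
  "simple_representatives K A r S \<longleftrightarrow>
     (\<forall>i<r. simple_module A (S i)) \<and>
     (\<forall>i<r. \<forall>j<r. module_iso A (S i) (S j) \<longrightarrow> i = j) \<and>
     (\<forall>T :: ('a, 'k list) module. fd_module K A T \<longrightarrow> simple_module A T \<longrightarrow>
        (\<exists>i<r. module_iso A T (S i)))"

definition ext_matrix ::
    "'k ring \<Rightarrow> ('k, 'a) module \<Rightarrow> nat \<Rightarrow> (nat \<Rightarrow> ('a, 's) module) \<Rightarrow> real mat" where
  "ext_matrix K A r S =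
     mat r r (\<lambda>(i, j). real (vectorspace.dim K (ext_space K A 1 (S i) (S j))))"

definition largest_eigenvalue :: "real mat \<Rightarrow> real" where
  "largest_eigenvalue E = Max {x. eigenvalue E x}"

definition perron_vector :: "real mat \<Rightarrow> real vec" where
  "perron_vector E =
     (THE v. eigenvector E v (largest_eigenvalue E) \<and> v \<bullet> v = 1 \<and> (\<forall>i<dim_vec v. v $ i > 0))"

definition alpha1 ::
    "'k ring \<Rightarrow> ('k, 'a) module \<Rightarrow> nat \<Rightarrow> (nat \<Rightarrow> ('a, 's) module) \<Rightarrow> ('a, 'm) module \<Rightarrow> real" where
  "alpha1 K A r S M =
     (\<Sum>i<r. real (simple_multiplicity A (S i) (submod M (soc A M)))
        * perron_vector (ext_matrix K A r S) $ i)"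

definition beta1 ::
    "'k ring \<Rightarrow> ('k, 'a) module \<Rightarrow> nat \<Rightarrow> (nat \<Rightarrow> ('a, 's) module) \<Rightarrow> ('a, 'm) module \<Rightarrow> real" where
  "beta1 K A r S M =
     (\<Sum>i<r. real (simple_multiplicity A (S i) (top_module A M))
        * perron_vector (ext_matrix K A r S) $ i)"

end

theory Submission imports Defs begin

text \<open>
  Let \<open>P\<^sub>i = Ae\<^sub>i\<close> be the projective cover of \<open>S\<^sub>i\<close>, so that \<open>dim e\<^sub>iN\<close> is the multiplicity of \<open>S\<^sub>i\<close> in
  \<open>N\<close>. The hypotheses force \<open>P\<^sub>i\<close> to have top and socle \<open>S\<^sub>i\<close> and middle layer given by row \<open>i\<close> of \<open>E\<close>.
  Hence, as long as the modules involved are not simple, the top vector \<open>t\<close> and the socle vector \<open>s\<close> of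
  a non-projective indecomposable \<open>N\<close> become \<open>E t - s\<close> and \<open>t\<close> for \<open>\<Omega>(N)\<close>, and \<open>s\<close> and \<open>E s - t\<close> for
  \<open>\<Omega>\<^sup>-\<^sup>1(N)\<close>. If \<open>Ext\<^sup>k(M,M) = 0\<close> for large \<open>k\<close>, then every map \<open>\<Omega>\<^sup>k(M) \<rightarrow> M\<close> factors through a
  projective module and lands in \<open>rad M\<close>; counting homomorphisms from a projective cover of
  \<open>\<Omega>\<^sup>k(M)\<close> into \<open>M\<close> then gives \<open>t \<bullet> t\<^sup>k = s \<bullet> t\<^sup>k\<^sup>+\<^sup>1\<close>, where \<open>t\<^sup>k\<close> is the top vector of \<open>\<Omega>\<^sup>k(M)\<close> and
  \<open>t\<close>, \<open>s\<close> belong to \<open>M\<close>. Projecting to the Perron vector shows that the numbers \<open>v \<bullet> t\<^sup>k\<close> form a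
  geometric progression with ratio \<open>\<rho> = \<beta>\<^sub>1/\<alpha>\<^sub>1\<close>, where \<open>\<rho> + 1/\<rho> = \<lambda>\<close>. They are bounded below by \<open>min v\<^sub>i > 0\<close>,
  so \<open>\<rho> \<ge> 1\<close>; the same argument for \<open>\<Omega>\<^sup>-\<^sup>k(M)\<close> gives \<open>\<rho> \<le> 1\<close> (a simple \<open>\<Omega>\<^sup>-\<^sup>k(M)\<close> cannot occur, as it
  would have socle vector \<open>s = 0\<close> in this count).
\<close>

section \<open>Left modules over a ring\<close>

text \<open>Three obstacles shape the argument. The matrix \<open>E\<close> is introduced through
  the radical layers of the P_i. There its symmetry is the symmetry of Cartan numbers, obtained by
  counting Hom(Q, P_j) twice: once with Q projective, once with P_j injective. Its irreducibility
  says that A has no pair of complementary two-sided ideals. That its entries are dim Ext^1(S_i,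
  S_j) is a separate computation. Next, the resolution behind Ext is an arbitrary choice and need
  not be minimal, so the vanishing of Ext^k has to be carried over to the minimal syzygies up to
  maps through projective modules. Finally, the relation between the tops holds only for large k,
  and the tops may have components along other eigenvectors of \<open>E\<close>. As \<open>E\<close>
  is symmetric, a combination of the relations obtained by applying powers of \<open>E\<close> -
  \<lambda> isolates the Perron component without diagonalising \<open>E\<close>. Multiplicities are
  counted as dim e_i N throughout: additivity on exact sequences is then rank-nullity, and
  composition series are never compared.\<close>

lemma (in abelian_group) minus_eq_zero_iff:
  assumes "x \<in> carrier G" "y \<in> carrier G" shows "x \<ominus> y = \<zero> \<longleftrightarrow> x = y"
  using assms by (metis a_minus_def add.inv_closed minus_equality r_neg)

lemma (in abelian_group) diff_zero [simp]:
  assumes "x \<in> carrier G" shows "x \<ominus> \<zero> = x" using assms by (simp add: a_minus_def)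

context left_module begin

declare lsmult_closed [simp, intro]
declare lsmult_one [simp]

lemma lsmult_l_null [simp]:
  assumes "x \<in> carrier M" shows "\<zero>\<^bsub>A\<^esub> \<odot>\<^bsub>M\<^esub> x = \<zero>\<^bsub>M\<^esub>"
  using lsmult_l_distr[of "\<zero>\<^bsub>A\<^esub>" "\<zero>\<^bsub>A\<^esub>"] assms by simp

lemma lsmult_r_null [simp]:
  assumes "a \<in> carrier A" shows "a \<odot>\<^bsub>M\<^esub> \<zero>\<^bsub>M\<^esub> = \<zero>\<^bsub>M\<^esub>"
  using lsmult_r_distr[of a "\<zero>\<^bsub>M\<^esub>" "\<zero>\<^bsub>M\<^esub>"] assms by simp

lemma lsmult_l_minus:
  assumes "a \<in> carrier A" "x \<in> carrier M" shows "(\<ominus>\<^bsub>A\<^esub> a) \<odot>\<^bsub>M\<^esub> x = \<ominus>\<^bsub>M\<^esub> (a \<odot>\<^bsub>M\<^esub> x)"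
proof (rule M.minus_equality[symmetric])
  show "(\<ominus>\<^bsub>A\<^esub> a) \<odot>\<^bsub>M\<^esub> x \<oplus>\<^bsub>M\<^esub> a \<odot>\<^bsub>M\<^esub> x = \<zero>\<^bsub>M\<^esub>"
    using assms lsmult_l_distr[of "\<ominus>\<^bsub>A\<^esub> a" a] by (simp add: A.l_neg)
qed (use assms in auto)

lemma lsmult_r_minus:
  assumes "a \<in> carrier A" "x \<in> carrier M" shows "a \<odot>\<^bsub>M\<^esub> (\<ominus>\<^bsub>M\<^esub> x) = \<ominus>\<^bsub>M\<^esub> (a \<odot>\<^bsub>M\<^esub> x)"
proof (rule M.minus_equality[symmetric])
  show "a \<odot>\<^bsub>M\<^esub> (\<ominus>\<^bsub>M\<^esub> x) \<oplus>\<^bsub>M\<^esub> a \<odot>\<^bsub>M\<^esub> x = \<zero>\<^bsub>M\<^esub>"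
    using assms lsmult_r_distr[of a "\<ominus>\<^bsub>M\<^esub> x" x] by (simp add: M.l_neg)
qed (use assms in auto)

lemma lsmult_r_diff:
  assumes "a \<in> carrier A" "x \<in> carrier M" "y \<in> carrier M"
  shows "a \<odot>\<^bsub>M\<^esub> (x \<ominus>\<^bsub>M\<^esub> y) = a \<odot>\<^bsub>M\<^esub> x \<ominus>\<^bsub>M\<^esub> a \<odot>\<^bsub>M\<^esub> y"
  using assms by (simp add: M.minus_eq lsmult_r_distr lsmult_r_minus)

lemma lsub_carrier: "left_submodule A (carrier M) M" by (auto simp: left_submodule_def)

lemma lsub_0: "left_submodule A {\<zero>\<^bsub>M\<^esub>} M" by (auto simp: left_submodule_def)

lemma lsub_neg:
  assumes "left_submodule A U M" "x \<in> U" shows "\<ominus>\<^bsub>M\<^esub> x \<in> U"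
proof -
  have "\<ominus>\<^bsub>M\<^esub> x = (\<ominus>\<^bsub>A\<^esub> \<one>\<^bsub>A\<^esub>) \<odot>\<^bsub>M\<^esub> x"
    using assms by (auto simp: left_submodule_def lsmult_l_minus)
  thus ?thesis using assms by (auto simp: left_submodule_def)
qed

lemma lsub_diff:
  assumes "left_submodule A U M" "x \<in> U" "y \<in> U" shows "x \<ominus>\<^bsub>M\<^esub> y \<in> U"
  using assms lsub_neg by (auto simp: left_submodule_def M.minus_eq)

lemma lsub_sum:
  assumes U: "left_submodule A U M" and V: "left_submodule A V M"
  shows "left_submodule A (U <+>\<^bsub>M\<^esub> V) M" unfolding left_submodule_def
proof (intro conjI ballI)
  have UV: "U \<subseteq> carrier M" "V \<subseteq> carrier M"
    using U V by (auto simp: left_submodule_def)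
  show "U <+>\<^bsub>M\<^esub> V \<subseteq> carrier M" using UV by (auto simp: set_add_def')
  show "\<zero>\<^bsub>M\<^esub> \<in> U <+>\<^bsub>M\<^esub> V"
  proof -
    have "\<zero>\<^bsub>M\<^esub> \<oplus>\<^bsub>M\<^esub> \<zero>\<^bsub>M\<^esub> \<in> U <+>\<^bsub>M\<^esub> V"
      using U V unfolding set_add_def' left_submodule_def by blast
    thus ?thesis by simp
  qed
  fix x assume "x \<in> U <+>\<^bsub>M\<^esub> V"
  then obtain u v where x: "u \<in> U" "v \<in> V" "x = u \<oplus>\<^bsub>M\<^esub> v"
    by (auto simp: set_add_def')
  {
    fix y assume "y \<in> U <+>\<^bsub>M\<^esub> V"
    then obtain u' v' where y: "u' \<in> U" "v' \<in> V" "y = u' \<oplus>\<^bsub>M\<^esub> v'"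
      by (auto simp: set_add_def')
    have "x \<oplus>\<^bsub>M\<^esub> y = (u \<oplus>\<^bsub>M\<^esub> u') \<oplus>\<^bsub>M\<^esub> (v \<oplus>\<^bsub>M\<^esub> v')"
      using UV x y by (simp add: M.a_ac subset_iff)
    moreover have "u \<oplus>\<^bsub>M\<^esub> u' \<in> U" "v \<oplus>\<^bsub>M\<^esub> v' \<in> V"
      using U V x y by (auto simp: left_submodule_def)
    ultimately show "x \<oplus>\<^bsub>M\<^esub> y \<in> U <+>\<^bsub>M\<^esub> V"
      by (auto simp: set_add_def')
  }
  fix a assume a: "a \<in> carrier A"
  have "a \<odot>\<^bsub>M\<^esub> x = a \<odot>\<^bsub>M\<^esub> u \<oplus>\<^bsub>M\<^esub> a \<odot>\<^bsub>M\<^esub> v"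
    using UV a x by (simp add: lsmult_r_distr subset_iff)
  moreover have "a \<odot>\<^bsub>M\<^esub> u \<in> U" "a \<odot>\<^bsub>M\<^esub> v \<in> V"
    using U V a x by (auto simp: left_submodule_def)
  ultimately show "a \<odot>\<^bsub>M\<^esub> x \<in> U <+>\<^bsub>M\<^esub> V"
    by (auto simp: set_add_def')
qed

lemma set_add_upper:
  assumes U: "left_submodule A U M" and V: "left_submodule A V M"
  shows "U \<subseteq> U <+>\<^bsub>M\<^esub> V" "V \<subseteq> U <+>\<^bsub>M\<^esub> V"
proof -
  have z: "\<zero>\<^bsub>M\<^esub> \<in> U" "\<zero>\<^bsub>M\<^esub> \<in> V" and UV: "U \<subseteq> carrier M" "V \<subseteq> carrier M"
    using U V by (auto simp: left_submodule_def)
  show "U \<subseteq> U <+>\<^bsub>M\<^esub> V"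
  proof
    fix u assume u: "u \<in> U"
    hence "u \<oplus>\<^bsub>M\<^esub> \<zero>\<^bsub>M\<^esub> = u" using UV by auto
    thus "u \<in> U <+>\<^bsub>M\<^esub> V" using u z unfolding set_add_def' by blast
  qed
  show "V \<subseteq> U <+>\<^bsub>M\<^esub> V"
  proof
    fix v assume v: "v \<in> V"
    hence "\<zero>\<^bsub>M\<^esub> \<oplus>\<^bsub>M\<^esub> v = v" using UV by auto
    thus "v \<in> U <+>\<^bsub>M\<^esub> V" using v z unfolding set_add_def' by blast
  qed
qed

lemma set_add_least:
  assumes "left_submodule A W M" "U \<subseteq> W" "V \<subseteq> W" shows "U <+>\<^bsub>M\<^esub> V \<subseteq> W"
  using assms by (auto simp: set_add_def' left_submodule_def subset_iff)

lemma submod_lm: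
  assumes U: "left_submodule A U M" shows "left_module A (submod M U)"
proof -
  have U': "U \<subseteq> carrier M" using U by (auto simp: left_submodule_def)
  have "abelian_group (submod M U)"
  proof (rule abelian_groupI)
    fix x assume "x \<in> carrier (submod M U)"
    hence x: "x \<in> U" by simp
    hence "\<ominus>\<^bsub>M\<^esub> x \<in> U" using U lsub_neg by blast
    moreover have "\<ominus>\<^bsub>M\<^esub> x \<oplus>\<^bsub>M\<^esub> x = \<zero>\<^bsub>M\<^esub>"
      using x U' by (auto simp: M.l_neg)
    ultimately show "\<exists>y\<in>carrier (submod M U). y \<oplus>\<^bsub>submod M U\<^esub> x = \<zero>\<^bsub>submod M U\<^esub>"
      by auto
  qed (use U U' in \<open>auto simp: left_submodule_def M.a_ac subset_iff\<close>)
  thus ?thesis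
    using U
    by (auto simp: left_module_def left_module_axioms_def A.ring_axioms left_submodule_def
      subset_iff lsmult_l_distr lsmult_r_distr lsmult_assoc)
qed

lemma submod_a_inv:
  assumes U: "left_submodule A U M" and x: "x \<in> U"
  shows "\<ominus>\<^bsub>submod M U\<^esub> x = \<ominus>\<^bsub>M\<^esub> x"
proof -
  interpret S: left_module A "submod M U" using submod_lm[OF U] .
  show ?thesis
  proof (rule S.M.minus_equality)
    show "\<ominus>\<^bsub>M\<^esub> x \<oplus>\<^bsub>submod M U\<^esub> x = \<zero>\<^bsub>submod M U\<^esub>"
      using U x by (auto simp: left_submodule_def M.l_neg)
  qed (use x lsub_neg[OF U x] in auto)
qed

lemma submod_diff:
  assumes U: "left_submodule A U M" and x: "x \<in> U" "y \<in> U"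
  shows "x \<ominus>\<^bsub>submod M U\<^esub> y = x \<ominus>\<^bsub>M\<^esub> y"
  using submod_a_inv[OF U x(2)] by (simp add: a_minus_def)

end

lemma lsub_submod_iff:
  assumes "left_submodule A U M"
  shows "left_submodule A V (submod M U) \<longleftrightarrow> left_submodule A V M \<and> V \<subseteq> U"
  using assms by (auto simp: left_submodule_def)

lemma lsub_Int:
  "left_submodule A U M \<Longrightarrow> left_submodule A V M \<Longrightarrow> left_submodule A (U \<inter> V) M"
  by (auto simp: left_submodule_def)

lemma set_add_submod [simp]: "U <+>\<^bsub>submod M W\<^esub> V = U <+>\<^bsub>M\<^esub> V"
  by (simp add: set_add_def')

lemma lsub_subset: "left_submodule A U M \<Longrightarrow> U \<subseteq> carrier M"
  by (simp add: left_submodule_def)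

lemma lsub_mem: "left_submodule A U M \<Longrightarrow> x \<in> U \<Longrightarrow> x \<in> carrier M"
  by (auto simp: left_submodule_def)

lemma lsub_zero: "left_submodule A U M \<Longrightarrow> \<zero>\<^bsub>M\<^esub> \<in> U"
  by (simp add: left_submodule_def)

lemma lsub_add:
  "left_submodule A U M \<Longrightarrow> x \<in> U \<Longrightarrow> y \<in> U \<Longrightarrow> x \<oplus>\<^bsub>M\<^esub> y \<in> U"
  by (simp add: left_submodule_def)

lemma lsub_smult:
  "left_submodule A U M \<Longrightarrow> a \<in> carrier A \<Longrightarrow> x \<in> U \<Longrightarrow> a \<odot>\<^bsub>M\<^esub> x \<in> U"
  by (simp add: left_submodule_def)

text \<open>Intersecting with the carrier covers the empty family, which arises for the radical of a
  module without maximal submodules.\<close>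

lemma (in left_module) lsub_Inter:
  "(\<And>U. U \<in> F \<Longrightarrow> left_submodule A U M) \<Longrightarrow> left_submodule A (carrier M \<inter> \<Inter>F) M"
  unfolding left_submodule_def by auto

section \<open>Homomorphisms\<close>

lemma module_homI:
  assumes "\<And>x. x \<in> carrier M \<Longrightarrow> f x \<in> carrier N"
    and "\<And>x y. x \<in> carrier M \<Longrightarrow> y \<in> carrier M \<Longrightarrow> f (x \<oplus>\<^bsub>M\<^esub> y) = f x \<oplus>\<^bsub>N\<^esub> f y"
    and "\<And>a x. a \<in> carrier A \<Longrightarrow> x \<in> carrier M \<Longrightarrow> f (a \<odot>\<^bsub>M\<^esub> x) = a \<odot>\<^bsub>N\<^esub> f x"
  shows "f \<in> module_hom A M N" using assms by (auto simp: module_hom_def)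

lemma mhom_closed: "f \<in> module_hom A M N \<Longrightarrow> x \<in> carrier M \<Longrightarrow> f x \<in> carrier N"
  by (auto simp: module_hom_def)

lemma mhom_comp:
  assumes "f \<in> module_hom A M N" "g \<in> module_hom A N L"
  shows "(\<lambda>x. g (f x)) \<in> module_hom A M L"
  using assms by (auto simp: module_hom_def Pi_def)

lemma mhom_id: "(\<lambda>x. x) \<in> module_hom A M M" by (auto simp: module_hom_def)

lemma mhom_cong:
  assumes "f \<in> module_hom A M N" "\<And>x. x \<in> carrier M \<Longrightarrow> g x = f x" "left_module A M"
  shows "g \<in> module_hom A M N"
proof -
  interpret left_module A M by fact
  show ?thesis using assms(1,2) by (auto simp: module_hom_def)
qed

lemma mhom_restrict:
  assumes "f \<in> module_hom A M N" "U \<subseteq> carrier M" shows "f \<in> module_hom A (submod M U) N"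
  using assms by (auto simp: module_hom_def subset_iff)

lemma mhom_corestrict:
  assumes "f \<in> module_hom A M N" "\<And>x. x \<in> carrier M \<Longrightarrow> f x \<in> V"
  shows "f \<in> module_hom A M (submod N V)" using assms by (auto simp: module_hom_def)

lemma mhom_extend_codomain:
  assumes "f \<in> module_hom A M (submod N V)" "V \<subseteq> carrier N"
  shows "f \<in> module_hom A M N" using assms by (auto simp: module_hom_def)

lemma mhom_incl: "U \<subseteq> carrier M \<Longrightarrow> (\<lambda>x. x) \<in> module_hom A (submod M U) M"
  by (auto simp: module_hom_def)

text \<open>\<open>module_hom\<close> is only a set of functions. Carrying both module structures
  along allows zero, negatives and differences to be derived from compatibility with the scalars 0
  and -1.\<close>

locale lm_hom = dom: left_module A M + cod: left_module A N
  for A :: "('a, 'z) ring_scheme" and M :: "('a, 'm) module" and N :: "('a, 'n) module" +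
  fixes f :: "'m \<Rightarrow> 'n"
  assumes hom: "f \<in> module_hom A M N"
begin

lemma closed [simp, intro]: "x \<in> carrier M \<Longrightarrow> f x \<in> carrier N"
  using hom by (auto simp: module_hom_def)

lemma add [simp]: "x \<in> carrier M \<Longrightarrow> y \<in> carrier M \<Longrightarrow> f (x \<oplus>\<^bsub>M\<^esub> y) = f x \<oplus>\<^bsub>N\<^esub> f y"
  using hom by (auto simp: module_hom_def)

lemma smult [simp]: "a \<in> carrier A \<Longrightarrow> x \<in> carrier M \<Longrightarrow> f (a \<odot>\<^bsub>M\<^esub> x) = a \<odot>\<^bsub>N\<^esub> f x"
  using hom by (auto simp: module_hom_def)

lemma zero [simp]: "f \<zero>\<^bsub>M\<^esub> = \<zero>\<^bsub>N\<^esub>"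
  using smult[of "\<zero>\<^bsub>A\<^esub>" "\<zero>\<^bsub>M\<^esub>"] by simp

lemma neg [simp]: "x \<in> carrier M \<Longrightarrow> f (\<ominus>\<^bsub>M\<^esub> x) = \<ominus>\<^bsub>N\<^esub> f x"
  using smult[of "\<ominus>\<^bsub>A\<^esub> \<one>\<^bsub>A\<^esub>"]
  by (simp add: dom.lsmult_l_minus cod.lsmult_l_minus)

lemma diff [simp]: "x \<in> carrier M \<Longrightarrow> y \<in> carrier M \<Longrightarrow> f (x \<ominus>\<^bsub>M\<^esub> y) = f x \<ominus>\<^bsub>N\<^esub> f y"
  by (simp add: dom.M.minus_eq cod.M.minus_eq)

lemma ker_iff [simp]: "x \<in> a_kernel M N f \<longleftrightarrow> x \<in> carrier M \<and> f x = \<zero>\<^bsub>N\<^esub>"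
  by (simp add: a_kernel_def')

lemma ker_submodule: "left_submodule A (a_kernel M N f) M" unfolding left_submodule_def by auto

lemma image_submodule: "left_submodule A U M \<Longrightarrow> left_submodule A (f ` U) N"
  unfolding left_submodule_def
proof (intro conjI ballI, goal_cases)
  case 1 thus ?case by auto
next
  case 2 thus ?case using zero by (metis image_eqI)
next
  case (3 x y)
  then obtain u v where "u \<in> U" "v \<in> U" "x = f u" "y = f v" by auto
  thus ?case
    using 3 by (intro image_eqI[of _ _ "u \<oplus>\<^bsub>M\<^esub> v"]) (auto simp: subset_iff)
next
  case (4 a x)
  then obtain u where "u \<in> U" "x = f u" by auto
  thus ?case using 4 by (intro image_eqI[of _ _ "a \<odot>\<^bsub>M\<^esub> u"]) auto
qed

lemma vimage_submodule:
  "left_submodule A V N \<Longrightarrow> left_submodule A {x \<in> carrier M. f x \<in> V} M"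
  unfolding left_submodule_def by auto

lemma inj_onI':
  assumes "\<And>x. x \<in> carrier M \<Longrightarrow> f x = \<zero>\<^bsub>N\<^esub> \<Longrightarrow> x = \<zero>\<^bsub>M\<^esub>"
  shows "inj_on f (carrier M)"
proof (rule inj_onI)
  fix x y assume *: "x \<in> carrier M" "y \<in> carrier M" "f x = f y"
  hence "x \<ominus>\<^bsub>M\<^esub> y = \<zero>\<^bsub>M\<^esub>" using * assms by auto
  thus "x = y" using * by simp
qed

lemma inj_onD':
  assumes "inj_on f (carrier M)" "x \<in> carrier M" "f x = \<zero>\<^bsub>N\<^esub>" shows "x = \<zero>\<^bsub>M\<^esub>"
  using assms zero by (metis dom.M.zero_closed inj_onD)

lemma inj_on_ker:
  "inj_on f (carrier M) \<longleftrightarrow> a_kernel M N f = {\<zero>\<^bsub>M\<^esub>}"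
proof
  assume "inj_on f (carrier M)"
  thus "a_kernel M N f = {\<zero>\<^bsub>M\<^esub>}" using inj_onD' by auto
next
  assume k: "a_kernel M N f = {\<zero>\<^bsub>M\<^esub>}"
  show "inj_on f (carrier M)"
  proof (rule inj_onI')
    fix x assume "x \<in> carrier M" "f x = \<zero>\<^bsub>N\<^esub>"
    thus "x = \<zero>\<^bsub>M\<^esub>" using k by force
  qed
qed

lemma restrict_hom:
  assumes "left_submodule A U M" shows "lm_hom A (submod M U) N f"
  by (intro lm_hom.intro dom.submod_lm assms cod.left_module_axioms lm_hom_axioms.intro
    mhom_restrict[OF hom] lsub_subset[OF assms])

lemma corestrict_hom:
  assumes "left_submodule A V N" "\<And>x. x \<in> carrier M \<Longrightarrow> f x \<in> V"
  shows "lm_hom A M (submod N V) f"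
  by (intro lm_hom.intro cod.submod_lm assms dom.left_module_axioms lm_hom_axioms.intro
    mhom_corestrict[OF hom])

lemma inv_hom:
  assumes bij: "bij_betw f (carrier M) (carrier N)"
  shows "inv_into (carrier M) f \<in> module_hom A N M"
proof -
  let ?g = "inv_into (carrier M) f"
  have inj: "inj_on f (carrier M)" and sur: "f ` carrier M = carrier N"
    using bij by (auto simp: bij_betw_def)
  have g: "?g y \<in> carrier M" "f (?g y) = y" if "y \<in> carrier N" for y
    using that sur by (auto intro: inv_into_into f_inv_into_f)
  show ?thesis
  proof (rule module_homI)
    fix x y assume xy: "x \<in> carrier N" "y \<in> carrier N"
    have "f (?g (x \<oplus>\<^bsub>N\<^esub> y)) = f (?g x \<oplus>\<^bsub>M\<^esub> ?g y)"
      using g xy by simp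
    thus "?g (x \<oplus>\<^bsub>N\<^esub> y) = ?g x \<oplus>\<^bsub>M\<^esub> ?g y"
      using inj g xy by (meson inj_onD cod.M.a_closed dom.M.a_closed)
  next
    fix a x assume ax: "a \<in> carrier A" "x \<in> carrier N"
    have "f (?g (a \<odot>\<^bsub>N\<^esub> x)) = f (a \<odot>\<^bsub>M\<^esub> ?g x)"
      using g ax by simp
    thus "?g (a \<odot>\<^bsub>N\<^esub> x) = a \<odot>\<^bsub>M\<^esub> ?g x"
      using inj g ax by (meson inj_onD cod.lsmult_closed dom.lsmult_closed)
  qed (use g in auto)
qed

end

lemma (in left_module) lm_hom_sub:
  assumes "lm_hom A M N f" "lm_hom A M N g"
  shows "(\<lambda>x. f x \<ominus>\<^bsub>N\<^esub> g x) \<in> module_hom A M N"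
proof -
  interpret f: lm_hom A M N f by fact
  interpret g: lm_hom A M N g by fact
  show ?thesis
    by (rule module_homI) (auto simp: f.cod.M.minus_eq f.cod.M.minus_add f.cod.M.a_ac
      f.cod.lsmult_r_distr f.cod.lsmult_r_minus)
qed

lemma (in left_module) lm_hom_add:
  assumes "lm_hom A M N f" "lm_hom A M N g"
  shows "(\<lambda>x. f x \<oplus>\<^bsub>N\<^esub> g x) \<in> module_hom A M N"
proof -
  interpret f: lm_hom A M N f by fact
  interpret g: lm_hom A M N g by fact
  show ?thesis by (rule module_homI) (auto simp: f.cod.lsmult_r_distr f.cod.M.a_ac)
qed

lemma lm_homI:
  "left_module A M \<Longrightarrow> left_module A N \<Longrightarrow> f \<in> module_hom A M N \<Longrightarrow> lm_hom A M N f"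
  by (simp add: lm_hom_def lm_hom_axioms_def)

lemma zero_hom:
  assumes "left_module A M" "left_module A N"
  shows "(\<lambda>x. \<zero>\<^bsub>N\<^esub>) \<in> module_hom A M N"
proof -
  interpret N: left_module A N by fact
  show ?thesis by (rule module_homI) auto
qed

text \<open>Covers quotients and transport of structure alike.\<close>

lemma left_module_surj_image:
  fixes N (structure)
  assumes M: "left_module A M" and sur: "p ` carrier M = carrier N"
    and add: "\<And>x y. x \<in> carrier M \<Longrightarrow> y \<in> carrier M \<Longrightarrow> p x \<oplus> p y = p (x \<oplus>\<^bsub>M\<^esub> y)"
    and smult: "\<And>a x. a \<in> carrier A \<Longrightarrow> x \<in> carrier M \<Longrightarrow> a \<odot> p x = p (a \<odot>\<^bsub>M\<^esub> x)"
    and zer: "\<zero> = p \<zero>\<^bsub>M\<^esub>"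
  shows "left_module A N" "p \<in> module_hom A M N"
proof -
  interpret left_module A M by fact
  have "abelian_group N"
  proof (rule abelian_groupI)
    fix x assume "x \<in> carrier N"
    then obtain u where "u \<in> carrier M" "x = p u" using sur by auto
    thus "\<exists>y\<in>carrier N. y \<oplus> x = \<zero>"
      by (intro bexI[of _ "p (\<ominus>\<^bsub>M\<^esub> u)"]) (auto simp: add zer M.l_neg simp
        flip: sur)
  qed (auto simp: add zer M.a_ac simp flip: sur)
  thus "left_module A N"
    by (auto simp: left_module_def left_module_axioms_def A.ring_axioms add smult lsmult_l_distr
      lsmult_r_distr lsmult_assoc simp flip: sur)
  show "p \<in> module_hom A M N" by (rule module_homI) (auto simp: add smult simp flip: sur)
qed

text \<open>Cosets agree exactly when the difference of representatives lies in U. Hence the union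
  that defines the scalar action in \<open>quot_module\<close> runs over equal cosets and collapses
  to one. The four conclusions are what later arguments use in place of the coset
  construction.\<close>

lemma quot_proj:
  fixes M (structure)
  assumes M: "left_module A M" and U: "left_submodule A U M"
  shows "left_module A (quot_module M U)"
    and "(\<lambda>x. U +>\<^bsub>M\<^esub> x) \<in> module_hom A M (quot_module M U)"
    and "(\<lambda>x. U +>\<^bsub>M\<^esub> x) ` carrier M = carrier (quot_module M U)"
    and "a_kernel M (quot_module M U) (\<lambda>x. U +>\<^bsub>M\<^esub> x) = U"
proof -
  interpret left_module A M by fact
  have U': "U \<subseteq> carrier M" using lsub_subset[OF U] .
  have "additive_subgroup U M"
    unfolding additive_subgroup_def
    by (rule M.add.subgroupI) (use U lsub_neg in \<open>auto simp: left_submodule_def\<close>)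
  then interpret G: abelian_subgroup U M by (intro abelian_subgroupI3 M.abelian_group_axioms)
  have mem: "z \<in> U +>\<^bsub>M\<^esub> x \<longleftrightarrow> z \<in> carrier M \<and> z \<ominus> x \<in> U" if "x \<in> carrier M" for x z
  proof
    assume z: "z \<in> U +>\<^bsub>M\<^esub> x"
    hence zc: "z \<in> carrier M" using that G.a_elemrcos_carrier by blast
    have "z \<oplus> \<ominus> x \<in> U" using G.a_rcos_module_imp[OF that z] .
    thus "z \<in> carrier M \<and> z \<ominus> x \<in> U" using zc by (simp add: M.minus_eq)
  next
    assume "z \<in> carrier M \<and> z \<ominus> x \<in> U"
    thus "z \<in> U +>\<^bsub>M\<^esub> x"
      using G.a_rcos_module_rev[OF that] by (simp add: M.minus_eq)
  qed
  have eq: "U +>\<^bsub>M\<^esub> x = U +>\<^bsub>M\<^esub> y \<longleftrightarrow> x \<ominus> y \<in> U" if "x \<in> carrier M" "y \<in> carrier M" for x y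
    using G.a_rcos_self mem G.a_repr_independence' that by blast
  have 1: "(\<lambda>x. U +>\<^bsub>M\<^esub> x) ` carrier M = carrier (quot_module M U)"
    by (auto simp: quot_module_def A_RCOSETS_def')
  note * = left_module_surj_image[OF M 1]
  have 2: "(U +>\<^bsub>M\<^esub> x) \<oplus>\<^bsub>quot_module M U\<^esub> (U +>\<^bsub>M\<^esub> y) = U +>\<^bsub>M\<^esub> (x \<oplus> y)"
    if "x \<in> carrier M" "y \<in> carrier M" for x y
    using that by (simp add: quot_module_def G.a_rcos_sum)
  have 3: "a \<odot>\<^bsub>quot_module M U\<^esub> (U +>\<^bsub>M\<^esub> x) = U +>\<^bsub>M\<^esub> (a \<odot> x)"
    if "a \<in> carrier A" "x \<in> carrier M" for a x
  proof -
    have "U +>\<^bsub>M\<^esub> (a \<odot> z) = U +>\<^bsub>M\<^esub> (a \<odot> x)" if "z \<in> U +>\<^bsub>M\<^esub> x" for z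
      using that \<open>a \<in> _\<close> \<open>x \<in> _\<close> mem eq lsub_smult[OF U]
      by (simp add: lsmult_r_diff[symmetric])
    moreover have "x \<in> U +>\<^bsub>M\<^esub> x" using that by (simp add: G.a_rcos_self)
    ultimately have "(\<Union>z\<in>U +>\<^bsub>M\<^esub> x. U +>\<^bsub>M\<^esub> (a \<odot> z)) = U +>\<^bsub>M\<^esub> (a \<odot> x)"
      by (intro UN_constant_eq) blast+
    thus ?thesis by (simp add: quot_module_def)
  qed
  have 4: "\<zero>\<^bsub>quot_module M U\<^esub> = U +>\<^bsub>M\<^esub> \<zero>"
    using U' by (simp add: quot_module_def)
  show "left_module A (quot_module M U)" "(\<lambda>x. U +>\<^bsub>M\<^esub> x) \<in> module_hom A M (quot_module M U)"
    by (rule *[OF 2 3 4]; assumption)+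
  show "(\<lambda>x. U +>\<^bsub>M\<^esub> x) ` carrier M = carrier (quot_module M U)" by (rule 1)
  show "a_kernel M (quot_module M U) (\<lambda>x. U +>\<^bsub>M\<^esub> x) = U"
  proof -
    have "U +>\<^bsub>M\<^esub> x = U +>\<^bsub>M\<^esub> \<zero> \<longleftrightarrow> x \<in> U" if "x \<in> carrier M" for x
      using eq that by simp
    thus ?thesis unfolding a_kernel_def' 4 using U' by blast
  qed
qed

section \<open>Transport of structure, direct sums and the regular module\<close>

definition transport :: "('m \<Rightarrow> 'x) \<Rightarrow> ('a, 'm) module \<Rightarrow> ('a, 'x) module" where
  "transport \<phi> M =
     (let \<psi> = inv_into (carrier M) \<phi> in
      \<lparr>carrier = \<phi> ` carrier M, mult = (\<lambda>x y. x), one = \<phi> \<zero>\<^bsub>M\<^esub>, zero = \<phi> \<zero>\<^bsub>M\<^esub>,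
       add = (\<lambda>x y. \<phi> (\<psi> x \<oplus>\<^bsub>M\<^esub> \<psi> y)), smult = (\<lambda>a x. \<phi> (a \<odot>\<^bsub>M\<^esub> \<psi> x))\<rparr>)"

lemma transport_iso:
  assumes M: "left_module A M" and inj: "inj_on \<phi> (carrier M)"
  shows "left_module A (transport \<phi> M)" "\<phi> \<in> module_hom A M (transport \<phi> M)"
    "bij_betw \<phi> (carrier M) (carrier (transport \<phi> M))"
proof -
  have 1: "\<phi> ` carrier M = carrier (transport \<phi> M)" by (simp add: transport_def Let_def)
  note * = left_module_surj_image[OF M 1]
  show "left_module A (transport \<phi> M)" "\<phi> \<in> module_hom A M (transport \<phi> M)"
    by (rule *; simp add: transport_def Let_def inv_into_f_f[OF inj])+
  show "bij_betw \<phi> (carrier M) (carrier (transport \<phi> M))"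
    using 1 inj by (simp add: bij_betw_def)
qed

definition dsum :: "('a, 'm) module \<Rightarrow> ('a, 'n) module \<Rightarrow> ('a, 'm \<times> 'n) module" where
  "dsum M N =
     \<lparr>carrier = carrier M \<times> carrier N, mult = (\<lambda>x y. x), one = (\<zero>\<^bsub>M\<^esub>, \<zero>\<^bsub>N\<^esub>),
      zero = (\<zero>\<^bsub>M\<^esub>, \<zero>\<^bsub>N\<^esub>),
      add = (\<lambda>x y. (fst x \<oplus>\<^bsub>M\<^esub> fst y, snd x \<oplus>\<^bsub>N\<^esub> snd y)),
      smult = (\<lambda>a x. (a \<odot>\<^bsub>M\<^esub> fst x, a \<odot>\<^bsub>N\<^esub> snd x))\<rparr>"

lemma dsum_simps [simp]:
  "carrier (dsum M N) = carrier M \<times> carrier N" "\<zero>\<^bsub>dsum M N\<^esub> = (\<zero>\<^bsub>M\<^esub>, \<zero>\<^bsub>N\<^esub>)"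
  "x \<oplus>\<^bsub>dsum M N\<^esub> y = (fst x \<oplus>\<^bsub>M\<^esub> fst y, snd x \<oplus>\<^bsub>N\<^esub> snd y)"
  "a \<odot>\<^bsub>dsum M N\<^esub> x = (a \<odot>\<^bsub>M\<^esub> fst x, a \<odot>\<^bsub>N\<^esub> snd x)"
  by (simp_all add: dsum_def)

lemma dsum_left_module:
  assumes "left_module A M" "left_module A N" shows "left_module A (dsum M N)"
proof -
  interpret M: left_module A M by fact
  interpret N: left_module A N by fact
  have "abelian_group (dsum M N)"
  proof (rule abelian_groupI)
    fix x assume "x \<in> carrier (dsum M N)"
    thus "\<exists>y\<in>carrier (dsum M N). y \<oplus>\<^bsub>dsum M N\<^esub> x = \<zero>\<^bsub>dsum M N\<^esub>"
      by (intro bexI[of _ "(\<ominus>\<^bsub>M\<^esub> fst x, \<ominus>\<^bsub>N\<^esub> snd x)"])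
        (auto simp: M.M.l_neg N.M.l_neg)
  qed (auto simp: M.M.a_ac N.M.a_ac)
  thus ?thesis
    by (auto simp: left_module_def left_module_axioms_def M.A.ring_axioms M.lsmult_l_distr
      M.lsmult_r_distr M.lsmult_assoc N.lsmult_l_distr N.lsmult_r_distr N.lsmult_assoc)
qed

lemma dsum_hom:
  assumes "left_module A M" "left_module A N"
  shows "fst \<in> module_hom A (dsum M N) M" "snd \<in> module_hom A (dsum M N) N"
    "(\<lambda>x. (x, \<zero>\<^bsub>N\<^esub>)) \<in> module_hom A M (dsum M N)" "(\<lambda>y. (\<zero>\<^bsub>M\<^esub>, y)) \<in> module_hom A N (dsum M N)"
proof -
  interpret M: left_module A M by fact
  interpret N: left_module A N by fact
  show "fst \<in> module_hom A (dsum M N) M" "snd \<in> module_hom A (dsum M N) N"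
    "(\<lambda>x. (x, \<zero>\<^bsub>N\<^esub>)) \<in> module_hom A M (dsum M N)" "(\<lambda>y. (\<zero>\<^bsub>M\<^esub>, y)) \<in> module_hom A N (dsum M N)"
    by (auto intro!: module_homI)
qed

lemma dsum_pair_hom:
  assumes "f \<in> module_hom A L M" "g \<in> module_hom A L N"
  shows "(\<lambda>x. (f x, g x)) \<in> module_hom A L (dsum M N)"
  using assms by (auto simp: module_hom_def)

lemma dsum_copair_hom:
  assumes "left_module A M" "left_module A N" "left_module A L"
    and f: "f \<in> module_hom A M L" and g: "g \<in> module_hom A N L"
  shows "(\<lambda>x. f (fst x) \<oplus>\<^bsub>L\<^esub> g (snd x)) \<in> module_hom A (dsum M N) L"
proof -
  interpret D: left_module A "dsum M N" using dsum_left_module assms by auto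
  show ?thesis
    using mhom_comp[OF dsum_hom(1)[OF assms(1,2)] f] mhom_comp[OF dsum_hom(2)[OF assms(1,2)] g]
    by (intro D.lm_hom_add lm_homI D.left_module_axioms assms(3))
qed

lemma regular_module_simps [simp]:
  "carrier (regular_module A) = carrier A" "\<zero>\<^bsub>regular_module A\<^esub> = \<zero>\<^bsub>A\<^esub>"
  "x \<oplus>\<^bsub>regular_module A\<^esub> y = x \<oplus>\<^bsub>A\<^esub> y" "x \<odot>\<^bsub>regular_module A\<^esub> y = x \<otimes>\<^bsub>A\<^esub> y"
  by (simp_all add: regular_module_def)

lemma regular_module_lm:
  assumes "ring A" shows "left_module A (regular_module A)"
proof -
  interpret ring A by fact
  have "abelian_group (regular_module A)"
  proof (rule abelian_groupI)
    fix x assume "x \<in> carrier (regular_module A)"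
    thus "\<exists>y\<in>carrier (regular_module A). y \<oplus>\<^bsub>regular_module A\<^esub> x = \<zero>\<^bsub>regular_module A\<^esub>"
      by (intro bexI[of _ "\<ominus>\<^bsub>A\<^esub> x"]) (auto simp: l_neg)
  qed (auto simp: a_ac)
  thus ?thesis
    by (auto simp: left_module_def left_module_axioms_def ring_axioms l_distr r_distr m_assoc)
qed

lemma orbit_hom:
  assumes "left_module A M" "x \<in> carrier M"
  shows "(\<lambda>a. a \<odot>\<^bsub>M\<^esub> x) \<in> module_hom A (regular_module A) M"
proof -
  interpret left_module A M by fact
  show ?thesis
    by (rule module_homI) (use assms in \<open>auto simp: lsmult_l_distr lsmult_assoc\<close>)
qed

lemma lsub_cyclic:
  assumes "left_module A M" "x \<in> carrier M" "left_submodule A I (regular_module A)"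
  shows "left_submodule A ((\<lambda>a. a \<odot>\<^bsub>M\<^esub> x) ` I) M"
proof -
  interpret left_module A M by fact
  show ?thesis
    by (rule lm_hom.image_submodule[OF lm_homI[OF regular_module_lm[OF A.ring_axioms] assms(1)
      orbit_hom[OF assms(1,2)]] assms(3)])
qed

section \<open>Dimensions\<close>

text \<open>Regarding vector spaces as left modules over K makes the lemmas on submodules, kernels
  and homomorphisms available for linear algebra as well.\<close>

lemma vs_lm:
  fixes V :: "('k, 'v) module"
  assumes "vectorspace K V" shows "left_module K V"
proof -
  interpret vectorspace K V by fact
  show ?thesis
    by (auto simp: left_module_def left_module_axioms_def R.ring_axioms M.abelian_group_axioms
      smult_l_distr smult_r_distr smult_assoc1)
qed

lemma lm_vs:
  fixes V :: "('k, 'v) module"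
  assumes "field K" "left_module K V" shows "vectorspace K V"
proof -
  interpret field K by fact
  interpret left_module K V by fact
  have "module K V"
    by (rule moduleI) (auto simp: is_cring M.abelian_group_axioms lsmult_l_distr lsmult_r_distr
      lsmult_assoc)
  thus ?thesis using assms(1) by (simp add: vectorspace_def)
qed

lemma subspace_iff_lsub:
  fixes V :: "('k, 'v) module"
  assumes "vectorspace K V" shows "subspace K U V \<longleftrightarrow> left_submodule K U V"
proof -
  interpret vectorspace K V by fact
  show ?thesis
    by (auto simp: subspace_def submodule_def left_submodule_def vectorspace_axioms module_axioms)
qed

lemma vectorspace_submod:
  fixes V :: "('k, 'v) module"
  assumes "vectorspace K V" "left_submodule K U V" shows "vectorspace K (submod V U)"
  using assms vectorspace.subspace_is_vs subspace_iff_lsub by blast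

lemma mhom_linear_map:
  fixes V :: "('k, 'v) module" and W :: "('k, 'w) module"
  assumes "vectorspace K V" "vectorspace K W" "f \<in> module_hom K V W"
  shows "linear_map K V W f"
  using assms by (simp add: linear_map_def mod_hom_def mod_hom_axioms_def vectorspace_def)

text \<open>Independence of a subset of U does not depend on whether it is tested in U or in V, so
  dim V bounds the size of independent sets in U, and a maximal one is a basis.
  Finite-dimensionality of subspaces comes from here.\<close>

lemma subspace_basis:
  fixes V :: "('k, 'v) module"
  assumes V: "vectorspace K V" and fd: "vectorspace.fin_dim K V" and U: "left_submodule K U V"
  shows "\<exists>B. finite B \<and> vectorspace.basis K (submod V U) B \<and> B \<subseteq> U \<and> module.lin_indpt K V B"
proof -
  interpret V: vectorspace K V by fact
  interpret U: vectorspace K "submod V U" using vectorspace_submod[OF V U] .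
  have sub: "submodule K U V" using U V subspace_iff_lsub subspace_def by blast
  have li: "U.lin_indpt B \<longleftrightarrow> V.lin_indpt B" if "B \<subseteq> U" for B
    using V.span_li_not_depend(2)[OF that sub] by simp
  have "\<exists>B. finite B \<and> maximal B (\<lambda>B. B \<subseteq> U \<and> U.lin_indpt B)"
  proof (rule maximal_exists)
    show "finite B \<and> card B \<le> V.dim" if "B \<subseteq> U \<and> U.lin_indpt B" for B
      using U that li V.li_le_dim[OF fd] by (force simp: left_submodule_def)
    show "{} \<subseteq> U \<and> U.lin_indpt {}" unfolding U.lin_dep_def by auto
  qed
  then obtain B where B: "finite B" "maximal B (\<lambda>B. B \<subseteq> U \<and> U.lin_indpt B)"
    by blast
  hence "U.basis B" using U.max_li_is_basis by simp
  moreover have "B \<subseteq> U" "U.lin_indpt B" using B by (auto simp: maximal_def)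
  ultimately show ?thesis using B li by blast
qed

lemma submod_fin_dim:
  fixes V :: "('k, 'v) module"
  assumes V: "vectorspace K V" and fd: "vectorspace.fin_dim K V" and U: "left_submodule K U V"
  shows "vectorspace.fin_dim K (submod V U)"
proof -
  obtain B where "finite B" "vectorspace.basis K (submod V U) B"
    using subspace_basis[OF assms] by blast
  thus ?thesis
    using vectorspace_submod[OF V U] by (auto simp: vectorspace.fin_dim_def vectorspace.basis_def)
qed

lemma submod_dim_mono:
  fixes V :: "('k, 'v) module"
  assumes V: "vectorspace K V" and fd: "vectorspace.fin_dim K V"
    and U: "left_submodule K U V" and W: "left_submodule K W V" and UW: "U \<subseteq> W"
  shows "vectorspace.dim K (submod V U) \<le> vectorspace.dim K (submod V W)"
    "vectorspace.dim K (submod V U) = vectorspace.dim K (submod V W) \<Longrightarrow> U = W"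
proof -
  interpret U: vectorspace K "submod V U" using vectorspace_submod[OF V U] .
  interpret W: vectorspace K "submod V W" using vectorspace_submod[OF V W] .
  have UinW: "left_submodule K U (submod V W)" using U UW lsub_submod_iff[OF W] by blast
  note finW = submod_fin_dim[OF V fd W]
  obtain B where B: "finite B" "U.basis B" "B \<subseteq> U" "W.lin_indpt B"
    using subspace_basis[OF W.vectorspace_axioms finW UinW] by auto
  have "U.dim = card B" using B U.dim_basis by blast
  moreover have c: "card B \<le> W.dim" using B UW W.li_le_dim[OF finW] by auto
  ultimately show "U.dim \<le> W.dim" by simp
  assume eq: "U.dim = W.dim"
  have "W.span B = W"
    using W.dim_li_is_basis[OF finW] B UW eq \<open>U.dim = card B\<close>
    by (simp add: W.basis_def)
  moreover have "W.span B \<subseteq> U"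
  proof (rule W.span_is_subset[OF B(3)])
    show "submodule K U (submod V W)"
      using UinW W.vectorspace_axioms subspace_iff_lsub subspace_def by blast
  qed
  ultimately show "U = W" using UW by auto
qed

lemma rank_nullity_mhom:
  fixes V :: "('k, 'v) module" and W :: "('k, 'w) module"
  assumes "vectorspace K V" "vectorspace K W" "f \<in> module_hom K V W" "vectorspace.fin_dim K V"
  shows "vectorspace.dim K V =
    vectorspace.dim K (submod V (a_kernel V W f)) + vectorspace.dim K (submod W (f ` carrier V))"
proof -
  interpret linear_map K V W f using mhom_linear_map[OF assms(1-3)] .
  show ?thesis using rank_nullity[OF assms(4)] by (auto simp: ker_def a_kernel_def' im_def)
qed

lemma surj_fin_dim_mhom:
  fixes V :: "('k, 'v) module" and W :: "('k, 'w) module"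
  assumes "vectorspace K V" "vectorspace K W" "f \<in> module_hom K V W" "vectorspace.fin_dim K V"
    "f ` carrier V = carrier W"
  shows "vectorspace.fin_dim K W" using linear_map.surj_fin_dim[OF mhom_linear_map] assms by blast

lemma dim_zero_iff:
  fixes V :: "('k, 'v) module" (structure)
  assumes V: "vectorspace K V" and fd: "vectorspace.fin_dim K V"
  shows "vectorspace.dim K V = 0 \<longleftrightarrow> carrier V = {\<zero>}"
proof -
  interpret vectorspace K V by fact
  obtain B where B: "finite B" "basis B" using finite_basis_exists[OF fd] by blast
  have d: "dim = card B" using B dim_basis by blast
  show ?thesis
  proof
    assume "dim = 0"
    thus "carrier V = {\<zero>}" using d B by (simp add: basis_def span_empty)
  next
    assume c: "carrier V = {\<zero>}"
    have "gen_set {\<zero>}"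
      using c
      by simp (metis M.zero_closed empty_subsetI in_own_span insert_subset span_is_subset2
        subset_antisym)
    thus "dim = 0" by (rule dim0I)
  qed
qed

text \<open>A finite spanning set of the kernel together with preimages of a finite spanning set of
  the image spans V. Rank-nullity is no substitute, as it presupposes that V is
  finite-dimensional.\<close>

lemma fin_dim_extension:
  fixes V :: "('k, 'v) module" (structure) and W :: "('k, 'w) module"
  assumes V: "vectorspace K V" and W: "vectorspace K W" and f: "f \<in> module_hom K V W"
    and fW: "vectorspace.fin_dim K W" and fk: "vectorspace.fin_dim K (submod V (a_kernel V W f))"
  shows "vectorspace.fin_dim K V"
proof -
  interpret V: vectorspace K V by fact
  interpret h: lm_hom K V W f using V W f by (intro lm_homI vs_lm)
  let ?k = "a_kernel V W f" and ?I = "f ` carrier V"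
  interpret k: vectorspace K "submod V ?k" using vectorspace_submod[OF V h.ker_submodule] .
  have subI: "left_submodule K ?I W" using h.image_submodule[OF h.dom.lsub_carrier] .
  interpret I: vectorspace K "submod W ?I" using vectorspace_submod[OF W subI] .
  obtain C where C: "finite C" "C \<subseteq> ?k" "k.span C = ?k"
    using fk by (auto simp: k.fin_dim_def)
  obtain D where D: "finite D" "D \<subseteq> ?I" "I.span D = ?I"
    using submod_fin_dim[OF W fW subI] by (auto simp: I.fin_dim_def)
  obtain B where B: "finite B" "B \<subseteq> carrier V" "f ` B = D"
    using finite_subset_image[OF D(1,2)] by auto
  have CV: "C \<union> B \<subseteq> carrier V" using C B by auto
  define S where "S = V.span (C \<union> B)"
  have S: "left_submodule K S V"
    using V.span_is_subspace[OF CV] subspace_iff_lsub[OF V] S_def by simp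
  have CBS: "C \<union> B \<subseteq> S" using V.in_own_span[OF CV] S_def by simp
  have kS: "?k \<subseteq> S"
    using lsub_submod_iff[OF h.ker_submodule] lsub_Int[OF S h.ker_submodule] subspace_iff_lsub[OF
      k.vectorspace_axioms] k.span_is_subset[of C "S \<inter> ?k"] CBS C
    by auto
  have fS: "?I \<subseteq> f ` S"
  proof -
    have "left_submodule K (f ` S) (submod W ?I)"
      using S h.image_submodule by (auto simp: left_submodule_def)
    thus ?thesis
      using subspace_iff_lsub[OF I.vectorspace_axioms] subspace_def I.span_is_subset[of D "f ` S"]
        B CBS D
      by blast
  qed
  have "carrier V \<subseteq> S"
  proof
    fix v assume v: "v \<in> carrier V"
    then obtain s where s: "s \<in> S" "f v = f s" using fS by blast
    have sV: "s \<in> carrier V" using S s by (auto simp: left_submodule_def)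
    hence "v \<ominus> s \<in> ?k" using v s by simp
    hence "v \<ominus> s \<oplus> s \<in> S" using kS s S by (auto simp: left_submodule_def)
    moreover have "v \<ominus> s \<oplus> s = v"
      using v sV by (simp add: V.M.minus_eq V.M.a_assoc V.M.l_neg)
    ultimately show "v \<in> S" by simp
  qed
  hence "V.span (C \<union> B) = carrier V" using S S_def by (auto simp: left_submodule_def)
  thus ?thesis using C B by (auto simp: V.fin_dim_def intro!: exI[of _ "C \<union> B"])
qed

text \<open>One choice of coefficients with respect to a finite spanning list is enough: a vector is
  recovered from its coefficients, so the choice is injective even when the list is not
  independent.\<close>

lemma fin_dim_list_injection:
  fixes V :: "('k, 'v) module"
  assumes V: "vectorspace K V" and fd: "vectorspace.fin_dim K V"
  shows "\<exists>\<phi> :: 'v \<Rightarrow> 'k list. inj_on \<phi> (carrier V)"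
proof -
  interpret vectorspace K V by fact
  obtain B where B: "finite B" "B \<subseteq> carrier V" "span B = carrier V"
    using fd by (auto simp: fin_dim_def)
  obtain bs where bs: "set bs = B" using B finite_list by blast
  have "\<forall>x\<in>carrier V. \<exists>a. a \<in> B \<rightarrow> carrier K \<and> x = lincomb a B"
    using B(3) unfolding finite_span[OF B(1,2)] by blast
  then obtain c where c: "\<And>x. x \<in> carrier V \<Longrightarrow> c x \<in> B \<rightarrow> carrier K \<and> x = lincomb (c x) B"
    by metis
  have "inj_on (\<lambda>x. map (c x) bs) (carrier V)"
  proof (rule inj_onI)
    fix x y assume xy: "x \<in> carrier V" "y \<in> carrier V" "map (c x) bs = map (c y) bs"
    thus "x = y" using bs lincomb_cong[of B B "c x" "c y"] B c by auto
  qed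
  thus ?thesis by blast
qed

section \<open>Finite-dimensional modules\<close>

lemma scalars_simps [simp]:
  "carrier (scalars A M) = carrier M" "\<zero>\<^bsub>scalars A M\<^esub> = \<zero>\<^bsub>M\<^esub>"
  "x \<oplus>\<^bsub>scalars A M\<^esub> y = x \<oplus>\<^bsub>M\<^esub> y"
  "c \<odot>\<^bsub>scalars A M\<^esub> x = (c \<odot>\<^bsub>A\<^esub> \<one>\<^bsub>A\<^esub>) \<odot>\<^bsub>M\<^esub> x"
  by (simp_all add: scalars_def)

lemma scalars_submod [simp]: "scalars A (submod M U) = submod (scalars A M) U"
  by (simp add: scalars_def)

lemma a_kernel_scalars [simp]: "a_kernel (scalars A M) (scalars A N) f = a_kernel M N f"
  by (simp add: a_kernel_def')

lemma fd_moduleD: "fd_module K A M \<Longrightarrow> left_module A M" "fd_module K A M \<Longrightarrow> vectorspace.fin_dim K (scalars A M)"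
  by (simp_all add: fd_module_def)

lemmas fd_lm = fd_moduleD(1) and fd_fdim = fd_moduleD(2)

context fd_algebra begin

abbreviation "fd M \<equiv> fd_module K A M"
abbreviation "projective M \<equiv> projective_module K A M"
abbreviation "indec M \<equiv> indecomposable_module A M"
abbreviation "simple M \<equiv> simple_module A M"
abbreviation "maxsub U M \<equiv> maximal_submodule A U M"
abbreviation "lsub U M \<equiv> left_submodule A U M"
abbreviation "lmod M \<equiv> left_module A M"
abbreviation "Hom M N \<equiv> module_hom A M N"
abbreviation "isom M N \<equiv> module_iso A M N"
abbreviation "fdim V \<equiv> vectorspace.fin_dim K V"
abbreviation "vdim V \<equiv> vectorspace.dim K V"

abbreviation "unit_scalar c \<equiv> c \<odot>\<^bsub>A\<^esub> \<one>\<^bsub>A\<^esub>"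

lemma field_K: "field K" using V.vectorspace_axioms by (simp add: vectorspace_def)

lemma ring_K: "ring K" using field_K by (simp add: field_def domain_def cring_def)

lemma unit_scalar_closed [simp]: "c \<in> carrier K \<Longrightarrow> unit_scalar c \<in> carrier A"
  by simp

lemma unit_scalar_comm:
  "c \<in> carrier K \<Longrightarrow> a \<in> carrier A \<Longrightarrow> unit_scalar c \<otimes>\<^bsub>A\<^esub> a = a \<otimes>\<^bsub>A\<^esub> unit_scalar c"
  by (simp add: smult_mult_left smult_mult_right)

lemma scalars_left_module:
  assumes "lmod M" shows "left_module K (scalars A M)"
proof -
  interpret M: left_module A M by fact
  have "abelian_group (scalars A M)"
  proof (rule abelian_groupI)
    fix x assume "x \<in> carrier (scalars A M)"
    thus "\<exists>y\<in>carrier (scalars A M). y \<oplus>\<^bsub>scalars A M\<^esub> x = \<zero>\<^bsub>scalars A M\<^esub>"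
      by (intro bexI[of _ "\<ominus>\<^bsub>M\<^esub> x"]) (auto simp: M.M.l_neg)
  qed (auto simp: M.M.a_ac)
  moreover have "(a \<otimes>\<^bsub>K\<^esub> b) \<odot>\<^bsub>A\<^esub> \<one>\<^bsub>A\<^esub> = unit_scalar a \<otimes>\<^bsub>A\<^esub> unit_scalar b"
    if "a \<in> carrier K" "b \<in> carrier K" for a b
    using that by (simp add: smult_mult_left smult_assoc1)
  ultimately show ?thesis
    by (auto simp: left_module_def left_module_axioms_def ring_K smult_l_distr M.lsmult_l_distr
      M.lsmult_r_distr M.lsmult_assoc)
qed

lemma scalars_vectorspace:
  assumes "lmod M" shows "vectorspace K (scalars A M)"
  using lm_vs[OF field_K scalars_left_module[OF assms]] .

lemma lsub_scalars:
  shows "lsub U M \<Longrightarrow> left_submodule K U (scalars A M)"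
  by (auto simp: left_submodule_def)

lemma mhom_scalars:
  shows "f \<in> Hom M N \<Longrightarrow> f \<in> module_hom K (scalars A M) (scalars A N)"
  by (auto simp: module_hom_def)

abbreviation mdim :: "('a, 'm) module \<Rightarrow> nat" where "mdim M \<equiv> vdim (scalars A M)"

lemma fd_submod:
  assumes "fd M" "lsub U M" shows "fd (submod M U)"
  using assms submod_fin_dim[OF scalars_vectorspace _ lsub_scalars] left_module.submod_lm
  by (auto simp: fd_module_def)

lemma fd_surj_image:
  assumes "fd M" "lmod N" "f \<in> Hom M N" "f ` carrier M = carrier N"
  shows "fd N"
  using assms surj_fin_dim_mhom[OF scalars_vectorspace scalars_vectorspace mhom_scalars]
  by (auto simp: fd_module_def)

lemma fd_extension:
  assumes "lmod M" "fd N" "f \<in> Hom M N"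
    "fd (submod M (a_kernel M N f))"
  shows "fd M"
  using assms fin_dim_extension[OF scalars_vectorspace scalars_vectorspace mhom_scalars]
  by (auto simp: fd_module_def)

lemma fd_inj_image:
  assumes M: "lmod M" and N: "fd N" and f: "f \<in> Hom M N"
    and inj: "inj_on f (carrier M)"
  shows "fd M"
proof -
  interpret f: lm_hom A M N f using M N f by (auto intro!: lm_homI simp: fd_module_def)
  have im: "lsub (f ` carrier M) N" using f.image_submodule[OF f.dom.lsub_carrier] .
  interpret g: lm_hom A M "submod N (f ` carrier M)" f using f.corestrict_hom[OF im] by auto
  have bij: "bij_betw f (carrier M) (carrier (submod N (f ` carrier M)))"
    using inj by (simp add: bij_betw_def)
  show ?thesis
    using fd_surj_image[OF fd_submod[OF N im] M g.inv_hom[OF bij]] bij_betw_inv_into[OF bij]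
    by (simp add: bij_betw_def)
qed

lemma fd_quot:
  assumes "fd M" "lsub U M" shows "fd (quot_module M U)"
  using assms quot_proj fd_surj_image by (metis fd_lm)

text \<open>Projectivity, injectivity, weak symmetry and the list of simple modules are all
  formulated for modules on coordinate lists. This copy is the passage from an arbitrary
  finite-dimensional module to that setting.\<close>

lemma klist_copy:
  fixes M :: "('a, 'm) module"
  assumes M: "fd M"
  shows "\<exists>(N :: ('a, 'k list) module) \<phi>. fd N \<and> \<phi> \<in> Hom M N \<and>
    bij_betw \<phi> (carrier M) (carrier N)"
proof -
  obtain \<phi> :: "'m \<Rightarrow> 'k list" where inj: "inj_on \<phi> (carrier M)"
    using fin_dim_list_injection[OF scalars_vectorspace[OF fd_lm[OF M]] fd_fdim[OF M]] by auto
  note * = transport_iso[OF fd_lm[OF M] inj]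
  show ?thesis using fd_surj_image[OF M *(1,2)] *(3) * by (auto simp: bij_betw_def)
qed

text \<open>The quotient by U in a form to which the lifting properties apply directly: a surjection
  with kernel U onto a module on coordinate lists.\<close>

lemma klist_quotient:
  assumes M: "fd M" and U: "lsub U M"
  shows "\<exists>(N :: ('a, 'k list) module) \<pi>. fd N \<and> \<pi> \<in> Hom M N \<and>
    \<pi> ` carrier M = carrier N \<and> a_kernel M N \<pi> = U"
proof -
  note Q = quot_proj[OF fd_lm[OF M] U]
  obtain N :: "('a, 'k list) module" and \<phi> where N: "fd N" "\<phi> \<in> Hom (quot_module M U) N"
    "bij_betw \<phi> (carrier (quot_module M U)) (carrier N)" using klist_copy[OF fd_quot[OF M U]] by blast
  interpret \<phi>: lm_hom A "quot_module M U" N \<phi>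
    using N Q by (auto intro!: lm_homI simp: fd_module_def)
  interpret p: lm_hom A M "quot_module M U" "\<lambda>x. U +>\<^bsub>M\<^esub> x"
    using M Q by (auto intro!: lm_homI simp: fd_module_def)
  have "a_kernel M N (\<lambda>x. \<phi> (U +>\<^bsub>M\<^esub> x)) = a_kernel M (quot_module M U) (\<lambda>x. U +>\<^bsub>M\<^esub> x)"
    using \<phi>.inj_onD'[OF bij_betw_imp_inj_on[OF N(3)] p.closed] \<phi>.zero unfolding
      a_kernel_def'
    by (metis (mono_tags, lifting))
  moreover have "(\<lambda>x. \<phi> (U +>\<^bsub>M\<^esub> x)) ` carrier M = carrier N"
    using Q(3) N(3) unfolding bij_betw_def by (metis image_image)
  ultimately show ?thesis using N(1) Q(4) mhom_comp[OF Q(2) N(2)] by metis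
qed

lemma fd_dsum:
  assumes M: "fd M" and N: "fd N" shows "fd (dsum M N)"
proof -
  have lm: "lmod M" "lmod N" using M N by (auto simp: fd_module_def)
  note D = dsum_left_module[OF lm]
  interpret s: lm_hom A "dsum M N" M fst using lm_homI[OF D lm(1) dsum_hom(1)[OF lm]] .
  have kf: "fd (submod (dsum M N) (a_kernel (dsum M N) M fst))"
  proof (rule fd_inj_image[OF _ N])
    show "lmod (submod (dsum M N) (a_kernel (dsum M N) M fst))"
      using s.dom.submod_lm[OF s.ker_submodule] .
    show "snd \<in> Hom (submod (dsum M N) (a_kernel (dsum M N) M fst)) N"
      by (rule mhom_restrict[OF dsum_hom(2)[OF lm]]) auto
    show "inj_on snd (carrier (submod (dsum M N) (a_kernel (dsum M N) M fst)))"
      by (auto simp: inj_on_def)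
  qed
  show ?thesis using fd_extension[OF D M dsum_hom(1)[OF lm] kf] .
qed

lemma fd_regular: "fd (regular_module A)"
proof -
  have lm: "lmod (regular_module A)" using regular_module_lm[OF A.ring_axioms] .
  have "(\<lambda>x. x) \<in> module_hom K A (scalars A (regular_module A))"
    by (rule module_homI) (auto simp: smult_mult_left)
  hence "fdim (scalars A (regular_module A))"
    by (intro surj_fin_dim_mhom[OF V.vectorspace_axioms scalars_vectorspace[OF lm] _
      fin_dim_carrier]) auto
  thus ?thesis using lm by (simp add: fd_module_def)
qed

lemma mdim_hom:
  assumes "fd M" "lmod N" "f \<in> Hom M N"
  shows "mdim M = mdim (submod M (a_kernel M N f)) + mdim (submod N (f ` carrier M))"
  using rank_nullity_mhom[OF scalars_vectorspace scalars_vectorspace mhom_scalars] assms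
  by (fastforce simp: fd_module_def)

lemma mdim_mono:
  assumes "fd M" "lsub U M" "lsub W M" "U \<subseteq> W"
  shows "mdim (submod M U) \<le> mdim (submod M W)" "U \<noteq> W \<Longrightarrow> mdim (submod M U) < mdim (submod M W)"
proof -
  have M: "vectorspace K (scalars A M)" "fdim (scalars A M)"
    using assms scalars_vectorspace by (auto simp: fd_module_def)
  note * = submod_dim_mono[OF M lsub_scalars[OF assms(2)] lsub_scalars[OF assms(3)] assms(4)]
  show "mdim (submod M U) \<le> mdim (submod M W)" using * by simp
  show "mdim (submod M U) < mdim (submod M W)" if "U \<noteq> W" using * that by force
qed

lemma mdim_mono_carrier:
  assumes "fd M" "lsub U M"
  shows "mdim (submod M U) \<le> mdim M" "U \<noteq> carrier M \<Longrightarrow> mdim (submod M U) < mdim M"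
  using mdim_mono[OF assms left_module.lsub_carrier lsub_subset] assms by (auto simp: fd_module_def)

lemma mdim_zero_iff:
  assumes "fd M" shows "mdim M = 0 \<longleftrightarrow> carrier M = {\<zero>\<^bsub>M\<^esub>}"
  using dim_zero_iff[OF scalars_vectorspace] assms by (fastforce simp: fd_module_def)

text \<open>Dimension takes the place of chain conditions: a submodule of greatest dimension with
  property Q is maximal for inclusion among those with Q.\<close>

lemma max_dim_submodule:
  assumes M: "fd M" and Q: "lsub U0 M" "Q U0"
  shows "\<exists>U. lsub U M \<and> Q U \<and>
    (\<forall>W. lsub W M \<and> Q W \<and> U \<subseteq> W \<longrightarrow> W = U) \<and> mdim (submod M U0) \<le> mdim (submod M U)"
proof -
  let ?P = "\<lambda>U. lsub U M \<and> Q U"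
  obtain U where U: "?P U" "\<forall>W. ?P W \<longrightarrow> mdim (submod M W) \<le> mdim (submod M U)"
    using mdim_mono_carrier[OF M] ex_has_greatest_nat[of ?P U0 "\<lambda>U. mdim (submod M U)"
      "Suc (mdim M)"] Q
    by (metis le_imp_less_Suc)
  have "W = U" if "lsub W M" "Q W" "U \<subseteq> W" for W
    using mdim_mono(2)[OF M _ that(1,3)] U that by force
  thus ?thesis using U Q by blast
qed

lemma min_dim_submodule:
  assumes M: "fd M" and Q: "lsub U0 M" "Q U0"
  shows "\<exists>U. lsub U M \<and> Q U \<and>
    (\<forall>W. lsub W M \<and> Q W \<and> W \<subseteq> U \<longrightarrow> W = U)"
proof -
  let ?P = "\<lambda>U. lsub U M \<and> Q U"
  obtain U where U: "?P U" "\<forall>W. ?P W \<longrightarrow> mdim (submod M U) \<le> mdim (submod M W)"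
    using ex_has_least_nat[of ?P U0 "\<lambda>U. mdim (submod M U)"] Q by metis
  have "W = U" if "lsub W M" "Q W" "W \<subseteq> U" for W
    using mdim_mono(2)[OF M that(1) _ that(3)] U that by force
  thus ?thesis using U by blast
qed

end

section \<open>Simple modules, radical and socle\<close>

lemma simple_moduleD:
  "simple_module A M \<Longrightarrow> left_module A M"
  "simple_module A M \<Longrightarrow> carrier M \<noteq> {\<zero>\<^bsub>M\<^esub>}"
  "simple_module A M \<Longrightarrow> left_submodule A U M \<Longrightarrow> U = {\<zero>\<^bsub>M\<^esub>} \<or> U = carrier M"
  by (auto simp: simple_module_def)

lemma module_iso_sym:
  assumes "left_module A M" "left_module A N" "module_iso A M N" shows "module_iso A N M"
proof -
  obtain f where f: "f \<in> module_hom A M N" "bij_betw f (carrier M) (carrier N)"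
    using assms by (auto simp: module_iso_def)
  thus ?thesis
    using lm_hom.inv_hom[OF lm_homI[OF assms(1,2)]] bij_betw_inv_into[OF f(2)]
    by (auto simp: module_iso_def)
qed

lemma module_iso_trans:
  assumes "module_iso A M N" "module_iso A N L" shows "module_iso A M L"
proof -
  obtain f g where f: "f \<in> module_hom A M N" "bij_betw f (carrier M) (carrier N)"
    and g: "g \<in> module_hom A N L" "bij_betw g (carrier N) (carrier L)"
    using assms by (auto simp: module_iso_def)
  thus ?thesis
    using mhom_comp[OF f(1)] bij_betw_trans[OF f(2) g(2)] by (auto simp: module_iso_def comp_def)
qed

lemma (in lm_hom) image_vimage:
  assumes sur: "f ` carrier M = carrier N" and V: "V \<subseteq> carrier N"
  shows "f ` {x \<in> carrier M. f x \<in> V} = V"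
proof
  show "V \<subseteq> f ` {x \<in> carrier M. f x \<in> V}" using sur V by auto

qed blast

lemma (in lm_hom) eq_iff_diff_ker:
  assumes "x \<in> carrier M" "y \<in> carrier M" shows "f x = f y \<longleftrightarrow> x \<ominus>\<^bsub>M\<^esub> y \<in> a_kernel M N f"
  using assms by simp

lemma (in lm_hom) ker_image: "f ` a_kernel M N f = {\<zero>\<^bsub>N\<^esub>}"
proof
  show "f ` a_kernel M N f \<subseteq> {\<zero>\<^bsub>N\<^esub>}" by auto
  show "{\<zero>\<^bsub>N\<^esub>} \<subseteq> f ` a_kernel M N f" by force
qed

text \<open>The homomorphism theorem: f is onto and h does not separate points that f identifies, so
  h may be evaluated on any preimage under f.\<close>

lemma (in lm_hom) mhom_factor:
  fixes L (structure)
  assumes sur: "f ` carrier M = carrier N" and h: "lm_hom A M L h"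
    and ker: "a_kernel M N f \<subseteq> a_kernel M L h"
  shows "\<exists>g. g \<in> module_hom A N L \<and> (\<forall>x\<in>carrier M. g (f x) = h x)"
proof -
  interpret h: lm_hom A M L h by fact
  have eq: "h x = h y" if "x \<in> carrier M" "y \<in> carrier M" "f x = f y" for x y
    using ker that eq_iff_diff_ker h.eq_iff_diff_ker by blast
  define g where "g y = h (inv_into (carrier M) f y)" for y
  have g: "g (f x) = h x" if "x \<in> carrier M" for x
    unfolding g_def using that by (intro eq) (auto simp: inv_into_into f_inv_into_f)
  have "g \<in> module_hom A N L"
  proof (rule module_homI)
    fix y assume "y \<in> carrier N" then obtain u where "u \<in> carrier M" "y = f u"
      using sur by blast
    thus "g y \<in> carrier L" using g by simp
  next
    fix y z assume "y \<in> carrier N" "z \<in> carrier N"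
    then obtain u v where u: "u \<in> carrier M" "y = f u" and v: "v \<in> carrier M" "z = f v"
      using sur by blast
    have "g (y \<oplus>\<^bsub>N\<^esub> z) = g (f (u \<oplus>\<^bsub>M\<^esub> v))"
      using u v by simp
    also have "\<dots> = h u \<oplus> h v" using u v by (subst g) auto
    finally show "g (y \<oplus>\<^bsub>N\<^esub> z) = g y \<oplus> g z" using u v g by simp
  next
    fix a y assume a: "a \<in> carrier A" and "y \<in> carrier N"
    then obtain u where u: "u \<in> carrier M" "y = f u" using sur by blast
    have "g (a \<odot>\<^bsub>N\<^esub> y) = g (f (a \<odot>\<^bsub>M\<^esub> u))" using u a by simp
    also have "\<dots> = a \<odot> h u" using u a by (subst g) auto
    finally show "g (a \<odot>\<^bsub>N\<^esub> y) = a \<odot> g y" using u g by simp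
  qed
  thus ?thesis using g by blast
qed

lemma (in lm_hom) simple_of_bij:
  assumes "bij_betw f (carrier M) (carrier N)" "simple_module A M" shows "simple_module A N"
  unfolding simple_module_def
proof (intro conjI allI impI)
  have inj: "inj_on f (carrier M)" and sur: "f ` carrier M = carrier N"
    using assms by (auto simp: bij_betw_def)
  show "left_module A N" by (rule cod.left_module_axioms)
  show "carrier N \<noteq> {\<zero>\<^bsub>N\<^esub>}"
    using inj_onD'[OF inj] simple_moduleD(2)[OF assms(2)] by auto
  fix V assume V: "left_submodule A V N"
  have "left_submodule A {x \<in> carrier M. f x \<in> V} M" by (rule vimage_submodule[OF V])
  then consider "{x \<in> carrier M. f x \<in> V} = {\<zero>\<^bsub>M\<^esub>}" | "{x \<in> carrier M. f x \<in> V} = carrier M"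
    using simple_moduleD(3)[OF assms(2)] by blast
  thus "V = {\<zero>\<^bsub>N\<^esub>} \<or> V = carrier N"
  proof cases
    case 1
    have "V \<subseteq> {\<zero>\<^bsub>N\<^esub>}"
    proof
      fix v assume v: "v \<in> V"
      then obtain x where x: "x \<in> carrier M" "v = f x" using sur lsub_subset[OF V] by blast
      hence "x \<in> {x \<in> carrier M. f x \<in> V}" using v by simp
      thus "v \<in> {\<zero>\<^bsub>N\<^esub>}" using x unfolding 1 by simp
    qed
    thus ?thesis using lsub_zero[OF V] by blast
  next
    case 2
    thus ?thesis using image_vimage[OF sur lsub_subset[OF V]] sur by simp
  qed
qed

lemma module_iso_simple:
  assumes "module_iso A M N" "left_module A N" "simple_module A M" shows "simple_module A N"
proof -
  obtain f where f: "f \<in> module_hom A M N" "bij_betw f (carrier M) (carrier N)"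
    using assms by (auto simp: module_iso_def)
  thus ?thesis using lm_hom.simple_of_bij[OF lm_homI] assms simple_moduleD(1) by blast
qed

text \<open>Submodules of N correspond to the submodules of M above the kernel, by taking preimages
  and images.\<close>

lemma (in lm_hom) surj_simple_maximal:
  assumes sur: "f ` carrier M = carrier N"
  shows "simple_module A N \<longleftrightarrow> maximal_submodule A (a_kernel M N f) M"
proof
  assume N: "simple_module A N"
  show "maximal_submodule A (a_kernel M N f) M" unfolding maximal_submodule_def
  proof (intro conjI allI impI ker_submodule)
    show "a_kernel M N f \<noteq> carrier M" using simple_moduleD(2)[OF N] ker_image sur by blast
    fix L assume L: "left_submodule A L M" "a_kernel M N f \<subseteq> L"
    have "f ` L = {\<zero>\<^bsub>N\<^esub>} \<or> f ` L = carrier N"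
      using simple_moduleD(3)[OF N image_submodule[OF L(1)]] .
    thus "L = a_kernel M N f \<or> L = carrier M"
    proof
      assume "f ` L = {\<zero>\<^bsub>N\<^esub>}"
      thus ?thesis using lsub_subset ker_iff L by blast
    next
      assume fL: "f ` L = carrier N"
      have "carrier M \<subseteq> L"
      proof
        fix x assume x: "x \<in> carrier M"
        then obtain l where l: "l \<in> L" "f x = f l" using fL by (metis closed imageE)
        have lM: "l \<in> carrier M" using l lsub_subset[OF L(1)] by auto
        hence "x \<ominus>\<^bsub>M\<^esub> l \<in> L" using L(2) x l by auto
        thus "x \<in> L"
          using l lsub_add[OF L(1)] x lM by (force simp: dom.M.minus_eq dom.M.a_assoc dom.M.l_neg)
      qed
      thus ?thesis using lsub_subset[OF L(1)] by auto
    qed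
  qed
next
  assume mx: "maximal_submodule A (a_kernel M N f) M"
  show "simple_module A N" unfolding simple_module_def
  proof (intro conjI allI impI cod.left_module_axioms)
    show "carrier N \<noteq> {\<zero>\<^bsub>N\<^esub>}"
      using mx by (auto simp: maximal_submodule_def)
    fix V assume V: "left_submodule A V N"
    let ?L = "{x \<in> carrier M. f x \<in> V}"
    have "a_kernel M N f \<subseteq> ?L" using lsub_zero[OF V] by auto
    hence "?L = a_kernel M N f \<or> ?L = carrier M"
      using mx vimage_submodule[OF V] unfolding maximal_submodule_def by blast
    moreover have "f ` ?L = V" by (rule image_vimage[OF sur lsub_subset[OF V]])
    ultimately show "V = {\<zero>\<^bsub>N\<^esub>} \<or> V = carrier N"
      using ker_image sur by (elim disjE) simp_all
  qed
qed

lemma (in left_module) diff_add_cancel: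
  "x \<in> carrier M \<Longrightarrow> y \<in> carrier M \<Longrightarrow> x \<ominus>\<^bsub>M\<^esub> y \<oplus>\<^bsub>M\<^esub> y = x"
  by (simp add: M.minus_eq M.a_assoc M.l_neg)

lemma (in left_module) add_diff_cancel:
  "x \<in> carrier M \<Longrightarrow> y \<in> carrier M \<Longrightarrow> (x \<oplus>\<^bsub>M\<^esub> y) \<ominus>\<^bsub>M\<^esub> y = x"
  by (simp add: M.minus_eq M.a_assoc M.r_neg)

lemma (in left_module) lsub_diffD:
  assumes "left_submodule A L M" "x \<in> carrier M" "l \<in> L" "x \<ominus>\<^bsub>M\<^esub> l \<in> L" shows "x \<in> L"
  using lsub_add[OF assms(1,4,3)] diff_add_cancel[OF assms(2)] lsub_mem[OF assms(1,3)] by simp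

lemma (in lm_hom) vimage_maximal:
  assumes sur: "f ` carrier M = carrier N" and V: "maximal_submodule A V N"
  shows "maximal_submodule A {x \<in> carrier M. f x \<in> V} M" unfolding maximal_submodule_def
proof (intro conjI allI impI)
  let ?P = "{x \<in> carrier M. f x \<in> V}"
  have V': "left_submodule A V N" "V \<noteq> carrier N"
    using V by (auto simp: maximal_submodule_def)
  show "left_submodule A ?P M" by (rule vimage_submodule[OF V'(1)])
  have fP: "f ` ?P = V" by (rule image_vimage[OF sur lsub_subset[OF V'(1)]])
  thus "?P \<noteq> carrier M" using V' sur by metis
  fix L assume L: "left_submodule A L M" "?P \<subseteq> L"
  have "V \<subseteq> f ` L" using image_mono[OF L(2), of f] fP by simp
  hence "f ` L = V \<or> f ` L = carrier N"
    using V image_submodule[OF L(1)] unfolding maximal_submodule_def by blast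
  thus "L = ?P \<or> L = carrier M"
  proof
    assume "f ` L = V" thus ?thesis using lsub_subset L by blast
  next
    assume fL: "f ` L = carrier N"
    have "carrier M \<subseteq> L"
    proof
      fix x assume x: "x \<in> carrier M"
      then obtain l where l: "l \<in> L" "f x = f l" using fL by (metis closed imageE)
      have lM: "l \<in> carrier M" using l lsub_subset[OF L(1)] by auto
      hence "f (x \<ominus>\<^bsub>M\<^esub> l) \<in> V"
        using x l eq_iff_diff_ker lsub_zero[OF V'(1)] by (simp only: ker_iff)
      thus "x \<in> L" using x lM L(2) dom.lsub_diffD[OF L(1) x l(1)] by blast
    qed
    thus ?thesis using lsub_subset[OF L(1)] by auto
  qed
qed

lemma (in lm_hom) image_maximal:
  assumes sur: "f ` carrier M = carrier N" and V: "maximal_submodule A V M" and k: "a_kernel M N f \<subseteq> V"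
  shows "maximal_submodule A (f ` V) N" unfolding maximal_submodule_def
proof (intro conjI allI impI)
  have V': "left_submodule A V M" "V \<noteq> carrier M"
    using V by (auto simp: maximal_submodule_def)
  have sat: "x \<in> V" if x: "x \<in> carrier M" "f x \<in> f ` V" for x
  proof -
    obtain v where v: "v \<in> V" "f x = f v" using x by auto
    have vM: "v \<in> carrier M" using v lsub_subset[OF V'(1)] by auto
    thus ?thesis using k x v ker_iff dom.lsub_diffD[OF V'(1) x(1) v(1)] by fastforce
  qed
  show "left_submodule A (f ` V) N" by (rule image_submodule[OF V'(1)])
  show "f ` V \<noteq> carrier N" using sat V' lsub_subset by blast
  fix L assume L: "left_submodule A L N" "f ` V \<subseteq> L"
  let ?P = "{x \<in> carrier M. f x \<in> L}"
  have "V \<subseteq> ?P" using L(2) lsub_mem[OF V'(1)] by auto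
  hence "?P = V \<or> ?P = carrier M"
    using V vimage_submodule[OF L(1)] unfolding maximal_submodule_def by blast
  moreover have "f ` ?P = L" by (rule image_vimage[OF sur lsub_subset[OF L(1)]])
  ultimately show "L = f ` V \<or> L = carrier N" using sur by (elim disjE) simp_all
qed

lemma (in left_module) rad_submodule: "left_submodule A (rad A M) M"
  unfolding rad_def by (rule lsub_Inter) (auto simp: maximal_submodule_def)

lemma (in lm_hom) rad_image:
  assumes sur: "f ` carrier M = carrier N" shows "f ` rad A M \<subseteq> rad A N"
  using vimage_maximal[OF sur] by (auto simp: rad_def)

lemma (in lm_hom) rad_image_superset:
  assumes sur: "f ` carrier M = carrier N" and k: "a_kernel M N f \<subseteq> rad A M"
  shows "rad A N \<subseteq> f ` rad A M"
proof
  fix y assume y: "y \<in> rad A N"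
  hence "y \<in> carrier N" by (simp add: rad_def)
  then obtain x where x: "x \<in> carrier M" "y = f x" using sur by blast
  have "x \<in> V" if V: "maximal_submodule A V M" for V
  proof -
    have kV: "a_kernel M N f \<subseteq> V" using k V by (auto simp: rad_def)
    have sub: "left_submodule A V M" using V by (simp add: maximal_submodule_def)
    have "f x \<in> f ` V" using image_maximal[OF sur V kV] y x by (auto simp: rad_def)
    then obtain v where v: "v \<in> V" "f x = f v" by auto
    have vM: "v \<in> carrier M" using v lsub_subset[OF sub] by auto
    thus ?thesis using kV x v ker_iff dom.lsub_diffD[OF sub x(1) v(1)] by fastforce
  qed
  thus "y \<in> f ` rad A M" using x by (auto simp: rad_def)
qed

lemma (in left_module) simple_Int:
  assumes "left_submodule A T M" "simple_module A (submod M T)" "left_submodule A W M"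
  shows "T \<inter> W = {\<zero>\<^bsub>M\<^esub>} \<or> T \<subseteq> W"
  using lsub_submod_iff[OF assms(1)] lsub_Int[OF assms(1,3)] simple_moduleD(3)[OF assms(2)]
  by fastforce

text \<open>A maximal submodule W of M either contains V or cuts out a maximal submodule of V, since
  in the second case W + V = M and V/(W \<inter> V) is the simple module M/W.\<close>

lemma (in left_module) rad_submod_subset:
  assumes V: "left_submodule A V M" shows "rad A (submod M V) \<subseteq> rad A M"
proof
  fix x assume x: "x \<in> rad A (submod M V)"
  hence xV: "x \<in> V" by (simp add: rad_def)
  have "x \<in> W" if W: "maximal_submodule A W M" for W
  proof (cases "V \<subseteq> W")
    case False
    have Ws: "left_submodule A W M" using W by (simp add: maximal_submodule_def)
    have "maximal_submodule A (W \<inter> V) (submod M V)"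
      unfolding maximal_submodule_def lsub_submod_iff[OF V]
    proof (intro conjI allI impI)
      show "left_submodule A (W \<inter> V) M" "W \<inter> V \<subseteq> V"
        using lsub_Int[OF Ws V] by auto
      show "W \<inter> V \<noteq> carrier (submod M V)" using False by auto
      fix L assume "left_submodule A L M \<and> L \<subseteq> V" and WL: "W \<inter> V \<subseteq> L"
      hence L: "left_submodule A L M" "L \<subseteq> V" by auto
      have "W <+>\<^bsub>M\<^esub> L = W \<or> W <+>\<^bsub>M\<^esub> L = carrier M"
        using W lsub_sum[OF Ws L(1)] set_add_upper[OF Ws L(1)] unfolding maximal_submodule_def
        by blast
      thus "L = W \<inter> V \<or> L = carrier (submod M V)"
      proof
        assume "W <+>\<^bsub>M\<^esub> L = W"
        thus ?thesis using set_add_upper[OF Ws L(1)] WL L by auto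
      next
        assume s: "W <+>\<^bsub>M\<^esub> L = carrier M"
        have "V \<subseteq> L"
        proof
          fix v assume v: "v \<in> V"
          hence vM: "v \<in> carrier M" using lsub_subset[OF V] by auto
          hence "v \<in> W <+>\<^bsub>M\<^esub> L" using s by simp
          then obtain w l where wl: "w \<in> W" "l \<in> L" "v = w \<oplus>\<^bsub>M\<^esub> l"
            by (auto simp: set_add_def')
          hence "v \<ominus>\<^bsub>M\<^esub> l = w"
            using lsub_subset[OF Ws] lsub_subset[OF L(1)] add_diff_cancel by auto
          moreover have "v \<ominus>\<^bsub>M\<^esub> l \<in> V"
            using v wl L lsub_diff[OF V] by auto
          ultimately show "v \<in> L" using WL lsub_diffD[OF L(1) vM] wl by auto
        qed
        thus ?thesis using L by auto
      qed
    qed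
    thus ?thesis using x by (auto simp: rad_def)
  qed (use xV in blast)
  moreover have "x \<in> carrier M" using xV lsub_subset[OF V] by auto
  ultimately show "x \<in> rad A M" by (simp add: rad_def)
qed

lemma (in left_module) soc_submodule: "left_submodule A (soc A M) M"
proof -
  let ?F = "{N. left_submodule A N M \<and>
         (\<forall>U. left_submodule A U M \<longrightarrow> simple_module A (submod M U) \<longrightarrow> U \<subseteq> N)}"
  have "soc A M = carrier M \<inter> \<Inter>?F"
    using lsub_carrier lsub_subset by (force simp: soc_def)
  thus ?thesis using lsub_Inter[of ?F] by auto
qed

lemma simple_subset_soc:
  "left_submodule A U M \<Longrightarrow> simple_module A (submod M U) \<Longrightarrow> U \<subseteq> soc A M"
  by (auto simp: soc_def)

lemma soc_least:
  assumes "left_submodule A N M"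
    "\<And>U. left_submodule A U M \<Longrightarrow> simple_module A (submod M U) \<Longrightarrow> U \<subseteq> N"
  shows "soc A M \<subseteq> N" using assms by (auto simp: soc_def)

lemma (in lm_hom) simple_image:
  assumes U: "left_submodule A U M" "simple_module A (submod M U)"
  shows "f ` U = {\<zero>\<^bsub>N\<^esub>} \<or> (simple_module A (submod N (f ` U)) \<and> inj_on f U)"
proof -
  interpret g: lm_hom A "submod M U" "submod N (f ` U)" f
    using lm_hom.corestrict_hom[OF restrict_hom[OF U(1)] image_submodule[OF U(1)]] by simp
  have "a_kernel (submod M U) (submod N (f ` U)) f = {\<zero>\<^bsub>M\<^esub>} \<or> a_kernel (submod M U) (submod N (f ` U)) f = U"
    using simple_moduleD(3)[OF U(2) g.ker_submodule] by simp
  thus ?thesis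
  proof
    assume "a_kernel (submod M U) (submod N (f ` U)) f = {\<zero>\<^bsub>M\<^esub>}"
    hence inj: "inj_on f (carrier (submod M U))" using g.inj_on_ker by simp
    thus ?thesis using g.simple_of_bij[OF _ U(2)] by (simp add: bij_betw_def)
  next
    assume "a_kernel (submod M U) (submod N (f ` U)) f = U"
    thus ?thesis using lsub_zero[OF image_submodule[OF U(1)]] by auto
  qed
qed

lemma (in lm_hom) soc_image: "f ` soc A M \<subseteq> soc A N"
proof -
  have "soc A M \<subseteq> {x \<in> carrier M. f x \<in> soc A N}"
  proof (rule soc_least)
    show "left_submodule A {x \<in> carrier M. f x \<in> soc A N} M"
      by (rule vimage_submodule[OF cod.soc_submodule])
    fix U assume U: "left_submodule A U M" "simple_module A (submod M U)"
    have "f ` U \<subseteq> soc A N"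
    proof (cases "f ` U = {\<zero>\<^bsub>N\<^esub>}")
      case True thus ?thesis using lsub_zero[OF cod.soc_submodule] by simp
    next
      case False thus ?thesis
        using simple_image[OF U] simple_subset_soc[OF image_submodule[OF U(1)]] by blast
    qed
    thus "U \<subseteq> {x \<in> carrier M. f x \<in> soc A N}" using lsub_subset[OF U(1)] by blast
  qed
  thus ?thesis by blast
qed

section \<open>Semisimple modules and Nakayama's lemma\<close>

context fd_algebra begin

lemma simple_submodule_exists:
  fixes M (structure)
  assumes M: "fd M" and W: "lsub W M" "W \<noteq> {\<zero>}"
  shows "\<exists>U. lsub U M \<and> simple (submod M U) \<and> U \<subseteq> W"
proof -
  interpret M: left_module A M using M by (rule fd_moduleD)
  obtain U where U: "lsub U M" "U \<noteq> {\<zero>} \<and> U \<subseteq> W"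
    and min: "\<And>V. lsub V M \<and> (V \<noteq> {\<zero>} \<and> V \<subseteq> W) \<and> V \<subseteq> U \<Longrightarrow> V = U"
    using min_dim_submodule[OF M W(1), of
      "\<lambda>U. U \<noteq> {\<zero>} \<and> U \<subseteq> W"] W(2)
    by blast
  have "simple (submod M U)"
    unfolding simple_module_def lsub_submod_iff[OF U(1)] using M.submod_lm U min by auto
  thus ?thesis using U by blast
qed

lemma maximal_submodule_exists:
  assumes M: "fd M" and U: "lsub U M" "U \<noteq> carrier M"
  shows "\<exists>V. maxsub V M \<and> U \<subseteq> V"
proof -
  obtain V where V: "lsub V M" "U \<subseteq> V \<and> V \<noteq> carrier M"
    and max: "\<And>W. lsub W M \<and> (U \<subseteq> W \<and> W \<noteq> carrier M) \<and> V \<subseteq> W \<Longrightarrow> W = V"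
    using max_dim_submodule[OF M U(1), of
      "\<lambda>V. U \<subseteq> V \<and> V \<noteq> carrier M"] U(2)
    by blast
  hence "maxsub V M" unfolding maximal_submodule_def by blast
  thus ?thesis using V by blast
qed

text \<open>A proper submodule lies in a maximal one, which contains the radical as well, so the sum
  cannot be everything.\<close>

lemma nakayama:
  assumes M: "fd M" and U: "lsub U M" "U <+>\<^bsub>M\<^esub> rad A M = carrier M"
  shows "U = carrier M"
proof (rule ccontr)
  assume "U \<noteq> carrier M"
  then obtain V where V: "maxsub V M" "U \<subseteq> V"
    using maximal_submodule_exists[OF M U(1)] by blast
  interpret M: left_module A M using M by (rule fd_moduleD)
  have "lsub V M" "V \<noteq> carrier M" using V by (auto simp: maximal_submodule_def)
  moreover have "rad A M \<subseteq> V" using V by (auto simp: rad_def)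
  ultimately show False using M.set_add_least[of V U "rad A M"] V U lsub_subset by blast
qed

text \<open>In a sum of simple modules, complements are found as submodules of maximal dimension that
  meet the given one trivially.\<close>

lemma semisimple_complement:
  fixes M (structure)
  assumes M: "fd M" and ss: "soc A M = carrier M" and U: "lsub U M"
  shows "\<exists>V. lsub V M \<and> U \<inter> V = {\<zero>} \<and> U <+>\<^bsub>M\<^esub> V = carrier M"
proof -
  interpret M: left_module A M using M by (rule fd_moduleD)
  have "U \<inter> {\<zero>} = {\<zero>}" using lsub_zero[OF U] by blast
  then obtain V where V: "lsub V M" "U \<inter> V = {\<zero>}"
    and max: "\<And>W. lsub W M \<and> U \<inter> W = {\<zero>} \<and> V \<subseteq> W \<Longrightarrow> W = V"
    using max_dim_submodule[OF M M.lsub_0, of "\<lambda>V. U \<inter> V = {\<zero>}"] by blast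
  have UV: "lsub (U <+>\<^bsub>M\<^esub> V) M" using M.lsub_sum[OF U V(1)] .
  have "U <+>\<^bsub>M\<^esub> V = carrier M"
  proof (rule ccontr)
    assume ne: "U <+>\<^bsub>M\<^esub> V \<noteq> carrier M"
    obtain T where T: "lsub T M" "simple (submod M T)" "\<not> T \<subseteq> U <+>\<^bsub>M\<^esub> V"
      using soc_least[OF UV] ss ne lsub_subset[OF UV] by blast
    hence T0: "T \<inter> (U <+>\<^bsub>M\<^esub> V) = {\<zero>}"
      using M.simple_Int[OF T(1,2) UV] by blast
    have VT: "lsub (V <+>\<^bsub>M\<^esub> T) M" using M.lsub_sum[OF V(1) T(1)] .
    have "U \<inter> (V <+>\<^bsub>M\<^esub> T) \<subseteq> {\<zero>}"
    proof
      fix u assume u: "u \<in> U \<inter> (V <+>\<^bsub>M\<^esub> T)"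
      then obtain v t where vt: "v \<in> V" "t \<in> T" "u = v \<oplus> t"
        by (auto simp: set_add_def')
      have c: "u \<in> carrier M" "v \<in> carrier M" "t \<in> carrier M"
        using vt lsub_mem[OF V(1)] lsub_mem[OF T(1)] by auto
      have "t = u \<ominus> v" using vt c by (simp add: M.M.a_comm M.add_diff_cancel)
      moreover have "u \<ominus> v \<in> U <+>\<^bsub>M\<^esub> V"
        using u vt M.set_add_upper[OF U V(1)] M.lsub_diff[OF UV] by auto
      ultimately have "u = v" using T0 vt c by auto
      thus "u \<in> {\<zero>}" using u vt V by auto
    qed
    thus False
      using lsub_zero[OF U] lsub_zero max VT M.set_add_upper[OF V(1) T(1)] T(3) M.set_add_upper[OF
        U V(1)]
      by blast
  qed
  thus ?thesis using V by blast
qed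

text \<open>A simple submodule of the radical would have a complement. A maximal submodule above
  that complement contains the radical too, hence everything.\<close>

lemma semisimple_rad_zero:
  fixes M (structure)
  assumes M: "fd M" and ss: "soc A M = carrier M"
  shows "rad A M = {\<zero>}"
proof (rule ccontr)
  interpret M: left_module A M using M by (rule fd_moduleD)
  assume "rad A M \<noteq> {\<zero>}"
  then obtain T where T: "lsub T M" "simple (submod M T)" "T \<subseteq> rad A M"
    using simple_submodule_exists[OF M M.rad_submodule] by blast
  obtain V where V: "lsub V M" "T \<inter> V = {\<zero>}" "T <+>\<^bsub>M\<^esub> V = carrier M"
    using semisimple_complement[OF M ss T(1)] by blast
  have "V \<noteq> carrier M" using simple_moduleD(2)[OF T(2)] V lsub_subset[OF T(1)] by auto
  then obtain W where W: "maxsub W M" "V \<subseteq> W"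
    using maximal_submodule_exists[OF M V(1)] by blast
  have "carrier M \<subseteq> W"
    using T M.set_add_least[of W T V] V W by (force simp: rad_def maximal_submodule_def)
  moreover have "W \<subseteq> carrier M" "W \<noteq> carrier M"
    using W by (auto simp: maximal_submodule_def left_submodule_def)
  ultimately show False by blast
qed

text \<open>Induction on dimension. A nonzero element of a simple submodule U lies outside some
  maximal submodule V, so M = U + V. The radical of V is again zero, which makes V a sum of simple
  modules.\<close>

lemma rad_zero_semisimple:
  assumes "fd M" "rad A M = {\<zero>\<^bsub>M\<^esub>}"
  shows "soc A M = carrier M" using assms
proof (induction "mdim M" arbitrary: M rule: less_induct)
  case less
  interpret M: left_module A M using less.prems(1) by (rule fd_moduleD)
  show ?case
  proof (cases "carrier M = {\<zero>\<^bsub>M\<^esub>}")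
    case True
    thus ?thesis using lsub_subset[OF M.soc_submodule] lsub_zero[OF M.soc_submodule] by auto
  next
    case False
    then obtain U where U: "lsub U M" "simple (submod M U)"
      using simple_submodule_exists[OF less.prems(1) M.lsub_carrier] by blast
    have "U \<noteq> {\<zero>\<^bsub>M\<^esub>}" using simple_moduleD(2)[OF U(2)] by simp
    then obtain x where x: "x \<in> U" "x \<noteq> \<zero>\<^bsub>M\<^esub>"
      using lsub_zero[OF U(1)] by blast
    then obtain V where V: "maxsub V M" "x \<notin> V"
      using less.prems(2) lsub_mem[OF U(1)] by (auto simp: rad_def)
    have Vs: "lsub V M" "V \<noteq> carrier M" using V by (auto simp: maximal_submodule_def)
    have UV: "U <+>\<^bsub>M\<^esub> V = carrier M"
    proof -
      have "V \<subseteq> U <+>\<^bsub>M\<^esub> V" "U \<subseteq> U <+>\<^bsub>M\<^esub> V"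
        using M.set_add_upper[OF U(1) Vs(1)] by auto
      thus ?thesis using V x M.lsub_sum[OF U(1)] unfolding maximal_submodule_def by blast
    qed
    have "soc A (submod M V) = V"
      using M.rad_submod_subset[OF Vs(1)] less.prems(2) lsub_zero[OF left_module.rad_submodule[OF
        M.submod_lm[OF Vs(1)]]] less.hyps[OF _ fd_submod[OF less.prems(1) Vs(1)]]
        mdim_mono_carrier(2)[OF less.prems(1) Vs]
      by auto
    moreover have "soc A (submod M V) \<subseteq> soc A M"
      using lm_hom.soc_image[OF lm_homI[OF M.submod_lm[OF Vs(1)] M.left_module_axioms mhom_incl[OF
        lsub_subset[OF Vs(1)]]]]
      by simp
    ultimately show ?thesis
      using UV M.set_add_least[OF M.soc_submodule simple_subset_soc[OF U], of V] lsub_subset[OF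
        M.soc_submodule]
      by simp
  qed
qed

section \<open>The Jacobson radical acting on modules\<close>

abbreviation J where "J \<equiv> jacobson_radical A"

lemma regular_lm: "lmod (regular_module A)" using regular_module_lm[OF A.ring_axioms] .

lemma J_left_submodule: "lsub J (regular_module A)"
  unfolding jacobson_radical_def by (rule left_module.rad_submodule[OF regular_lm])

lemma J_carrier: "j \<in> J \<Longrightarrow> j \<in> carrier A"
  using lsub_subset[OF J_left_submodule] by auto

lemma simple_cyclic:
  fixes S (structure)
  assumes S: "simple S" and x: "x \<in> carrier S" "x \<noteq> \<zero>"
  shows "(\<lambda>a. a \<odot> x) ` carrier A = carrier S"
proof -
  interpret S: left_module A S using S by (rule simple_moduleD)
  have "(\<lambda>a. a \<odot> x) ` carrier A = {\<zero>} \<or> (\<lambda>a. a \<odot> x) ` carrier A = carrier S"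
    using lsub_cyclic[OF S.left_module_axioms x(1), of "carrier A"] left_module.lsub_carrier[OF
      regular_lm] simple_moduleD(3)[OF S]
    by simp
  moreover have "x \<in> (\<lambda>a. a \<odot> x) ` carrier A" using x by (intro image_eqI) auto
  ultimately show ?thesis using x by blast
qed

lemma fd_simple:
  assumes S: "simple S" shows "fd S"
proof -
  interpret S: left_module A S using S by (rule simple_moduleD)
  obtain x where x: "x \<in> carrier S" "x \<noteq> \<zero>\<^bsub>S\<^esub>"
    using simple_moduleD(2)[OF S] by blast
  show ?thesis
    using fd_surj_image[OF fd_regular S.left_module_axioms orbit_hom[OF S.left_module_axioms x(1)]]
      simple_cyclic[OF S x]
    by simp
qed

text \<open>For nonzero x the map a \<mapsto> a x is onto S, so its kernel is a maximal left ideal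
  and contains J.\<close>

lemma J_annihilates_simple:
  fixes S (structure)
  assumes S: "simple S" and j: "j \<in> J" and x: "x \<in> carrier S"
  shows "j \<odot> x = \<zero>"
proof (cases "x = \<zero>")
  case True
  interpret S: left_module A S using S by (rule simple_moduleD)
  show ?thesis using True J_carrier[OF j] by simp
next
  case False
  interpret S: left_module A S using S by (rule simple_moduleD)
  interpret h: lm_hom A "regular_module A" S "\<lambda>a. a \<odot> x"
    by (intro lm_homI regular_lm S.left_module_axioms orbit_hom x)
  show ?thesis
    using h.surj_simple_maximal simple_cyclic[OF S x False] S j
    by (auto simp: jacobson_radical_def rad_def)
qed

text \<open>For a maximal left ideal I the quotient A/I is simple, and j kills the class of 1 only
  if j lies in I. Simple modules on coordinate lists suffice because A/I has such a copy.\<close>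

lemma JI:
  assumes j: "j \<in> carrier A"
    and kill: "\<And>(S :: ('a, 'k list) module) x. simple S \<Longrightarrow> x \<in> carrier S \<Longrightarrow> j \<odot>\<^bsub>S\<^esub> x = \<zero>\<^bsub>S\<^esub>"
  shows "j \<in> J"
proof -
  have "j \<in> I" if I: "maxsub I (regular_module A)" for I
  proof -
    have "lsub I (regular_module A)" using I by (simp add: maximal_submodule_def)
    then obtain Q :: "('a, 'k list) module" and p where Q: "fd Q" "p \<in> Hom (regular_module A) Q"
      "p ` carrier (regular_module A) = carrier Q" "a_kernel (regular_module A) Q p = I"
      using klist_quotient[OF fd_regular] by blast
    interpret p: lm_hom A "regular_module A" Q p using Q by (intro lm_homI regular_lm fd_moduleD)
    have "j \<odot>\<^bsub>Q\<^esub> p \<one>\<^bsub>A\<^esub> = \<zero>\<^bsub>Q\<^esub>"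
      using p.surj_simple_maximal[OF Q(3)] Q(4) I kill by simp
    moreover have "p j = j \<odot>\<^bsub>Q\<^esub> p \<one>\<^bsub>A\<^esub>"
      using p.smult[of j "\<one>\<^bsub>A\<^esub>"] j by simp
    ultimately show ?thesis using Q(4) j by auto
  qed
  thus ?thesis using j by (simp add: jacobson_radical_def rad_def)
qed

text \<open>J is an intersection of left ideals, so closure under right multiplication is not
  visible from its definition; it follows from the description of J as the common annihilator of the
  simple modules.\<close>

lemma J_mult_right:
  assumes "j \<in> J" "a \<in> carrier A" shows "j \<otimes>\<^bsub>A\<^esub> a \<in> J"
proof (rule JI)
  show "j \<otimes>\<^bsub>A\<^esub> a \<in> carrier A" using assms J_carrier by simp
  fix S :: "('a, 'k list) module" and x assume S: "simple S" "x \<in> carrier S"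
  interpret S: left_module A S using S by (intro simple_moduleD)
  show "(j \<otimes>\<^bsub>A\<^esub> a) \<odot>\<^bsub>S\<^esub> x = \<zero>\<^bsub>S\<^esub>"
    using S assms J_carrier J_annihilates_simple[OF S(1)] by (simp add: S.lsmult_assoc)
qed

text \<open>The submodule of elements that J moves into W. At W = 0 it is the socle, and iterating
  it gives the upper Loewy series.\<close>

definition ann :: "('a, 'm) module \<Rightarrow> 'm set \<Rightarrow> 'm set" where
  "ann M W = {x \<in> carrier M. \<forall>j\<in>J. j \<odot>\<^bsub>M\<^esub> x \<in> W}"

text \<open>The submodule JU, taken as the least submodule that contains all products rather than as
  a set of finite sums.\<close>

definition Jmul :: "('a, 'm) module \<Rightarrow> 'm set \<Rightarrow> 'm set" where
  "Jmul M U = \<Inter>{W. lsub W M \<and> (\<forall>j\<in>J. \<forall>x\<in>U. j \<odot>\<^bsub>M\<^esub> x \<in> W)}"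

lemma ann_submodule:
  fixes M (structure)
  assumes M: "lmod M" and W: "lsub W M" shows "lsub (ann M W) M" unfolding left_submodule_def
proof (intro conjI ballI)
  interpret M: left_module A M by fact
  show "ann M W \<subseteq> carrier M" "\<zero> \<in> ann M W"
    using J_carrier lsub_zero[OF W] by (auto simp: ann_def)
  fix x assume x: "x \<in> ann M W"
  show "x \<oplus> y \<in> ann M W" if "y \<in> ann M W" for y
    using x that J_carrier lsub_add[OF W] by (auto simp: ann_def M.lsmult_r_distr)
  show "a \<odot> x \<in> ann M W" if a: "a \<in> carrier A" for a
    using x a J_carrier J_mult_right by (auto simp: ann_def M.lsmult_assoc[symmetric])
qed

lemma Jmul_submodule:
  assumes M: "lmod M" and U: "U \<subseteq> carrier M" shows "lsub (Jmul M U) M"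
proof -
  interpret M: left_module A M by fact
  let ?F = "{W. lsub W M \<and> (\<forall>j\<in>J. \<forall>x\<in>U. j \<odot>\<^bsub>M\<^esub> x \<in> W)}"
  have "Jmul M U = carrier M \<inter> \<Inter>?F"
    using M.lsub_carrier U J_carrier by (force simp: Jmul_def)
  thus ?thesis using M.lsub_Inter[of ?F] by auto
qed

lemma Jmul_mem: "j \<in> J \<Longrightarrow> x \<in> U \<Longrightarrow> j \<odot>\<^bsub>M\<^esub> x \<in> Jmul M U"
  by (auto simp: Jmul_def)

lemma Jmul_least:
  "lsub W M \<Longrightarrow> (\<And>j x. j \<in> J \<Longrightarrow> x \<in> U \<Longrightarrow> j \<odot>\<^bsub>M\<^esub> x \<in> W) \<Longrightarrow> Jmul M U \<subseteq> W"
  by (auto simp: Jmul_def)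

text \<open>The adjunction between multiplication by J and \<open>ann\<close>. It reduces inclusions
  of radical powers to conditions on single products.\<close>

lemma Jmul_subset_iff:
  "lsub W M \<Longrightarrow> U \<subseteq> carrier M \<Longrightarrow> Jmul M U \<subseteq> W \<longleftrightarrow> U \<subseteq> ann M W"
  using Jmul_least[of W M U] Jmul_mem[of _ _ U] by (fastforce simp: ann_def)

lemma Jmul_subset:
  "lsub U M \<Longrightarrow> Jmul M U \<subseteq> U"
  using J_carrier by (intro Jmul_least) (auto intro: lsub_smult)

lemma Jmul_mono:
  assumes "lmod M" "U \<subseteq> W" "W \<subseteq> carrier M" shows "Jmul M U \<subseteq> Jmul M W"
  by (rule Jmul_least[OF Jmul_submodule[OF assms(1,3)]]) (rule Jmul_mem, assumption, erule
    subsetD[OF assms(2)])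

lemma Jmul_image:
  assumes f: "lm_hom A M N f" and U: "U \<subseteq> carrier M" shows "f ` Jmul M U = Jmul N (f ` U)"
proof
  interpret f: lm_hom A M N f by fact
  have fU: "f ` U \<subseteq> carrier N" using U by auto
  have "Jmul M U \<subseteq> {x \<in> carrier M. f x \<in> Jmul N (f ` U)}"
  proof (rule Jmul_least)
    show "lsub {x \<in> carrier M. f x \<in> Jmul N (f ` U)} M"
      by (rule f.vimage_submodule[OF Jmul_submodule[OF f.cod.left_module_axioms fU]])
    fix j x assume "j \<in> J" "x \<in> U"
    thus "j \<odot>\<^bsub>M\<^esub> x \<in> {x \<in> carrier M. f x \<in> Jmul N (f ` U)}"
      using U J_carrier Jmul_mem[of j "f x" "f ` U"] by (simp add: subset_iff)
  qed
  thus "f ` Jmul M U \<subseteq> Jmul N (f ` U)" by blast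
  show "Jmul N (f ` U) \<subseteq> f ` Jmul M U"
  proof (rule Jmul_least)
    show "lsub (f ` Jmul M U) N"
      by (rule f.image_submodule[OF Jmul_submodule[OF f.dom.left_module_axioms U]])
    fix j y assume j: "j \<in> J" and "y \<in> f ` U"
    then obtain x where "x \<in> U" "y = f x" by auto
    thus "j \<odot>\<^bsub>N\<^esub> y \<in> f ` Jmul M U"
      using U J_carrier[OF j] Jmul_mem[OF j, of x] f.smult[of j] by (metis image_eqI subsetD)
  qed
qed

lemma Jmul_submod:
  assumes M: "lmod M" and V: "lsub V M" and U: "U \<subseteq> V"
  shows "Jmul (submod M V) U = Jmul M U"
proof -
  interpret M: left_module A M by fact
  have "lm_hom A (submod M V) M (\<lambda>x. x)"
    by (intro lm_homI M.submod_lm V M mhom_incl lsub_subset[OF V])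
  from Jmul_image[OF this] show ?thesis using U by simp
qed

text \<open>Dividing by J removes the radical of the regular module, and a module with zero radical
  is semisimple.\<close>

lemma A_mod_J_semisimple:
  "\<exists>(Q :: ('a, 'k list) module) p. fd Q \<and> p \<in> Hom (regular_module A) Q \<and>
    p ` carrier A = carrier Q \<and> a_kernel (regular_module A) Q p = J \<and> soc A Q = carrier Q"
proof -
  obtain Q :: "('a, 'k list) module" and p where Q: "fd Q" "p \<in> Hom (regular_module A) Q"
    "p ` carrier (regular_module A) = carrier Q" "a_kernel (regular_module A) Q p = J"
    using klist_quotient[OF fd_regular J_left_submodule] by blast
  interpret p: lm_hom A "regular_module A" Q p using Q by (intro lm_homI regular_lm fd_moduleD)
  have "rad A Q \<subseteq> p ` J"
    using p.rad_image_superset[OF Q(3)] Q(4) by (simp add: jacobson_radical_def)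
  also have "\<dots> \<subseteq> {\<zero>\<^bsub>Q\<^esub>}" using Q(4) p.ker_iff by blast
  finally have "rad A Q = {\<zero>\<^bsub>Q\<^esub>}"
    using lsub_zero[OF p.cod.rad_submodule] by blast
  hence "soc A Q = carrier Q" by (rule rad_zero_semisimple[OF Q(1)])
  thus ?thesis using Q by auto
qed

text \<open>If J kills x, then a \<mapsto> a x factors through the semisimple module A/J, so x is
  the image of a socle element. Conversely, J kills every simple submodule.\<close>

lemma soc_eq_ann:
  fixes M (structure)
  assumes M: "lmod M" shows "soc A M = ann M {\<zero>}"
proof
  interpret M: left_module A M by fact
  show "soc A M \<subseteq> ann M {\<zero>}"
  proof (rule soc_least[OF ann_submodule[OF M M.lsub_0]])
    fix U assume U: "lsub U M" "simple (submod M U)"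
    show "U \<subseteq> ann M {\<zero>}"
      using J_annihilates_simple[OF U(2)] lsub_mem[OF U(1)] by (auto simp: ann_def)
  qed
  obtain Q :: "('a, 'k list) module" and p where Q: "fd Q" "p \<in> Hom (regular_module A) Q"
    "p ` carrier A = carrier Q" "a_kernel (regular_module A) Q p = J" "soc A Q = carrier Q"
    using A_mod_J_semisimple by blast
  interpret p: lm_hom A "regular_module A" Q p using Q by (intro lm_homI regular_lm fd_moduleD)
  show "ann M {\<zero>} \<subseteq> soc A M"
  proof
    fix x assume x: "x \<in> ann M {\<zero>}"
    hence xM: "x \<in> carrier M" by (simp add: ann_def)
    interpret h: lm_hom A "regular_module A" M "\<lambda>a. a \<odot> x"
      by (intro lm_homI regular_lm M orbit_hom xM)
    have "a_kernel (regular_module A) Q p \<subseteq> a_kernel (regular_module A) M (\<lambda>a. a \<odot> x)"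
      unfolding Q(4) using x J_carrier by (auto simp: ann_def)
    then obtain g where g: "g \<in> Hom Q M" "\<forall>a\<in>carrier A. g (p a) = a \<odot> x"
      using p.mhom_factor[OF _ h.lm_hom_axioms] Q(3) by auto
    interpret g: lm_hom A Q M g using g by (intro lm_homI p.cod.left_module_axioms M)
    have "g (p \<one>\<^bsub>A\<^esub>) = x" using g(2) xM by simp
    moreover have "p \<one>\<^bsub>A\<^esub> \<in> soc A Q" using Q(5) by simp
    ultimately show "x \<in> soc A M" using g.soc_image by blast
  qed
qed

text \<open>J acts as zero on M/JM, which is therefore semisimple with zero radical; this gives one
  inclusion. For the other, J kills the simple quotient by each maximal submodule.\<close>

lemma rad_eq_Jmul:
  fixes M (structure)
  assumes M: "fd M" shows "rad A M = Jmul M (carrier M)"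
proof
  interpret M: left_module A M using M by (rule fd_moduleD)
  have JM: "lsub (Jmul M (carrier M)) M" using Jmul_submodule[OF M.left_module_axioms] by blast
  obtain Q :: "('a, 'k list) module" and p where Q: "fd Q" "p \<in> Hom M Q"
    "p ` carrier M = carrier Q" "a_kernel M Q p = Jmul M (carrier M)"
    using klist_quotient[OF M JM] by blast
  interpret p: lm_hom A M Q p using Q by (intro lm_homI M.left_module_axioms fd_moduleD)
  have "carrier Q \<subseteq> ann Q {\<zero>\<^bsub>Q\<^esub>}"
  proof
    fix y assume y: "y \<in> carrier Q"
    then obtain x where x: "x \<in> carrier M" "y = p x" using Q(3) by blast
    have "j \<odot>\<^bsub>Q\<^esub> y = \<zero>\<^bsub>Q\<^esub>" if j: "j \<in> J" for j
    proof -
      have "j \<odot> x \<in> a_kernel M Q p" unfolding Q(4) by (rule Jmul_mem[OF j x(1)])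
      thus ?thesis using x J_carrier[OF j] by simp
    qed
    thus "y \<in> ann Q {\<zero>\<^bsub>Q\<^esub>}" using y by (simp add: ann_def)
  qed
  hence "soc A Q = carrier Q"
    using soc_eq_ann[OF p.cod.left_module_axioms] lsub_subset[OF p.cod.soc_submodule] by auto
  hence "rad A Q = {\<zero>\<^bsub>Q\<^esub>}" by (rule semisimple_rad_zero[OF Q(1)])
  thus "rad A M \<subseteq> Jmul M (carrier M)"
    using p.rad_image[OF Q(3)] Q(4) lsub_subset[OF M.rad_submodule] by (auto simp: a_kernel_def')
next
  interpret M: left_module A M using M by (rule fd_moduleD)
  have "j \<odot> x \<in> V" if V: "maxsub V M" and j: "j \<in> J" and x: "x \<in> carrier M" for V j x
  proof -
    have "lsub V M" using V by (simp add: maximal_submodule_def)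
    then obtain Q :: "('a, 'k list) module" and p where Q: "fd Q" "p \<in> Hom M Q"
      "p ` carrier M = carrier Q" "a_kernel M Q p = V" using klist_quotient[OF M] by blast
    interpret p: lm_hom A M Q p using Q by (intro lm_homI M.left_module_axioms fd_moduleD)
    show ?thesis
      using p.surj_simple_maximal[OF Q(3)] V J_annihilates_simple[OF _ j p.closed] Q(4) x
        J_carrier[OF j]
      by auto
  qed
  thus "Jmul M (carrier M) \<subseteq> rad A M"
    using J_carrier by (intro Jmul_least M.rad_submodule) (auto simp: rad_def)
qed

end

section \<open>Endomorphisms of indecomposable modules\<close>

lemma set_addE:
  assumes "x \<in> U <+>\<^bsub>M\<^esub> V" obtains u v where "u \<in> U" "v \<in> V" "x = u \<oplus>\<^bsub>M\<^esub> v"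
  using assms by (auto simp: set_add_def')

lemma bij_betw_eqD: "bij_betw f S T \<Longrightarrow> x \<in> S \<Longrightarrow> y \<in> S \<Longrightarrow> f x = f y \<Longrightarrow> x = y"
  by (auto simp: bij_betw_def dest: inj_onD)

text \<open>The first coordinate factors through the addition map from the external sum of N and L
  onto M, because a pair with sum zero has its entries in N \<inter> L.\<close>

lemma direct_sum_projection:
  fixes M (structure)
  assumes M: "left_module A M" and N: "left_submodule A N M" and L: "left_submodule A L M"
    and int: "N \<inter> L = {\<zero>}" and sum: "N <+>\<^bsub>M\<^esub> L = carrier M"
  shows "\<exists>\<pi>\<in>module_hom A M M. (\<forall>x\<in>N. \<pi> x = x) \<and> (\<forall>x\<in>L. \<pi> x = \<zero>) \<and>
    (\<forall>x\<in>carrier M. \<pi> x \<in> N) \<and> (\<forall>x\<in>carrier M. x \<ominus> \<pi> x \<in> L)"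
proof -
  interpret M: left_module A M by fact
  have lm: "left_module A (submod M N)" "left_module A (submod M L)" using M.submod_lm N L by auto
  let ?D = "dsum (submod M N) (submod M L)"
  let ?f = "\<lambda>z. fst z \<oplus> snd z"
  have D: "left_module A ?D" using dsum_left_module lm by auto
  have NL: "N \<subseteq> carrier M" "L \<subseteq> carrier M"
    using N L by (auto simp: left_submodule_def)
  have fh: "?f \<in> module_hom A ?D M"
    using dsum_copair_hom[OF lm M mhom_incl[OF NL(1)] mhom_incl[OF NL(2)]] by simp
  interpret f: lm_hom A ?D M ?f by (intro lm_homI D M fh)
  have fst: "fst \<in> module_hom A ?D M" using mhom_extend_codomain[OF dsum_hom(1)[OF lm] NL(1)] .
  have sur: "?f ` carrier ?D = carrier M"
  proof
    show "?f ` carrier ?D \<subseteq> carrier M" by blast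
    show "carrier M \<subseteq> ?f ` carrier ?D"
    proof
      fix x assume "x \<in> carrier M"
      hence "x \<in> N <+>\<^bsub>M\<^esub> L" using sum by simp
      then obtain n l where "n \<in> N" "l \<in> L" "x = n \<oplus> l" by (rule set_addE)
      thus "x \<in> ?f ` carrier ?D" by (intro image_eqI) auto
    qed
  qed
  have ker: "a_kernel ?D M ?f \<subseteq> a_kernel ?D M fst"
  proof
    fix z assume "z \<in> a_kernel ?D M ?f"
    hence z: "fst z \<in> N" "snd z \<in> L" "fst z \<oplus> snd z = \<zero>" by auto
    hence "fst z = \<ominus> snd z" using NL by (intro M.M.minus_equality[symmetric]) auto
    thus "z \<in> a_kernel ?D M fst"
      using M.lsub_neg[OF L] int z by (auto simp: a_kernel_def' mem_Times_iff)
  qed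
  obtain g where g: "g \<in> module_hom A M M" "\<forall>z\<in>carrier ?D. g (?f z) = fst z"
    using f.mhom_factor[OF sur lm_homI[OF D M fst] ker] by auto
  have eq: "g (n \<oplus> l) = n" if "n \<in> N" "l \<in> L" for n l using g(2) that by auto
  have z: "\<zero> \<in> N" "\<zero> \<in> L" using N L by (auto simp: left_submodule_def)
  have "g x \<in> N \<and> x \<ominus> g x \<in> L" if "x \<in> carrier M" for x
  proof -
    have "x \<in> N <+>\<^bsub>M\<^esub> L" using sum that by simp
    then obtain n l where nl: "n \<in> N" "l \<in> L" "x = n \<oplus> l" by (rule set_addE)
    thus ?thesis using NL M.add_diff_cancel[of l] eq by (force simp: M.M.a_comm)
  qed
  moreover have "g x = x" if "x \<in> N" for x using eq[OF that z(2)] that NL by auto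
  moreover have "g x = \<zero>" if "x \<in> L" for x using eq[OF z(1) that] that NL by auto
  ultimately show ?thesis using g(1) by blast
qed

lemma funpow_hom:
  assumes "f \<in> module_hom A M M" shows "(f ^^ n) \<in> module_hom A M M"
proof (induction n)
  case 0 thus ?case using mhom_id by simp
next
  case (Suc n) thus ?case using mhom_comp[OF Suc assms] by simp
qed

context fd_algebra begin

lemma inj_endo_bij:
  assumes M: "fd M" and f: "f \<in> Hom M M" and inj: "inj_on f (carrier M)"
  shows "bij_betw f (carrier M) (carrier M)"
proof -
  interpret f: lm_hom A M M f using M f by (auto intro!: lm_homI simp: fd_module_def)
  show ?thesis
    using f.inj_on_ker mdim_zero_iff[OF fd_submod[OF M f.ker_submodule]] mdim_hom[OF M
      f.dom.left_module_axioms f] mdim_mono_carrier(2)[OF M f.image_submodule[OF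
      f.dom.lsub_carrier]] inj
    by (auto simp: bij_betw_def)
qed

lemma surj_endo_bij:
  assumes M: "fd M" and f: "f \<in> Hom M M" and sur: "f ` carrier M = carrier M"
  shows "bij_betw f (carrier M) (carrier M)"
proof -
  interpret f: lm_hom A M M f using M f by (auto intro!: lm_homI simp: fd_module_def)
  show ?thesis
    using mdim_hom[OF M f.dom.left_module_axioms f] mdim_zero_iff[OF fd_submod[OF M
      f.ker_submodule]] sur f.inj_on_ker
    by (simp add: bij_betw_def)
qed

text \<open>Fitting's lemma. An exponent whose image has least dimension makes the power bijective
  on its own image. The exponent is written \<open>Suc n\<close> because the applications need a
  positive power: its image lies in that of f and its kernel contains that of f.\<close>

lemma fitting:
  fixes M (structure)
  assumes M: "fd M" and f: "f \<in> Hom M M"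
  shows "\<exists>n. (f ^^ Suc n) ` carrier M \<inter> a_kernel M M (f ^^ Suc n) = {\<zero>} \<and>
    (f ^^ Suc n) ` carrier M <+>\<^bsub>M\<^esub> a_kernel M M (f ^^ Suc n) = carrier M"
proof -
  have lm: "lmod M" using M by (rule fd_moduleD)
  obtain n where n: "\<And>m. mdim (submod M ((f ^^ Suc n) ` carrier M)) \<le> mdim (submod M ((f ^^ Suc m) ` carrier M))"
    using ex_has_least_nat[of "\<lambda>_. True" 0
      "\<lambda>n. mdim (submod M ((f ^^ Suc n) ` carrier M))"]
    by auto
  let ?g = "f ^^ Suc n"
  have gh: "?g \<in> Hom M M" by (rule funpow_hom[OF f])
  interpret g: lm_hom A M M ?g by (intro lm_homI lm gh)
  let ?I = "?g ` carrier M" and ?k = "a_kernel M M ?g"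
  have I: "lsub ?I M" by (rule g.image_submodule[OF g.dom.lsub_carrier])
  have gI: "lsub (?g ` ?I) M" by (rule g.image_submodule[OF I])
  have sub: "?g ` ?I \<subseteq> ?I" by blast
  have "?g ` ?I = (f ^^ Suc (Suc (n + n))) ` carrier M"
  proof -
    have "?g ` ?I = ((f ^^ Suc n) \<circ> (f ^^ Suc n)) ` carrier M" by (simp only: image_comp)
    also have "(f ^^ Suc n) \<circ> (f ^^ Suc n) = f ^^ (Suc n + Suc n)" by (simp only: funpow_add)
    finally show ?thesis by simp
  qed
  hence gII: "?g ` ?I = ?I" using n[of "Suc (n + n)"] mdim_mono(2)[OF M gI I sub] by auto
  have sum: "carrier M \<subseteq> ?I <+>\<^bsub>M\<^esub> ?k"
  proof
    fix x assume x: "x \<in> carrier M"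
    hence "?g x \<in> ?g ` ?I" using gII by blast
    then obtain y where y: "y \<in> ?I" "?g x = ?g y" by blast
    have yM: "y \<in> carrier M" using y by blast
    hence "x \<ominus> y \<in> ?k" using g.eq_iff_diff_ker x y by blast
    hence "y \<oplus> (x \<ominus> y) \<in> ?I <+>\<^bsub>M\<^esub> ?k"
      using y unfolding set_add_def' by blast
    moreover have "y \<oplus> (x \<ominus> y) = x"
      using g.dom.diff_add_cancel x yM by (simp add: g.dom.M.a_comm)
    ultimately show "x \<in> ?I <+>\<^bsub>M\<^esub> ?k" by simp
  qed
  interpret r: lm_hom A "submod M ?I" "submod M ?I" ?g
    using lm_hom.corestrict_hom[OF g.restrict_hom[OF I], of ?I] I sub by auto
  have int: "?I \<inter> ?k \<subseteq> {\<zero>}"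
    using surj_endo_bij[OF fd_submod[OF M I] r.hom] gII r.inj_onD'
    by (auto simp: bij_betw_def a_kernel_def')
  hence "?I \<inter> ?k = {\<zero>}" using lsub_zero[OF I] lsub_zero[OF g.ker_submodule] by blast
  moreover have "?I <+>\<^bsub>M\<^esub> ?k = carrier M"
    using sum lsub_subset[OF g.dom.lsub_sum[OF I g.ker_submodule]] by blast
  ultimately show ?thesis by blast
qed

text \<open>The endomorphism ring is local. By Fitting's lemma some positive power of f is zero or
  injective; in the first case f has no nonzero fixed point, so 1 - f is injective, hence
  bijective.\<close>

lemma indecomposable_endo:
  fixes M (structure)
  assumes M: "fd M" and ind: "indec M" and f: "f \<in> Hom M M"
  shows "bij_betw f (carrier M) (carrier M) \<or>
    bij_betw (\<lambda>x. x \<ominus> f x) (carrier M) (carrier M)"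
proof -
  have lm: "lmod M" using M by (rule fd_moduleD)
  interpret f: lm_hom A M M f by (intro lm_homI lm f)
  obtain n where n: "(f ^^ Suc n) ` carrier M \<inter> a_kernel M M (f ^^ Suc n) = {\<zero>}"
    "(f ^^ Suc n) ` carrier M <+>\<^bsub>M\<^esub> a_kernel M M (f ^^ Suc n) = carrier M"
    using fitting[OF M f] by blast
  interpret g: lm_hom A M M "f ^^ Suc n" by (intro lm_homI lm funpow_hom f)
  have "(f ^^ Suc n) ` carrier M = {\<zero>} \<or> a_kernel M M (f ^^ Suc n) = {\<zero>}"
    using ind n g.ker_submodule g.image_submodule[OF f.dom.lsub_carrier] unfolding
      indecomposable_module_def
    by blast
  thus ?thesis
  proof
    assume k: "a_kernel M M (f ^^ Suc n) = {\<zero>}"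
    have "inj_on f (carrier M)"
    proof (rule f.inj_onI')
      fix x assume x: "x \<in> carrier M" "f x = \<zero>"
      interpret h: lm_hom A M M "f ^^ n" by (intro lm_homI lm funpow_hom f)
      show "x = \<zero>" using k x by (force simp: funpow_swap1 a_kernel_def')
    qed
    thus ?thesis using inj_endo_bij[OF M f] by blast
  next
    assume I: "(f ^^ Suc n) ` carrier M = {\<zero>}"
    have dh: "(\<lambda>x. x \<ominus> f x) \<in> Hom M M"
      by (intro f.dom.lm_hom_sub lm_homI lm mhom_id f)
    interpret d: lm_hom A M M "\<lambda>x. x \<ominus> f x" by (intro lm_homI lm dh)
    have "inj_on (\<lambda>x. x \<ominus> f x) (carrier M)"
    proof (rule d.inj_onI')
      fix x assume x: "x \<in> carrier M" "x \<ominus> f x = \<zero>"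
      hence fx: "f x = x" by simp
      have "(f ^^ k) x = x" for k by (induction k) (auto simp: fx)
      thus "x = \<zero>" using I x by (metis image_eqI singletonD)
    qed
    thus ?thesis using inj_endo_bij[OF M dh] by blast
  qed
qed

text \<open>The criterion is applied to the projection of a decomposition: if it or its complement
  is injective or surjective, one summand is zero. Both kinds of conditions are offered because
  kernels of covers yield injectivity and cokernels yield surjectivity.\<close>

lemma indecomposableI:
  fixes M (structure)
  assumes M: "lmod M" and ne: "carrier M \<noteq> {\<zero>}"
    and split: "\<And>\<pi>. \<pi> \<in> Hom M M \<Longrightarrow>
      inj_on \<pi> (carrier M) \<or> inj_on (\<lambda>x. x \<ominus> \<pi> x) (carrier M) \<or>
      \<pi> ` carrier M = carrier M \<or> (\<lambda>x. x \<ominus> \<pi> x) ` carrier M = carrier M"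
  shows "indec M" unfolding indecomposable_module_def
proof (intro conjI allI impI M ne)
  interpret M: left_module A M by fact
  fix N L assume N: "lsub N M" and L: "lsub L M"
    and NL: "N \<inter> L = {\<zero>}" "N <+>\<^bsub>M\<^esub> L = carrier M"
  obtain \<pi> where \<pi>: "\<pi> \<in> Hom M M" "\<forall>x\<in>N. \<pi> x = x" "\<forall>x\<in>L. \<pi> x = \<zero>"
    "\<forall>x\<in>carrier M. \<pi> x \<in> N" "\<forall>x\<in>carrier M. x \<ominus> \<pi> x \<in> L"
    using direct_sum_projection[OF M N L NL] by blast
  interpret p: lm_hom A M M \<pi> by (intro lm_homI M \<pi>(1))
  interpret q: lm_hom A M M "\<lambda>x. x \<ominus> \<pi> x"
    by (intro lm_homI M M.lm_hom_sub mhom_id \<pi>(1))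
  have sub: "N \<subseteq> carrier M" "L \<subseteq> carrier M"
    using N L by (auto simp: left_submodule_def)
  have z: "\<zero> \<in> N" "\<zero> \<in> L" using N L by (auto simp: left_submodule_def)
  consider "inj_on \<pi> (carrier M)" | "inj_on (\<lambda>x. x \<ominus> \<pi> x) (carrier M)"
    | "\<pi> ` carrier M = carrier M" | "(\<lambda>x. x \<ominus> \<pi> x) ` carrier M = carrier M"
    using split[OF \<pi>(1)] by blast
  thus "N = {\<zero>} \<or> L = {\<zero>}"
  proof cases
    case 1
    thus ?thesis using p.inj_onD' \<pi>(3) sub z by blast
  next
    case 2
    have "x \<ominus> \<pi> x = \<zero>" if "x \<in> N" for x using that \<pi>(2) sub by auto
    thus ?thesis using q.inj_onD'[OF 2] sub z by blast
  next
    case 3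
    hence "L = N \<inter> L" using \<pi>(4) sub by force
    thus ?thesis using NL by simp
  next
    case 4
    hence "N = N \<inter> L" using \<pi>(5) sub by force
    thus ?thesis using NL by simp
  qed
qed

text \<open>An idempotent of the kernel of a projective cover extends to the cover and thus acts on the
  indecomposable quotient, where it or its complement is invertible.\<close>

lemma indecomposable_kernel:
  fixes P (structure)
  assumes P: "fd P" and Y: "fd Y" and ind: "indec Y"
    and p: "p \<in> Hom P Y" "p ` carrier P = carrier Y"
    and cover: "\<And>N. lsub N P \<Longrightarrow> N <+>\<^bsub>P\<^esub> a_kernel P Y p = carrier P \<Longrightarrow> N = carrier P"
    and ext: "\<And>\<pi>. \<pi> \<in> Hom (submod P (a_kernel P Y p)) P \<Longrightarrow>
      \<exists>\<theta>\<in>Hom P P. \<forall>x\<in>a_kernel P Y p. \<theta> x = \<pi> x"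
    and ne: "a_kernel P Y p \<noteq> {\<zero>}"
  shows "indec (submod P (a_kernel P Y p))"
proof (rule indecomposableI)
  have lm: "lmod P" "lmod Y" using P Y by (auto simp: fd_module_def)
  interpret p: lm_hom A P Y p by (intro lm_homI lm p)
  let ?Z = "a_kernel P Y p"
  show "lmod (submod P ?Z)" by (rule p.dom.submod_lm[OF p.ker_submodule])
  show "carrier (submod P ?Z) \<noteq> {\<zero>\<^bsub>submod P ?Z\<^esub>}" using ne by simp
  have ZP: "?Z \<subseteq> carrier P" by auto
  fix \<pi> assume \<pi>: "\<pi> \<in> Hom (submod P ?Z) (submod P ?Z)"
  hence \<pi>Z: "\<pi> x \<in> ?Z" if "x \<in> ?Z" for x using that mhom_closed[OF \<pi>] by simp
  obtain \<theta> where \<theta>: "\<theta> \<in> Hom P P" "\<forall>x\<in>?Z. \<theta> x = \<pi> x"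
    using ext[OF mhom_extend_codomain[OF \<pi> ZP]] by blast
  interpret \<theta>: lm_hom A P P \<theta> by (intro lm_homI lm \<theta>)
  obtain g where g: "g \<in> Hom Y Y" "\<forall>x\<in>carrier P. g (p x) = p (\<theta> x)"
    using \<theta>(2) \<pi>Z p.mhom_factor[OF p(2) lm_homI[OF lm mhom_comp[OF \<theta>(1) p(1)]]]
    by (force simp: a_kernel_def')
  have bijI: "bij_betw \<eta> (carrier P) (carrier P)"
    if \<eta>: "\<eta> \<in> Hom P P" and h: "bij_betw h (carrier Y) (carrier Y)" "\<forall>x\<in>carrier P. h (p x) = p (\<eta> x)" for \<eta> h
  proof -
    interpret \<eta>: lm_hom A P P \<eta> by (intro lm_homI lm \<eta>)
    have im: "lsub (\<eta> ` carrier P) P" by (rule \<eta>.image_submodule[OF p.dom.lsub_carrier])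
    have "carrier P \<subseteq> \<eta> ` carrier P <+>\<^bsub>P\<^esub> ?Z"
    proof
      fix x assume x: "x \<in> carrier P"
      then obtain y where "y \<in> carrier Y" "p x = h y"
        using h(1) by (metis bij_betw_def imageE p.closed)
      then obtain z where z: "z \<in> carrier P" "p x = p (\<eta> z)"
        using p(2) h(2) by (metis imageE)
      hence "x \<ominus> \<eta> z \<in> ?Z" using p.eq_iff_diff_ker x by blast
      moreover have "\<eta> z \<oplus> (x \<ominus> \<eta> z) = x"
        using p.dom.diff_add_cancel x z by (simp add: p.dom.M.a_comm)
      ultimately show "x \<in> \<eta> ` carrier P <+>\<^bsub>P\<^esub> ?Z"
        using z unfolding set_add_def' by blast
    qed
    thus ?thesis
      using lsub_subset[OF p.dom.lsub_sum[OF im p.ker_submodule]] surj_endo_bij[OF P \<eta>]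
        cover[OF im]
      by blast
  qed
  have dh: "(\<lambda>x. x \<ominus> \<theta> x) \<in> Hom P P"
    by (intro p.dom.lm_hom_sub lm_homI lm mhom_id \<theta>)
  have "bij_betw g (carrier Y) (carrier Y) \<or> bij_betw (\<lambda>x. x \<ominus>\<^bsub>Y\<^esub> g x) (carrier Y) (carrier Y)"
    by (rule indecomposable_endo[OF Y ind g(1)])
  thus "inj_on \<pi> (carrier (submod P ?Z)) \<or> inj_on (\<lambda>x. x \<ominus>\<^bsub>submod P ?Z\<^esub> \<pi> x) (carrier (submod P ?Z)) \<or>
    \<pi> ` carrier (submod P ?Z) = carrier (submod P ?Z) \<or>
    (\<lambda>x. x \<ominus>\<^bsub>submod P ?Z\<^esub> \<pi> x) ` carrier (submod P ?Z) = carrier (submod P ?Z)"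
  proof
    assume "bij_betw g (carrier Y) (carrier Y)"
    hence "inj_on \<theta> (carrier P)" using bijI[OF \<theta>(1)] g(2) by (auto simp: bij_betw_def)
    hence "inj_on \<pi> ?Z"
      using ZP inj_on_subset \<theta>(2) by (metis (no_types, lifting) inj_on_cong)
    thus ?thesis by simp
  next
    assume b: "bij_betw (\<lambda>x. x \<ominus>\<^bsub>Y\<^esub> g x) (carrier Y) (carrier Y)"
    have "inj_on (\<lambda>x. x \<ominus> \<theta> x) ?Z"
      using bijI[OF dh b] g(2) ZP inj_on_subset by (auto simp: bij_betw_def)
    moreover have "x \<ominus>\<^bsub>submod P ?Z\<^esub> \<pi> x = x \<ominus> \<theta> x" if "x \<in> ?Z" for x
      using p.dom.submod_diff[OF p.ker_submodule that \<pi>Z] \<theta>(2) that by simp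
    ultimately have "inj_on (\<lambda>x. x \<ominus>\<^bsub>submod P ?Z\<^esub> \<pi> x) ?Z"
      by (metis (no_types, lifting) inj_on_cong)
    thus ?thesis by simp
  qed
qed

text \<open>Dual to \<open>indecomposable_kernel\<close>. An endomorphism of Y lifts to I and
  restricts to the indecomposable kernel, where it or its complement is bijective. Injectivity
  spreads from the essential kernel to I, and a bijection of I induces a surjection of Y.\<close>

lemma indecomposable_cokernel:
  fixes I (structure)
  assumes I: "fd I" and Y: "fd Y"
    and p: "p \<in> Hom I Y" "p ` carrier I = carrier Y"
    and ind: "indec (submod I (a_kernel I Y p))"
    and ess: "\<And>N. lsub N I \<Longrightarrow> N \<inter> a_kernel I Y p = {\<zero>} \<Longrightarrow> N = {\<zero>}"
    and lift: "\<And>g. g \<in> Hom I Y \<Longrightarrow> \<exists>\<theta>\<in>Hom I I. \<forall>x\<in>carrier I. p (\<theta> x) = g x"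
    and ne: "carrier Y \<noteq> {\<zero>\<^bsub>Y\<^esub>}"
  shows "indec Y"
proof (rule indecomposableI[OF _ ne])
  have lm: "lmod I" "lmod Y" using I Y by (auto simp: fd_module_def)
  show "lmod Y" by fact
  interpret p: lm_hom A I Y p by (intro lm_homI lm p)
  let ?Z = "a_kernel I Y p"
  fix \<pi> assume \<pi>: "\<pi> \<in> Hom Y Y"
  interpret \<pi>: lm_hom A Y Y \<pi> by (intro lm_homI lm \<pi>)
  obtain \<theta> where \<theta>: "\<theta> \<in> Hom I I" "\<forall>x\<in>carrier I. p (\<theta> x) = \<pi> (p x)"
    using lift[OF mhom_comp[OF p(1) \<pi>]] by blast
  interpret \<theta>: lm_hom A I I \<theta> by (intro lm_homI lm \<theta>)
  have \<theta>Z: "\<theta> x \<in> ?Z" if "x \<in> ?Z" for x using that \<theta>(2) by auto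
  have rh: "\<theta> \<in> Hom (submod I ?Z) (submod I ?Z)"
  proof (rule mhom_corestrict)
    show "\<theta> \<in> Hom (submod I ?Z) I" by (rule mhom_restrict[OF \<theta>(1)]) auto
  qed (use \<theta>Z in simp)
  have bijI: "bij_betw \<eta> (carrier I) (carrier I)"
    if \<eta>: "\<eta> \<in> Hom I I" and inj: "inj_on \<eta> ?Z" for \<eta>
  proof -
    interpret \<eta>: lm_hom A I I \<eta> by (intro lm_homI lm \<eta>)
    have "a_kernel I I \<eta> \<inter> ?Z = {\<zero>}"
      using inj \<eta> by (auto dest: inj_onD[of \<eta> ?Z _ "\<zero>"])
    thus ?thesis
      using ess[OF \<eta>.ker_submodule] inj_endo_bij[OF I \<eta>] \<eta>.inj_on_ker by blast
  qed
  have dh: "(\<lambda>x. x \<ominus> \<theta> x) \<in> Hom I I"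
    by (intro p.dom.lm_hom_sub lm_homI lm mhom_id \<theta>)
  have surI: "h ` carrier Y = carrier Y" if \<eta>: "bij_betw \<eta> (carrier I) (carrier I)"
    and h: "\<forall>x\<in>carrier I. p (\<eta> x) = h (p x)" for \<eta> h
  proof -
    have "h ` carrier Y = (\<lambda>x. h (p x)) ` carrier I" using p(2) by (metis image_image)
    also have "\<dots> = (\<lambda>x. p (\<eta> x)) ` carrier I" using h by simp
    also have "\<dots> = p ` \<eta> ` carrier I" by (simp add: image_image)
    also have "\<dots> = carrier Y" using \<eta> p(2) by (simp add: bij_betw_def)
    finally show ?thesis .
  qed
  have "bij_betw \<theta> ?Z ?Z \<or> bij_betw (\<lambda>x. x \<ominus>\<^bsub>submod I ?Z\<^esub> \<theta> x) ?Z ?Z"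
    using indecomposable_endo[OF fd_submod[OF I p.ker_submodule] ind rh] by simp
  thus "inj_on \<pi> (carrier Y) \<or> inj_on (\<lambda>x. x \<ominus>\<^bsub>Y\<^esub> \<pi> x) (carrier Y) \<or>
    \<pi> ` carrier Y = carrier Y \<or> (\<lambda>x. x \<ominus>\<^bsub>Y\<^esub> \<pi> x) ` carrier Y = carrier Y"
  proof
    assume "bij_betw \<theta> ?Z ?Z"
    thus ?thesis using surI[OF bijI[OF \<theta>(1)]] \<theta>(2) by (auto simp: bij_betw_def)
  next
    assume b: "bij_betw (\<lambda>x. x \<ominus>\<^bsub>submod I ?Z\<^esub> \<theta> x) ?Z ?Z"
    have "x \<ominus>\<^bsub>submod I ?Z\<^esub> \<theta> x = x \<ominus> \<theta> x" if "x \<in> ?Z" for x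
      using p.dom.submod_diff[OF p.ker_submodule that \<theta>Z[OF that]] .
    hence "inj_on (\<lambda>x. x \<ominus> \<theta> x) ?Z"
      using b unfolding bij_betw_def by (metis (no_types, lifting) inj_on_cong)
    thus ?thesis using surI[OF bijI[OF dh]] \<theta>(2) by auto
  qed
qed

section \<open>Projective and injective modules\<close>

lemma projectiveD: "projective P \<Longrightarrow> fd P" by (simp add: projective_module_def)

lemma injectiveD: "injective_module K A P \<Longrightarrow> fd P"
  by (simp add: injective_module_def)

lemma projectiveE:
  fixes L :: "('a, 'k list) module" and N :: "('a, 'k list) module"
  assumes "projective P" "fd L" "fd N" "g \<in> Hom L N"
    "g ` carrier L = carrier N" "f \<in> Hom P N"
  shows "\<exists>h\<in>Hom P L. \<forall>x\<in>carrier P. g (h x) = f x"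
  using assms by (simp add: projective_module_def)

lemma injectiveE:
  fixes L :: "('a, 'k list) module" and N :: "('a, 'k list) module"
  assumes "injective_module K A I" "fd L" "fd N" "g \<in> Hom L N"
    "inj_on g (carrier L)" "f \<in> Hom L I"
  shows "\<exists>h\<in>Hom N I. \<forall>x\<in>carrier L. h (g x) = f x"
  using assms by (simp add: injective_module_def)

text \<open>Conjugating with copies on coordinate lists frees the lifting property from the carrier
  type fixed in the definition.\<close>

lemma projective_lift:
  assumes P: "projective P" and L: "fd L" and N: "fd N"
    and g: "g \<in> Hom L N" "g ` carrier L = carrier N" and f: "f \<in> Hom P N"
  shows "\<exists>h\<in>Hom P L. \<forall>x\<in>carrier P. g (h x) = f x"
proof -
  obtain L' :: "('a, 'k list) module" and \<phi> where L': "fd L'" "\<phi> \<in> Hom L L'"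
    "bij_betw \<phi> (carrier L) (carrier L')" using klist_copy[OF L] by blast
  obtain N' :: "('a, 'k list) module" and \<psi> where N': "fd N'" "\<psi> \<in> Hom N N'"
    "bij_betw \<psi> (carrier N) (carrier N')" using klist_copy[OF N] by blast
  let ?i = "inv_into (carrier L) \<phi>"
  have ih: "?i \<in> Hom L' L"
    using lm_hom.inv_hom[OF lm_homI[OF fd_lm[OF L] fd_lm[OF L'(1)] L'(2)] L'(3)] .
  have ib: "bij_betw ?i (carrier L') (carrier L)" by (rule bij_betw_inv_into[OF L'(3)])
  let ?g = "\<lambda>x. \<psi> (g (?i x))"
  have gh: "?g \<in> Hom L' N'" using mhom_comp[OF mhom_comp[OF ih g(1)] N'(2)] .
  have "?g ` carrier L' = \<psi> ` g ` ?i ` carrier L'" by (simp add: image_image)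
  also have "\<dots> = carrier N'" using ib g(2) N'(3) by (simp add: bij_betw_def)
  finally have gs: "?g ` carrier L' = carrier N'" .
  obtain h where h: "h \<in> Hom P L'" "\<forall>x\<in>carrier P. ?g (h x) = \<psi> (f x)"
    using projectiveE[OF P L'(1) N'(1) gh gs mhom_comp[OF f N'(2)]] by blast
  have "g (?i (h x)) = f x" if "x \<in> carrier P" for x
    using mhom_closed[OF h(1)] mhom_closed[OF ih] mhom_closed[OF g(1)] mhom_closed[OF f] h(2) that
      bij_betw_eqD[OF N'(3)]
    by auto
  thus ?thesis by (intro bexI[OF _ mhom_comp[OF h(1) ih]]) simp
qed

lemma injective_extend:
  assumes I: "injective_module K A I" and L: "fd L" and N: "fd N"
    and g: "g \<in> Hom L N" "inj_on g (carrier L)" and f: "f \<in> Hom L I"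
  shows "\<exists>h\<in>Hom N I. \<forall>x\<in>carrier L. h (g x) = f x"
proof -
  obtain L' :: "('a, 'k list) module" and \<phi> where L': "fd L'" "\<phi> \<in> Hom L L'"
    "bij_betw \<phi> (carrier L) (carrier L')" using klist_copy[OF L] by blast
  obtain N' :: "('a, 'k list) module" and \<psi> where N': "fd N'" "\<psi> \<in> Hom N N'"
    "bij_betw \<psi> (carrier N) (carrier N')" using klist_copy[OF N] by blast
  let ?i = "inv_into (carrier L) \<phi>"
  have ih: "?i \<in> Hom L' L"
    using lm_hom.inv_hom[OF lm_homI[OF fd_lm[OF L] fd_lm[OF L'(1)] L'(2)] L'(3)] .
  have ib: "bij_betw ?i (carrier L') (carrier L)" by (rule bij_betw_inv_into[OF L'(3)])
  let ?g = "\<lambda>x. \<psi> (g (?i x))"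
  have gh: "?g \<in> Hom L' N'" using mhom_comp[OF mhom_comp[OF ih g(1)] N'(2)] .
  have "inj_on ?g (carrier L')"
  proof (rule inj_onI)
    fix x y assume xy: "x \<in> carrier L'" "y \<in> carrier L'" "?g x = ?g y"
    show "x = y"
      using xy mhom_closed[OF ih] mhom_closed[OF g(1)] bij_betw_eqD[OF N'(3)] inj_onD[OF g(2)]
        bij_betw_eqD[OF ib]
      by auto
  qed
  then obtain h where h: "h \<in> Hom N' I" "\<forall>x\<in>carrier L'. h (?g x) = f (?i x)"
    using injectiveE[OF I L'(1) N'(1) gh _ mhom_comp[OF ih f]] by blast
  have "h (\<psi> (g x)) = f x" if "x \<in> carrier L" for x
    using that L'(3) h(2) mhom_closed[OF L'(2) that] by (auto simp: bij_betw_def)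
  thus ?thesis by (intro bexI[OF _ mhom_comp[OF N'(2) h(1)]]) simp
qed

lemma projective_retract:
  assumes P: "projective P" and Q: "fd Q"
    and i: "i \<in> Hom Q P" and r: "r \<in> Hom P Q" and ri: "\<And>x. x \<in> carrier Q \<Longrightarrow> r (i x) = x"
  shows "projective Q" unfolding projective_module_def
proof (intro conjI allI impI ballI Q)
  fix L N :: "('a, 'k list) module" and g f
  assume *: "fd L" "fd N" "g \<in> Hom L N" "f \<in> Hom Q N"
    "g ` carrier L = carrier N"
  obtain h where h: "h \<in> Hom P L" "\<forall>x\<in>carrier P. g (h x) = f (r x)"
    using projective_lift[OF P *(1,2,3,5) mhom_comp[OF r *(4)]] by blast
  show "\<exists>h\<in>Hom Q L. \<forall>x\<in>carrier Q. g (h x) = f x"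
    using mhom_comp[OF i h(1)] h(2) ri mhom_closed[OF i] by (intro bexI) auto
qed

lemma injective_retract:
  assumes P: "injective_module K A P" and Q: "fd Q"
    and i: "i \<in> Hom Q P" and r: "r \<in> Hom P Q" and ri: "\<And>x. x \<in> carrier Q \<Longrightarrow> r (i x) = x"
  shows "injective_module K A Q" unfolding injective_module_def
proof (intro conjI allI impI ballI Q)
  fix L N :: "('a, 'k list) module" and g f
  assume *: "fd L" "fd N" "g \<in> Hom L N" "f \<in> Hom L Q"
    "inj_on g (carrier L)"
  obtain h where h: "h \<in> Hom N P" "\<forall>x\<in>carrier L. h (g x) = i (f x)"
    using injective_extend[OF P *(1,2,3,5) mhom_comp[OF *(4) i]] by blast
  show "\<exists>h\<in>Hom N Q. \<forall>x\<in>carrier L. h (g x) = f x"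
    using mhom_comp[OF h(1) r] h(2) ri mhom_closed[OF *(4)] by (intro bexI) auto
qed

lemma bij_inv_retract:
  assumes "lmod P" "lmod Q" "f \<in> Hom P Q" "bij_betw f (carrier P) (carrier Q)"
  shows "inv_into (carrier P) f \<in> Hom Q P" "\<And>x. x \<in> carrier Q \<Longrightarrow> f (inv_into (carrier P) f x) = x"
    "\<And>x. x \<in> carrier P \<Longrightarrow> inv_into (carrier P) f (f x) = x"
  using lm_hom.inv_hom[OF lm_homI] assms by (auto simp: bij_betw_def f_inv_into_f)

lemma projective_iso:
  assumes P: "projective P" and Q: "lmod Q" and f: "f \<in> Hom P Q" "bij_betw f (carrier P) (carrier Q)"
  shows "projective Q"
  using projective_retract[OF P _ _ f(1)] bij_inv_retract[OF fd_lm[OF projectiveD[OF P]] Q f]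
    fd_surj_image[OF projectiveD[OF P] Q f(1)] f(2)
  by (auto simp: bij_betw_def)

lemma injective_iso:
  assumes P: "injective_module K A P" and Q: "lmod Q" and f: "f \<in> Hom P Q" "bij_betw f (carrier P) (carrier Q)"
  shows "injective_module K A Q"
  using injective_retract[OF P _ _ f(1)] bij_inv_retract[OF fd_lm[OF injectiveD[OF P]] Q f]
    fd_surj_image[OF injectiveD[OF P] Q f(1)] f(2)
  by (auto simp: bij_betw_def)

lemma projective_dsum:
  fixes Q (structure)
  assumes P: "projective P" and Q: "projective Q"
  shows "projective (dsum P Q)" unfolding projective_module_def
proof (intro conjI allI impI ballI)
  have fd: "fd P" "fd Q" using P Q projectiveD by auto
  hence lm: "lmod P" "lmod Q" using fd_moduleD by auto
  show "fd (dsum P Q)" by (rule fd_dsum[OF fd])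
  fix L N :: "('a, 'k list) module" and g f
  assume *: "fd L" "fd N" "g \<in> Hom L N" "f \<in> Hom (dsum P Q) N"
    "g ` carrier L = carrier N"
  have lmL: "lmod L" "lmod N" using * fd_moduleD by auto
  interpret P: left_module A P by fact
  interpret Q: left_module A Q by fact
  interpret g: lm_hom A L N g by (intro lm_homI lmL *)
  interpret f: lm_hom A "dsum P Q" N f by (intro lm_homI lmL * dsum_left_module lm)
  obtain h where h: "h \<in> Hom P L" "\<forall>x\<in>carrier P. g (h x) = f (x, \<zero>)"
    using projective_lift[OF P *(1,2,3,5) mhom_comp[OF dsum_hom(3)[OF lm] *(4)]] by blast
  obtain k where k: "k \<in> Hom Q L" "\<forall>x\<in>carrier Q. g (k x) = f (\<zero>\<^bsub>P\<^esub>, x)"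
    using projective_lift[OF Q *(1,2,3,5) mhom_comp[OF dsum_hom(4)[OF lm] *(4)]] by blast
  have "g (h (fst z) \<oplus>\<^bsub>L\<^esub> k (snd z)) = f z" if z: "z \<in> carrier (dsum P Q)" for z
  proof -
    have zz: "fst z \<in> carrier P" "snd z \<in> carrier Q" using z by auto
    have "g (h (fst z) \<oplus>\<^bsub>L\<^esub> k (snd z)) = f (fst z, \<zero>) \<oplus>\<^bsub>N\<^esub> f (\<zero>\<^bsub>P\<^esub>, snd z)"
      using zz h k mhom_closed[OF h(1)] mhom_closed[OF k(1)] by simp
    also have "\<dots> = f ((fst z, \<zero>) \<oplus>\<^bsub>dsum P Q\<^esub> (\<zero>\<^bsub>P\<^esub>, snd z))"
      using zz by (subst f.add) auto
    also have "\<dots> = f z" using zz by simp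
    finally show ?thesis .
  qed
  thus "\<exists>h\<in>Hom (dsum P Q) L. \<forall>x\<in>carrier (dsum P Q). g (h x) = f x"
    by (intro bexI[OF _ dsum_copair_hom[OF lm lmL(1) h(1) k(1)]]) blast
qed

lemma injective_dsum:
  assumes P: "injective_module K A P" and Q: "injective_module K A Q"
  shows "injective_module K A (dsum P Q)" unfolding injective_module_def
proof (intro conjI allI impI ballI)
  have fd: "fd P" "fd Q" using P Q injectiveD by auto
  hence lm: "lmod P" "lmod Q" using fd_moduleD by auto
  show "fd (dsum P Q)" by (rule fd_dsum[OF fd])
  fix L N :: "('a, 'k list) module" and g f
  assume *: "fd L" "fd N" "g \<in> Hom L N" "f \<in> Hom L (dsum P Q)"
    "inj_on g (carrier L)"
  obtain h where h: "h \<in> Hom N P" "\<forall>x\<in>carrier L. h (g x) = fst (f x)"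
    using injective_extend[OF P *(1,2,3,5) mhom_comp[OF *(4) dsum_hom(1)[OF lm]]] by blast
  obtain k where k: "k \<in> Hom N Q" "\<forall>x\<in>carrier L. k (g x) = snd (f x)"
    using injective_extend[OF Q *(1,2,3,5) mhom_comp[OF *(4) dsum_hom(2)[OF lm]]] by blast
  show "\<exists>h\<in>Hom N (dsum P Q). \<forall>x\<in>carrier L. h (g x) = f x"
    by (intro bexI[OF _ dsum_pair_hom[OF h(1) k(1)]]) (use h(2) k(2) in simp)
qed

lemma projective_regular: "projective (regular_module A)" unfolding projective_module_def
proof (intro conjI allI impI ballI fd_regular)
  fix L N :: "('a, 'k list) module" and g f
  assume *: "fd L" "fd N" "g \<in> Hom L N" "f \<in> Hom (regular_module A) N"
    "g ` carrier L = carrier N"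
  interpret g: lm_hom A L N g using * by (intro lm_homI fd_moduleD)
  interpret f: lm_hom A "regular_module A" N f using * by (intro lm_homI regular_lm fd_moduleD)
  have "f \<one>\<^bsub>A\<^esub> \<in> carrier N" by simp
  then obtain x where x: "x \<in> carrier L" "f \<one>\<^bsub>A\<^esub> = g x" using *(5) by blast
  have "g (a \<odot>\<^bsub>L\<^esub> x) = f a" if "a \<in> carrier A" for a
    using that x f.smult[of a "\<one>\<^bsub>A\<^esub>"] by simp
  thus "\<exists>h\<in>Hom (regular_module A) L. \<forall>x\<in>carrier (regular_module A). g (h x) = f x"
    by (intro bexI[OF _ orbit_hom[OF g.dom.left_module_axioms x(1)]]) simp
qed

text \<open>Stands in for a finite free module mapping onto Y. Among maps from modules that are both
  projective and injective, one with image of greatest dimension is onto: an element outside the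
  image could be reached by adding a copy of A, which selfinjectivity makes injective too.\<close>

lemma proj_inj_surj:
  fixes Y (structure)
  assumes si: "selfinjective K A" and Y: "fd Y"
  shows "\<exists>(F :: ('a, 'k list) module) f. projective F \<and> injective_module K A F \<and>
    f \<in> Hom F Y \<and> f ` carrier F = carrier Y"
proof -
  have lmY: "lmod Y" using Y by (rule fd_moduleD)
  let ?P = "\<lambda>(F :: ('a, 'k list) module, f). projective F \<and> injective_module K A F \<and>
    f \<in> Hom F Y"
  obtain R :: "('a, 'k list) module" and \<rho> where R: "fd R" "\<rho> \<in> Hom (regular_module A) R"
    "bij_betw \<rho> (carrier (regular_module A)) (carrier R)" using klist_copy[OF fd_regular] by blast
  have lmR: "lmod R" using R by (intro fd_moduleD)
  have "?P (R, \<lambda>x. \<zero>)"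
    using projective_iso[OF projective_regular lmR R(2,3)] si injective_iso[OF _ lmR R(2,3)]
      zero_hom[OF lmR lmY]
    by (auto simp: selfinjective_def)
  moreover have "\<forall>z. ?P z \<longrightarrow> mdim (submod Y (snd z ` carrier (fst z))) < Suc (mdim Y)"
  proof (intro allI impI)
    fix z assume z: "?P z"
    then interpret h: lm_hom A "fst z" Y "snd z"
      by (intro lm_homI lmY) (auto intro: fd_lm[OF projectiveD])
    show "mdim (submod Y (snd z ` carrier (fst z))) < Suc (mdim Y)"
      using mdim_mono_carrier(1)[OF Y h.image_submodule[OF h.dom.lsub_carrier]] by simp
  qed
  ultimately obtain z where z: "?P z"
    and mz: "\<And>w. ?P w \<Longrightarrow> mdim (submod Y (snd w ` carrier (fst w))) \<le> mdim (submod Y (snd z ` carrier (fst z)))"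
    using ex_has_greatest_nat[of ?P _ "\<lambda>z. mdim (submod Y (snd z ` carrier (fst z)))"
      "Suc (mdim Y)"]
    by blast
  obtain F f where zF: "z = (F, f)" by (cases z)
  have F: "projective F" "injective_module K A F" "f \<in> Hom F Y" using z zF by auto
  have lmF: "lmod F" by (rule fd_lm[OF projectiveD[OF F(1)]])
  interpret f: lm_hom A F Y f by (intro lm_homI lmF lmY F)
  have "f ` carrier F = carrier Y"
  proof (rule ccontr)
    assume "f ` carrier F \<noteq> carrier Y"
    then obtain x where x: "x \<in> carrier Y" "x \<notin> f ` carrier F" by blast
    have oh: "(\<lambda>a. a \<odot> x) \<in> Hom (regular_module A) Y"
      by (rule orbit_hom[OF lmY x(1)])
    let ?D = "dsum F (regular_module A)" and ?h = "\<lambda>w. f (fst w) \<oplus> snd w \<odot> x"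
    have D: "projective ?D" "injective_module K A ?D"
      using projective_dsum[OF F(1) projective_regular] injective_dsum[OF F(2)] si
      by (auto simp: selfinjective_def)
    have hh: "?h \<in> Hom ?D Y" by (rule dsum_copair_hom[OF lmF regular_lm lmY F(3) oh])
    obtain D' :: "('a, 'k list) module" and \<phi> where D': "fd D'" "\<phi> \<in> Hom ?D D'"
      "bij_betw \<phi> (carrier ?D) (carrier D')" using klist_copy[OF projectiveD[OF D(1)]] by blast
    have lmD: "lmod ?D" "lmod D'" using D' D by (auto intro: fd_moduleD projectiveD)
    note inv = bij_inv_retract[OF lmD D'(2,3)]
    let ?k = "\<lambda>w. ?h (inv_into (carrier ?D) \<phi> w)"
    have kh: "?k \<in> Hom D' Y" by (rule mhom_comp[OF inv(1) hh])
    have P': "?P (D', ?k)"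
      using projective_iso[OF D(1) lmD(2) D'(2,3)] injective_iso[OF D(2) lmD(2) D'(2,3)] kh by simp
    interpret k: lm_hom A D' Y ?k by (intro lm_homI lmD lmY kh)
    have mem: "?h w \<in> ?k ` carrier D'" if "w \<in> carrier ?D" for w
      using inv(3)[OF that] mhom_closed[OF D'(2) that] by (metis (no_types, lifting) image_eqI)
    have "f ` carrier F \<subseteq> ?k ` carrier D'"
    proof
      fix y assume "y \<in> f ` carrier F"
      then obtain u where "u \<in> carrier F" "y = f u" by blast
      thus "y \<in> ?k ` carrier D'" using mem[of "(u, \<zero>\<^bsub>A\<^esub>)"] x by simp
    qed
    moreover have "x \<in> ?k ` carrier D'"
      using mem[of "(\<zero>\<^bsub>F\<^esub>, \<one>\<^bsub>A\<^esub>)"] x by simp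
    ultimately show False
      using mdim_mono(2)[OF Y f.image_submodule[OF f.dom.lsub_carrier] k.image_submodule[OF
        k.dom.lsub_carrier]] x mz[OF P'] zF
      by auto
  qed
  thus ?thesis using F by blast
qed

lemma projective_split:
  assumes P: "projective P" and L: "fd L"
    and g: "g \<in> Hom L P" "g ` carrier L = carrier P"
  shows "\<exists>h\<in>Hom P L. \<forall>x\<in>carrier P. g (h x) = x"
  using projective_lift[OF P L projectiveD[OF P] g mhom_id] .

text \<open>A surjection onto a projective module splits, so P is a retract of a module that is also
  injective.\<close>

lemma projective_injective:
  assumes si: "selfinjective K A" and P: "projective P" shows "injective_module K A P"
proof -
  obtain F :: "('a, 'k list) module" and f where F: "projective F" "injective_module K A F"
    "f \<in> Hom F P" "f ` carrier F = carrier P" using proj_inj_surj[OF si projectiveD[OF P]] by blast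
  obtain h where h: "h \<in> Hom P F" "\<forall>x\<in>carrier P. f (h x) = x"
    using projective_split[OF P projectiveD[OF F(1)] F(3,4)] by blast
  show ?thesis using injective_retract[OF F(2) projectiveD[OF P] h(1) F(3)] h(2) by blast
qed

text \<open>A projective module of minimal dimension mapping onto \<open>Y\<close> is a projective cover: if a proper
  submodule \<open>N\<close> maps onto \<open>Y\<close>, then Fitting's lemma for a lift \<open>P \<rightarrow> N\<close> of the identity of \<open>Y\<close> yields
  a smaller direct summand that still maps onto \<open>Y\<close>.\<close>

lemma projective_cover_exists:
  assumes si: "selfinjective K A" and Y: "fd Y"
  shows "\<exists>(P :: ('a, 'k list) module) p. projective_cover K A P p Y"
proof -
  have lmY: "lmod Y" using Y by (rule fd_moduleD)
  let ?C = "\<lambda>(P :: ('a, 'k list) module, p). projective P \<and> p \<in> Hom P Y \<and> p ` carrier P = carrier Y"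
  obtain z0 where z0: "?C z0" using proj_inj_surj[OF si Y] by blast
  obtain z where z: "?C z" and mz: "\<And>w. ?C w \<Longrightarrow> mdim (fst z) \<le> mdim (fst w)"
    using ex_has_least_nat[of ?C z0 "\<lambda>z. mdim (fst z)"] z0 by blast
  obtain P p where zP: "z = (P, p)" by (cases z)
  have P: "projective P" "p \<in> Hom P Y" "p ` carrier P = carrier Y" using z zP by auto
  have fd: "fd P" using P by (intro projectiveD)
  have lmP: "lmod P" using fd by (rule fd_moduleD)
  interpret p: lm_hom A P Y p by (intro lm_homI lmP lmY P)
  have "N = carrier P" if N: "lsub N P" "N <+>\<^bsub>P\<^esub> a_kernel P Y p = carrier P" for N
  proof (rule ccontr)
    assume ne: "N \<noteq> carrier P"
    have NP: "N \<subseteq> carrier P" using N by (simp add: left_submodule_def)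
    have pN: "p ` N = carrier Y"
    proof -
      have "p x \<in> p ` N" if x: "x \<in> carrier P" for x
      proof -
        have "x \<in> N <+>\<^bsub>P\<^esub> a_kernel P Y p" using N(2) x by simp
        then obtain n k where nk: "n \<in> N" "k \<in> a_kernel P Y p" "x = n \<oplus>\<^bsub>P\<^esub> k"
          by (rule set_addE)
        thus ?thesis using NP by auto
      qed
      hence "p ` carrier P \<subseteq> p ` N" by (rule image_subsetI)
      thus ?thesis using P(3) image_mono[OF NP, of p] by simp
    qed
    obtain h where h: "h \<in> Hom P (submod P N)" "\<forall>x\<in>carrier P. p (h x) = p x"
      using projective_lift[OF P(1) fd_submod[OF fd N(1)] Y mhom_restrict[OF P(2) NP] _ P(2)] pN
      by auto
    have hP: "h \<in> Hom P P" using mhom_extend_codomain[OF h(1) NP] .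
    obtain n where n: "(h ^^ Suc n) ` carrier P \<inter> a_kernel P P (h ^^ Suc n) = {\<zero>\<^bsub>P\<^esub>}"
      "(h ^^ Suc n) ` carrier P <+>\<^bsub>P\<^esub> a_kernel P P (h ^^ Suc n) = carrier P"
      using fitting[OF fd hP] by blast
    let ?g = "h ^^ Suc n"
    interpret g: lm_hom A P P ?g by (intro lm_homI lmP funpow_hom hP)
    let ?I = "?g ` carrier P"
    have I: "lsub ?I P" by (rule g.image_submodule[OF p.dom.lsub_carrier])
    have IN: "?I \<subseteq> N" using mhom_closed[OF funpow_hom[OF hP]] mhom_closed[OF h(1)] by auto
    have pit: "p ((h ^^ m) x) = p x" if "x \<in> carrier P" for x m
      using that mhom_closed[OF funpow_hom[OF hP]] h(2) by (induction m) auto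
    obtain \<pi> where \<pi>: "\<pi> \<in> Hom P P" "\<forall>x\<in>?I. \<pi> x = x" "\<forall>x\<in>carrier P. \<pi> x \<in> ?I"
      using direct_sum_projection[OF lmP I g.ker_submodule n] by blast
    have "projective (submod P ?I)"
    proof (rule projective_retract[OF P(1) fd_submod[OF fd I] mhom_incl[OF lsub_subset[OF I]]])
      show "\<pi> \<in> Hom P (submod P ?I)"
        by (rule mhom_corestrict[OF \<pi>(1)]) (use \<pi>(3) in blast)
      fix x assume "x \<in> carrier (submod P ?I)"
      thus "\<pi> x = x" using \<pi>(2) by auto
    qed
    hence C': "?C (submod P ?I, p)"
      using pit P(3) mhom_restrict[OF P(2) lsub_subset[OF I]]
      by (simp add: image_image del: funpow.simps)
    hence "mdim P \<le> mdim (submod P ?I)" using mz[OF C'] zP by simp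
    moreover have "mdim (submod P ?I) \<le> mdim (submod P N)" using mdim_mono(1)[OF fd I N(1) IN] .
    moreover have "mdim (submod P N) < mdim P" using mdim_mono_carrier(2)[OF fd N(1) ne] .
    ultimately show False by simp
  qed
  thus ?thesis using P by (auto simp: projective_cover_def)
qed

end

section \<open>Schur's lemma\<close>

context
  fixes K :: "'k ring" and V :: "('k, 'v) module" (structure) and T :: "'v \<Rightarrow> 'v" and u :: 'v
  assumes V: "vectorspace K V" and T: "T \<in> module_hom K V V" and u: "u \<in> carrier V"
begin

interpretation K: field K using V by (simp add: vectorspace_def)
interpretation V: left_module K V using vs_lm[OF V] .
interpretation T: lm_hom K V V T by (intro lm_homI V.left_module_axioms T)

text \<open>\<open>horner \<zero> p\<close> is \<open>p(T) u\<close>; polynomials are lists with the leading coefficient first.\<close>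

definition horner :: "'v \<Rightarrow> 'k list \<Rightarrow> 'v" where
  "horner x p = foldl (\<lambda>z a. T z \<oplus> a \<odot> u) x p"

lemma horner_simps: "horner x [] = x" "horner x (a # p) = horner (T x \<oplus> a \<odot> u) p"
  by (simp_all add: horner_def)

lemma horner_closed: "x \<in> carrier V \<Longrightarrow> set p \<subseteq> carrier K \<Longrightarrow> horner x p \<in> carrier V"
  using u by (induction p arbitrary: x) (auto simp: horner_simps)

lemma horner_add:
  assumes "length p = length q" "x \<in> carrier V" "y \<in> carrier V" "set p \<subseteq> carrier K" "set q \<subseteq> carrier K"
  shows "horner (x \<oplus> y) (map2 (\<oplus>\<^bsub>K\<^esub>) p q) = horner x p \<oplus> horner y q"
  using assms
proof (induction p q arbitrary: x y rule: list_induct2)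
  case (Cons a p b q)
  have "T (x \<oplus> y) \<oplus> (a \<oplus>\<^bsub>K\<^esub> b) \<odot> u = (T x \<oplus> a \<odot> u) \<oplus> (T y \<oplus> b \<odot> u)"
    using Cons.prems u by (simp add: V.lsmult_l_distr V.M.a_ac)
  thus ?case using Cons u by (simp add: horner_simps)
qed (simp add: horner_simps)

lemma horner_smult:
  assumes "c \<in> carrier K" "x \<in> carrier V" "set p \<subseteq> carrier K"
  shows "horner (c \<odot> x) (map ((\<otimes>\<^bsub>K\<^esub>) c) p) = c \<odot> horner x p"
  using assms(2,3)
proof (induction p arbitrary: x)
  case (Cons a p)
  have "T (c \<odot> x) \<oplus> (c \<otimes>\<^bsub>K\<^esub> a) \<odot> u = c \<odot> (T x \<oplus> a \<odot> u)"
    using Cons.prems u assms(1) by (simp add: V.lsmult_r_distr V.lsmult_assoc)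
  thus ?case using Cons u by (simp add: horner_simps)
qed (simp add: horner_simps)

lemma horner_pad: "horner \<zero> (\<zero>\<^bsub>K\<^esub> # p) = horner \<zero> p"
  using u by (simp add: horner_simps)

lemma horner_eval:
  assumes "c \<in> carrier K" "set p \<subseteq> carrier K" "b \<in> carrier K"
  shows "foldl (\<lambda>z a. z \<otimes>\<^bsub>K\<^esub> c \<oplus>\<^bsub>K\<^esub> a) b p = b \<otimes>\<^bsub>K\<^esub> c [^]\<^bsub>K\<^esub> length p \<oplus>\<^bsub>K\<^esub> K.eval p c"
  using assms(2,3)
proof (induction p arbitrary: b)
  case (Cons a p)
  have "foldl (\<lambda>z a. z \<otimes>\<^bsub>K\<^esub> c \<oplus>\<^bsub>K\<^esub> a) b (a # p) =
      (b \<otimes>\<^bsub>K\<^esub> c \<oplus>\<^bsub>K\<^esub> a) \<otimes>\<^bsub>K\<^esub> c [^]\<^bsub>K\<^esub> length p \<oplus>\<^bsub>K\<^esub> K.eval p c"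
    using Cons assms(1) by simp
  also have "\<dots> = b \<otimes>\<^bsub>K\<^esub> c [^]\<^bsub>K\<^esub> length (a # p) \<oplus>\<^bsub>K\<^esub> K.eval (a # p) c"
    using Cons.prems assms(1) K.eval_in_carrier
    by (simp add: K.l_distr K.m_assoc K.a_assoc K.m_comm[of "c [^]\<^bsub>K\<^esub> length p"])
  finally show ?case .
qed simp

text \<open>The intermediate values of Horner's scheme at c started with b, without the last one.
  They are the coefficients of the quotient by X - c; the omitted value is the remainder.\<close>

fun partials :: "'k \<Rightarrow> 'k \<Rightarrow> 'k list \<Rightarrow> 'k list" where
  "partials c b [] = []" | "partials c b (a # p) = b # partials c (b \<otimes>\<^bsub>K\<^esub> c \<oplus>\<^bsub>K\<^esub> a) p"

text \<open>Division by \<open>X - c\<close> with remainder, evaluated at \<open>T\<close>.\<close>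

lemma horner_division:
  assumes c: "c \<in> carrier K"
  shows "z \<in> carrier V \<Longrightarrow> b \<in> carrier K \<Longrightarrow> set p \<subseteq> carrier K \<Longrightarrow>
    horner (T z \<ominus> c \<odot> z \<oplus> b \<odot> u) p =
    T (horner z (partials c b p)) \<ominus> c \<odot> horner z (partials c b p)
      \<oplus> foldl (\<lambda>z a. z \<otimes>\<^bsub>K\<^esub> c \<oplus>\<^bsub>K\<^esub> a) b p \<odot> u"
proof (induction p arbitrary: z b)
  case (Cons a p)
  let ?z = "T z \<oplus> b \<odot> u"
  have "T (T z \<ominus> c \<odot> z \<oplus> b \<odot> u) \<oplus> a \<odot> u
      = T (T z) \<ominus> c \<odot> T z \<oplus> b \<odot> T u \<oplus> a \<odot> u"
    using Cons.prems c u by simp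
  moreover have "T ?z \<ominus> c \<odot> ?z \<oplus> (b \<otimes>\<^bsub>K\<^esub> c \<oplus>\<^bsub>K\<^esub> a) \<odot> u
      = T (T z) \<oplus> b \<odot> T u \<ominus> (c \<odot> T z \<oplus> (b \<otimes>\<^bsub>K\<^esub> c) \<odot> u)
        \<oplus> ((b \<otimes>\<^bsub>K\<^esub> c) \<odot> u \<oplus> a \<odot> u)"
    using Cons.prems c u
    by (simp add: V.lsmult_l_distr V.lsmult_r_distr V.lsmult_assoc[symmetric] K.m_comm)
  moreover have "T (T z) \<oplus> b \<odot> T u \<ominus> (c \<odot> T z \<oplus> y) \<oplus> (y \<oplus> a \<odot> u)
      = T (T z) \<ominus> c \<odot> T z \<oplus> b \<odot> T u \<oplus> a \<odot> u" if y: "y \<in> carrier V" for y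
    using Cons.prems c u y by (auto simp: V.M.minus_eq V.M.minus_add V.M.a_ac V.M.r_neg2)
  ultimately show ?case
    using Cons.IH[of ?z "b \<otimes>\<^bsub>K\<^esub> c \<oplus>\<^bsub>K\<^esub> a"] Cons.prems c
      u
    by (simp add: horner_simps)
qed (use u in \<open>simp add: horner_simps\<close>)

lemma length_partials: "length (partials c b p) = length p" by (induction p arbitrary: b) auto

lemma partials_closed:
  "c \<in> carrier K \<Longrightarrow> b \<in> carrier K \<Longrightarrow> set p \<subseteq> carrier K \<Longrightarrow> set (partials c b p) \<subseteq> carrier K"
  by (induction p arbitrary: b) auto

text \<open>\<open>W n\<close> is the space of all p(T) u with p of length n, that is of degree
  below n. The increasing chain of these spaces must stop in finite dimension, and a stop expresses
  the next power of T applied to u through the lower ones.\<close>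

lemma horner_annihilator_exists:
  assumes fin: "vectorspace.fin_dim K V"
  shows "\<exists>p. p \<noteq> [] \<and> hd p \<noteq> \<zero>\<^bsub>K\<^esub> \<and> set p \<subseteq> carrier K \<and> horner \<zero> p = \<zero>"
proof -
  define W where "W n = horner \<zero> ` {p. length p = n \<and> set p \<subseteq> carrier K}" for n
  have set2: "set (map2 (\<oplus>\<^bsub>K\<^esub>) p q) \<subseteq> carrier K" if "set p \<subseteq> carrier K" "set q \<subseteq> carrier K" for p q
    using that by (auto dest: set_zip_leftD set_zip_rightD)
  have sub: "left_submodule K (W n) V" for n unfolding left_submodule_def
  proof (intro conjI ballI)
    show "W n \<subseteq> carrier V" using horner_closed by (auto simp: W_def)
    have "horner \<zero> (replicate n \<zero>\<^bsub>K\<^esub>) = \<zero>"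
      by (induction n) (auto simp: horner_pad, simp add: horner_simps)
    thus "\<zero> \<in> W n"
      unfolding W_def by (intro image_eqI[of _ _ "replicate n \<zero>\<^bsub>K\<^esub>"]) auto
    fix x assume "x \<in> W n"
    then obtain p where p: "length p = n" "set p \<subseteq> carrier K" "x = horner \<zero> p"
      by (auto simp: W_def)
    show "x \<oplus> y \<in> W n" if yW: "y \<in> W n" for y
    proof -
      obtain q where q: "length q = n" "set q \<subseteq> carrier K" "y = horner \<zero> q"
        using yW by (auto simp: W_def)
      hence "x \<oplus> y = horner \<zero> (map2 (\<oplus>\<^bsub>K\<^esub>) p q)"
        using p horner_add[of p q "\<zero>" "\<zero>"] by simp
      thus ?thesis
        using p q set2 unfolding W_def
        by (intro image_eqI[of _ _ "map2 (\<oplus>\<^bsub>K\<^esub>) p q"]) auto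
    qed
    show "c \<odot> x \<in> W n" if c: "c \<in> carrier K" for c
    proof -
      have "c \<odot> x = horner \<zero> (map ((\<otimes>\<^bsub>K\<^esub>) c) p)"
        using p c horner_smult[of c "\<zero>"] by simp
      thus ?thesis
        using p c unfolding W_def
        by (intro image_eqI[of _ _ "map ((\<otimes>\<^bsub>K\<^esub>) c) p"]) auto
    qed
  qed
  have mono: "W n \<subseteq> W (Suc n)" for n
  proof
    fix x assume "x \<in> W n"
    then obtain p where p: "length p = n" "set p \<subseteq> carrier K" "x = horner \<zero> p"
      by (auto simp: W_def)
    thus "x \<in> W (Suc n)"
      unfolding W_def using horner_pad
      by (intro image_eqI[of _ _ "\<zero>\<^bsub>K\<^esub> # p"]) auto
  qed
  let ?d = "\<lambda>n. vectorspace.dim K (submod V (W n))"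
  have "\<exists>n. W n = W (Suc n)"
  proof (rule ccontr)
    assume "\<nexists>n. W n = W (Suc n)"
    hence lt: "?d n < ?d (Suc n)" for n
      using submod_dim_mono[OF V fin sub sub mono] by (meson le_neq_implies_less)
    have "n \<le> ?d n" for n
      by (induction n) (use lt in \<open>auto simp: Suc_le_eq intro: le_less_trans\<close>)
    moreover have "?d n \<le> vectorspace.dim K V" for n
      using submod_dim_mono(1)[OF V fin sub V.lsub_carrier lsub_subset[OF sub]] by simp
    ultimately show False by (meson not_less_eq_eq)
  qed
  then obtain n where n: "W n = W (Suc n)" by blast
  \<comment> \<open>The polynomial X^n. Subtracting the equivalent polynomial of length n, padded by
    a zero, leaves the leading coefficient 1.\<close>
  let ?x = "\<one>\<^bsub>K\<^esub> # replicate n \<zero>\<^bsub>K\<^esub>"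
  have x: "length ?x = Suc n" "set ?x \<subseteq> carrier K" by auto
  hence "horner \<zero> ?x \<in> W (Suc n)" unfolding W_def by blast
  hence "horner \<zero> ?x \<in> W n" using n by simp
  then obtain q where q: "length q = n" "set q \<subseteq> carrier K" "horner \<zero> ?x = horner \<zero> q"
    by (auto simp: W_def)
  let ?m = "map ((\<otimes>\<^bsub>K\<^esub>) (\<ominus>\<^bsub>K\<^esub> \<one>\<^bsub>K\<^esub>)) (\<zero>\<^bsub>K\<^esub> # q)"
  have m: "set ?m \<subseteq> carrier K" "length ?m = Suc n" using q by auto
  have hm: "horner \<zero> ?m = \<ominus> horner \<zero> q"
    using horner_smult[of "\<ominus>\<^bsub>K\<^esub> \<one>\<^bsub>K\<^esub>" "\<zero>"
      "\<zero>\<^bsub>K\<^esub> # q"] horner_pad horner_closed q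
    by (auto simp: V.lsmult_l_minus)
  let ?p = "map2 (\<oplus>\<^bsub>K\<^esub>) ?x ?m"
  have "horner \<zero> ?p = horner \<zero> ?x \<oplus> horner \<zero> ?m"
    using horner_add[of ?x ?m "\<zero>" "\<zero>"] x m by simp
  also have "\<dots> = \<zero>" unfolding hm using horner_closed q by (simp add: V.M.r_neg)
  finally have "horner \<zero> ?p = \<zero>" .
  moreover have "set ?p \<subseteq> carrier K" using set2[OF x(2) m(1)] .
  moreover have "?p \<noteq> []" "hd ?p \<noteq> \<zero>\<^bsub>K\<^esub>" by auto
  ultimately show ?thesis by blast
qed

text \<open>Take an annihilating polynomial p of least length. It is not constant as u is nonzero,
  so it has a root c. By minimality the quotient by X - c does not annihilate u; its value at u is
  an eigenvector for c.\<close>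

lemma eigenvector_exists_aux:
  assumes ac: "algebraically_closed K" and fin: "vectorspace.fin_dim K V" and u0: "u \<noteq> \<zero>"
  shows "\<exists>c\<in>carrier K. \<exists>v\<in>carrier V. v \<noteq> \<zero> \<and> T v = c \<odot> v"
proof -
  let ?P = "\<lambda>p. p \<noteq> [] \<and> hd p \<noteq> \<zero>\<^bsub>K\<^esub> \<and> set p \<subseteq> carrier K \<and> horner \<zero> p = \<zero>"
  obtain p where p: "?P p" and min: "\<And>q. ?P q \<Longrightarrow> length p \<le> length q"
    using horner_annihilator_exists[OF fin] ex_has_least_nat[of ?P] by metis
  obtain a p' where ap: "p = a # p'" using p by (cases p) auto
  have a: "a \<in> carrier K" "a \<noteq> \<zero>\<^bsub>K\<^esub>" "set p' \<subseteq> carrier K"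
    using p ap by auto
  have p'ne: "p' \<noteq> []"
  proof
    assume "p' = []"
    hence au: "a \<odot> u = \<zero>" using p ap u a by (simp add: horner_simps)
    have "u = (inv\<^bsub>K\<^esub> a \<otimes>\<^bsub>K\<^esub> a) \<odot> u"
      using a u K.field_Units by simp
    also have "\<dots> = inv\<^bsub>K\<^esub> a \<odot> (a \<odot> u)"
      using a u by (intro V.lsmult_assoc) auto
    also have "\<dots> = \<zero>" using au a by simp
    finally show False using u0 by simp
  qed
  interpret ac: algebraically_closed K by fact
  have pc: "p \<in> carrier (poly_ring K)"
    using ap a by (simp add: univ_poly_carrier[symmetric] polynomial_def)
  obtain c where "c \<in># K.roots p"
    using ac.roots_over_carrier[OF pc] ap p'ne by (force simp: K.splitted_def)
  hence c: "c \<in> carrier K" "K.eval p c = \<zero>\<^bsub>K\<^esub>"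
    using K.roots_mem_iff_is_root[OF pc] by (auto simp: K.is_root_def)
  let ?q = "partials c a p'"
  have q: "length ?q < length p" "set ?q \<subseteq> carrier K" "?q \<noteq> []" "hd ?q = a"
    using length_partials partials_closed[OF c(1) a(1,3)] ap p'ne by (auto, (cases p'; simp)+)
  let ?z = "horner \<zero> ?q"
  have zc: "?z \<in> carrier V" using horner_closed q by simp
  have "horner \<zero> p = horner (T \<zero> \<ominus> c \<odot> \<zero> \<oplus> a \<odot> u) p'"
    using ap c by (simp add: horner_simps)
  also have "\<dots> = T ?z \<ominus> c \<odot> ?z \<oplus> \<zero>\<^bsub>K\<^esub> \<odot> u"
    using horner_eval c ap a horner_division[OF c(1), of "\<zero>"] by simp
  finally have "T ?z \<ominus> c \<odot> ?z = \<zero>" using p zc c u by simp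
  thus ?thesis using min[of ?q] q a c zc by auto
qed

end

lemma eigenvector_exists:
  fixes K :: "'k ring" and V :: "('k, 'v) module"
  assumes "algebraically_closed K" "vectorspace K V" "vectorspace.fin_dim K V" "T \<in> module_hom K V V"
    "carrier V \<noteq> {\<zero>\<^bsub>V\<^esub>}"
  shows "\<exists>c\<in>carrier K. \<exists>v\<in>carrier V. v \<noteq> \<zero>\<^bsub>V\<^esub> \<and> T v = c \<odot>\<^bsub>V\<^esub> v"
proof -
  interpret left_module K V using vs_lm[OF assms(2)] .
  obtain u where u: "u \<in> carrier V" "u \<noteq> \<zero>\<^bsub>V\<^esub>"
    using assms(5) by blast
  show ?thesis by (rule eigenvector_exists_aux[OF assms(2,4) u(1) assms(1,3) u(2)])
qed

text \<open>Scalars act by central elements, so f minus an eigenvalue is again a homomorphism. It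
  kills an eigenvector, and its kernel is then all of S.\<close>

lemma (in fd_algebra) schur:
  fixes S (structure)
  assumes ac: "algebraically_closed K" and S: "simple S" and f: "f \<in> Hom S S"
  shows "\<exists>c\<in>carrier K. \<forall>x\<in>carrier S. f x = unit_scalar c \<odot> x"
proof -
  interpret S: left_module A S using S by (rule simple_moduleD)
  have fd: "fd S" by (rule fd_simple[OF S])
  obtain c v where c: "c \<in> carrier K" and v: "v \<in> carrier S" "v \<noteq> \<zero>" "f v = unit_scalar c \<odot> v"
    using eigenvector_exists[OF ac scalars_vectorspace[OF S.left_module_axioms] fd_fdim[OF fd]
      mhom_scalars[OF f]] simple_moduleD(2)[OF S]
    by auto
  have uc: "unit_scalar c \<in> carrier A" using c by simp
  have ch: "(\<lambda>x. unit_scalar c \<odot> x) \<in> Hom S S"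
    by (rule module_homI) (use uc unit_scalar_comm[OF c] in \<open>auto simp: S.lsmult_r_distr
      S.lsmult_assoc[symmetric]\<close>)
  have dh: "(\<lambda>x. f x \<ominus> unit_scalar c \<odot> x) \<in> Hom S S"
    by (intro S.lm_hom_sub lm_homI S.left_module_axioms f ch)
  interpret d: lm_hom A S S "\<lambda>x. f x \<ominus> unit_scalar c \<odot> x"
    by (intro lm_homI S.left_module_axioms dh)
  have "f v \<in> carrier S" using mhom_closed[OF f v(1)] .
  hence "f x \<ominus> unit_scalar c \<odot> x = \<zero>" if "x \<in> carrier S" for x
    using simple_moduleD(3)[OF S d.ker_submodule] v that by force
  thus ?thesis using mhom_closed[OF f] c by auto
qed

section \<open>Primitive idempotents\<close>

context fd_algebra begin

definition idem :: "'a \<Rightarrow> bool" where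
  "idem e \<longleftrightarrow> e \<in> carrier A \<and> e \<otimes>\<^bsub>A\<^esub> e = e"

text \<open>For an idempotent e this is the left ideal Ae; the fixed-point form turns membership
  into an equation.\<close>

definition lideal :: "'a \<Rightarrow> ('a, 'a) module" where
  "lideal e = submod (regular_module A) {x \<in> carrier A. x \<otimes>\<^bsub>A\<^esub> e = x}"

definition efix :: "'a \<Rightarrow> ('a, 'm) module \<Rightarrow> 'm set" where
  "efix e N = {x \<in> carrier N. e \<odot>\<^bsub>N\<^esub> x = x}"

text \<open>The dimension of eN, which is that of Hom(Ae, N). It is defined for every module without
  a filtration, so no independence of composition series has to be shown.\<close>

definition cdim :: "'a \<Rightarrow> ('a, 'm) module \<Rightarrow> nat" where
  "cdim e N = vdim (submod (scalars A N) (efix e N))"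

lemma idemD: "idem e \<Longrightarrow> e \<in> carrier A" "idem e \<Longrightarrow> e \<otimes>\<^bsub>A\<^esub> e = e"
  by (auto simp: idem_def)

lemma lideal_simps [simp]:
  "carrier (lideal e) = {x \<in> carrier A. x \<otimes>\<^bsub>A\<^esub> e = x}" "\<zero>\<^bsub>lideal e\<^esub> = \<zero>\<^bsub>A\<^esub>"
  "x \<oplus>\<^bsub>lideal e\<^esub> y = x \<oplus>\<^bsub>A\<^esub> y" "x \<odot>\<^bsub>lideal e\<^esub> y = x \<otimes>\<^bsub>A\<^esub> y"
  by (simp_all add: lideal_def)

lemma lideal_submodule:
  "e \<in> carrier A \<Longrightarrow> lsub {x \<in> carrier A. x \<otimes>\<^bsub>A\<^esub> e = x} (regular_module A)"
  by (auto simp: left_submodule_def A.l_distr A.m_assoc)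

lemma lideal_fd: "e \<in> carrier A \<Longrightarrow> fd (lideal e)"
  unfolding lideal_def by (rule fd_submod[OF fd_regular lideal_submodule])

lemma lideal_lm: "e \<in> carrier A \<Longrightarrow> lmod (lideal e)" by (rule fd_lm[OF lideal_fd])

lemma lideal_retract:
  assumes e: "idem e"
  shows "(\<lambda>x. x) \<in> Hom (lideal e) (regular_module A)"
    "(\<lambda>x. x \<otimes>\<^bsub>A\<^esub> e) \<in> Hom (regular_module A) (lideal e)"
  using idemD[OF e] by (auto intro!: module_homI simp: A.l_distr A.m_assoc)

lemma lideal_projective: "idem e \<Longrightarrow> projective (lideal e)"
  using projective_retract[OF projective_regular lideal_fd lideal_retract] idemD by simp

lemma lideal_injective: "selfinjective K A \<Longrightarrow> idem e \<Longrightarrow> injective_module K A (lideal e)"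
  using injective_retract[OF _ lideal_fd lideal_retract] idemD by (simp add: selfinjective_def)

lemma lideal_hom:
  assumes N: "lmod N" and e: "e \<in> carrier A" and y: "y \<in> carrier N"
  shows "(\<lambda>x. x \<odot>\<^bsub>N\<^esub> y) \<in> Hom (lideal e) N"
proof -
  interpret N: left_module A N by fact
  show ?thesis
    by (rule module_homI) (use y in \<open>auto simp: N.lsmult_l_distr N.lsmult_assoc\<close>)
qed

lemma efixD: "y \<in> efix e N \<Longrightarrow> y \<in> carrier N" "y \<in> efix e N \<Longrightarrow> e \<odot>\<^bsub>N\<^esub> y = y"
  by (auto simp: efix_def)

lemma efix_smult:
  assumes N: "lmod N" and e: "idem e" and y: "y \<in> carrier N"
  shows "e \<odot>\<^bsub>N\<^esub> y \<in> efix e N"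
proof -
  interpret N: left_module A N by fact
  show ?thesis using idemD[OF e] y by (auto simp: efix_def N.lsmult_assoc[symmetric])
qed

lemma efix_subspace:
  fixes N (structure)
  assumes N: "lmod N" and e: "e \<in> carrier A"
  shows "left_submodule K (efix e N) (scalars A N)"
proof -
  interpret N: left_module A N by fact
  have "e \<odot> (unit_scalar c \<odot> x) = unit_scalar c \<odot> (e \<odot> x)"
    if "c \<in> carrier K" "x \<in> carrier N" for c x
    using that e unit_scalar_comm by (simp add: N.lsmult_assoc[symmetric])
  thus ?thesis using e by (auto simp: left_submodule_def efix_def N.lsmult_r_distr)
qed

lemma efix_submod: "U \<subseteq> carrier N \<Longrightarrow> efix e (submod N U) = efix e N \<inter> U"
  by (auto simp: efix_def)

text \<open>Passing from N to eN is exact: if y = f x is fixed by e, then also y = f (e x). The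
  equation is then rank-nullity on the subspaces fixed by e.\<close>

lemma cdim_hom:
  assumes e: "idem e" and M: "fd M" and N: "lmod N" and f: "f \<in> Hom M N"
  shows "cdim e M = cdim e (submod M (a_kernel M N f)) + cdim e (submod N (f ` carrier M))"
proof -
  have lm: "lmod M" using M by (rule fd_moduleD)
  interpret f: lm_hom A M N f by (intro lm_homI lm N f)
  let ?V = "submod (scalars A M) (efix e M)" and ?W = "submod (scalars A N) (efix e N)"
  have V: "vectorspace K ?V" "vectorspace K ?W"
    using vectorspace_submod[OF scalars_vectorspace efix_subspace] lm N idemD[OF e] by auto
  have fV: "fdim ?V"
    using submod_fin_dim[OF scalars_vectorspace[OF lm] fd_fdim[OF M] efix_subspace[OF lm]] idemD[OF
      e]
    by auto
  have fh: "f \<in> module_hom K ?V ?W"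
    using idemD[OF e] by (auto intro!: module_homI simp: efix_def simp flip: f.smult)
  have k: "a_kernel ?V ?W f = efix e (submod M (a_kernel M N f))"
    by (auto simp: a_kernel_def' efix_def)
  have i: "f ` carrier ?V = efix e (submod N (f ` carrier M))"
  proof
    show "f ` carrier ?V \<subseteq> efix e (submod N (f ` carrier M))"
      using idemD[OF e] by (auto simp: efix_def simp flip: f.smult)
    show "efix e (submod N (f ` carrier M)) \<subseteq> f ` carrier ?V"
    proof
      fix y assume "y \<in> efix e (submod N (f ` carrier M))"
      then obtain x where x: "x \<in> carrier M" "y = f x" "e \<odot>\<^bsub>N\<^esub> y = y"
        by (auto simp: efix_def)
      hence "y = f (e \<odot>\<^bsub>M\<^esub> x)" using idemD[OF e] by simp
      thus "y \<in> f ` carrier ?V" using efix_smult[OF lm e x(1)] by simp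
    qed
  qed
  show ?thesis using rank_nullity_mhom[OF V fh fV] unfolding k i cdim_def by simp
qed

lemma cdim_bij:
  fixes M (structure)
  assumes e: "idem e" and M: "fd M" and N: "lmod N" and f: "f \<in> Hom M N"
    and b: "bij_betw f (carrier M) (carrier N)"
  shows "cdim e M = cdim e N"
proof -
  have lm: "lmod M" using M by (rule fd_moduleD)
  interpret f: lm_hom A M N f by (intro lm_homI lm N f)
  show ?thesis
    using cdim_hom[OF e fd_submod[OF M f.dom.lsub_0] lm mhom_incl] b f.inj_on_ker cdim_hom[OF e M N
      f]
    by (auto simp: a_kernel_def' bij_betw_def)
qed

lemma cdim_mono:
  assumes e: "e \<in> carrier A" and M: "fd M" and U: "lsub U M" and W: "lsub W M"
    and UW: "U \<subseteq> W"
  shows "cdim e (submod M U) \<le> cdim e (submod M W)"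
proof -
  have lm: "lmod M" using M by (rule fd_moduleD)
  have *: "left_submodule K (efix e (submod M Y)) (scalars A M)" if "lsub Y M" for Y
    using lsub_Int[OF efix_subspace[OF lm e] lsub_scalars[OF that]] efix_submod[OF lsub_subset[OF
      that]]
    by simp
  show ?thesis
    using submod_dim_mono(1)[OF scalars_vectorspace[OF lm] fd_fdim[OF M] *[OF U] *[OF W]] UW
      efix_submod[OF lsub_subset[OF U]] efix_submod[OF lsub_subset[OF W]]
    by (simp add: cdim_def) blast
qed

lemma cdim_zero_iff:
  assumes e: "e \<in> carrier A" and M: "fd M"
  shows "cdim e M = 0 \<longleftrightarrow> efix e M = {\<zero>\<^bsub>M\<^esub>}"
proof -
  have lm: "lmod M" using M by (rule fd_moduleD)
  note s = efix_subspace[OF lm e]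
  show ?thesis
    using dim_zero_iff[OF vectorspace_submod[OF scalars_vectorspace[OF lm] s] submod_fin_dim[OF
      scalars_vectorspace[OF lm] fd_fdim[OF M] s]]
    by (simp add: cdim_def)
qed

lemma cdim_zero_module:
  assumes e: "e \<in> carrier A" and M: "fd M" and c: "carrier M = {\<zero>\<^bsub>M\<^esub>}"
  shows "cdim e M = 0"
proof -
  interpret M: left_module A M using M by (rule fd_moduleD)
  show ?thesis using cdim_zero_iff[OF e M] c e by (auto simp: efix_def)
qed

lemma cdim_surj:
  assumes "idem e" "fd M" "lmod N" "f \<in> Hom M N" "f ` carrier M = carrier N"
  shows "cdim e M = cdim e (submod M (a_kernel M N f)) + cdim e N"
  using cdim_hom[OF assms(1-4)] assms(5) by simp

text \<open>If \<open>Q\<close> fails at \<open>0\<close> and splits over sums, then it holds at a primitive idempotent as soon as it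
  holds at \<open>1\<close>: take \<open>e\<close> with \<open>Q e\<close> and \<open>Ae\<close> of minimal dimension.\<close>

lemma primitive_idempotent_exists:
  assumes Q1: "Q \<one>\<^bsub>A\<^esub>" and Q0: "\<not> Q \<zero>\<^bsub>A\<^esub>"
    and split: "\<And>n l. n \<in> carrier A \<Longrightarrow> l \<in> carrier A \<Longrightarrow> Q (n \<oplus>\<^bsub>A\<^esub> l) \<Longrightarrow> Q n \<or> Q l"
  shows "\<exists>e. idem e \<and> Q e \<and> indec (lideal e)"
proof -
  have "idem \<one>\<^bsub>A\<^esub> \<and> Q \<one>\<^bsub>A\<^esub>"
    using Q1 by (simp add: idem_def)
  then obtain e where e: "idem e" "Q e" and min: "\<And>d. idem d \<Longrightarrow> Q d \<Longrightarrow> mdim (lideal e) \<le> mdim (lideal d)"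
    using ex_has_least_nat[of "\<lambda>e. idem e \<and> Q e" _ "\<lambda>e. mdim (lideal e)"]
    by blast
  have eA: "e \<in> carrier A" "e \<otimes>\<^bsub>A\<^esub> e = e" using idemD[OF e(1)] by auto
  interpret P: left_module A "lideal e" by (rule lideal_lm[OF eA(1)])
  \<comment> \<open>Write e = n + l along a decomposition of Ae. The element n l = n - n n lies in
    both summands, so it is zero and n is idempotent. If Q holds at n, then An, a part of the
    summand N, has at least the dimension of Ae by minimality, which leaves nothing for L. The
    statement is kept general because it is used with the summands exchanged.\<close>
  have part: "idem n \<and> (Q n \<longrightarrow> L = {\<zero>\<^bsub>A\<^esub>})"
    if N: "lsub N (lideal e)" and L: "lsub L (lideal e)"
      and NL: "N \<inter> L = {\<zero>\<^bsub>A\<^esub>}" and n: "n \<in> N" and l: "l \<in> L" and enl: "e = n \<oplus>\<^bsub>A\<^esub> l" for N L n l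
  proof -
    have sub: "N \<subseteq> carrier (lideal e)" "L \<subseteq> carrier (lideal e)"
      using N L by (auto simp: left_submodule_def)
    have nA: "n \<in> carrier A" "n \<otimes>\<^bsub>A\<^esub> e = n" and lA: "l \<in> carrier A" "l \<otimes>\<^bsub>A\<^esub> e = l"
      using sub n l by auto
    have nn: "n \<otimes>\<^bsub>A\<^esub> n \<in> N" "n \<otimes>\<^bsub>A\<^esub> l \<in> L"
      using lsub_smult[OF N nA(1) n] lsub_smult[OF L nA(1) l] by auto
    have "n = n \<otimes>\<^bsub>A\<^esub> n \<oplus>\<^bsub>A\<^esub> n \<otimes>\<^bsub>A\<^esub> l"
      using nA lA by (metis A.r_distr enl)
    hence "n \<otimes>\<^bsub>A\<^esub> l = n \<ominus>\<^bsub>A\<^esub> n \<otimes>\<^bsub>A\<^esub> n"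
      using nA lA by (metis A.m_closed A.minus_eq A.a_comm A.r_neg1 A.a_inv_closed)
    moreover have "n \<ominus>\<^bsub>lideal e\<^esub> n \<otimes>\<^bsub>A\<^esub> n \<in> N"
      using P.lsub_diff[OF N n nn(1)] .
    moreover have "n \<ominus>\<^bsub>lideal e\<^esub> n \<otimes>\<^bsub>A\<^esub> n = n \<ominus>\<^bsub>A\<^esub> n \<otimes>\<^bsub>A\<^esub> n"
    proof -
      have "n \<ominus>\<^bsub>lideal e\<^esub> y = n \<ominus>\<^bsub>A\<^esub> y" if y: "y \<in> carrier (lideal e)" for y
      proof -
        have "\<ominus>\<^bsub>lideal e\<^esub> y = \<ominus>\<^bsub>A\<^esub> y"
          by (rule P.M.minus_equality) (use y eA in \<open>auto simp: A.l_neg A.l_minus\<close>)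
        thus ?thesis by (simp add: a_minus_def)
      qed
      thus ?thesis using nn(1) sub by blast
    qed
    ultimately have nl0: "n \<otimes>\<^bsub>A\<^esub> l = \<zero>\<^bsub>A\<^esub>"
      using nn NL by auto
    hence idn: "n \<otimes>\<^bsub>A\<^esub> n = n"
      using \<open>n = n \<otimes>\<^bsub>A\<^esub> n \<oplus>\<^bsub>A\<^esub> n
        \<otimes>\<^bsub>A\<^esub> l\<close> nA
      by simp
    hence "idem n" using nA by (simp add: idem_def)
    moreover have "L = {\<zero>\<^bsub>A\<^esub>}" if "Q n"
    proof -
      have sN: "carrier (lideal n) \<subseteq> N"
      proof
        fix x assume "x \<in> carrier (lideal n)"
        thus "x \<in> N" using lsub_smult[OF N _ n, of x] by simp
      qed
      have sub': "lsub N (regular_module A)"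
        using N lsub_submod_iff[OF lideal_submodule[OF eA(1)]] by (simp add: lideal_def)
      show ?thesis
        using mdim_mono(1)[OF fd_regular lideal_submodule[OF nA(1)] sub'] sN min[OF \<open>idem
          n\<close> that] mdim_mono_carrier(2)[OF lideal_fd[OF eA(1)] N] NL sub
        by (auto simp: lideal_def)
    qed
    ultimately show ?thesis by blast
  qed
  have "indec (lideal e)" unfolding indecomposable_module_def
  proof (intro conjI allI impI P.left_module_axioms)
    show "carrier (lideal e) \<noteq> {\<zero>\<^bsub>lideal e\<^esub>}" using e Q0 eA by force
    fix N L assume N: "lsub N (lideal e)" and L: "lsub L (lideal e)"
      and NL: "N \<inter> L = {\<zero>\<^bsub>lideal e\<^esub>}" and s: "N <+>\<^bsub>lideal e\<^esub> L = carrier (lideal e)"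
    have "e \<in> N <+>\<^bsub>lideal e\<^esub> L" unfolding s using eA by simp
    then obtain n l where nl: "n \<in> N" "l \<in> L" "e = n \<oplus>\<^bsub>lideal e\<^esub> l"
      by (rule set_addE)
    have nlA: "n \<in> carrier A" "l \<in> carrier A" using nl lsub_mem[OF N] lsub_mem[OF L] by auto
    show "N = {\<zero>\<^bsub>lideal e\<^esub>} \<or> L = {\<zero>\<^bsub>lideal e\<^esub>}"
      using split[OF] e(2) part[OF N L _ nl(1,2)] part[OF L N _ nl(2,1)] NL nl(3) nlA
      by (auto simp: A.a_comm)
  qed
  thus ?thesis using e by blast
qed

lemma nonzero_smult_hom:
  fixes S (structure)
  assumes S: "simple S" and e: "idem e" and y: "y \<in> efix e S" "y \<noteq> \<zero>"
  shows "(\<lambda>x. x \<odot> y) ` carrier (lideal e) = carrier S"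
proof -
  have lm: "lmod S" using S by (rule simple_moduleD)
  have yS: "y \<in> carrier S" using y by (auto simp: efix_def)
  have eA: "e \<in> carrier A" "e \<otimes>\<^bsub>A\<^esub> e = e" using idemD[OF e] by auto
  interpret h: lm_hom A "lideal e" S "\<lambda>x. x \<odot> y"
    by (intro lm_homI lideal_lm eA lm lideal_hom yS)
  have "(\<lambda>x. x \<odot> y) ` carrier (lideal e) = {\<zero>} \<or> (\<lambda>x. x \<odot> y) ` carrier (lideal e) = carrier S"
    using simple_moduleD(3)[OF S h.image_submodule[OF h.dom.lsub_carrier]] .
  moreover have "y \<in> (\<lambda>x. x \<odot> y) ` carrier (lideal e)"
    using y eA by (intro image_eqI) (auto simp: efix_def)
  ultimately show ?thesis using y by blast
qed

text \<open>A maximal radical means that Ae has exactly one maximal submodule.\<close>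

definition local_idem :: "'a \<Rightarrow> bool" where
  "local_idem e \<longleftrightarrow> idem e \<and> maxsub (rad A (lideal e)) (lideal e)"

lemma local_idem_ker:
  fixes S (structure)
  assumes S: "simple S" and e: "local_idem e" and y: "y \<in> efix e S" "y \<noteq> \<zero>"
  shows "a_kernel (lideal e) S (\<lambda>x. x \<odot> y) = rad A (lideal e)"
proof -
  have lm: "lmod S" using S by (rule simple_moduleD)
  have eA: "idem e" "e \<in> carrier A" using e idemD by (auto simp: local_idem_def)
  interpret h: lm_hom A "lideal e" S "\<lambda>x. x \<odot> y"
    by (intro lm_homI lideal_lm eA lm lideal_hom efixD[OF y(1)])
  have mx: "maxsub (a_kernel (lideal e) S (\<lambda>x. x \<odot> y)) (lideal e)"
    using h.surj_simple_maximal[OF nonzero_smult_hom[OF S eA(1) y]] S by simp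
  hence "rad A (lideal e) \<subseteq> a_kernel (lideal e) S (\<lambda>x. x \<odot> y)"
    by (auto simp: rad_def)
  thus ?thesis using e mx unfolding local_idem_def maximal_submodule_def by blast
qed

text \<open>Both modules are Ae modulo its radical, through x \<mapsto> x u and x \<mapsto> x w;
  matching the images of e takes u to w.\<close>

lemma local_idem_transport:
  fixes S (structure)
  assumes e: "local_idem e" and S: "simple S" and T: "simple T"
    and u: "u \<in> efix e S" "u \<noteq> \<zero>" and w: "w \<in> efix e T" "w \<noteq> \<zero>\<^bsub>T\<^esub>"
  shows "\<exists>\<phi>\<in>Hom S T. bij_betw \<phi> (carrier S) (carrier T) \<and> \<phi> u = w"
proof -
  have lm: "lmod S" "lmod T" using S T by (auto intro: simple_moduleD)
  have eA: "idem e" "e \<in> carrier A" "e \<otimes>\<^bsub>A\<^esub> e = e"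
    using e idemD by (auto simp: local_idem_def)
  interpret h: lm_hom A "lideal e" S "\<lambda>x. x \<odot> u"
    by (intro lm_homI lideal_lm eA lm lideal_hom efixD[OF u(1)])
  interpret g: lm_hom A "lideal e" T "\<lambda>x. x \<odot>\<^bsub>T\<^esub> w"
    by (intro lm_homI lideal_lm eA lm lideal_hom efixD[OF w(1)])
  note sur = nonzero_smult_hom[OF S eA(1) u] and sur' = nonzero_smult_hom[OF T eA(1) w]
  obtain \<phi> where \<phi>: "\<phi> \<in> Hom S T" "\<forall>x\<in>carrier (lideal e). \<phi> (x \<odot> u) = x \<odot>\<^bsub>T\<^esub> w"
    using local_idem_ker[OF S e u] local_idem_ker[OF T e w] h.mhom_factor[OF sur g.lm_hom_axioms]
    by blast
  interpret \<phi>: lm_hom A S T \<phi> by (intro lm_homI lm \<phi>)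
  have "\<phi> (e \<odot> u) = e \<odot>\<^bsub>T\<^esub> w" using \<phi>(2) eA by simp
  hence uw: "\<phi> u = w" using efixD[OF u(1)] efixD[OF w(1)] by simp
  have "a_kernel S T \<phi> = {\<zero>}"
    using uw w \<phi>.ker_iff efixD(1)[OF u(1)] simple_moduleD(3)[OF S \<phi>.ker_submodule]
    by blast
  moreover have "\<phi> ` carrier S = carrier T"
    using simple_moduleD(3)[OF T \<phi>.image_submodule[OF left_module.lsub_carrier[OF lm(1)]]] uw
      efixD(1)[OF u(1)] w
    by auto
  ultimately show ?thesis using \<phi>.inj_on_ker \<phi>(1) uw by (auto simp: bij_betw_def)
qed

text \<open>Any nonzero w in eS is the image of u under an endomorphism of S, which is a scalar by
  Schur's lemma. So u spans eS.\<close>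

lemma local_idem_cdim_simple:
  fixes S (structure)
  assumes ac: "algebraically_closed K" and e: "local_idem e" and S: "simple S"
    and u: "u \<in> efix e S" "u \<noteq> \<zero>"
  shows "cdim e S = 1"
proof -
  have lm: "lmod S" using S by (rule simple_moduleD)
  have eA: "idem e" "e \<in> carrier A" using e idemD by (auto simp: local_idem_def)
  let ?V = "submod (scalars A S) (efix e S)"
  interpret W: vectorspace K ?V
    using vectorspace_submod[OF scalars_vectorspace[OF lm] efix_subspace[OF lm eA(2)]] .
  have uV: "u \<in> carrier ?V" using u by simp
  have sp: "left_submodule K (W.span {u}) ?V"
    using W.span_is_subspace subspace_iff_lsub[OF W.vectorspace_axioms] uV by simp
  have us: "u \<in> W.span {u}" using W.span_self[OF uV] .
  have "W.span {u} = carrier ?V"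
  proof
    show "W.span {u} \<subseteq> carrier ?V" using lsub_subset[OF sp] .
    show "carrier ?V \<subseteq> W.span {u}"
    proof
      fix w assume "w \<in> carrier ?V"
      hence w: "w \<in> efix e S" by simp
      show "w \<in> W.span {u}"
      proof (cases "w = \<zero>")
        case True thus ?thesis using lsub_zero[OF sp] by simp
      next
        case False
        obtain \<phi> where \<phi>: "\<phi> \<in> Hom S S" "\<phi> u = w"
          using local_idem_transport[OF e S S u w False] by blast
        obtain c where c: "c \<in> carrier K" "\<forall>x\<in>carrier S. \<phi> x = unit_scalar c \<odot> x"
          using schur[OF ac S \<phi>(1)] by blast
        thus ?thesis using \<phi>(2) efixD(1)[OF u(1)] lsub_smult[OF sp c(1) us] by simp
      qed
    qed
  qed
  thus ?thesis using W.dim1I u by (simp add: cdim_def)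
qed

end

section \<open>Weakly symmetric algebras with radical cube zero\<close>

lemma (in lm_hom) indec_of_bij:
  assumes b: "bij_betw f (carrier M) (carrier N)" and ind: "indecomposable_module A M"
  shows "indecomposable_module A N" unfolding indecomposable_module_def
proof (intro conjI allI impI cod.left_module_axioms)
  let ?g = "inv_into (carrier M) f"
  interpret g: lm_hom A N M ?g
    by (intro lm_homI cod.left_module_axioms dom.left_module_axioms inv_hom b)
  have fg: "f (?g y) = y" if "y \<in> carrier N" for y
    using that b by (auto simp: bij_betw_def f_inv_into_f)
  have gf: "?g (f x) = x" if "x \<in> carrier M" for x using that b by (auto simp: bij_betw_def)
  have zero: "U = {\<zero>\<^bsub>N\<^esub>}" if "left_submodule A U N" "?g ` U = {\<zero>\<^bsub>M\<^esub>}" for U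
  proof -
    have "y = \<zero>\<^bsub>N\<^esub>" if y: "y \<in> U" for y
    proof -
      have "?g y = \<zero>\<^bsub>M\<^esub>"
        using that \<open>?g ` U = {\<zero>\<^bsub>M\<^esub>}\<close> by auto
      thus ?thesis using fg[of y] lsub_mem[OF \<open>left_submodule A U N\<close> y] by simp
    qed
    thus ?thesis using lsub_zero[OF that(1)] by blast
  qed
  show "carrier N \<noteq> {\<zero>\<^bsub>N\<^esub>}"
  proof
    assume "carrier N = {\<zero>\<^bsub>N\<^esub>}"
    hence "x = \<zero>\<^bsub>M\<^esub>" if "x \<in> carrier M" for x
      using inj_onD'[OF bij_betw_imp_inj_on[OF b] that] closed[OF that] by auto
    thus False using ind unfolding indecomposable_module_def by blast
  qed
  fix U V assume U: "left_submodule A U N" and V: "left_submodule A V N" and UV: "U \<inter> V = {\<zero>\<^bsub>N\<^esub>}"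
    and s: "U <+>\<^bsub>N\<^esub> V = carrier N"
  have sub: "U \<subseteq> carrier N" "V \<subseteq> carrier N"
    using U V by (auto simp: left_submodule_def)
  have "?g ` U \<inter> ?g ` V \<subseteq> {\<zero>\<^bsub>M\<^esub>}"
  proof
    fix x assume "x \<in> ?g ` U \<inter> ?g ` V"
    then obtain u v where uv: "u \<in> U" "v \<in> V" "x = ?g u" "x = ?g v" by blast
    hence "u = v" using fg sub by (metis subsetD)
    thus "x \<in> {\<zero>\<^bsub>M\<^esub>}" using UV uv by force
  qed
  hence 1: "?g ` U \<inter> ?g ` V = {\<zero>\<^bsub>M\<^esub>}"
    using lsub_zero[OF g.image_submodule[OF U]] lsub_zero[OF g.image_submodule[OF V]] by blast
  have 2: "?g ` U <+>\<^bsub>M\<^esub> ?g ` V = carrier M"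
  proof
    show "?g ` U <+>\<^bsub>M\<^esub> ?g ` V \<subseteq> carrier M"
      using lsub_subset[OF dom.lsub_sum[OF g.image_submodule[OF U] g.image_submodule[OF V]]] .
    show "carrier M \<subseteq> ?g ` U <+>\<^bsub>M\<^esub> ?g ` V"
    proof
      fix x assume x: "x \<in> carrier M"
      hence "f x \<in> U <+>\<^bsub>N\<^esub> V" using s by simp
      then obtain u v where uv: "u \<in> U" "v \<in> V" "f x = u \<oplus>\<^bsub>N\<^esub> v"
        by (rule set_addE)
      hence "x = ?g u \<oplus>\<^bsub>M\<^esub> ?g v" using sub gf[OF x] by force
      thus "x \<in> ?g ` U <+>\<^bsub>M\<^esub> ?g ` V" using uv unfolding set_add_def' by blast
    qed
  qed
  have "?g ` U = {\<zero>\<^bsub>M\<^esub>} \<or> ?g ` V = {\<zero>\<^bsub>M\<^esub>}"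
    using ind 1 2 g.image_submodule[OF U] g.image_submodule[OF V] unfolding
      indecomposable_module_def
    by blast
  thus "U = {\<zero>\<^bsub>N\<^esub>} \<or> V = {\<zero>\<^bsub>N\<^esub>}" using zero U V by blast
qed

context fd_algebra begin

text \<open>Weak symmetry speaks of modules on coordinate lists, so everything is carried over from
  such a copy of Ae. The isomorphism between top and socle is recorded as one endomorphism of Ae,
  with the radical as kernel and the socle as image; in this form it can be fed into additivity of
  \<open>cdim\<close>.\<close>

lemma ws_primitive:
  assumes ws: "weakly_symmetric K A" and e: "idem e" and ind: "indec (lideal e)"
  shows "local_idem e" "simple (submod (lideal e) (soc A (lideal e)))"
    "\<exists>g\<in>Hom (lideal e) (lideal e).
      a_kernel (lideal e) (lideal e) g = rad A (lideal e) \<and> g ` carrier (lideal e) = soc A (lideal e)"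
proof -
  let ?L = "lideal e"
  have fdL: "fd ?L" using lideal_fd idemD[OF e] by blast
  have lmL: "lmod ?L" using fdL by (rule fd_moduleD)
  obtain P :: "('a, 'k list) module" and f where P: "fd P" "f \<in> Hom ?L P"
    "bij_betw f (carrier ?L) (carrier P)" using klist_copy[OF fdL] by blast
  have lmP: "lmod P" using P by (intro fd_moduleD)
  interpret f: lm_hom A ?L P f by (intro lm_homI lmL lmP P)
  let ?g = "inv_into (carrier ?L) f"
  note inv = bij_inv_retract[OF lmL lmP P(2,3)]
  interpret g: lm_hom A P ?L ?g by (intro lm_homI lmL lmP inv)
  have bg: "bij_betw ?g (carrier P) (carrier ?L)" by (rule bij_betw_inv_into[OF P(3)])
  have fs: "f ` carrier ?L = carrier P" and gs: "?g ` carrier P = carrier ?L"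
    using P(3) bg by (auto simp: bij_betw_def)
  have simple: "simple (submod P (soc A P))" and iso: "isom (submod P (soc A P)) (top_module A P)"
    using ws projective_iso[OF lideal_projective[OF e] lmP P(2,3)] f.indec_of_bij[OF P(3) ind]
    by (auto simp: weakly_symmetric_def)
  note Q = quot_proj[OF lmP f.cod.rad_submodule, folded top_module_def]
  obtain h where h: "h \<in> Hom (submod P (soc A P)) (top_module A P)"
    "bij_betw h (soc A P) (carrier (top_module A P))" using iso by (auto simp: module_iso_def)
  have lmS: "lmod (submod P (soc A P))" using simple by (rule simple_moduleD)
  let ?p = "\<lambda>x. rad A P +>\<^bsub>P\<^esub> x"
  interpret p: lm_hom A P "top_module A P" ?p by (intro lm_homI lmP Q)
  have "simple (top_module A P)" using module_iso_simple[OF iso Q(1) simple] .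
  hence maxP: "maxsub (rad A P) P" using p.surj_simple_maximal[OF Q(3)] Q(4) by simp
  have gr: "?g ` rad A P = rad A ?L"
    using g.rad_image g.inj_on_ker bg lsub_zero[OF f.cod.rad_submodule] g.image_maximal[OF gs maxP]
    by (auto simp: bij_betw_def rad_def)
  show "local_idem e"
    using g.inj_on_ker bg lsub_zero[OF f.cod.rad_submodule] g.image_maximal[OF gs maxP] gr e
    by (auto simp: bij_betw_def local_idem_def)
  have gsoc: "?g ` soc A P = soc A ?L"
  proof
    show "?g ` soc A P \<subseteq> soc A ?L" by (rule g.soc_image)
    show "soc A ?L \<subseteq> ?g ` soc A P"
      using inv(3) lsub_mem[OF f.dom.soc_submodule] f.soc_image by force
  qed
  have nz: "soc A P \<noteq> {\<zero>\<^bsub>P\<^esub>}" using simple_moduleD(2)[OF simple] by simp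
  have ginj: "x = \<zero>\<^bsub>P\<^esub>" if "x \<in> carrier P" "?g x = \<zero>\<^bsub>?L\<^esub>" for x
    using g.inj_onD' bg that by (simp add: bij_betw_def)
  have "?g ` soc A P \<noteq> {\<zero>\<^bsub>?L\<^esub>}"
    using ginj lsub_mem[OF f.cod.soc_submodule] nz by blast
  thus "simple (submod ?L (soc A ?L))"
    using g.simple_image[OF f.cod.soc_submodule simple] gsoc by simp
  let ?h' = "inv_into (soc A P) h"
  have h': "?h' \<in> Hom (top_module A P) (submod P (soc A P))"
    using bij_inv_retract(1)[OF lmS Q(1) h(1)] h(2) by simp
  have bh': "bij_betw ?h' (carrier (top_module A P)) (soc A P)" by (rule bij_betw_inv_into[OF h(2)])
  interpret h': lm_hom A "top_module A P" "submod P (soc A P)" ?h' by (intro lm_homI Q lmS h')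
  have h'P: "?h' \<in> Hom (top_module A P) P"
    using mhom_extend_codomain[OF h' lsub_subset[OF f.cod.soc_submodule]] .
  let ?G = "\<lambda>x. ?g (?h' (?p (f x)))"
  have GH: "?G \<in> Hom ?L ?L"
    using mhom_comp[OF mhom_comp[OF mhom_comp[OF P(2) Q(2)] h'P] inv(1)] .
  have "a_kernel ?L ?L ?G = rad A ?L"
  proof -
    have "?G x = \<zero>\<^bsub>?L\<^esub> \<longleftrightarrow> x \<in> rad A ?L" if x: "x \<in> carrier ?L" for x
    proof -
      have c: "f x \<in> carrier P" "?p (f x) \<in> carrier (top_module A P)" using x by auto
      have "?h' (?p (f x)) \<in> carrier P" by (rule mhom_closed[OF h'P c(2)])
      hence "?G x = \<zero>\<^bsub>?L\<^esub> \<longleftrightarrow> ?h' (?p (f x)) = \<zero>\<^bsub>P\<^esub>"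
        using ginj g.zero by metis
      also have "\<dots> \<longleftrightarrow> ?p (f x) = \<zero>\<^bsub>top_module A P\<^esub>"
        using h'.inj_onD'[OF bij_betw_imp_inj_on[OF bh'] c(2)] by auto
      also have "\<dots> \<longleftrightarrow> f x \<in> rad A P"
        using Q(4) c by (auto simp: a_kernel_def')
      also have "\<dots> \<longleftrightarrow> x \<in> rad A ?L"
        using gr inv(3)[OF x] f.rad_image[OF fs] by force
      finally show ?thesis .
    qed
    thus ?thesis using lsub_subset[OF f.dom.rad_submodule] by (auto simp only: a_kernel_def')
  qed
  moreover have "?G ` carrier ?L = soc A ?L"
  proof -
    have "?G ` carrier ?L = ?g ` ?h' ` ?p ` f ` carrier ?L" by (simp add: image_image)
    also have "\<dots> = ?g ` soc A P" using fs Q(3) bh' by (simp add: bij_betw_def)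
    finally show ?thesis using gsoc by simp
  qed
  ultimately show "\<exists>g\<in>Hom ?L ?L. a_kernel ?L ?L g = rad A ?L \<and> g ` carrier ?L = soc A ?L"
    using GH by blast
qed

end

section \<open>The standing assumptions and the indecomposable projective modules P_i\<close>

locale rad_cube_zero = fd_algebra K A for K :: "'k ring" and A :: "('k, 'a) module" +
  fixes r :: nat and S :: "nat \<Rightarrow> ('a, 's) module"
  assumes ac: "algebraically_closed K" and ws: "weakly_symmetric K A"
    and indec_alg: "indecomposable_algebra K A"
    and J3: "\<lbrakk>a \<in> J; b \<in> J; c \<in> J\<rbrakk> \<Longrightarrow> a \<otimes>\<^bsub>A\<^esub> b \<otimes>\<^bsub>A\<^esub> c = \<zero>\<^bsub>A\<^esub>"
    and J2: "\<exists>a\<in>J. \<exists>b\<in>J. a \<otimes>\<^bsub>A\<^esub> b \<noteq> \<zero>\<^bsub>A\<^esub>"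
    and reps: "simple_representatives K A r S"
begin

lemma si: "selfinjective K A" using ws by (simp add: weakly_symmetric_def)

lemma S_simple: "i < r \<Longrightarrow> simple (S i)"
  using reps by (simp add: simple_representatives_def)

lemma S_lm: "i < r \<Longrightarrow> lmod (S i)" using S_simple simple_moduleD(1) by blast

lemma S_inj: "i < r \<Longrightarrow> j < r \<Longrightarrow> isom (S i) (S j) \<Longrightarrow> i = j"
  using reps by (simp add: simple_representatives_def)

lemma simple_iso_S:
  assumes T: "simple T" shows "\<exists>i<r. isom T (S i)"
proof -
  obtain N :: "('a, 'k list) module" and f where N: "fd N" "f \<in> Hom T N"
    "bij_betw f (carrier T) (carrier N)" using klist_copy[OF fd_simple[OF T]] by blast
  have iso: "isom T N" using N by (auto simp: module_iso_def)
  have "simple N" using module_iso_simple[OF iso _ T] N fd_lm by blast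
  then obtain i where "i < r" "isom N (S i)"
    using reps N(1) by (auto simp: simple_representatives_def)
  thus ?thesis using module_iso_trans[OF iso] by blast
qed

text \<open>Acting as nonzero on S_i holds for 1, fails for 0, and passes from a sum to one of its
  terms, so it can be arranged for a primitive idempotent.\<close>

lemma primitive_idempotent_for_simple:
  assumes i: "i < r"
  shows "\<exists>e. idem e \<and> efix e (S i) \<noteq> {\<zero>\<^bsub>S i\<^esub>} \<and> indec (lideal e)"
proof -
  interpret T: left_module A "S i" using S_lm[OF i] .
  obtain x where x: "x \<in> carrier (S i)" "x \<noteq> \<zero>\<^bsub>S i\<^esub>"
    using simple_moduleD(2)[OF S_simple[OF i]] by blast
  let ?Q = "\<lambda>e. \<exists>x\<in>carrier (S i). e \<odot>\<^bsub>S i\<^esub> x \<noteq> \<zero>\<^bsub>S i\<^esub>"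
  have "\<exists>e. idem e \<and> ?Q e \<and> indec (lideal e)"
  proof (rule primitive_idempotent_exists)
    show "?Q \<one>\<^bsub>A\<^esub>" using x by (intro bexI) auto
    show "\<not> ?Q \<zero>\<^bsub>A\<^esub>" by simp
    fix n l assume nl: "n \<in> carrier A" "l \<in> carrier A" "?Q (n \<oplus>\<^bsub>A\<^esub> l)"
    then obtain y where y: "y \<in> carrier (S i)" "n \<odot>\<^bsub>S i\<^esub> y \<oplus>\<^bsub>S i\<^esub> l \<odot>\<^bsub>S i\<^esub> y \<noteq> \<zero>\<^bsub>S i\<^esub>"
      by (auto simp: T.lsmult_l_distr)
    thus "?Q n \<or> ?Q l" by force
  qed
  then obtain e y where e: "idem e" "indec (lideal e)"
    and y: "y \<in> carrier (S i)" "e \<odot>\<^bsub>S i\<^esub> y \<noteq> \<zero>\<^bsub>S i\<^esub>" by blast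
  have "e \<odot>\<^bsub>S i\<^esub> y \<in> efix e (S i)"
    by (rule efix_smult[OF S_lm[OF i] e(1) y(1)])
  thus ?thesis using e y by blast
qed

definition e :: "nat \<Rightarrow> 'a" where
  "e i = (SOME e. idem e \<and> efix e (S i) \<noteq> {\<zero>\<^bsub>S i\<^esub>} \<and> indec (lideal e))"

abbreviation P :: "nat \<Rightarrow> ('a, 'a) module" where "P i \<equiv> lideal (e i)"

abbreviation c :: "nat \<Rightarrow> ('a, 'm) module \<Rightarrow> nat" where "c i N \<equiv> cdim (e i) N"

lemma e_props:
  assumes "i < r"
  shows "idem (e i)" "efix (e i) (S i) \<noteq> {\<zero>\<^bsub>S i\<^esub>}" "indec (P i)"
  using someI_ex[OF primitive_idempotent_for_simple[OF assms]] by (auto simp: e_def)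

lemma e_carrier: "i < r \<Longrightarrow> e i \<in> carrier A" "i < r \<Longrightarrow> e i \<otimes>\<^bsub>A\<^esub> e i = e i"
  using idemD[OF e_props(1)] by auto

lemma P_local: "i < r \<Longrightarrow> local_idem (e i)"
  using ws_primitive(1)[OF ws] e_props by blast

lemma P_fd: "i < r \<Longrightarrow> fd (P i)" and P_lm: "i < r \<Longrightarrow> lmod (P i)"
  using lideal_fd lideal_lm e_carrier by auto

lemma P_rad_maximal: "i < r \<Longrightarrow> maxsub (rad A (P i)) (P i)"
  using P_local by (simp add: local_idem_def)

lemma e_S_nonzero:
  assumes "i < r" obtains u where "u \<in> efix (e i) (S i)" "u \<noteq> \<zero>\<^bsub>S i\<^esub>"
proof -
  interpret left_module A "S i" using S_lm[OF assms] .
  show ?thesis using e_carrier[OF assms] that e_props(2)[OF assms] by (auto simp: efix_def)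
qed

lemma iso_of_efix:
  assumes i: "i < r" and T: "simple T" and w: "w \<in> efix (e i) T" "w \<noteq> \<zero>\<^bsub>T\<^esub>"
  shows "isom T (S i)"
proof -
  obtain u where u: "u \<in> efix (e i) (S i)" "u \<noteq> \<zero>\<^bsub>S i\<^esub>"
    using e_S_nonzero[OF i] .
  show ?thesis
    using local_idem_transport[OF P_local[OF i] T S_simple[OF i] w u] by (auto simp: module_iso_def)
qed

lemma c_S:
  assumes i: "i < r" and j: "j < r" shows "c i (S j) = (if i = j then 1 else 0)"
proof (cases "i = j")
  case True
  thus ?thesis
    using e_S_nonzero[OF i] local_idem_cdim_simple[OF ac P_local[OF i] S_simple[OF i]] by metis
next
  case False
  interpret left_module A "S j" using S_lm[OF j] .
  have "efix (e i) (S j) \<subseteq> {\<zero>\<^bsub>S j\<^esub>}"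
  proof
    fix w assume w: "w \<in> efix (e i) (S j)"
    show "w \<in> {\<zero>\<^bsub>S j\<^esub>}"
      using iso_of_efix[OF i S_simple[OF j] w] False S_inj[OF j i] by fastforce
  qed
  moreover have "\<zero>\<^bsub>S j\<^esub> \<in> efix (e i) (S j)"
    using e_carrier[OF i] by (simp add: efix_def)
  ultimately show ?thesis
    using False cdim_zero_iff[OF e_carrier(1)[OF i] fd_simple[OF S_simple[OF j]]] by auto
qed

lemma c_iso:
  assumes "i < r" "fd M" "lmod N" "isom M N" shows "c i M = c i N"
  using cdim_bij[OF e_props(1)] assms by (auto simp: module_iso_def)

lemma c_simple:
  assumes j: "j < r" and i: "i < r" and T: "simple T" and iso: "isom T (S i)"
  shows "c j T = (if i = j then 1 else 0)"
  using c_iso[OF j fd_simple[OF T] S_lm[OF i] iso] c_S[OF j i] by auto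

text \<open>A simple module is isomorphic to exactly one S_k, and its counts are those of S_k; so
  the count at i decides whether k = i.\<close>

lemma c_simple_iff:
  assumes i: "i < r" and T: "simple T"
  shows "isom T (S i) \<longleftrightarrow> c i T = 1" "c i T \<in> {0, 1}"
proof -
  obtain k where k: "k < r" "isom T (S k)" using simple_iso_S[OF T] by blast
  have ck: "c i T = (if k = i then 1 else 0)" by (rule c_simple[OF i k(1) T k(2)])
  thus "c i T \<in> {0, 1}" by simp
  have "k = i" if "isom T (S i)"
    using c_simple[OF k(1) i T that] c_simple[OF k(1) k(1) T k(2)] by (metis zero_neq_one)
  thus "isom T (S i) \<longleftrightarrow> c i T = 1" using ck k(2) by (cases "k = i") auto
qed

lemma c_nonzero:
  assumes M: "fd M" and ne: "carrier M \<noteq> {\<zero>\<^bsub>M\<^esub>}" shows "\<exists>i<r. c i M > 0"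
proof -
  interpret M: left_module A M using M by (rule fd_moduleD)
  obtain U where U: "lsub U M" "simple (submod M U)"
    using simple_submodule_exists[OF M M.lsub_carrier ne] by blast
  obtain i where i: "i < r" "isom (submod M U) (S i)" using simple_iso_S[OF U(2)] by blast
  have "c i (submod M U) = 1" using c_simple_iff(1)[OF i(1) U(2)] i(2) by blast
  moreover have "c i (submod M U) \<le> c i M"
    using cdim_mono[OF e_carrier(1)[OF i(1)] M U(1) M.lsub_carrier lsub_subset[OF U(1)]] by simp
  ultimately show ?thesis using i by (intro exI[of _ i]) simp
qed

lemma c_surj:
  assumes "i < r" "fd M" "lmod N" "f \<in> Hom M N" "f ` carrier M = carrier N"
  shows "c i M = c i (submod M (a_kernel M N f)) + c i N"
  using cdim_surj[OF e_props(1)] assms by blast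

lemma c_mono:
  assumes "i < r" "fd M" "lsub U M" "lsub W M" "U \<subseteq> W"
  shows "c i (submod M U) \<le> c i (submod M W)" using cdim_mono[OF e_carrier(1)] assms by blast

lemma c_mono_carrier:
  assumes "i < r" "fd M" "lsub U M"
  shows "c i (submod M U) \<le> c i M"
  using c_mono[OF assms left_module.lsub_carrier lsub_subset[OF assms(3)]] fd_lm[OF assms(2)]
  by simp

text \<open>\<open>t i M\<close> is the multiplicity of \<open>S\<^sub>i\<close> in the top of \<open>M\<close>.\<close>

definition t :: "nat \<Rightarrow> ('a, 'm) module \<Rightarrow> nat" where
  "t i M = c i M - c i (submod M (rad A M))"

lemma c_eq_t:
  assumes "i < r" "fd M" shows "c i M = t i M + c i (submod M (rad A M))"
  using c_mono_carrier[OF assms left_module.rad_submodule[OF fd_lm[OF assms(2)]]]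
  by (simp add: t_def)

text \<open>P_i modulo its radical is simple, and the class of e_i is a nonzero element fixed by
  e_i; hence this simple module is S_i.\<close>

lemma t_P:
  assumes i: "i < r" and j: "j < r" shows "t j (P i) = (if i = j then 1 else 0)"
proof -
  have R: "lsub (rad A (P i)) (P i)" by (rule left_module.rad_submodule[OF P_lm[OF i]])
  obtain T :: "('a, 'k list) module" and p where T: "fd T" "p \<in> Hom (P i) T"
    "p ` carrier (P i) = carrier T" "a_kernel (P i) T p = rad A (P i)" using klist_quotient[OF P_fd[OF i] R] by blast
  have lmT: "lmod T" using T by (intro fd_moduleD)
  interpret p: lm_hom A "P i" T p by (intro lm_homI P_lm[OF i] lmT T)
  have simple: "simple T" using p.surj_simple_maximal[OF T(3)] T(4) P_rad_maximal[OF i] by simp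
  have ei: "e i \<in> carrier (P i)" using e_carrier[OF i] by simp
  have pe: "p (e i) \<in> efix (e i) T"
    using p.smult[OF e_carrier(1)[OF i] ei] e_carrier[OF i] by (simp add: efix_def)
  have "p (e i) \<noteq> \<zero>\<^bsub>T\<^esub>"
  proof
    assume "p (e i) = \<zero>\<^bsub>T\<^esub>"
    hence "x \<in> rad A (P i)" if "x \<in> carrier (P i)" for x
      using T(4) ei p.ker_iff lsub_smult[OF R, of x "e i"] that by simp
    thus False using P_rad_maximal[OF i] lsub_subset[OF R] by (auto simp: maximal_submodule_def)
  qed
  thus ?thesis
    using iso_of_efix[OF i simple pe] c_simple[OF j i simple] c_surj[OF j P_fd[OF i] lmT T(2,3)]
      T(4)
    by (simp add: t_def)
qed

text \<open>There is an endomorphism of P_i with kernel the radical and image the socle. By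
  additivity the socle has the same count at i as the top, namely 1, which identifies it as
  S_i.\<close>

lemma P_soc:
  assumes i: "i < r"
  shows "simple (submod (P i) (soc A (P i)))" "isom (submod (P i) (soc A (P i))) (S i)"
proof -
  show simple: "simple (submod (P i) (soc A (P i)))"
    using ws_primitive(2)[OF ws] e_props[OF i] by blast
  obtain g where g: "g \<in> Hom (P i) (P i)" "a_kernel (P i) (P i) g = rad A (P i)"
    "g ` carrier (P i) = soc A (P i)" using ws_primitive(3)[OF ws] e_props[OF i] by blast
  show "isom (submod (P i) (soc A (P i))) (S i)"
    using cdim_hom[OF e_props(1)[OF i] P_fd[OF i] P_lm[OF i]] g t_P[OF i i] c_simple_iff(1)[OF i
      simple]
    by (simp add: t_def)
qed

text \<open>The surjection splits because N is projective, and P_i is indecomposable, so either the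
  kernel or the copy of N is zero; N is not.\<close>

lemma P_surj_bij:
  fixes N (structure)
  assumes i: "i < r" and N: "projective N" "carrier N \<noteq> {\<zero>}"
    and f: "f \<in> Hom (P i) N" "f ` carrier (P i) = carrier N"
  shows "bij_betw f (carrier (P i)) (carrier N)"
proof -
  have lm: "lmod N" by (rule fd_lm[OF projectiveD[OF N(1)]])
  interpret f: lm_hom A "P i" N f by (intro lm_homI P_lm[OF i] lm f)
  obtain h where h: "h \<in> Hom N (P i)" "\<forall>x\<in>carrier N. f (h x) = x"
    using projective_split[OF N(1) P_fd[OF i] f] by blast
  interpret h: lm_hom A N "P i" h by (intro lm_homI P_lm[OF i] lm h)
  let ?H = "h ` carrier N" and ?k = "a_kernel (P i) N f"
  have H: "lsub ?H (P i)" by (rule h.image_submodule[OF f.cod.lsub_carrier])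
  have int: "?H \<inter> ?k = {\<zero>\<^bsub>P i\<^esub>}"
    using h(2) lsub_zero[OF f.ker_submodule] by force
  have sum: "?H <+>\<^bsub>P i\<^esub> ?k = carrier (P i)"
  proof
    show "?H <+>\<^bsub>P i\<^esub> ?k \<subseteq> carrier (P i)"
      using lsub_subset[OF f.dom.lsub_sum[OF H f.ker_submodule]] .
    show "carrier (P i) \<subseteq> ?H <+>\<^bsub>P i\<^esub> ?k"
    proof
      fix x assume x: "x \<in> carrier (P i)"
      have fx: "f x \<in> carrier N" "h (f x) \<in> carrier (P i)" using f.closed[OF x] by blast+
      hence "x \<ominus>\<^bsub>P i\<^esub> h (f x) \<in> ?k"
        using f.eq_iff_diff_ker[OF x fx(2)] h(2) by simp
      moreover have "h (f x) \<oplus>\<^bsub>P i\<^esub> (x \<ominus>\<^bsub>P i\<^esub> h (f x)) = x"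
        using f.dom.diff_add_cancel[OF x fx(2)] f.dom.M.a_comm[OF fx(2) f.dom.M.minus_closed[OF x
          fx(2)]]
        by simp
      ultimately show "x \<in> ?H <+>\<^bsub>P i\<^esub> ?k"
        using fx(1) unfolding set_add_def' by blast
    qed
  qed
  have "?H = {\<zero>\<^bsub>P i\<^esub>} \<or> ?k = {\<zero>\<^bsub>P i\<^esub>}"
    using e_props(3)[OF i] H f.ker_submodule int sum unfolding indecomposable_module_def by blast
  moreover have "?H \<noteq> {\<zero>\<^bsub>P i\<^esub>}"
  proof
    assume H0: "?H = {\<zero>\<^bsub>P i\<^esub>}"
    have "y = \<zero>" if "y \<in> carrier N" for y
    proof -
      have "h y = \<zero>\<^bsub>P i\<^esub>" using that H0 by blast
      thus ?thesis using h(2) that f.zero by metis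
    qed
    thus False using N(2) by blast
  qed
  ultimately show ?thesis using f.inj_on_ker f(2) by (simp add: bij_betw_def)
qed

text \<open>The simple top of Ad is some S_i and so contains a nonzero element fixed by e_i.
  Multiplying a preimage by e_i gives an element outside the radical, and by Nakayama's lemma the
  corresponding map from P_i is onto.\<close>

lemma primitive_iso_P:
  assumes d: "idem d" and ind: "indec (lideal d)"
  shows "\<exists>i<r. \<exists>f\<in>Hom (P i) (lideal d). bij_betw f (carrier (P i)) (carrier (lideal d))"
proof -
  let ?L = "lideal d"
  have fd: "fd ?L" and lm: "lmod ?L" using idemD[OF d] lideal_fd lideal_lm by auto
  interpret L: left_module A ?L by fact
  have mx: "maxsub (rad A ?L) ?L" using ws_primitive(1)[OF ws d ind] by (simp add: local_idem_def)
  obtain T :: "('a, 'k list) module" and p where T: "fd T" "p \<in> Hom ?L T"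
    "p ` carrier ?L = carrier T" "a_kernel ?L T p = rad A ?L" using klist_quotient[OF fd L.rad_submodule] by blast
  have lmT: "lmod T" using T by (intro fd_moduleD)
  interpret p: lm_hom A ?L T p by (intro lm_homI lm lmT T)
  have simple: "simple T" using p.surj_simple_maximal[OF T(3)] T(4) mx by simp
  then obtain i where i: "i < r" "isom T (S i)" using simple_iso_S by blast
  have "efix (e i) T \<noteq> {\<zero>\<^bsub>T\<^esub>}"
    using c_simple_iff(1)[OF i(1) simple] i(2) cdim_zero_iff[OF e_carrier(1)[OF i(1)] T(1)] by simp
  moreover have "\<zero>\<^bsub>T\<^esub> \<in> efix (e i) T"
    using lsub_zero[OF efix_subspace[OF lmT e_carrier(1)[OF i(1)]]] by simp
  ultimately obtain w where w: "w \<in> efix (e i) T" "w \<noteq> \<zero>\<^bsub>T\<^esub>" by blast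
  have "w \<in> p ` carrier ?L" unfolding T(3) by (rule efixD(1)[OF w(1)])
  then obtain y where y: "y \<in> carrier ?L" "p y = w" by (elim imageE) metis
  have hy: "(\<lambda>x. x \<odot>\<^bsub>?L\<^esub> y) \<in> Hom (P i) ?L"
    by (rule lideal_hom[OF lm e_carrier(1)[OF i(1)] y(1)])
  interpret h: lm_hom A "P i" ?L "\<lambda>x. x \<odot>\<^bsub>?L\<^esub> y"
    by (intro lm_homI P_lm[OF i(1)] lm hy)
  let ?I = "(\<lambda>x. x \<odot>\<^bsub>?L\<^esub> y) ` carrier (P i)"
  have I: "lsub ?I ?L" by (rule h.image_submodule[OF h.dom.lsub_carrier])
  have "e i \<odot>\<^bsub>?L\<^esub> y \<in> ?I" using e_carrier[OF i(1)] by simp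
  moreover have "e i \<odot>\<^bsub>?L\<^esub> y \<notin> rad A ?L"
    using p.smult[OF e_carrier(1)[OF i(1)]] y efixD(2)[OF w(1)] T(4) w(2) p.ker_iff by metis
  ultimately have "?I <+>\<^bsub>?L\<^esub> rad A ?L = carrier ?L"
    using mx L.lsub_sum[OF I] L.set_add_upper[OF I] unfolding maximal_submodule_def by blast
  hence "?I = carrier ?L" by (rule nakayama[OF fd I])
  moreover have "carrier ?L \<noteq> {\<zero>\<^bsub>?L\<^esub>}"
    using ind by (simp add: indecomposable_module_def)
  ultimately show ?thesis using P_surj_bij[OF i(1) lideal_projective[OF d]] hy i(1) by blast
qed

end

section \<open>Homomorphism spaces\<close>

lemma hom_space_simps:
  "carrier (hom_space A M N) = module_hom A M N \<inter> extensional (carrier M)"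
  "\<zero>\<^bsub>hom_space A M N\<^esub> = (\<lambda>x\<in>carrier M. \<zero>\<^bsub>N\<^esub>)"
  "f \<oplus>\<^bsub>hom_space A M N\<^esub> g = (\<lambda>x\<in>carrier M. f x \<oplus>\<^bsub>N\<^esub> g x)"
  "s \<odot>\<^bsub>hom_space A M N\<^esub> f = (\<lambda>x\<in>carrier M. (s \<odot>\<^bsub>A\<^esub> \<one>\<^bsub>A\<^esub>) \<odot>\<^bsub>N\<^esub> f x)"
  by (simp_all add: hom_space_def)

lemma hom_space_ext:
  assumes "f \<in> carrier (hom_space A M N)" "g \<in> carrier (hom_space A M N)"
    "\<And>x. x \<in> carrier M \<Longrightarrow> f x = g x"
  shows "f = g" using assms by (auto simp: hom_space_simps intro: extensionalityI)

lemma restrict_hom_space: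
  assumes M: "left_module A M" and f: "f \<in> module_hom A M N"
  shows "(\<lambda>x\<in>carrier M. f x) \<in> carrier (hom_space A M N)"
  using mhom_cong[OF f _ M, of "restrict f (carrier M)"] by (simp add: hom_space_simps)

text \<open>One family covers both kinds of subspaces to be counted: maps that factor through M/W,
  and maps with values in the submodule U.\<close>

definition hom_set ::
    "('k, 'a) module \<Rightarrow> ('a, 'm) module \<Rightarrow> ('a, 'n) module \<Rightarrow> 'm set \<Rightarrow> 'n set \<Rightarrow> ('m \<Rightarrow> 'n) set" where
  "hom_set A M N W U =
     {f \<in> carrier (hom_space A M N). (\<forall>x\<in>W. f x = \<zero>\<^bsub>N\<^esub>) \<and> (\<forall>x\<in>carrier M. f x \<in> U)}"

context fd_algebra begin

lemma hom_space_vs: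
  fixes N (structure)
  assumes M: "lmod M" and N: "lmod N"
  shows "vectorspace K (hom_space A M N)"
proof (rule lm_vs[OF field_K])
  interpret M: left_module A M by fact
  interpret N: left_module A N by fact
  let ?H = "hom_space A M N"
  have hom: "lm_hom A M N f" if "f \<in> carrier ?H" for f
    using that by (intro lm_homI M N) (simp add: hom_space_simps)
  have add: "f \<oplus>\<^bsub>?H\<^esub> g \<in> carrier ?H" if "f \<in> carrier ?H" "g \<in> carrier ?H" for f g
    unfolding hom_space_simps(3)
    by (rule restrict_hom_space[OF M M.lm_hom_add[OF hom[OF that(1)] hom[OF that(2)]]])
  have sm: "a \<odot>\<^bsub>?H\<^esub> f \<in> carrier ?H" if "a \<in> carrier K" "f \<in> carrier ?H" for a f
    unfolding hom_space_simps(4)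
  proof (rule restrict_hom_space[OF M])
    interpret f: lm_hom A M N f by (rule hom[OF that(2)])
    show "(\<lambda>x. unit_scalar a \<odot> f x) \<in> Hom M N"
      using that(1) unit_scalar_comm
      by (intro module_homI) (auto simp: N.lsmult_r_distr N.lsmult_assoc[symmetric])
  qed
  have z: "\<zero>\<^bsub>?H\<^esub> \<in> carrier ?H"
    unfolding hom_space_simps(2) by (rule restrict_hom_space[OF M zero_hom[OF M N]])
  have cl: "f x \<in> carrier N" if "f \<in> carrier ?H" "x \<in> carrier M" for f x
    using lm_hom.closed[OF hom[OF that(1)] that(2)] .
  note ext = hom_space_ext[of _ A M N]
  have "abelian_group ?H"
  proof (rule abelian_groupI)
    fix f g h assume f: "f \<in> carrier ?H" and g: "g \<in> carrier ?H" and h: "h \<in> carrier ?H"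
    show "f \<oplus>\<^bsub>?H\<^esub> g \<oplus>\<^bsub>?H\<^esub> h = f \<oplus>\<^bsub>?H\<^esub> (g \<oplus>\<^bsub>?H\<^esub> h)"
      by (rule) (use f g h cl in \<open>auto simp: hom_space_simps(3) N.M.a_assoc\<close>)
  next
    fix f g assume f: "f \<in> carrier ?H" and g: "g \<in> carrier ?H"
    show "f \<oplus>\<^bsub>?H\<^esub> g = g \<oplus>\<^bsub>?H\<^esub> f"
      by (rule) (use f g add cl in \<open>auto simp: hom_space_simps(3) N.M.a_comm\<close>)
  next
    fix f assume f: "f \<in> carrier ?H"
    show "\<zero>\<^bsub>?H\<^esub> \<oplus>\<^bsub>?H\<^esub> f = f"
      by (rule ext[OF add[OF z]]) (use f cl in \<open>auto simp: hom_space_simps(2,3)\<close>)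
    interpret f: lm_hom A M N f by (rule hom[OF f])
    have "(\<lambda>x. \<zero> \<ominus> f x) \<in> Hom M N"
      by (intro M.lm_hom_sub lm_homI M N zero_hom f.hom)
    hence m: "(\<lambda>x\<in>carrier M. \<zero> \<ominus> f x) \<in> carrier ?H"
      by (rule restrict_hom_space[OF M])
    show "\<exists>g\<in>carrier ?H. g \<oplus>\<^bsub>?H\<^esub> f = \<zero>\<^bsub>?H\<^esub>"
    proof (rule bexI[OF _ m], rule ext)
      fix x assume "x \<in> carrier M"
      thus "((\<lambda>x\<in>carrier M. \<zero> \<ominus> f x) \<oplus>\<^bsub>?H\<^esub> f) x = \<zero>\<^bsub>?H\<^esub> x"
        by (simp add: hom_space_simps(2,3) N.diff_add_cancel)
    qed (use add[OF m f] z in auto)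
  qed (use add z in auto)
  moreover have "(a \<otimes>\<^bsub>K\<^esub> b) \<odot>\<^bsub>A\<^esub> \<one>\<^bsub>A\<^esub> = unit_scalar a \<otimes>\<^bsub>A\<^esub> unit_scalar b"
    if "a \<in> carrier K" "b \<in> carrier K" for a b
    using that by (simp add: smult_mult_left smult_assoc1)
  ultimately show "left_module K ?H" unfolding left_module_def left_module_axioms_def
  proof (intro conjI allI impI ring_K)
    fix a b f assume a: "a \<in> carrier K" and b: "b \<in> carrier K" and f: "f \<in> carrier ?H"
    show "(a \<oplus>\<^bsub>K\<^esub> b) \<odot>\<^bsub>?H\<^esub> f = a \<odot>\<^bsub>?H\<^esub> f \<oplus>\<^bsub>?H\<^esub> b \<odot>\<^bsub>?H\<^esub> f"
      using a b cl[OF f] by (auto simp: hom_space_simps(3,4) smult_l_distr N.lsmult_l_distr)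
    assume "\<And>a b. a \<in> carrier K \<Longrightarrow> b \<in> carrier K \<Longrightarrow>
      (a \<otimes>\<^bsub>K\<^esub> b) \<odot>\<^bsub>A\<^esub> \<one>\<^bsub>A\<^esub> = unit_scalar a \<otimes>\<^bsub>A\<^esub> unit_scalar b"
    thus "(a \<otimes>\<^bsub>K\<^esub> b) \<odot>\<^bsub>?H\<^esub> f = a \<odot>\<^bsub>?H\<^esub> (b \<odot>\<^bsub>?H\<^esub> f)"
      using a b cl[OF f] by (auto simp: hom_space_simps(4) N.lsmult_assoc)
  next
    fix a f g assume "a \<in> carrier K" "f \<in> carrier ?H" "g \<in> carrier ?H"
    thus "a \<odot>\<^bsub>?H\<^esub> (f \<oplus>\<^bsub>?H\<^esub> g) = a \<odot>\<^bsub>?H\<^esub> f \<oplus>\<^bsub>?H\<^esub> a \<odot>\<^bsub>?H\<^esub> g"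
      using cl by (auto simp: hom_space_simps(3,4) N.lsmult_r_distr)
  next
    fix f assume f: "f \<in> carrier ?H"
    have one: "\<one>\<^bsub>K\<^esub> \<in> carrier K" by simp
    show "\<one>\<^bsub>K\<^esub> \<odot>\<^bsub>?H\<^esub> f = f"
      by (rule ext[OF sm[OF one f] f]) (use cl[OF f] in \<open>simp add: hom_space_simps(4)\<close>)
  qed (use sm in auto)
qed

lemma hom_space_linear_eval:
  assumes "x \<in> carrier M"
  shows "(\<lambda>f. f x) \<in> module_hom K (hom_space A M N) (scalars A N)"
  using assms by (intro module_homI) (auto simp: hom_space_simps module_hom_def)

lemma hom_set_subspace:
  assumes M: "lmod M" and N: "lmod N" and W: "W \<subseteq> carrier M" and U: "lsub U N"
  shows "left_submodule K (hom_set A M N W U) (hom_space A M N)"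
proof -
  interpret H: left_module K "hom_space A M N" by (rule vs_lm[OF hom_space_vs[OF M N]])
  interpret N: left_module A N by fact
  show ?thesis unfolding left_submodule_def
  proof (intro conjI ballI)
    show "hom_set A M N W U \<subseteq> carrier (hom_space A M N)" by (auto simp: hom_set_def)
    show "\<zero>\<^bsub>hom_space A M N\<^esub> \<in> hom_set A M N W U"
      using W lsub_zero[OF U] H.M.zero_closed by (auto simp: hom_set_def hom_space_simps(2))
    fix f assume f: "f \<in> hom_set A M N W U"
    show "f \<oplus>\<^bsub>hom_space A M N\<^esub> g \<in> hom_set A M N W U" if "g \<in> hom_set A M N W U" for g
      using f that W lsub_add[OF U] H.M.a_closed by (auto simp: hom_set_def hom_space_simps(3))
    show "a \<odot>\<^bsub>hom_space A M N\<^esub> f \<in> hom_set A M N W U" if "a \<in> carrier K" for a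
      using f that W lsub_smult[OF U] H.lsmult_closed by (auto simp: hom_set_def hom_space_simps(4))
  qed
qed

lemma fin_dim_zero_space:
  fixes V :: "('k, 'v) module"
  assumes "vectorspace K V" "carrier V = {\<zero>\<^bsub>V\<^esub>}"
  shows "fdim V"
proof -
  interpret VV: vectorspace K V by fact
  show ?thesis unfolding VV.fin_dim_def using VV.span_empty assms(2) by (intro exI[of _ "{}"]) simp
qed

text \<open>A homomorphism that vanishes on a finite spanning set is zero. Dropping one vanishing
  condition at a time enlarges the space by at most the image of an evaluation, which lies in the
  finite-dimensional N.\<close>

lemma hom_space_fin_dim:
  assumes M: "fd M" and N: "fd N"
  shows "fdim (hom_space A M N)"
proof -
  have lm: "lmod M" "lmod N" using M N by (auto intro: fd_moduleD)
  interpret Nm: left_module A N by (rule lm)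
  let ?H = "hom_space A M N"
  have VH: "vectorspace K ?H" by (rule hom_space_vs[OF lm])
  note sub = hom_set_subspace[OF lm _ Nm.lsub_carrier]
  let ?Z = "\<lambda>W. submod ?H (hom_set A M N W (carrier N))"
  have red: "fdim (?Z W) \<Longrightarrow> fdim ?H" if "finite W" "W \<subseteq> carrier M" for W
    using that
  proof (induction W rule: finite_induct)
    case empty
    have "hom_set A M N {} (carrier N) = carrier ?H"
      by (auto simp: hom_set_def hom_space_simps module_hom_def)
    thus ?case using empty by simp
  next
    case (insert x W)
    have x: "x \<in> carrier M" and W: "W \<subseteq> carrier M" using insert by auto
    have vW: "vectorspace K (?Z W)" by (rule vectorspace_submod[OF VH sub[OF W]])
    have ev: "(\<lambda>f. f x) \<in> module_hom K (?Z W) (scalars A N)"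
      by (rule mhom_restrict[OF hom_space_linear_eval[OF x] lsub_subset[OF sub[OF W]]])
    have "a_kernel (?Z W) (scalars A N) (\<lambda>f. f x) = hom_set A M N (insert x W) (carrier N)"
      by (auto simp: a_kernel_def' hom_set_def)
    thus ?case
      using fin_dim_extension[OF vW scalars_vectorspace[OF lm(2)] ev fd_fdim[OF N]] insert.prems
        insert.IH
      by simp
  qed
  interpret VV: vectorspace K "scalars A M" by (rule scalars_vectorspace[OF lm(1)])
  obtain B where B: "finite B" "B \<subseteq> carrier M" "VV.span B = carrier M"
    using fd_fdim[OF M] by (auto simp: VV.fin_dim_def)
  have "f = \<zero>\<^bsub>?H\<^esub>" if f: "f \<in> hom_set A M N B (carrier N)" for f
  proof (rule hom_space_ext)
    have fh: "f \<in> Hom M N" using f by (auto simp: hom_set_def hom_space_simps)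
    interpret f: lm_hom A M N f by (intro lm_homI lm fh)
    have "VV.span B \<subseteq> a_kernel M N f"
      using lsub_scalars[OF f.ker_submodule] subspace_iff_lsub[OF VV.vectorspace_axioms] f B
      by (intro VV.span_is_subset) (auto simp: hom_set_def)
    thus "f x = \<zero>\<^bsub>?H\<^esub> x" if "x \<in> carrier M" for x
      using B that by (auto simp: hom_space_simps(2))
  qed (use f restrict_hom_space[OF lm(1) zero_hom[OF lm]] in \<open>auto simp: hom_set_def hom_space_simps(2)\<close>)
  hence "hom_set A M N B (carrier N) = {\<zero>\<^bsub>?H\<^esub>}"
    using lsub_zero[OF sub[OF B(2)]] by blast
  hence "carrier (?Z B) = {\<zero>\<^bsub>?Z B\<^esub>}" by simp
  hence "fdim (?Z B)" by (rule fin_dim_zero_space[OF vectorspace_submod[OF VH sub[OF B(2)]]])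
  thus ?thesis using red[OF B(1,2)] by blast
qed

abbreviation hdim :: "('a, 'm) module \<Rightarrow> ('a, 'n) module \<Rightarrow> 'm set \<Rightarrow> 'n set \<Rightarrow> nat" where
  "hdim M N W U \<equiv> vdim (submod (hom_space A M N) (hom_set A M N W U))"

lemma hdim_zero:
  assumes M: "fd M" and N: "fd N" and W: "W \<subseteq> carrier M" and U: "lsub U N"
    and z: "\<And>f x. f \<in> hom_set A M N W U \<Longrightarrow> x \<in> carrier M \<Longrightarrow> f x = \<zero>\<^bsub>N\<^esub>"
  shows "hdim M N W U = 0"
proof -
  have lm: "lmod M" "lmod N" using M N by (auto intro: fd_moduleD)
  have VH: "vectorspace K (hom_space A M N)" by (rule hom_space_vs[OF lm])
  note s = hom_set_subspace[OF lm W U]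
  have "f = \<zero>\<^bsub>hom_space A M N\<^esub>" if f: "f \<in> hom_set A M N W U" for f
    by (rule hom_space_ext) (use f z[OF f] restrict_hom_space[OF lm(1) zero_hom[OF lm]] in
      \<open>auto simp: hom_set_def hom_space_simps(2)\<close>)
  hence "hom_set A M N W U = {\<zero>\<^bsub>hom_space A M N\<^esub>}"
    using lsub_zero[OF s] by blast
  thus ?thesis
    using dim_zero_iff[OF vectorspace_submod[OF VH s] submod_fin_dim[OF VH hom_space_fin_dim[OF M
      N] s]]
    by simp
qed

lemma hdim_full: "hdim M N {} (carrier N) = vdim (hom_space A M N)"
proof -
  have "hom_set A M N {} (carrier N) = carrier (hom_space A M N)"
    by (auto simp: hom_set_def hom_space_simps module_hom_def)
  thus ?thesis by simp
qed

lemma hdim_rank_nullity: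
  fixes V :: "('k, 'v) module"
  assumes M: "fd M" and N: "fd N" and W: "W \<subseteq> carrier M" and U: "lsub U N"
    and V: "vectorspace K V" and R: "R \<in> module_hom K (submod (hom_space A M N) (hom_set A M N W U)) V"
    and ker: "\<And>f. f \<in> hom_set A M N W U \<Longrightarrow> R f = \<zero>\<^bsub>V\<^esub> \<longleftrightarrow> f \<in> H'"
    and H': "H' \<subseteq> hom_set A M N W U"
    and im: "R ` hom_set A M N W U = I"
  shows "hdim M N W U = vdim (submod (hom_space A M N) H') + vdim (submod V I)"
proof -
  have lm: "lmod M" "lmod N" using M N by (auto intro: fd_moduleD)
  have VH: "vectorspace K (hom_space A M N)" by (rule hom_space_vs[OF lm])
  note s = hom_set_subspace[OF lm W U]
  have "a_kernel (submod (hom_space A M N) (hom_set A M N W U)) V R = H'"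
    using ker H' by (auto simp: a_kernel_def')
  thus ?thesis
    using rank_nullity_mhom[OF vectorspace_submod[OF VH s] V R submod_fin_dim[OF VH
      hom_space_fin_dim[OF M N] s]] im
    by simp
qed

end

context rad_cube_zero begin

text \<open>A nonzero map from T lands in the simple socle of N and is an isomorphism onto it. If T
  is isomorphic to that socle, Schur's lemma makes all such maps multiples of one; otherwise there
  are none.\<close>

lemma hom_simple_dim:
  fixes N (structure)
  assumes j: "j < r" and T: "simple T" and N: "fd N"
    and sN: "simple (submod N (soc A N))" "isom (submod N (soc A N)) (S j)"
  shows "vdim (hom_space A T N) = c j T"
proof -
  have lmT: "lmod T" and fdT: "fd T" using T by (auto intro: simple_moduleD fd_simple)
  have lmN: "lmod N" using N by (rule fd_moduleD)
  interpret Tm: left_module A T by fact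
  interpret Nm: left_module A N by fact
  have lmS: "lmod (submod N (soc A N))" using sN(1) by (rule simple_moduleD)
  have cs: "carrier (submod N (soc A N)) = soc A N" by simp
  have im: "f x \<in> soc A N" if "f \<in> Hom T N" "x \<in> carrier T" for f x
    using simple_subset_soc[OF Tm.lsub_carrier] T lsub_subset[OF Tm.soc_submodule]
      lm_hom.soc_image[OF lm_homI[OF lmT lmN that(1)]] that(2)
    by auto
  have nz: "bij_betw f (carrier T) (soc A N)" if f: "f \<in> Hom T N" and x: "x \<in> carrier T" "f x \<noteq> \<zero>" for f x
  proof -
    interpret f: lm_hom A T N f by (intro lm_homI lmT lmN f)
    have "f ` carrier T \<noteq> {\<zero>}" using x by blast
    hence inj: "inj_on f (carrier T)" using f.simple_image[OF Tm.lsub_carrier] T by simp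
    have "lsub (f ` carrier T) (submod N (soc A N))"
      using lsub_submod_iff[OF Nm.soc_submodule] f.image_submodule[OF Tm.lsub_carrier] im[OF f]
      by blast
    hence "f ` carrier T = soc A N"
      using simple_moduleD(3)[OF sN(1)] \<open>f ` carrier T \<noteq> {\<zero>}\<close> by fastforce
    thus ?thesis using inj by (simp add: bij_betw_def)
  qed
  show ?thesis
  proof (cases "isom T (S j)")
    case False
    have "f x = \<zero>" if f: "f \<in> hom_set A T N {} (carrier N)" and x: "x \<in> carrier T" for f x
    proof (rule ccontr)
      assume ne: "f x \<noteq> \<zero>"
      have fh: "f \<in> Hom T N" using f by (auto simp: hom_set_def hom_space_simps)
      have "isom T (submod N (soc A N))"
        unfolding module_iso_def using mhom_corestrict[OF fh im[OF fh]] nz[OF fh x ne] by auto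
      thus False using False module_iso_trans sN(2) by blast
    qed
    hence "hdim T N {} (carrier N) = 0" by (intro hdim_zero fdT N Nm.lsub_carrier) auto
    moreover have "c j T = 0" using c_simple_iff[OF j T] False by auto
    ultimately show ?thesis unfolding hdim_full by simp
  next
    case True
    have "isom T (submod N (soc A N))"
      using module_iso_trans[OF True module_iso_sym[OF lmS S_lm[OF j] sN(2)]] .
    then obtain \<phi> where \<phi>: "\<phi> \<in> Hom T (submod N (soc A N))" "bij_betw \<phi> (carrier T) (soc A N)"
      by (auto simp: module_iso_def)
    have \<phi>N: "\<phi> \<in> Hom T N"
      by (rule mhom_extend_codomain[OF \<phi>(1) lsub_subset[OF Nm.soc_submodule]])
    note inv = bij_inv_retract[OF lmT lmS \<phi>(1), unfolded cs, OF \<phi>(2)]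
    interpret VV: vectorspace K "hom_space A T N" by (rule hom_space_vs[OF lmT lmN])
    let ?u = "\<lambda>x\<in>carrier T. \<phi> x"
    have u: "?u \<in> carrier (hom_space A T N)" by (rule restrict_hom_space[OF lmT \<phi>N])
    have sp: "left_submodule K (VV.span {?u}) (hom_space A T N)"
      using VV.span_is_subspace[of "{?u}"] subspace_iff_lsub[OF VV.vectorspace_axioms] u by simp
    have us: "?u \<in> VV.span {?u}" using VV.span_self[OF u] .
    have "carrier (hom_space A T N) \<subseteq> VV.span {?u}"
    proof
      fix f assume f: "f \<in> carrier (hom_space A T N)"
      hence fh: "f \<in> Hom T N" by (simp add: hom_space_simps)
      have "(\<lambda>x. inv_into (carrier T) \<phi> (f x)) \<in> Hom T T"
        by (rule mhom_comp[OF mhom_corestrict[OF fh im[OF fh]] inv(1)])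
      then obtain s where s: "s \<in> carrier K" "\<forall>x\<in>carrier T. inv_into (carrier T) \<phi> (f x) = unit_scalar s \<odot>\<^bsub>T\<^esub> x"
        using schur[OF ac T] by blast
      have "f = s \<odot>\<^bsub>hom_space A T N\<^esub> ?u"
      proof (rule hom_space_ext[OF f])
        show "s \<odot>\<^bsub>hom_space A T N\<^esub> ?u \<in> carrier (hom_space A T N)"
          using lsub_mem[OF sp lsub_smult[OF sp s(1) us]] .
        fix x assume x: "x \<in> carrier T"
        have "f x = \<phi> (inv_into (carrier T) \<phi> (f x))" using inv(2)[OF im[OF fh x]] by simp
        also have "\<dots> = \<phi> (unit_scalar s \<odot>\<^bsub>T\<^esub> x)" using s x by simp
        also have "\<dots> = unit_scalar s \<odot> \<phi> x"
          using module_hom_smult[OF \<phi>N unit_scalar_closed[OF s(1)] x] .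
        finally show "f x = (s \<odot>\<^bsub>hom_space A T N\<^esub> ?u) x"
          using x by (simp add: hom_space_simps(4))
      qed
      thus "f \<in> VV.span {?u}" using lsub_smult[OF sp s(1) us] by simp
    qed
    hence "VV.gen_set {?u}" using lsub_subset[OF sp] by simp
    moreover have "?u \<noteq> \<zero>\<^bsub>hom_space A T N\<^esub>"
    proof
      assume z: "?u = \<zero>\<^bsub>hom_space A T N\<^esub>"
      have "\<phi> x = \<zero>" if "x \<in> carrier T" for x
        using fun_cong[OF z, of x] that by (simp add: hom_space_simps(2))
      hence "soc A N \<subseteq> {\<zero>}" using \<phi>(2) by (auto simp: bij_betw_def)
      thus False using simple_moduleD(2)[OF sN(1)] lsub_zero[OF Nm.soc_submodule] by auto
    qed
    ultimately have "VV.dim = 1" using VV.dim1I u by blast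
    thus ?thesis using c_simple_iff(1)[OF j T] True by simp
  qed
qed

text \<open>By induction along a chain of submodules with simple factors.\<close>

lemma hom_count:
  fixes N (structure)
  assumes j: "j < r" and M: "fd M" and N: "fd N"
    and sN: "simple (submod N (soc A N))" "isom (submod N (soc A N)) (S j)"
    and ext: "\<And>W W' h. lsub W M \<Longrightarrow> lsub W' M \<Longrightarrow> W0 \<subseteq> W \<Longrightarrow> W \<subseteq> W' \<Longrightarrow>
      h \<in> Hom (submod M W') N \<Longrightarrow> (\<And>x. x \<in> W \<Longrightarrow> h x = \<zero>) \<Longrightarrow>
      \<exists>f\<in>Hom M N. \<forall>x\<in>W'. f x = h x"
  shows "lsub W M \<Longrightarrow> W0 \<subseteq> W \<Longrightarrow> hdim M N W (carrier N) + c j (submod M W) = c j M"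
proof (induction "mdim M - mdim (submod M W)" arbitrary: W rule: less_induct)
  case less
  note W = less.prems(1) and W0 = less.prems(2)
  have lmM: "lmod M" and lmN: "lmod N" using M N by (auto intro: fd_moduleD)
  interpret Mm: left_module A M by fact
  interpret Nm: left_module A N by fact
  have WM: "W \<subseteq> carrier M" using W by (rule lsub_subset)
  show ?case
  proof (cases "W = carrier M")
    case True
    have "hdim M N W (carrier N) = 0"
      by (rule hdim_zero[OF M N WM Nm.lsub_carrier]) (use True in \<open>auto simp:
        hom_set_def\<close>)
    thus ?thesis using True by simp
  next
    case False
    \<comment> \<open>W' is minimal among the submodules strictly above W, so W'/W is simple and the
      induction continues with W'.\<close>
    obtain W' where W': "lsub W' M" "W \<subset> W'"
      and min: "\<And>V. lsub V M \<and> W \<subset> V \<and> V \<subseteq> W' \<Longrightarrow> V = W'"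
      using min_dim_submodule[OF M Mm.lsub_carrier, of "\<lambda>V. W \<subset> V"] False WM
      by blast
    have W'M: "W' \<subseteq> carrier M" using W'(1) by (rule lsub_subset)
    have fdW': "fd (submod M W')" by (rule fd_submod[OF M W'(1)])
    have lmW': "lmod (submod M W')" using fdW' by (rule fd_moduleD)
    have WW': "lsub W (submod M W')" using lsub_submod_iff[OF W'(1)] W W'(2) by blast
    obtain T :: "('a, 'k list) module" and p where T: "fd T" "p \<in> Hom (submod M W') T"
      "p ` carrier (submod M W') = carrier T" "a_kernel (submod M W') T p = W" using klist_quotient[OF fdW' WW'] by blast
    have lmT: "lmod T" using T by (intro fd_moduleD)
    interpret p: lm_hom A "submod M W'" T p by (intro lm_homI lmW' lmT T)
    have "maxsub W (submod M W')"
      unfolding maximal_submodule_def lsub_submod_iff[OF W'(1)] using W W' min by auto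
    hence simple: "simple T" using p.surj_simple_maximal[OF T(3)] T(4) by simp
    let ?s = "inv_into W' p"
    have s: "?s y \<in> W'" "p (?s y) = y" if "y \<in> carrier T" for y
      using that T(3) by (auto intro: inv_into_into f_inv_into_f)
    \<comment> \<open>Restriction to W', read on the quotient T = W'/W. Its kernel consists of the
      maps that vanish on W', and the extension hypothesis makes it onto Hom(T, N).\<close>
    let ?R = "\<lambda>f. \<lambda>y\<in>carrier T. f (?s y)"
    have fac: "?R f \<in> carrier (hom_space A T N) \<and> (\<forall>x\<in>W'. ?R f (p x) = f x)"
      if f: "f \<in> hom_set A M N W (carrier N)" for f
    proof -
      have fh: "f \<in> Hom M N" using f by (auto simp: hom_set_def hom_space_simps)
      interpret f: lm_hom A "submod M W'" N f
        by (rule lm_hom.restrict_hom[OF lm_homI[OF lmM lmN fh] W'(1)])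
      have "a_kernel (submod M W') T p \<subseteq> a_kernel (submod M W') N f"
        unfolding T(4) using f W'(2) by (auto simp: hom_set_def)
      then obtain g where g: "g \<in> Hom T N" "\<forall>x\<in>W'. g (p x) = f x"
        using p.mhom_factor[OF T(3) f.lm_hom_axioms] by auto
      have eq: "?R f = (\<lambda>y\<in>carrier T. g y)" by (rule restrict_ext) (use g(2) s in metis)
      thus ?thesis unfolding eq using g(2) restrict_hom_space[OF lmT g(1)] by simp
    qed
    have RH: "?R \<in> module_hom K (submod (hom_space A M N) (hom_set A M N W (carrier N))) (hom_space A T N)"
    proof (rule module_homI)
      fix f g assume f: "f \<in> carrier (submod (hom_space A M N) (hom_set A M N W (carrier N)))"
      thus "?R f \<in> carrier (hom_space A T N)" using fac by simp
      show "?R (f \<oplus>\<^bsub>submod (hom_space A M N) (hom_set A M N W (carrier N))\<^esub> g) = ?R f \<oplus>\<^bsub>hom_space A T N\<^esub> ?R g"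
        using s(1) W'M by (auto simp: hom_space_simps(3) subset_iff)
      show "?R (a \<odot>\<^bsub>submod (hom_space A M N) (hom_set A M N W (carrier N))\<^esub> f) = a \<odot>\<^bsub>hom_space A T N\<^esub> ?R f" for a
        using s(1) W'M by (auto simp: hom_space_simps(4) subset_iff)
    qed
    have im: "?R ` hom_set A M N W (carrier N) = carrier (hom_space A T N)"
    proof
      show "?R ` hom_set A M N W (carrier N) \<subseteq> carrier (hom_space A T N)"
        using fac by blast
      show "carrier (hom_space A T N) \<subseteq> ?R ` hom_set A M N W (carrier N)"
      proof
        fix g assume g: "g \<in> carrier (hom_space A T N)"
        hence gh: "g \<in> Hom T N" by (simp add: hom_space_simps)
        interpret g: lm_hom A T N g by (intro lm_homI lmT lmN gh)
        have "g (p x) = \<zero>" if "x \<in> W" for x using that T(4) by auto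
        then obtain f where f: "f \<in> Hom M N" "\<forall>x\<in>W'. f x = g (p x)"
          using ext[OF W W'(1) W0 _ mhom_comp[OF T(2) gh]] W'(2) by blast
        let ?f = "\<lambda>x\<in>carrier M. f x"
        have "f x = \<zero>" if "x \<in> W" for x
          using that f(2) W'(2) \<open>\<And>x. x \<in> W \<Longrightarrow> g (p x) =
            \<zero>\<close>
          by auto
        hence fm: "?f \<in> hom_set A M N W (carrier N)"
          using restrict_hom_space[OF lmM f(1)] WM mhom_closed[OF f(1)] by (auto simp: hom_set_def)
        have Rf: "?R ?f = g"
        proof (rule hom_space_ext[OF _ g])
          show "?R ?f \<in> carrier (hom_space A T N)" using fac[OF fm] by blast
          fix y assume y: "y \<in> carrier T"
          have "?R ?f y = f (?s y)" using s(1) W'M y by auto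
          also have "\<dots> = g (p (?s y))" using f(2) s(1)[OF y] by blast
          finally show "?R ?f y = g y" using s(2)[OF y] by simp
        qed
        show "g \<in> ?R ` hom_set A M N W (carrier N)"
          by (rule image_eqI[where f = "?R" and x = "?f", OF Rf[symmetric] fm])
      qed
    qed
    have ker: "?R f = \<zero>\<^bsub>hom_space A T N\<^esub> \<longleftrightarrow> f \<in> hom_set A M N W' (carrier N)"
      if f: "f \<in> hom_set A M N W (carrier N)" for f
      using fac[OF f] f s(1) by (fastforce simp: hom_set_def hom_space_simps(2))
    have "hdim M N W (carrier N) = hdim M N W' (carrier N) + vdim (submod (hom_space A T N) (carrier (hom_space A T N)))"
      by (rule hdim_rank_nullity[OF M N WM Nm.lsub_carrier hom_space_vs[OF lmT lmN] RH ker _ im])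
        (use W'(2) in \<open>auto simp: hom_set_def\<close>)
    also have "vdim (submod (hom_space A T N) (carrier (hom_space A T N))) = c j T"
      using hom_simple_dim[OF j simple N sN] by simp
    finally have 1: "hdim M N W (carrier N) = hdim M N W' (carrier N) + c j T" .
    have 2: "c j (submod M W') = c j (submod M W) + c j T"
      using c_surj[OF j fdW' lmT T(2,3)] T(4) by simp
    show ?thesis
      using mdim_mono(2)[OF M W W'(1)] mdim_mono_carrier(1)[OF M W'(1)] less.hyps[OF _ W'(1)] W0
        W'(2) 1 2
      by fastforce
  qed
qed

text \<open>Injectivity extends maps from every submodule, so each composition factor S_j of M/W
  contributes one dimension to Hom(M/W, N).\<close>

lemma injective_hom_count:
  assumes j: "j < r" and M: "fd M" and N: "injective_module K A N"
    and sN: "simple (submod N (soc A N))" "isom (submod N (soc A N)) (S j)"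
    and W: "lsub W M"
  shows "hdim M N W (carrier N) + c j (submod M W) = c j M"
proof (rule hom_count[OF j M injectiveD[OF N] sN _ W, of "{}"])
  fix W W' h assume *: "lsub W' M" "h \<in> Hom (submod M W') N"
  thus "\<exists>f\<in>Hom M N. \<forall>x\<in>W'. f x = h x"
    using injective_extend[OF N fd_submod[OF M *(1)] M mhom_incl[OF lsub_subset] _ *(2)] by auto
qed auto

text \<open>Above the radical the quotient of M is semisimple, so a map defined on W' is extended
  along a complement of its image there. No injectivity of N is involved.\<close>

lemma semisimple_hom_count:
  assumes j: "j < r" and M: "fd M" and N: "simple N" "isom N (S j)"
    and W: "lsub W M" "rad A M \<subseteq> W"
  shows "hdim M N W (carrier N) + c j (submod M W) = c j M"
proof (rule hom_count[OF j M fd_simple[OF N(1)] _ _ _ W])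
  have lmN: "lmod N" using N(1) by (rule simple_moduleD)
  interpret Nm: left_module A N by fact
  have "soc A N = carrier N"
    using simple_subset_soc[OF Nm.lsub_carrier] N lsub_subset[OF Nm.soc_submodule] by auto
  thus "simple (submod N (soc A N))" "isom (submod N (soc A N)) (S j)" using N by simp_all
  fix W W' h assume W: "lsub W M" and W': "lsub W' M" and RW: "rad A M \<subseteq> W" and WW': "W \<subseteq> W'"
    and h: "h \<in> Hom (submod M W') N" and h0: "\<And>x. x \<in> W \<Longrightarrow> h x = \<zero>\<^bsub>N\<^esub>"
  have lmM: "lmod M" using M by (rule fd_moduleD)
  obtain Q :: "('a, 'k list) module" and p where Q: "fd Q" "p \<in> Hom M Q"
    "p ` carrier M = carrier Q" "a_kernel M Q p = W" using klist_quotient[OF M W] by blast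
  have lmQ: "lmod Q" using Q by (intro fd_moduleD)
  interpret p: lm_hom A M Q p by (intro lm_homI lmM lmQ Q)
  have "rad A Q = {\<zero>\<^bsub>Q\<^esub>}"
    using rad_eq_Jmul[OF M] rad_eq_Jmul[OF Q(1)] Jmul_image[OF p.lm_hom_axioms, of "carrier M"]
      Q(3) RW Q(4) lsub_zero[OF p.cod.rad_submodule]
    by fastforce
  hence ss: "soc A Q = carrier Q" by (rule rad_zero_semisimple[OF Q(1)])
  have pW': "lsub (p ` W') Q" by (rule p.image_submodule[OF W'])
  obtain Y where Y: "lsub Y Q" "p ` W' \<inter> Y = {\<zero>\<^bsub>Q\<^esub>}" "p ` W' <+>\<^bsub>Q\<^esub> Y = carrier Q"
    using semisimple_complement[OF Q(1) ss pW'] by blast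
  obtain \<pi> where \<pi>: "\<pi> \<in> Hom Q Q" "\<forall>x\<in>p ` W'. \<pi> x = x" "\<forall>x\<in>carrier Q. \<pi> x \<in> p ` W'"
    using direct_sum_projection[OF lmQ pW' Y] by blast
  interpret q: lm_hom A "submod M W'" "submod Q (p ` W')" p
    using lm_hom.corestrict_hom[OF p.restrict_hom[OF W'] pW'] by simp
  interpret h: lm_hom A "submod M W'" N h by (intro lm_homI q.dom.left_module_axioms lmN h)
  obtain g where g: "g \<in> Hom (submod Q (p ` W')) N" "\<forall>x\<in>W'. g (p x) = h x"
    using Q(4) lsub_mem[OF W'] h0 q.mhom_factor[OF _ h.lm_hom_axioms] by force
  have "(\<lambda>x. g (\<pi> (p x))) \<in> Hom M N"
    by (rule mhom_comp[OF mhom_comp[OF Q(2) mhom_corestrict[OF \<pi>(1)]] g(1)]) (use \<pi>(3) in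
      blast)
  thus "\<exists>f\<in>Hom M N. \<forall>x\<in>W'. f x = h x" by (rule) (use g(2) \<pi>(2) in auto)
qed

lemma mhom_rad_simple:
  assumes M: "fd M" and N: "simple N" and f: "f \<in> Hom M N" and x: "x \<in> rad A M"
  shows "f x = \<zero>\<^bsub>N\<^esub>"
proof -
  have lm: "lmod M" "lmod N" using M N by (auto intro: fd_moduleD simple_moduleD)
  interpret f: lm_hom A M N f by (intro lm_homI lm f)
  have "Jmul M (carrier M) \<subseteq> a_kernel M N f"
    by (rule Jmul_least[OF f.ker_submodule]) (use J_carrier J_annihilates_simple[OF N] in auto)
  thus ?thesis using x rad_eq_Jmul[OF M] f.ker_iff by blast
qed

lemma hom_top_dim:
  assumes j: "j < r" and M: "fd M" and N: "simple N" "isom N (S j)"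
  shows "vdim (hom_space A M N) = t j M"
proof -
  interpret Mm: left_module A M using M by (rule fd_moduleD)
  have "hom_set A M N (rad A M) (carrier N) = hom_set A M N {} (carrier N)"
    using mhom_rad_simple[OF M N(1)] by (auto simp: hom_set_def hom_space_simps)
  hence "hdim M N (rad A M) (carrier N) = vdim (hom_space A M N)" using hdim_full by metis
  thus ?thesis using semisimple_hom_count[OF j M N Mm.rad_submodule] c_eq_t[OF j M] by simp
qed

text \<open>Induction on U through a maximal submodule V with U/V isomorphic to S_k. Projectivity of
  Q makes Hom(Q, U) \<rightarrow> Hom(Q, U/V) onto, with kernel Hom(Q, V), and Hom(Q, S_k) has
  dimension \<open>t k Q\<close>.\<close>

lemma projective_hom_count:
  fixes N (structure)
  assumes Q: "projective Q" and N: "fd N"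
  shows "lsub U N \<Longrightarrow> hdim Q N {} U = (\<Sum>i<r. t i Q * c i (submod N U))"
proof (induction "mdim (submod N U)" arbitrary: U rule: less_induct)
  case less
  note U = less.prems
  have fdQ: "fd Q" using Q by (rule projectiveD)
  have lmQ: "lmod Q" and lmN: "lmod N" using fdQ N by (auto intro: fd_moduleD)
  have fdU: "fd (submod N U)" by (rule fd_submod[OF N U])
  have lmU: "lmod (submod N U)" using fdU by (rule fd_moduleD)
  interpret Um: left_module A "submod N U" by fact
  have UN: "U \<subseteq> carrier N" using U by (rule lsub_subset)
  show ?case
  proof (cases "U = {\<zero>}")
    case True
    have "hdim Q N {} U = 0"
      by (rule hdim_zero[OF fdQ N _ U]) (use True in \<open>auto simp: hom_set_def\<close>)
    moreover have "c i (submod N U) = 0" if "i < r" for i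
      by (rule cdim_zero_module[OF e_carrier(1)[OF that] fdU]) (use True in simp)
    ultimately show ?thesis by simp
  next
    case False
    have z: "lsub {\<zero>} (submod N U)" using Um.lsub_0 by simp
    obtain V where V: "maxsub V (submod N U)" using maximal_submodule_exists[OF fdU z] False by auto
    hence V': "lsub V N" "V \<subseteq> U" "V \<noteq> U" "lsub V (submod N U)"
      unfolding maximal_submodule_def lsub_submod_iff[OF U] by auto
    obtain T :: "('a, 'k list) module" and p where T: "fd T" "p \<in> Hom (submod N U) T"
      "p ` carrier (submod N U) = carrier T" "a_kernel (submod N U) T p = V" using klist_quotient[OF fdU V'(4)] by blast
    have lmT: "lmod T" using T by (intro fd_moduleD)
    interpret p: lm_hom A "submod N U" T p by (intro lm_homI lmU lmT T)
    have simple: "simple T" using p.surj_simple_maximal[OF T(3)] T(4) V by simp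
    obtain k where k: "k < r" "isom T (S k)" using simple_iso_S[OF simple] by blast
    let ?R = "\<lambda>f. \<lambda>x\<in>carrier Q. p (f x)"
    have fU: "f \<in> Hom Q (submod N U)" if "f \<in> hom_set A Q N {} U" for f
      using that by (intro mhom_corestrict) (auto simp: hom_set_def hom_space_simps)
    have RH: "?R \<in> module_hom K (submod (hom_space A Q N) (hom_set A Q N {} U)) (hom_space A Q T)"
    proof (rule module_homI)
      fix f g assume f: "f \<in> carrier (submod (hom_space A Q N) (hom_set A Q N {} U))"
      hence f': "f x \<in> U" if "x \<in> carrier Q" for x using that by (simp add: hom_set_def)
      show "?R f \<in> carrier (hom_space A Q T)"
        using restrict_hom_space[OF lmQ mhom_comp[OF fU T(2)]] f by simp
      show "?R (a \<odot>\<^bsub>submod (hom_space A Q N) (hom_set A Q N {} U)\<^esub> f) = a \<odot>\<^bsub>hom_space A Q T\<^esub> ?R f"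
        if "a \<in> carrier K" for a
        using p.smult[OF unit_scalar_closed[OF that]] f' by (auto simp: hom_space_simps(4))
      assume g: "g \<in> carrier (submod (hom_space A Q N) (hom_set A Q N {} U))"
      hence g': "g x \<in> U" if "x \<in> carrier Q" for x using that by (simp add: hom_set_def)
      show "?R (f \<oplus>\<^bsub>submod (hom_space A Q N) (hom_set A Q N {} U)\<^esub> g) = ?R f \<oplus>\<^bsub>hom_space A Q T\<^esub> ?R g"
        using p.add f' g' by (auto simp: hom_space_simps(3))
    qed
    have im: "?R ` hom_set A Q N {} U = carrier (hom_space A Q T)"
    proof
      show "?R ` hom_set A Q N {} U \<subseteq> carrier (hom_space A Q T)"
        using restrict_hom_space[OF lmQ mhom_comp[OF fU T(2)]] by blast
      show "carrier (hom_space A Q T) \<subseteq> ?R ` hom_set A Q N {} U"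
      proof
        fix g assume g: "g \<in> carrier (hom_space A Q T)"
        hence gh: "g \<in> Hom Q T" by (simp add: hom_space_simps)
        obtain f where f: "f \<in> Hom Q (submod N U)" "\<forall>x\<in>carrier Q. p (f x) = g x"
          using projective_lift[OF Q fdU T(1-3) gh] by blast
        let ?f = "\<lambda>x\<in>carrier Q. f x"
        have fN: "f \<in> Hom Q N" by (rule mhom_extend_codomain[OF f(1) UN])
        have fm: "?f \<in> hom_set A Q N {} U"
          using restrict_hom_space[OF lmQ fN] mhom_closed[OF f(1)] by (auto simp: hom_set_def)
        have Rf: "?R ?f = g"
        proof (rule hom_space_ext[OF _ g])
          show "?R ?f \<in> carrier (hom_space A Q T)"
            by (rule restrict_hom_space[OF lmQ mhom_comp[OF fU[OF fm] T(2)]])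
        qed (use f(2) in simp)
        show "g \<in> ?R ` hom_set A Q N {} U"
          by (rule image_eqI[where f = "?R" and x = "?f", OF Rf[symmetric] fm])
      qed
    qed
    have ker: "?R f = \<zero>\<^bsub>hom_space A Q T\<^esub> \<longleftrightarrow> f \<in> hom_set A Q N {} V" if f: "f \<in> hom_set A Q N {} U" for f
      using T(4) f by (auto simp: hom_set_def hom_space_simps(2) fun_eq_iff)
    have "hdim Q N {} U = hdim Q N {} V + vdim (submod (hom_space A Q T) (carrier (hom_space A Q T)))"
      by (rule hdim_rank_nullity[OF fdQ N _ U hom_space_vs[OF lmQ lmT] RH ker _ im]) (use V'(2) in
        \<open>auto simp: hom_set_def\<close>)
    also have "vdim (submod (hom_space A Q T) (carrier (hom_space A Q T))) = t k Q"
      using hom_top_dim[OF k(1) fdQ simple k(2)] by simp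
    also have "hdim Q N {} V = (\<Sum>i<r. t i Q * c i (submod N V))"
      using less.hyps[OF _ V'(1)] mdim_mono(2)[OF N V'(1) U V'(2,3)] by blast
    also have "(\<Sum>i<r. t i Q * c i (submod N V)) + t k Q = (\<Sum>i<r. t i Q * c i (submod N V) + t i Q * c i T)"
    proof -
      have "(\<Sum>i<r. t i Q * c i T) = (\<Sum>i<r. if i = k then t i Q else 0)"
        by (rule sum.cong) (use c_simple[OF _ k(1) simple k(2)] in auto)
      thus ?thesis using k(1) by (simp add: sum.distrib)
    qed
    also have "\<dots> = (\<Sum>i<r. t i Q * c i (submod N U))"
      by (rule sum.cong) (use c_surj[OF _ fdU lmT T(2,3)] T(4) in \<open>auto simp:
        algebra_simps\<close>)
    finally show ?thesis .
  qed
qed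

lemma P_injective: "i < r \<Longrightarrow> injective_module K A (P i)"
  using lideal_injective[OF si e_props(1)] .

lemma P_projective: "i < r \<Longrightarrow> projective (P i)"
  using lideal_projective[OF e_props(1)] .

text \<open>Hom(Q, P_j) is counted twice. As P_j is injective with socle S_j, its dimension is
  \<open>c j Q\<close>; as Q is projective, it is the sum on the right. Weak symmetry enters through
  the socle of P_j.\<close>

lemma c_projective:
  fixes Q (structure)
  assumes Q: "projective Q" and j: "j < r"
  shows "c j Q = (\<Sum>i<r. t i Q * c i (P j))"
proof -
  interpret Qm: left_module A Q by (rule fd_lm[OF projectiveD[OF Q]])
  interpret Pm: left_module A "P j" by (rule P_lm[OF j])
  have fd0: "fd (submod Q {\<zero>})" by (rule fd_submod[OF projectiveD[OF Q] Qm.lsub_0])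
  have "hdim Q (P j) {\<zero>} (carrier (P j)) = c j Q"
    using injective_hom_count[OF j projectiveD[OF Q] P_injective[OF j] P_soc[OF j] Qm.lsub_0]
      cdim_zero_module[OF e_carrier(1)[OF j] fd0]
    by simp
  moreover have "hom_set A Q (P j) {\<zero>} (carrier (P j)) = hom_set A Q (P j) {} (carrier (P j))"
  proof -
    have "f \<zero> = \<zero>\<^bsub>P j\<^esub>" if "f \<in> Hom Q (P j)" for f
      using lm_hom.zero[OF lm_homI[OF Qm.left_module_axioms Pm.left_module_axioms that]] .
    thus ?thesis by (auto simp: hom_set_def hom_space_simps)
  qed
  moreover
  ultimately show ?thesis
    using projective_hom_count[OF Q P_fd[OF j] Pm.lsub_carrier] by (simp del: lideal_simps)
qed

lemma cartan_symmetric: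
  assumes "i < r" "j < r" shows "c j (P i) = c i (P j)"
proof -
  have "c j (P i) = (\<Sum>k<r. (if k = i then c k (P j) else 0))"
    unfolding c_projective[OF P_projective[OF assms(1)] assms(2)]
    by (rule sum.cong) (use t_P[OF assms(1)] in auto)
  thus ?thesis using assms by simp
qed

end

section \<open>Blocks and Loewy length\<close>

context fd_algebra begin

text \<open>Products of elements of B and C lie in B \<inter> C = 0. The components of 1 are
  therefore identities of B and of C, and a \<mapsto> (a x, a y) is an isomorphism onto the
  product.\<close>

lemma not_indecomposable_algebra:
  assumes B: "lsub B (regular_module A)" "\<And>b a. b \<in> B \<Longrightarrow> a \<in> carrier A \<Longrightarrow> b \<otimes>\<^bsub>A\<^esub> a \<in> B"
    and C: "lsub C (regular_module A)" "\<And>b a. b \<in> C \<Longrightarrow> a \<in> carrier A \<Longrightarrow> b \<otimes>\<^bsub>A\<^esub> a \<in> C"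
    and BC: "B \<inter> C = {\<zero>\<^bsub>A\<^esub>}" and eB: "x \<in> B" and eC: "y \<in> C" and one: "\<one>\<^bsub>A\<^esub> = x \<oplus>\<^bsub>A\<^esub> y"
    and ne: "B \<noteq> {\<zero>\<^bsub>A\<^esub>}" "C \<noteq> {\<zero>\<^bsub>A\<^esub>}"
  shows "\<not> indecomposable_algebra K A"
proof -
  \<comment> \<open>Stated for arbitrary ideals so that it yields both factors, the second with the
    roles exchanged.\<close>
  have part: "fd_algebra K (A\<lparr>carrier := B, one := x\<rparr>) \<and> (\<forall>a\<in>B. a \<otimes>\<^bsub>A\<^esub> x = a \<and> x \<otimes>\<^bsub>A\<^esub> a = a) \<and> (\<forall>a\<in>C. a \<otimes>\<^bsub>A\<^esub> x = \<zero>\<^bsub>A\<^esub>)"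
    if B: "lsub B (regular_module A)" "\<And>b a. b \<in> B \<Longrightarrow> a \<in> carrier A \<Longrightarrow> b \<otimes>\<^bsub>A\<^esub> a \<in> B"
      and C: "lsub C (regular_module A)" "\<And>b a. b \<in> C \<Longrightarrow> a \<in> carrier A \<Longrightarrow> b \<otimes>\<^bsub>A\<^esub> a \<in> C"
      and BC: "B \<inter> C = {\<zero>\<^bsub>A\<^esub>}" and eB: "x \<in> B" and eC: "y \<in> C" and one: "\<one>\<^bsub>A\<^esub> = x \<oplus>\<^bsub>A\<^esub> y" for B C x y
  proof -
    have BA: "B \<subseteq> carrier A" "C \<subseteq> carrier A"
      using B C by (auto simp: left_submodule_def)
    have xy: "x \<in> carrier A" "y \<in> carrier A" using BA eB eC by auto
    have mB: "a \<otimes>\<^bsub>A\<^esub> b \<in> B" if "a \<in> carrier A" "b \<in> B" for a b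
      using lsub_smult[OF B(1)] that by simp
    have mC: "a \<otimes>\<^bsub>A\<^esub> b \<in> C" if "a \<in> carrier A" "b \<in> C" for a b
      using lsub_smult[OF C(1)] that by simp
    have z: "a \<otimes>\<^bsub>A\<^esub> y = \<zero>\<^bsub>A\<^esub>" "y \<otimes>\<^bsub>A\<^esub> a = \<zero>\<^bsub>A\<^esub>" if "a \<in> B" for a
    proof -
      have "a \<otimes>\<^bsub>A\<^esub> y \<in> B \<inter> C" "y \<otimes>\<^bsub>A\<^esub> a \<in> B \<inter> C"
        using mC[OF _ eC] mB[OF xy(2)] B(2)[OF that xy(2)] C(2)[OF eC] that BA by auto
      thus "a \<otimes>\<^bsub>A\<^esub> y = \<zero>\<^bsub>A\<^esub>" "y \<otimes>\<^bsub>A\<^esub> a = \<zero>\<^bsub>A\<^esub>"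
        using BC by auto
    qed
    have id: "a \<otimes>\<^bsub>A\<^esub> x = a \<and> x \<otimes>\<^bsub>A\<^esub> a = a" if "a \<in> B" for a
    proof -
      have aA: "a \<in> carrier A" using that BA by auto
      have "a = a \<otimes>\<^bsub>A\<^esub> x \<oplus>\<^bsub>A\<^esub> a \<otimes>\<^bsub>A\<^esub> y"
        using aA xy one by (metis A.r_distr A.r_one)
      moreover have "a = x \<otimes>\<^bsub>A\<^esub> a \<oplus>\<^bsub>A\<^esub> y \<otimes>\<^bsub>A\<^esub> a"
        using aA xy one by (metis A.l_distr A.l_one)
      ultimately show ?thesis using z[OF that] aA xy by simp
    qed
    have cz: "a \<otimes>\<^bsub>A\<^esub> x = \<zero>\<^bsub>A\<^esub>" if "a \<in> C" for a
      using mB[OF _ eB] C(2)[OF that xy(1)] that BA BC by auto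
    let ?B = "A\<lparr>carrier := B, one := x\<rparr>"
    have sub: "left_submodule K B A" unfolding left_submodule_def
    proof (intro conjI ballI BA)
      show "\<zero>\<^bsub>A\<^esub> \<in> B" using lsub_zero[OF B(1)] by simp
      fix a assume a: "a \<in> B"
      show "a \<oplus>\<^bsub>A\<^esub> b \<in> B" if "b \<in> B" for b
        using lsub_add[OF B(1) a that] by simp
      fix s assume s: "s \<in> carrier K"
      show "s \<odot>\<^bsub>A\<^esub> a \<in> B"
        using s a BA mB[OF unit_scalar_closed a] by (auto simp: smult_mult_left)
    qed
    have VA: "vectorspace K A" by (rule V.vectorspace_axioms)
    have lmB: "left_module K (submod A B)" by (rule left_module.submod_lm[OF vs_lm[OF VA] sub])
    have 1: "left_module K ?B" "(\<lambda>a. a) \<in> module_hom K (submod A B) ?B"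
      by (rule left_module_surj_image[OF lmB, of "\<lambda>a. a"]; simp)+
    have vsB: "vectorspace K ?B" by (rule lm_vs[OF field_K 1(1)])
    interpret Bm: left_module K ?B by (rule 1)
    have "ring ?B"
    proof (rule ringI)
      show "abelian_group ?B" by (rule Bm.M.abelian_group_axioms)
      show "monoid ?B" using eB id BA B(2) by (intro monoidI) (auto simp: subset_iff A.m_assoc)
    qed (use BA in \<open>auto simp: subset_iff A.l_distr A.r_distr\<close>)
    moreover have "fdim ?B"
      using surj_fin_dim_mhom[OF vectorspace_submod[OF VA sub] vsB 1(2) submod_fin_dim[OF VA
        fin_dim_carrier sub]]
      by simp
    ultimately show ?thesis
      using vsB BA id cz
      by (auto simp: fd_algebra_def fd_algebra_axioms_def smult_mult_left smult_mult_right
        subset_iff)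
  qed
  have BA: "B \<subseteq> carrier A" "C \<subseteq> carrier A"
    using B C by (auto simp: left_submodule_def)
  have xy: "x \<in> carrier A" "y \<in> carrier A" using BA eB eC by auto
  let ?B = "A\<lparr>carrier := B, one := x\<rparr>" and ?C = "A\<lparr>carrier := C, one := y\<rparr>"
  have pB: "fd_algebra K ?B" "\<And>a. a \<in> B \<Longrightarrow> a \<otimes>\<^bsub>A\<^esub> x = a" "\<And>a. a \<in> B \<Longrightarrow> x \<otimes>\<^bsub>A\<^esub> a = a" "\<And>a. a \<in> C \<Longrightarrow> a \<otimes>\<^bsub>A\<^esub> x = \<zero>\<^bsub>A\<^esub>"
    using part[OF B C BC eB eC one] by blast+
  have one': "\<one>\<^bsub>A\<^esub> = y \<oplus>\<^bsub>A\<^esub> x"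
    using one xy by (simp add: A.a_comm)
  have pC: "fd_algebra K ?C" "\<And>a. a \<in> C \<Longrightarrow> a \<otimes>\<^bsub>A\<^esub> y = a" "\<And>a. a \<in> C \<Longrightarrow> y \<otimes>\<^bsub>A\<^esub> a = a" "\<And>a. a \<in> B \<Longrightarrow> a \<otimes>\<^bsub>A\<^esub> y = \<zero>\<^bsub>A\<^esub>"
    using part[OF C B _ eC eB one'] BC by (simp_all add: Int_commute)
  let ?f = "\<lambda>a. (a \<otimes>\<^bsub>A\<^esub> x, a \<otimes>\<^bsub>A\<^esub> y)"
  have mem: "a \<otimes>\<^bsub>A\<^esub> x \<in> B" "a \<otimes>\<^bsub>A\<^esub> y \<in> C" if "a \<in> carrier A" for a
    using lsub_smult[OF B(1) that eB] lsub_smult[OF C(1) that eC] by simp_all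
  have "algebra_iso K A (algebra_prod ?B ?C)" unfolding algebra_iso_def
  proof (intro exI[of _ ?f] conjI)
    have "(a \<otimes>\<^bsub>A\<^esub> b) \<otimes>\<^bsub>A\<^esub> x = (a \<otimes>\<^bsub>A\<^esub> x) \<otimes>\<^bsub>A\<^esub> (b \<otimes>\<^bsub>A\<^esub> x)" if "a \<in> carrier A" "b \<in> carrier A" for a b
      using that xy pB(3)[OF mem(1)] by (simp add: A.m_assoc)
    moreover have "(a \<otimes>\<^bsub>A\<^esub> b) \<otimes>\<^bsub>A\<^esub> y = (a \<otimes>\<^bsub>A\<^esub> y) \<otimes>\<^bsub>A\<^esub> (b \<otimes>\<^bsub>A\<^esub> y)" if "a \<in> carrier A" "b \<in> carrier A" for a b
      using that xy pC(3)[OF mem(2)] by (simp add: A.m_assoc)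
    ultimately show "?f \<in> Ring.ring_hom A (algebra_prod ?B ?C)"
      using xy mem by (intro ring_hom_memI) (auto simp: algebra_prod_def A.l_distr)
    show "?f \<in> module_hom K A (algebra_prod ?B ?C)"
      using xy mem by (intro module_homI) (auto simp: algebra_prod_def A.l_distr smult_mult_left)
    show "bij_betw ?f (carrier A) (carrier (algebra_prod ?B ?C))"
    proof (rule bij_betw_byWitness[where f' = "\<lambda>(b, c). b \<oplus>\<^bsub>A\<^esub> c"])
      show "\<forall>a\<in>carrier A. (case ?f a of (b, c) \<Rightarrow> b \<oplus>\<^bsub>A\<^esub> c) = a"
        using xy by (auto simp: A.r_distr[symmetric] simp flip: one)
      show "\<forall>z\<in>carrier (algebra_prod ?B ?C). ?f (case z of (b, c) \<Rightarrow> b \<oplus>\<^bsub>A\<^esub> c) = z"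
        using BA xy pB(2,4) pC(2,4) by (auto simp: algebra_prod_def A.l_distr subset_iff)
      show "?f ` carrier A \<subseteq> carrier (algebra_prod ?B ?C)"
        using mem by (auto simp: algebra_prod_def)
      show "(\<lambda>(b, c). b \<oplus>\<^bsub>A\<^esub> c) ` carrier (algebra_prod ?B ?C) \<subseteq> carrier A"
        using BA by (auto simp: algebra_prod_def)
    qed
  qed
  moreover have "carrier ?B \<noteq> {\<zero>\<^bsub>?B\<^esub>}" "carrier ?C \<noteq> {\<zero>\<^bsub>?C\<^esub>}"
    using ne by auto
  ultimately show ?thesis using pB(1) pC(1) unfolding indecomposable_algebra_def by blast
qed

definition rad2 :: "('a, 'm) module \<Rightarrow> 'm set" where "rad2 M = Jmul M (rad A M)"

lemma rad2_submodule:
  assumes "lmod M" shows "lsub (rad2 M) M"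
  unfolding rad2_def
  by (rule Jmul_submodule[OF assms lsub_subset[OF left_module.rad_submodule[OF assms]]])

lemma rad2_subset_rad:
  assumes "lmod M" shows "rad2 M \<subseteq> rad A M"
  unfolding rad2_def by (rule Jmul_subset[OF left_module.rad_submodule[OF assms]])

lemma rad_hom_image:
  assumes f: "lm_hom A M N f" and M: "fd M" and N: "fd N"
  shows "f ` rad A M \<subseteq> rad A N" "f ` rad2 M \<subseteq> rad2 N"
    "f ` carrier M = carrier N \<Longrightarrow> f ` rad A M = rad A N" "f ` carrier M = carrier N \<Longrightarrow> f ` rad2 M = rad2 N"
proof -
  interpret f: lm_hom A M N f by fact
  have 1: "f ` rad A M = Jmul N (f ` carrier M)"
    using rad_eq_Jmul[OF M] Jmul_image[OF f, of "carrier M"] by simp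
  thus R: "f ` rad A M \<subseteq> rad A N"
    using rad_eq_Jmul[OF N] Jmul_mono[OF f.cod.left_module_axioms, of "f ` carrier M" "carrier N"]
    by auto
  have 2: "f ` rad2 M = Jmul N (f ` rad A M)"
    unfolding rad2_def by (rule Jmul_image[OF f lsub_subset[OF f.dom.rad_submodule]])
  show "f ` rad2 M \<subseteq> rad2 N"
    using 2 Jmul_mono[OF f.cod.left_module_axioms R lsub_subset[OF f.cod.rad_submodule]]
    by (simp add: rad2_def)
  assume s: "f ` carrier M = carrier N"
  thus R': "f ` rad A M = rad A N" using 1 rad_eq_Jmul[OF N] by simp
  thus "f ` rad2 M = rad2 N" using 2 by (simp add: rad2_def)
qed

text \<open>The adjunction of \<open>Jmul_subset_iff\<close> applied twice; the condition becomes b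
  (a x) \<in> W for all a, b in J.\<close>

lemma rad2_subset_iff:
  assumes M: "fd M" and W: "lsub W M"
  shows "rad2 M \<subseteq> W \<longleftrightarrow> carrier M \<subseteq> ann M (ann M W)"
proof -
  have lm: "lmod M" using M by (rule fd_moduleD)
  interpret Mm: left_module A M by fact
  have "rad2 M \<subseteq> W \<longleftrightarrow> rad A M \<subseteq> ann M W"
    unfolding rad2_def by (rule Jmul_subset_iff[OF W lsub_subset[OF Mm.rad_submodule]])
  also have "\<dots> \<longleftrightarrow> carrier M \<subseteq> ann M (ann M W)"
    unfolding rad_eq_Jmul[OF M] by (rule Jmul_subset_iff[OF ann_submodule[OF lm W]]) simp
  finally show ?thesis .
qed

lemma rad_subset_soc_iff:
  fixes M (structure)
  assumes M: "fd M" shows "rad A M \<subseteq> soc A M \<longleftrightarrow> rad2 M = {\<zero>}"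
proof -
  have lm: "lmod M" using M by (rule fd_moduleD)
  interpret Mm: left_module A M by fact
  have "rad2 M \<subseteq> {\<zero>} \<longleftrightarrow> rad A M \<subseteq> soc A M"
    unfolding rad2_def soc_eq_ann[OF lm]
    by (rule Jmul_subset_iff[OF Mm.lsub_0 lsub_subset[OF Mm.rad_submodule]])
  thus ?thesis using lsub_zero[OF rad2_submodule[OF lm]] by blast
qed

end

section \<open>Radical layers of the P_i and the matrix E\<close>

context rad_cube_zero begin

lemma rad2_subset_soc:
  fixes M (structure)
  assumes M: "fd M" shows "rad2 M \<subseteq> soc A M"
proof -
  have lm: "lmod M" using M by (rule fd_moduleD)
  interpret Mm: left_module A M by fact
  have "carrier M \<subseteq> ann M (ann M (ann M {\<zero>}))"
  proof
    fix x assume x: "x \<in> carrier M"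
    have "j1 \<odot> (j2 \<odot> (j3 \<odot> x)) = \<zero>" if j: "j1 \<in> J" "j2 \<in> J" "j3 \<in> J" for j1 j2 j3
    proof -
      have c: "j1 \<in> carrier A" "j2 \<in> carrier A" "j3 \<in> carrier A"
        using j J_carrier by auto
      hence "j1 \<odot> (j2 \<odot> (j3 \<odot> x)) = (j1 \<otimes>\<^bsub>A\<^esub> j2 \<otimes>\<^bsub>A\<^esub> j3) \<odot> x"
        using x by (simp add: Mm.lsmult_assoc)
      thus ?thesis using J3[OF j] x by simp
    qed
    thus "x \<in> ann M (ann M (ann M {\<zero>}))" using x J_carrier by (auto simp: ann_def)
  qed
  thus ?thesis unfolding soc_eq_ann[OF lm] rad2_subset_iff[OF M ann_submodule[OF lm Mm.lsub_0]] .
qed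

text \<open>The multiplicity of S_j in the middle layer rad P_i / rad^2 P_i. That it equals dim
  Ext^1(S_i, S_j) is proved in \<open>ext_dim\<close>; the subtraction never truncates, as rad^2
  lies in rad.\<close>

definition E :: "nat \<Rightarrow> nat \<Rightarrow> nat" where
  "E i j = c j (submod (P i) (rad A (P i))) - c j (submod (P i) (rad2 (P i)))"

lemma c_E:
  assumes i: "i < r" and j: "j < r"
  shows "c j (submod (P i) (rad A (P i))) = E i j + c j (submod (P i) (rad2 (P i)))"
  using c_mono[OF j P_fd[OF i] rad2_submodule[OF P_lm[OF i]] left_module.rad_submodule[OF P_lm[OF
    i]] rad2_subset_rad[OF P_lm[OF i]]]
  by (simp add: E_def)

lemma c_P_soc:
  assumes i: "i < r" and j: "j < r"
  shows "c j (submod (P i) (soc A (P i))) = (if i = j then 1 else 0)"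
  using c_simple[OF j i P_soc[OF i]] .

lemma P_rad2_cases:
  assumes i: "i < r" shows "rad2 (P i) = {\<zero>\<^bsub>P i\<^esub>} \<or> rad2 (P i) = soc A (P i)"
proof -
  interpret Pm: left_module A "P i" by (rule P_lm[OF i])
  have "lsub (rad2 (P i)) (submod (P i) (soc A (P i)))"
    unfolding lsub_submod_iff[OF Pm.soc_submodule] using rad2_submodule[OF P_lm[OF i]]
      rad2_subset_soc[OF P_fd[OF i]]
    by blast
  thus ?thesis using simple_moduleD(3)[OF P_soc(1)[OF i]] by fastforce
qed

lemma c_P_rad2_off_diagonal:
  assumes i: "i < r" and j: "j < r" and ne: "i \<noteq> j" shows "c j (submod (P i) (rad2 (P i))) = 0"
proof -
  have "c j (submod (P i) (rad2 (P i))) \<le> c j (submod (P i) (soc A (P i)))"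
    by (rule c_mono[OF j P_fd[OF i] rad2_submodule[OF P_lm[OF i]] left_module.soc_submodule[OF
      P_lm[OF i]] rad2_subset_soc[OF P_fd[OF i]]])
  thus ?thesis using c_P_soc[OF i j] ne by simp
qed

text \<open>The top of P_i is S_i, and rad^2 lies in the socle S_i. For i different from j only the
  middle layer contributes to \<open>c j (P i)\<close>, so symmetry is that of the Cartan
  numbers.\<close>

lemma E_symmetric:
  assumes i: "i < r" and j: "j < r" shows "E i j = E j i"
proof (cases "i = j")
  case False
  show ?thesis
    using c_eq_t[OF j P_fd] c_eq_t[OF i P_fd] t_P i j False c_E c_P_rad2_off_diagonal
      cartan_symmetric[OF i j]
    by simp
qed simp

lemma lideal_mult_zero:
  assumes i: "i < r" and j: "j < r" and 0: "c j (P i) = 0" and x: "x \<in> carrier (P i)"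
  shows "e j \<otimes>\<^bsub>A\<^esub> x = \<zero>\<^bsub>A\<^esub>"
proof -
  have "efix (e j) (P i) = {\<zero>\<^bsub>P i\<^esub>}"
    using 0 cdim_zero_iff[OF e_carrier(1)[OF j] P_fd[OF i]] by simp
  moreover have "e j \<odot>\<^bsub>P i\<^esub> x \<in> efix (e j) (P i)"
    by (rule efix_smult[OF P_lm[OF i] e_props(1)[OF j] x])
  ultimately show ?thesis by simp
qed

text \<open>The elements a such that Aa has no composition factor S_j with j in Y. For Y the
  complement of a union of blocks this is the corresponding two-sided ideal of A.\<close>

definition block :: "nat set \<Rightarrow> 'a set" where
  "block Y = {a \<in> carrier A. \<forall>j\<in>Y. \<forall>b\<in>carrier A. e j \<otimes>\<^bsub>A\<^esub> (b \<otimes>\<^bsub>A\<^esub> a) = \<zero>\<^bsub>A\<^esub>}"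

lemma block_ideal:
  assumes Y: "Y \<subseteq> {..<r}"
  shows "lsub (block Y) (regular_module A)"
    "\<And>b a. b \<in> block Y \<Longrightarrow> a \<in> carrier A \<Longrightarrow> b \<otimes>\<^bsub>A\<^esub> a \<in> block Y"
proof -
  have eY: "e j \<in> carrier A" if "j \<in> Y" for j using that Y e_carrier by auto
  show "lsub (block Y) (regular_module A)" unfolding left_submodule_def
  proof (intro conjI ballI)
    fix x assume x: "x \<in> block Y"
    show "x \<oplus>\<^bsub>regular_module A\<^esub> y \<in> block Y" if "y \<in> block Y" for y
      using x that eY by (auto simp: block_def A.r_distr)
    show "a \<odot>\<^bsub>regular_module A\<^esub> x \<in> block Y" if "a \<in> carrier A" for a
      using x that by (auto simp: block_def) (metis A.m_assoc A.m_closed)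
  qed (use eY in \<open>auto simp: block_def\<close>)
  fix b a assume "b \<in> block Y" "a \<in> carrier A"
  hence "b \<in> carrier A" "\<And>j d. j \<in> Y \<Longrightarrow> d \<in> carrier A \<Longrightarrow> e j \<otimes>\<^bsub>A\<^esub> (d \<otimes>\<^bsub>A\<^esub> b) = \<zero>\<^bsub>A\<^esub>"
    by (auto simp: block_def)
  moreover have "e j \<otimes>\<^bsub>A\<^esub> (d \<otimes>\<^bsub>A\<^esub> (b \<otimes>\<^bsub>A\<^esub> a)) = (e j \<otimes>\<^bsub>A\<^esub> (d \<otimes>\<^bsub>A\<^esub> b)) \<otimes>\<^bsub>A\<^esub> a"
    if "j \<in> Y" "d \<in> carrier A" for j d
    using that eY \<open>a \<in> carrier A\<close> \<open>b \<in> carrier A\<close>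
    by (simp add: A.m_assoc)
  ultimately show "b \<otimes>\<^bsub>A\<^esub> a \<in> block Y"
    using \<open>a \<in> carrier A\<close> by (simp add: block_def)
qed

text \<open>If \<open>E\<close> had no entry from I to its complement I', then by symmetry of the
  Cartan numbers no P_i with i in I would share a composition factor with a P_j with j in I'. The
  ideals \<open>block I'\<close> and \<open>block I\<close> then meet in 0, since a nonzero cyclic
  left ideal has some composition factor, and together they contain 1. This splits A.\<close>

lemma E_irreducible:
  assumes I: "I \<subseteq> {..<r}" "I \<noteq> {}" "\<And>i j. i \<in> I \<Longrightarrow> j < r \<Longrightarrow> j \<notin> I \<Longrightarrow> E i j = 0"
  shows "I = {..<r}"
proof (rule ccontr)
  assume "I \<noteq> {..<r}"
  let ?I' = "{..<r} - I"
  have c0: "c j (P i) = 0 \<and> c i (P j) = 0" if ij: "i \<in> I" "j \<in> ?I'" for i j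
  proof -
    have lt: "i < r" "j < r" "i \<noteq> j" using ij I by auto
    show ?thesis
      using c_eq_t[OF lt(2) P_fd] t_P c_E I(3) ij c_P_rad2_off_diagonal lt cartan_symmetric by simp
  qed
  have Pblock: "carrier (P i) \<subseteq> block Y" if i: "i < r" and Y: "Y \<subseteq> {..<r}" "\<And>j. j \<in> Y \<Longrightarrow> c j (P i) = 0" for i Y
  proof
    fix x assume x: "x \<in> carrier (P i)"
    have "e j \<otimes>\<^bsub>A\<^esub> (b \<otimes>\<^bsub>A\<^esub> x) = \<zero>\<^bsub>A\<^esub>" if "j \<in> Y" "b \<in> carrier A" for j b
      by (rule lideal_mult_zero[OF i]) (use that Y x e_carrier[OF i] in \<open>auto simp:
        A.m_assoc\<close>)
    thus "x \<in> block Y" using x by (simp add: block_def)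
  qed
  let ?B = "block ?I'" and ?C = "block I"
  have sI': "?I' \<subseteq> {..<r}" by blast
  note B = block_ideal[OF sI'] and C = block_ideal[OF I(1)]
  have PB: "carrier (P i) \<subseteq> ?B" if "i \<in> I" for i
    using Pblock[of i ?I'] c0 that I by auto
  have PC: "carrier (P j) \<subseteq> ?C" if "j \<in> ?I'" for j using Pblock c0 that I by auto
  have BA: "?B \<subseteq> carrier A" "?C \<subseteq> carrier A" by (auto simp: block_def)
  have zB: "\<zero>\<^bsub>A\<^esub> \<in> ?B" "\<zero>\<^bsub>A\<^esub> \<in> ?C"
    using lsub_zero[OF B(1)] lsub_zero[OF C(1)] by simp_all
  have BC: "?B \<inter> ?C = {\<zero>\<^bsub>A\<^esub>}"
  proof -
    have "a = \<zero>\<^bsub>A\<^esub>" if a: "a \<in> ?B" "a \<in> ?C" for a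
    proof (rule ccontr)
      assume a0: "a \<noteq> \<zero>\<^bsub>A\<^esub>"
      have aA: "a \<in> carrier A" using a BA by auto
      have kill: "e j \<otimes>\<^bsub>A\<^esub> (b \<otimes>\<^bsub>A\<^esub> a) = \<zero>\<^bsub>A\<^esub>" if "j < r" "b \<in> carrier A" for j b
        using a that by (cases "j \<in> I") (auto simp: block_def)
      let ?N = "(\<lambda>b. b \<odot>\<^bsub>regular_module A\<^esub> a) ` carrier (regular_module A)"
      have N: "lsub ?N (regular_module A)"
        by (rule lsub_cyclic[OF regular_lm _ left_module.lsub_carrier[OF regular_lm]]) (use aA in
          simp)
      have "a \<in> ?N" using aA by (intro image_eqI[of _ _ "\<one>\<^bsub>A\<^esub>"]) auto
      then obtain j where j: "j < r" "c j (submod (regular_module A) ?N) > 0"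
        using a0 c_nonzero[OF fd_submod[OF fd_regular N]] by auto
      have "efix (e j) (submod (regular_module A) ?N) \<subseteq> {\<zero>\<^bsub>A\<^esub>}"
        using kill[OF j(1)] by (auto simp: efix_def)
      moreover have "\<zero>\<^bsub>A\<^esub> \<in> efix (e j) (submod (regular_module A) ?N)"
        using lsub_zero[OF N] e_carrier[OF j(1)] by (auto simp: efix_def)
      ultimately show False
        using cdim_zero_iff[OF e_carrier(1)[OF j(1)] fd_submod[OF fd_regular N]] j(2) by auto
    qed
    thus ?thesis using zB by blast
  qed
  \<comment> \<open>Failing to lie in the sum of the two ideals would pass from 1 to some primitive
    idempotent d. But Ad is isomorphic to some P_i, and the condition that defines
    \<open>block\<close>, being expressed by left multiplications, is carried from P_i to d.\<close>
  have "\<exists>x\<in>?B. \<exists>y\<in>?C. \<one>\<^bsub>A\<^esub> = x \<oplus>\<^bsub>A\<^esub> y"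
  proof (rule ccontr)
    let ?Q = "\<lambda>d. \<not> (\<exists>x\<in>?B. \<exists>y\<in>?C. d = x \<oplus>\<^bsub>A\<^esub> y)"
    assume Q1: "?Q \<one>\<^bsub>A\<^esub>"
    have "\<exists>d. idem d \<and> ?Q d \<and> indec (lideal d)"
    proof (rule primitive_idempotent_exists[where Q = ?Q, OF Q1])
      show "\<not> ?Q \<zero>\<^bsub>A\<^esub>" using zB by (metis A.l_zero A.zero_closed)
      fix n l assume "n \<in> carrier A" "l \<in> carrier A" and Q: "?Q (n \<oplus>\<^bsub>A\<^esub> l)"
      show "?Q n \<or> ?Q l"
      proof (rule ccontr)
        assume "\<not> (?Q n \<or> ?Q l)"
        then obtain u v w z where uv: "u \<in> ?B" "v \<in> ?C" "n = u \<oplus>\<^bsub>A\<^esub> v" and wz: "w \<in> ?B" "z \<in> ?C" "l = w \<oplus>\<^bsub>A\<^esub> z"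
          by blast
        have "u \<in> carrier A" "v \<in> carrier A" "w \<in> carrier A" "z \<in> carrier A"
          using uv wz BA by auto
        hence "n \<oplus>\<^bsub>A\<^esub> l = (u \<oplus>\<^bsub>A\<^esub> w) \<oplus>\<^bsub>A\<^esub> (v \<oplus>\<^bsub>A\<^esub> z)"
          unfolding uv wz by (simp add: A.a_ac)
        moreover have "u \<oplus>\<^bsub>A\<^esub> w \<in> ?B" "v \<oplus>\<^bsub>A\<^esub> z \<in> ?C"
          using lsub_add[OF B(1) uv(1) wz(1)] lsub_add[OF C(1) uv(2) wz(2)] by simp_all
        ultimately show False using Q by blast
      qed
    qed
    then obtain d where d: "idem d" "?Q d" "indec (lideal d)" by blast
    then obtain i f where i: "i < r" and f: "f \<in> Hom (P i) (lideal d)" "bij_betw f (carrier (P i)) (carrier (lideal d))"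
      using primitive_iso_P by blast
    have dA: "d \<in> carrier A" "d \<otimes>\<^bsub>A\<^esub> d = d" using idemD[OF d(1)] by auto
    interpret f: lm_hom A "P i" "lideal d" f by (intro lm_homI P_lm[OF i] lideal_lm dA f)
    have "d \<in> f ` carrier (P i)" using f(2) dA by (simp add: bij_betw_def)
    then obtain x where x: "x \<in> carrier (P i)" "d = f x" by blast
    have tr: "d \<in> block Y" if Y: "carrier (P i) \<subseteq> block Y" "Y \<subseteq> {..<r}" for Y
    proof -
      have "e j \<otimes>\<^bsub>A\<^esub> (b \<otimes>\<^bsub>A\<^esub> d) = \<zero>\<^bsub>A\<^esub>" if jb: "j \<in> Y" "b \<in> carrier A" for j b
      proof -
        have ej: "e j \<in> carrier A" using jb Y e_carrier by auto
        have "e j \<otimes>\<^bsub>A\<^esub> (b \<otimes>\<^bsub>A\<^esub> d) = e j \<odot>\<^bsub>lideal d\<^esub> (b \<odot>\<^bsub>lideal d\<^esub> f x)"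
          using x by simp
        also have "\<dots> = f (e j \<odot>\<^bsub>P i\<^esub> (b \<odot>\<^bsub>P i\<^esub> x))"
          using f.smult[OF ej f.dom.lsmult_closed[OF jb(2) x(1)]] f.smult[OF jb(2) x(1)] by simp
        also have "e j \<odot>\<^bsub>P i\<^esub> (b \<odot>\<^bsub>P i\<^esub> x) = \<zero>\<^bsub>P i\<^esub>"
          using Y(1) x(1) jb by (auto simp: block_def)
        finally show ?thesis using f.zero by simp
      qed
      thus ?thesis using dA by (simp add: block_def)
    qed
    show False using tr[OF PB] tr[OF PC I(1)] i zB dA d(2) by force
  qed
  then obtain x y where xy: "x \<in> ?B" "y \<in> ?C" "\<one>\<^bsub>A\<^esub> = x \<oplus>\<^bsub>A\<^esub> y"
    by blast
  have nz: "e i \<noteq> \<zero>\<^bsub>A\<^esub>" "e i \<in> carrier (P i)" if i: "i < r" for i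
  proof -
    show "e i \<in> carrier (P i)" using e_carrier[OF i] by simp
    obtain u where "u \<in> efix (e i) (S i)" "u \<noteq> \<zero>\<^bsub>S i\<^esub>"
      using e_S_nonzero[OF i] .
    thus "e i \<noteq> \<zero>\<^bsub>A\<^esub>"
      using left_module.lsmult_l_null[OF S_lm[OF i]] by (metis efixD)
  qed
  have "?B \<noteq> {\<zero>\<^bsub>A\<^esub>}" using I PB nz by blast
  moreover have "?C \<noteq> {\<zero>\<^bsub>A\<^esub>}"
    using I \<open>I \<noteq> {..<r}\<close> PC nz by fastforce
  ultimately show False using not_indecomposable_algebra[OF B C BC xy] indec_alg by blast
qed

lemma r_pos: "r > 0"
proof -
  obtain a b where ab: "a \<in> J" "b \<in> J" "a \<otimes>\<^bsub>A\<^esub> b \<noteq> \<zero>\<^bsub>A\<^esub>"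
    using J2 by blast
  thus ?thesis using J_carrier c_nonzero[OF fd_regular] by force
qed

text \<open>If rad^2 P_i were 0, then rad P_i would lie in the socle S_i, row i of \<open>E\<close>
  would vanish off the diagonal, and irreducibility would leave i as the only index. Every primitive
  left ideal would then be a copy of P_i and be killed by J^2, against J^2 \<noteq> 0.\<close>

lemma P_rad2:
  assumes i: "i < r" shows "rad2 (P i) = soc A (P i)" "rad2 (P i) \<noteq> {\<zero>\<^bsub>P i\<^esub>}"
proof -
  show ne: "rad2 (P i) \<noteq> {\<zero>\<^bsub>P i\<^esub>}"
  proof
    assume 0: "rad2 (P i) = {\<zero>\<^bsub>P i\<^esub>}"
    have rs: "rad A (P i) \<subseteq> soc A (P i)" using 0 rad_subset_soc_iff[OF P_fd[OF i]] by simp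
    have "E k j = 0" if k: "k \<in> {i}" and j: "j < r" "j \<notin> {i}" for k j
    proof -
      have "c j (submod (P i) (rad A (P i))) \<le> c j (submod (P i) (soc A (P i)))"
        by (rule c_mono[OF j(1) P_fd[OF i] left_module.rad_submodule[OF P_lm[OF i]]
          left_module.soc_submodule[OF P_lm[OF i]] rs])
      thus ?thesis using c_P_soc[OF i] j k by (simp add: E_def)
    qed
    hence r: "{i} = {..<r}" using E_irreducible[of "{i}"] i by auto
    obtain a b where ab: "a \<in> J" "b \<in> J" "a \<otimes>\<^bsub>A\<^esub> b \<noteq> \<zero>\<^bsub>A\<^esub>"
      using J2 by blast
    have abA: "a \<in> carrier A" "b \<in> carrier A" using ab J_carrier by auto
    \<comment> \<open>A nonzero product a b acts as nonzero on some primitive idempotent d, which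
      puts a nonzero element into rad^2 of Ad.\<close>
    let ?Q = "\<lambda>d. (a \<otimes>\<^bsub>A\<^esub> b) \<otimes>\<^bsub>A\<^esub> d \<noteq> \<zero>\<^bsub>A\<^esub>"
    have "\<exists>d. idem d \<and> ?Q d \<and> indec (lideal d)"
      by (rule primitive_idempotent_exists) (use ab abA in \<open>auto simp: A.r_distr\<close>)
    then obtain d where d: "idem d" "?Q d" "indec (lideal d)" by blast
    then obtain k f where k: "k < r" and f: "f \<in> Hom (P k) (lideal d)" "bij_betw f (carrier (P k)) (carrier (lideal d))"
      using primitive_iso_P by blast
    have ki: "k = i" using k r by auto
    have dA: "d \<in> carrier A" "d \<otimes>\<^bsub>A\<^esub> d = d" using idemD[OF d(1)] by auto
    interpret f: lm_hom A "P k" "lideal d" f by (intro lm_homI P_lm[OF k] lideal_lm dA f)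
    have "rad2 (lideal d) = f ` rad2 (P k)"
      using rad_hom_image(4)[OF f.lm_hom_axioms P_fd[OF k] lideal_fd[OF dA(1)]] f(2)
      by (simp add: bij_betw_def)
    also have "\<dots> = {\<zero>\<^bsub>A\<^esub>}" unfolding ki 0 using f.zero by simp
    finally have z: "rad2 (lideal d) = {\<zero>\<^bsub>A\<^esub>}" .
    have "d \<in> carrier (lideal d)" using dA by simp
    hence "b \<odot>\<^bsub>lideal d\<^esub> d \<in> rad A (lideal d)"
      unfolding rad_eq_Jmul[OF lideal_fd[OF dA(1)]] by (rule Jmul_mem[OF ab(2)])
    hence "a \<odot>\<^bsub>lideal d\<^esub> (b \<odot>\<^bsub>lideal d\<^esub> d) \<in> rad2 (lideal d)"
      unfolding rad2_def by (rule Jmul_mem[OF ab(1)])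
    thus False using z abA dA d(2) by (simp add: A.m_assoc)
  qed
  thus "rad2 (P i) = soc A (P i)" using P_rad2_cases[OF i] by blast
qed

lemma c_P:
  assumes i: "i < r" and j: "j < r" shows "c j (P i) = (if i = j then 2 else 0) + E i j"
  using c_eq_t[OF j P_fd[OF i]] t_P[OF i j] c_E[OF i j] P_rad2(1)[OF i] c_P_soc[OF i j] by auto

lemma c_P_rad:
  assumes i: "i < r" and j: "j < r"
  shows "c j (submod (P i) (rad A (P i))) = (if i = j then 1 else 0) + E i j"
  using c_E[OF i j] P_rad2(1)[OF i] c_P_soc[OF i j] by auto

text \<open>The second socle contains the radical, which is a maximal submodule. It is not all of
  P_i, since otherwise the radical would lie in the socle and rad^2 P_i would vanish.\<close>

lemma P_ann:
  assumes i: "i < r" shows "ann (P i) (soc A (P i)) = rad A (P i)"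
proof -
  interpret Pm: left_module A "P i" by (rule P_lm[OF i])
  have s: "lsub (ann (P i) (soc A (P i))) (P i)"
    by (rule ann_submodule[OF P_lm[OF i] Pm.soc_submodule])
  have "rad A (P i) \<subseteq> ann (P i) (soc A (P i))"
    using rad2_subset_soc[OF P_fd[OF i]] unfolding rad2_def
    by (subst (asm) Jmul_subset_iff[OF Pm.soc_submodule lsub_subset[OF Pm.rad_submodule]])
  hence "ann (P i) (soc A (P i)) = rad A (P i) \<or> ann (P i) (soc A (P i)) = carrier (P i)"
    using P_rad_maximal[OF i] s unfolding maximal_submodule_def by blast
  moreover have "ann (P i) (soc A (P i)) \<noteq> carrier (P i)"
  proof
    assume "ann (P i) (soc A (P i)) = carrier (P i)"
    hence "rad A (P i) \<subseteq> soc A (P i)"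
      unfolding rad_eq_Jmul[OF P_fd[OF i]] using Jmul_subset_iff[OF Pm.soc_submodule, of
        "carrier (P i)"]
      by blast
    thus False using rad_subset_soc_iff[OF P_fd[OF i]] P_rad2(2)[OF i] by blast
  qed
  ultimately show ?thesis by blast
qed

lemma c_projective_E:
  assumes Q: "projective Q" and j: "j < r"
  shows "c j Q = 2 * t j Q + (\<Sum>i<r. t i Q * E i j)"
proof -
  have "c j Q = (\<Sum>i<r. (if i = j then 2 * t i Q else 0) + t i Q * E i j)"
    unfolding c_projective[OF Q j]
    by (rule sum.cong) (use c_P[OF j] E_symmetric[OF j] in \<open>auto simp: algebra_simps\<close>)
  thus ?thesis using j by (simp add: sum.distrib)
qed

text \<open>A map Q \<rightarrow> P_j kills rad^2 Q exactly when J^2 kills its values, that is when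
  the values lie in the second socle of P_j, which is its radical. Counting these maps by
  projectivity of Q and by injectivity of P_j gives two formulas, and their comparison leaves
  \<open>t j Q\<close>.\<close>

lemma projective_rad2:
  assumes Q: "projective Q" and j: "j < r"
  shows "c j (submod Q (rad2 Q)) = t j Q"
proof -
  have fdQ: "fd Q" using Q by (rule projectiveD)
  have lmQ: "lmod Q" using fdQ by (rule fd_moduleD)
  interpret Pm: left_module A "P j" by (rule P_lm[OF j])
  have "hom_set A Q (P j) (rad2 Q) (carrier (P j)) = hom_set A Q (P j) {} (rad A (P j))"
  proof -
    have "(\<forall>x\<in>rad2 Q. f x = \<zero>\<^bsub>P j\<^esub>) \<longleftrightarrow> (\<forall>x\<in>carrier Q. f x \<in> rad A (P j))"
      if fh: "f \<in> Hom Q (P j)" for f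
    proof -
      interpret f: lm_hom A Q "P j" f by (intro lm_homI lmQ P_lm[OF j] fh)
      have "(\<forall>x\<in>rad2 Q. f x = \<zero>\<^bsub>P j\<^esub>) \<longleftrightarrow> rad2 Q \<subseteq> a_kernel Q (P j) f"
        using lsub_subset[OF rad2_submodule[OF lmQ]] by auto
      also have "\<dots> \<longleftrightarrow> carrier Q \<subseteq> ann Q (ann Q (a_kernel Q (P j) f))"
        by (rule rad2_subset_iff[OF fdQ f.ker_submodule])
      also have "\<dots> \<longleftrightarrow> (\<forall>x\<in>carrier Q. \<forall>a\<in>J. \<forall>b\<in>J. b \<odot>\<^bsub>P j\<^esub> (a \<odot>\<^bsub>P j\<^esub> f x) = \<zero>\<^bsub>P j\<^esub>)"
        unfolding ann_def subset_iff using J_carrier by (simp del: cong:) blast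
      also have "\<dots> \<longleftrightarrow> (\<forall>x\<in>carrier Q. f x \<in> ann (P j) (ann (P j) {\<zero>\<^bsub>P j\<^esub>}))"
        unfolding ann_def using J_carrier by (simp del: lideal_simps cong:)
      finally show ?thesis using P_ann[OF j] soc_eq_ann[OF P_lm[OF j]] by simp
    qed
    thus ?thesis by (auto simp: hom_set_def hom_space_simps simp del: dest: mhom_closed)
  qed
  hence "hdim Q (P j) (rad2 Q) (carrier (P j)) = (\<Sum>i<r. t i Q * c i (submod (P j) (rad A (P j))))"
    using projective_hom_count[OF Q P_fd[OF j] Pm.rad_submodule] by simp
  also have "\<dots> = (\<Sum>i<r. (if i = j then t i Q else 0) + t i Q * E i j)"
    by (rule sum.cong) (use c_P_rad[OF j] E_symmetric[OF j] in \<open>auto simp: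
      algebra_simps\<close>)
  also have "\<dots> = t j Q + (\<Sum>i<r. t i Q * E i j)" using j by (simp add: sum.distrib)
  finally show ?thesis
    using injective_hom_count[OF j fdQ P_injective[OF j] P_soc[OF j] rad2_submodule[OF lmQ]]
      c_projective_E[OF Q j]
    by simp
qed

lemma simple_embeds_P:
  assumes T: "simple T"
  shows "\<exists>i<r. \<exists>f\<in>Hom T (P i). inj_on f (carrier T)"
proof -
  obtain i where i: "i < r" "isom T (S i)" using simple_iso_S[OF T] by blast
  have "isom (S i) (submod (P i) (soc A (P i)))"
    using module_iso_sym[OF simple_moduleD(1)[OF P_soc(1)[OF i(1)]] S_lm[OF i(1)] P_soc(2)[OF
      i(1)]] .
  hence "isom T (submod (P i) (soc A (P i)))" using module_iso_trans i(2) by blast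
  then obtain f where f: "f \<in> Hom T (submod (P i) (soc A (P i)))" "inj_on f (carrier T)"
    by (auto simp: module_iso_def bij_betw_def)
  thus ?thesis
    using mhom_extend_codomain[OF f(1) lsub_subset[OF left_module.soc_submodule[OF P_lm]]] i(1)
    by blast
qed

lemma P_essential:
  assumes i: "i < r" and U: "lsub U (P i)" "U \<noteq> {\<zero>\<^bsub>P i\<^esub>}"
  shows "soc A (P i) \<subseteq> U"
proof -
  interpret Pm: left_module A "P i" by (rule P_lm[OF i])
  obtain T where T: "lsub T (P i)" "simple (submod (P i) T)" "T \<subseteq> U"
    using simple_submodule_exists[OF P_fd[OF i] U] by blast
  have "T \<subseteq> soc A (P i)" using simple_subset_soc[OF T(1,2)] .
  thus ?thesis
    using lsub_submod_iff[OF Pm.soc_submodule] T(1) simple_moduleD(3)[OF P_soc(1)[OF i]] T(3)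
      simple_moduleD(2)[OF T(2)]
    by fastforce
qed

text \<open>The isomorphism from the socle of \<open>P\<^sub>i\<close> onto a simple submodule of the injective module \<open>Q\<close>
  extends to an embedding of \<open>P\<^sub>i\<close>, so the simple submodule lies in the square of the radical.\<close>

lemma projective_soc:
  assumes Q: "projective Q" shows "soc A Q = rad2 Q"
proof
  have fdQ: "fd Q" using Q by (rule projectiveD)
  have lmQ: "lmod Q" using fdQ by (rule fd_moduleD)
  show "rad2 Q \<subseteq> soc A Q" by (rule rad2_subset_soc[OF fdQ])
  show "soc A Q \<subseteq> rad2 Q"
  proof (rule soc_least[OF rad2_submodule[OF lmQ]])
    fix U assume U: "lsub U Q" "simple (submod Q U)"
    obtain i where i: "i < r" "isom (submod Q U) (S i)" using simple_iso_S[OF U(2)] by blast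
    have lmU: "lmod (submod Q U)" using U(2) by (rule simple_moduleD)
    have s: "lsub (soc A (P i)) (P i)" by (rule left_module.soc_submodule[OF P_lm[OF i(1)]])
    have "isom (submod (P i) (soc A (P i))) (submod Q U)"
      using module_iso_trans[OF P_soc(2)[OF i(1)] module_iso_sym[OF lmU S_lm[OF i(1)] i(2)]] .
    then obtain f where f: "f \<in> Hom (submod (P i) (soc A (P i))) (submod Q U)" "f ` soc A (P i) = U"
      by (auto simp: module_iso_def bij_betw_def)
    have fQ: "f \<in> Hom (submod (P i) (soc A (P i))) Q"
      using mhom_extend_codomain[OF f(1) lsub_subset[OF U(1)]] .
    obtain g where g: "g \<in> Hom (P i) Q" "\<forall>x\<in>soc A (P i). g x = f x"
      using injective_extend[OF projective_injective[OF si Q] fd_submod[OF P_fd[OF i(1)] s] P_fd[OF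
        i(1)] mhom_incl[OF lsub_subset[OF s]] _ fQ]
      by auto
    have "U = g ` rad2 (P i)" using f(2) g(2) P_rad2(1)[OF i(1)] by (metis image_cong)
    also have "\<dots> \<subseteq> rad2 Q"
      by (rule rad_hom_image(2)[OF lm_homI[OF P_lm[OF i(1)] lmQ g(1)] P_fd[OF i(1)] fdQ])
    finally show "U \<subseteq> rad2 Q" .
  qed
qed

text \<open>An element outside the radical survives in some simple quotient T of type S_j. The map Q
  \<rightarrow> T lifts through P_j \<rightarrow> T; the lift sends the second socle of Q into the
  second socle of P_j, which is rad P_j and is killed in T.\<close>

lemma projective_ann:
  assumes Q: "projective Q" shows "ann Q (soc A Q) \<subseteq> rad A Q"
proof
  fix x assume x: "x \<in> ann Q (soc A Q)"
  have fdQ: "fd Q" using Q by (rule projectiveD)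
  have lmQ: "lmod Q" using fdQ by (rule fd_moduleD)
  have xQ: "x \<in> carrier Q" using x by (simp add: ann_def)
  show "x \<in> rad A Q"
  proof (rule ccontr)
    assume "x \<notin> rad A Q"
    then obtain V where V: "maxsub V Q" "x \<notin> V" using xQ by (auto simp: rad_def)
    hence Vs: "lsub V Q" by (simp add: maximal_submodule_def)
    obtain T :: "('a, 'k list) module" and p where T: "fd T" "p \<in> Hom Q T"
      "p ` carrier Q = carrier T" "a_kernel Q T p = V" using klist_quotient[OF fdQ Vs] by blast
    have lmT: "lmod T" using T by (intro fd_moduleD)
    interpret p: lm_hom A Q T p by (intro lm_homI lmQ lmT T)
    have simple: "simple T" using p.surj_simple_maximal[OF T(3)] T(4) V by simp
    obtain j where j: "j < r" "isom T (S j)" using simple_iso_S[OF simple] by blast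
    have "efix (e j) T \<noteq> {\<zero>\<^bsub>T\<^esub>}"
      using c_simple_iff(1)[OF j(1) simple] j(2) cdim_zero_iff[OF e_carrier(1)[OF j(1)] T(1)]
      by simp
    moreover have "\<zero>\<^bsub>T\<^esub> \<in> efix (e j) T"
      using lsub_zero[OF efix_subspace[OF lmT e_carrier(1)[OF j(1)]]] by simp
    ultimately obtain w where w: "w \<in> efix (e j) T" "w \<noteq> \<zero>\<^bsub>T\<^esub>"
      by blast
    have gh: "(\<lambda>x. x \<odot>\<^bsub>T\<^esub> w) \<in> Hom (P j) T"
      by (rule lideal_hom[OF lmT e_carrier(1)[OF j(1)] efixD(1)[OF w(1)]])
    obtain f where f: "f \<in> Hom Q (P j)" "\<forall>x\<in>carrier Q. f x \<odot>\<^bsub>T\<^esub> w = p x"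
      using projective_lift[OF Q P_fd[OF j(1)] T(1) gh nonzero_smult_hom[OF simple e_props(1)[OF
        j(1)] w] T(2)]
      by blast
    interpret f: lm_hom A Q "P j" f by (intro lm_homI lmQ P_lm[OF j(1)] f)
    have "f x \<in> ann (P j) (soc A (P j))"
      using x f.soc_image f.smult[OF J_carrier] f.closed by (force simp: ann_def)
    thus False
      using V(2) T(4) xQ mhom_rad_simple[OF P_fd[OF j(1)] simple gh] P_ann[OF j(1)] f(2) by auto
  qed
qed

end

section \<open>Syzygies and cosyzygies\<close>

context rad_cube_zero begin

text \<open>Counts in the radical. It is the socle vector once the socle is known to equal the
  radical, see \<open>indecomposable_soc\<close>.\<close>

abbreviation s :: "nat \<Rightarrow> ('a, 'm) module \<Rightarrow> nat" where "s i N \<equiv> c i (submod N (rad A N))"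

lemma t_s_iso:
  assumes M: "fd M" and N: "lmod N" and f: "f \<in> Hom M N" "bij_betw f (carrier M) (carrier N)"
    and i: "i < r"
  shows "t i M = t i N" "s i M = s i N"
proof -
  interpret f: lm_hom A M N f by (intro lm_homI fd_lm[OF M] N f)
  have sur: "f ` carrier M = carrier N" using f(2) by (simp add: bij_betw_def)
  have fdN: "fd N" by (rule fd_surj_image[OF M N f(1) sur])
  have im: "f ` rad A M = rad A N" by (rule rad_hom_image(3)[OF f.lm_hom_axioms M fdN sur])
  have sub: "rad A M \<subseteq> carrier M" by (rule lsub_subset[OF f.dom.rad_submodule])
  have "bij_betw f (rad A M) (rad A N)" using bij_betw_subset[OF f(2) sub] im by simp
  hence "isom (submod M (rad A M)) (submod N (rad A N))"
    unfolding module_iso_def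
    by (intro bexI) (use mhom_restrict[OF f(1) sub] im in \<open>auto intro!:
      mhom_corestrict\<close>)
  thus s: "s i M = s i N"
    by (rule c_iso[OF i fd_submod[OF M f.dom.rad_submodule] f.cod.submod_lm[OF
      f.cod.rad_submodule]])
  have "c i M = c i N" using c_iso[OF i M N] f unfolding module_iso_def by blast
  thus "t i M = t i N" using s by (simp add: t_def)
qed

text \<open>A simple submodule U outside the radical avoids some maximal submodule W, whence N is
  the direct sum of U and W. Indecomposability leaves N = U, which is simple.\<close>

lemma indecomposable_soc:
  fixes N (structure)
  assumes N: "fd N" and ind: "indec N" and z: "rad2 N = {\<zero>}"
    and ns: "\<not> simple N"
  shows "soc A N = rad A N"
proof (rule subset_antisym)
  interpret N: left_module A N by (rule fd_lm[OF N])
  show "rad A N \<subseteq> soc A N" using rad_subset_soc_iff[OF N] z by simp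
  show "soc A N \<subseteq> rad A N"
  proof (rule soc_least[OF N.rad_submodule])
    fix U assume U: "lsub U N" "simple (submod N U)"
    show "U \<subseteq> rad A N"
    proof (rule ccontr)
      assume "\<not> U \<subseteq> rad A N"
      then obtain W where W: "maxsub W N" "\<not> U \<subseteq> W"
        using lsub_subset[OF U(1)] unfolding rad_def by blast
      have Wsub: "lsub W N" "W \<noteq> carrier N" using W unfolding maximal_submodule_def by auto
      have 0: "U \<inter> W = {\<zero>}" using N.simple_Int[OF U Wsub(1)] W(2) by blast
      have up: "U \<subseteq> U <+>\<^bsub>N\<^esub> W" "W \<subseteq> U <+>\<^bsub>N\<^esub> W"
        by (rule N.set_add_upper[OF U(1) Wsub(1)])+
      hence "U <+>\<^bsub>N\<^esub> W = carrier N"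
        using W N.lsub_sum[OF U(1)] unfolding maximal_submodule_def by blast
      moreover have "U \<noteq> {\<zero>}" using simple_moduleD(2)[OF U(2)] by simp
      ultimately have "W = {\<zero>}"
        using ind 0 U(1) Wsub(1) unfolding indecomposable_module_def by blast
      thus False
        using \<open>U <+>\<^bsub>N\<^esub> W = carrier N\<close> N.set_add_least[OF U(1), of U W]
          lsub_subset[OF U(1)] lsub_zero[OF U(1)] U(2) ns
        by auto
    qed
  qed
qed

text \<open>The nonzero quotient N/W has a composition factor S_i, so e_i N cannot be contained in
  W.\<close>

lemma proper_submodule_efix:
  assumes N: "fd N" and W: "lsub W N" "W \<noteq> carrier N"
  shows "\<exists>i<r. \<exists>y\<in>efix (e i) N. y \<notin> W"
proof (rule ccontr)
  assume no: "\<not> ?thesis"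
  note q = quot_proj[OF fd_lm[OF N] W(1)]
  have eq: "c i (submod N W) = c i N" if "i < r" for i
  proof -
    have "efix (e i) (submod N W) = efix (e i) N"
      using no that efix_submod[OF lsub_subset[OF W(1)], of "e i"] by blast
    thus ?thesis by (simp add: cdim_def)
  qed
  have "c i (quot_module N W) = 0" if "i < r" for i
    using c_surj[OF that N q(1,2,3)] q(4) eq[OF that] by simp
  thus False
    using c_nonzero[OF fd_quot[OF N W(1)]] mhom_closed[OF q(2)] q(4) W(2)
    by (fastforce simp: a_kernel_def')
qed

text \<open>If J^2 N \<noteq> 0, some y in e_i N has J^2 y \<noteq> 0. The map x \<mapsto> x y on
  P_i then does not kill rad^2 P_i, the essential socle, and is injective. As P_i is injective it
  splits off, and N is isomorphic to P_i.\<close>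

lemma nonprojective_rad2:
  fixes N (structure)
  assumes N: "fd N" and ind: "indec N" and np: "\<not> projective N"
  shows "rad2 N = {\<zero>}"
proof (rule ccontr)
  assume ne: "rad2 N \<noteq> {\<zero>}"
  interpret N: left_module A N by (rule fd_lm[OF N])
  let ?W = "ann N (ann N {\<zero>})"
  have W: "lsub ?W N" by (intro ann_submodule N.left_module_axioms N.lsub_0)
  have "?W \<noteq> carrier N"
    using ne lsub_zero[OF rad2_submodule[OF N.left_module_axioms]] rad2_subset_iff[OF N N.lsub_0]
    by blast
  from proper_submodule_efix[OF N W this] obtain i y where i: "i < r" and y: "y \<in> efix (e i) N" "y \<notin> ?W"
    by blast
  have yN: "y \<in> carrier N" "e i \<odot> y = y" using efixD[OF y(1)] by auto
  obtain a b where ab: "a \<in> J" "b \<in> J" "b \<odot> (a \<odot> y) \<noteq> \<zero>"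
    using y(2) yN(1) J_carrier unfolding ann_def by auto
  let ?f = "\<lambda>x. x \<odot> y"
  interpret f: lm_hom A "P i" N ?f
    by (intro lm_homI P_lm[OF i] N.left_module_axioms lideal_hom e_carrier(1)[OF i] yN)
  have ei: "e i \<in> carrier (P i)" using e_carrier[OF i] by simp
  have ker0: "a_kernel (P i) N ?f = {\<zero>\<^bsub>P i\<^esub>}"
  proof (rule ccontr)
    assume "a_kernel (P i) N ?f \<noteq> {\<zero>\<^bsub>P i\<^esub>}"
    hence sub: "rad2 (P i) \<subseteq> a_kernel (P i) N ?f"
      using P_essential[OF i f.ker_submodule] P_rad2(1)[OF i] by simp
    have "?f (b \<odot>\<^bsub>P i\<^esub> (a \<odot>\<^bsub>P i\<^esub> e i)) = \<zero>"
    proof -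
      have "b \<odot>\<^bsub>P i\<^esub> (a \<odot>\<^bsub>P i\<^esub> e i) \<in> rad2 (P i)"
        unfolding rad2_def using Jmul_mem[OF ab(1) ei, of "P i"] rad_eq_Jmul[OF P_fd[OF i]]
        by (intro Jmul_mem ab) simp
      thus ?thesis using sub f.ker_iff by blast
    qed
    moreover have "?f (b \<odot>\<^bsub>P i\<^esub> (a \<odot>\<^bsub>P i\<^esub> e i)) = b \<odot> (a \<odot> y)"
      using f.smult[OF J_carrier[OF ab(2)] f.dom.lsmult_closed[OF J_carrier[OF ab(1)] ei]]
        f.smult[OF J_carrier[OF ab(1)] ei] yN(2)
      by metis
    ultimately show False using ab by simp
  qed
  have inj: "inj_on ?f (carrier (P i))" using ker0 f.inj_on_ker by simp
  obtain h where h: "h \<in> Hom N (P i)" and hf: "\<And>x. x \<in> carrier (P i) \<Longrightarrow> h (?f x) = x"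
    using injective_extend[OF P_injective[OF i] P_fd[OF i] N f.hom inj mhom_id] by blast
  \<comment> \<open>The idempotent endomorphism belonging to the copy of P_i. It fixes y, so its
    complement is not injective, and the dichotomy for indecomposable modules makes the copy all of
    N.\<close>
  let ?g = "\<lambda>z. ?f (h z)"
  have g: "?g \<in> Hom N N" by (rule mhom_comp[OF h f.hom])
  from indecomposable_endo[OF N ind g] show False
  proof
    assume b: "bij_betw ?g (carrier N) (carrier N)"
    have "z \<in> ?f ` carrier (P i)" if "z \<in> carrier N" for z
    proof -
      have "z \<in> ?g ` carrier N" using b that by (simp add: bij_betw_def)
      then obtain x where x: "z = ?g x" "x \<in> carrier N" by (rule)
      show ?thesis by (rule) (use x mhom_closed[OF h] in auto)
    qed
    hence "bij_betw ?f (carrier (P i)) (carrier N)" using inj unfolding bij_betw_def by blast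
    thus False using projective_iso[OF P_projective[OF i] N.left_module_axioms f.hom] np by simp
  next
    assume b: "bij_betw (\<lambda>x. x \<ominus> ?g x) (carrier N) (carrier N)"
    have "y \<ominus> ?g y = \<zero>" using hf[OF ei] yN by simp
    moreover have "\<zero> \<ominus> ?g \<zero> = \<zero>"
      using hf[of "\<zero>\<^bsub>P i\<^esub>"] f.zero f.dom.zero_closed by simp
    ultimately show False using bij_betw_eqD[OF b yN(1) N.zero_closed] lsub_zero[OF W] y(2) by simp
  qed
qed

text \<open>For projective modules rad^2 has the same multiplicities as the top, so its vanishing
  empties the top and with it the whole module.\<close>

lemma projective_rad2_zero:
  fixes Q (structure)
  assumes Q: "projective Q" and z: "rad2 Q = {\<zero>}"
  shows "carrier Q = {\<zero>}"
proof (rule ccontr)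
  assume ne: "carrier Q \<noteq> {\<zero>}"
  note fd = projectiveD[OF Q]
  have "t j Q = 0" if j: "j < r" for j
    using projective_rad2[OF Q j] z cdim_zero_module[OF e_carrier(1)[OF j] fd_submod[OF fd
      left_module.lsub_0[OF fd_lm[OF fd]]]]
    by simp
  thus False using c_nonzero[OF fd ne] c_projective_E[OF Q] by auto
qed

text \<open>Both \<open>\<Omega>\<close> and \<open>\<Omega>\<^sup>-\<^sup>1\<close> give short exact sequences of the following shape.\<close>

lemma exact_step:
  fixes N (structure)
  assumes Q: "projective Q" and N: "lmod N"
    and p: "p \<in> Hom Q N" "p ` carrier Q = carrier N"
    and Z: "rad2 Q \<subseteq> a_kernel Q N p" "a_kernel Q N p \<subseteq> rad A Q"
  defines "Z \<equiv> submod Q (a_kernel Q N p)"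
  shows "rad2 N = {\<zero>}" "rad2 Z = {\<zero>\<^bsub>Z\<^esub>}" "i < r \<Longrightarrow> t i N = t i Q"
    "soc A Z = rad A Z \<Longrightarrow> i < r \<Longrightarrow> s i Z = t i N"
    "soc A Z = rad A Z \<Longrightarrow> i < r \<Longrightarrow> t i Z + s i N = (\<Sum>k<r. t k N * E k i)"
proof -
  note fd = projectiveD[OF Q]
  interpret p: lm_hom A Q N p by (intro lm_homI fd_lm[OF fd] N p)
  have fdN: "fd N" by (rule fd_surj_image[OF fd N p])
  have fdZ: "fd Z" unfolding Z_def by (rule fd_submod[OF fd p.ker_submodule])
  note im = rad_hom_image[OF p.lm_hom_axioms fd fdN]
  have "rad2 N \<subseteq> {\<zero>}" unfolding im(4)[OF p(2), symmetric] using Z(1) by auto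
  thus zN: "rad2 N = {\<zero>}" using lsub_zero[OF rad2_submodule[OF N]] by blast
  have J2: "a \<odot>\<^bsub>Q\<^esub> x \<in> rad2 Q" if "a \<in> J" "x \<in> rad A Q" for a x
    unfolding rad2_def using that by (rule Jmul_mem)
  have J3: "b \<odot>\<^bsub>Q\<^esub> y = \<zero>\<^bsub>Q\<^esub>" if "b \<in> J" "y \<in> rad2 Q" for b y
    using that rad2_subset_soc[OF fd] soc_eq_ann[OF p.dom.left_module_axioms]
    by (auto simp: ann_def)
  have "rad2 Z \<subseteq> {\<zero>\<^bsub>Z\<^esub>}"
    unfolding rad2_subset_iff[OF fdZ left_module.lsub_0[OF fd_lm[OF fdZ]]] using J2 J3 Z J_carrier
      unfolding Z_def ann_def
    by auto
  thus "rad2 Z = {\<zero>\<^bsub>Z\<^esub>}"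
    using lsub_zero[OF rad2_submodule[OF fd_lm[OF fdZ]]] by blast
  have cQ: "c j Q = c j Z + c j N" if "j < r" for j unfolding Z_def by (rule c_surj[OF that fd N p])
  have crad: "c j (submod Q (rad A Q)) = c j Z + s j N" if j: "j < r" for j
  proof -
    interpret q: lm_hom A "submod Q (rad A Q)" "submod N (rad A N)" p
    proof (rule lm_hom.corestrict_hom[OF p.restrict_hom[OF p.dom.rad_submodule] p.cod.rad_submodule])
      show "p x \<in> rad A N" if "x \<in> carrier (submod Q (rad A Q))" for x
        using im(1) that by auto
    qed
    have "a_kernel (submod Q (rad A Q)) (submod N (rad A N)) p = a_kernel Q N p"
      using Z(2) lsub_subset[OF p.dom.rad_submodule] by auto
    moreover have "c j (submod Q (rad A Q)) = c j (submod (submod Q (rad A Q)) (a_kernel (submod Q (rad A Q)) (submod N (rad A N)) p)) + s j N"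
      by (rule c_surj[OF j fd_submod[OF fd p.dom.rad_submodule] q.cod.left_module_axioms q.hom])
        (use im(3)[OF p(2)] in simp)
    ultimately show ?thesis unfolding Z_def by simp
  qed
  show tN: "t i N = t i Q" if "i < r" for i using cQ[OF that] crad[OF that] by (simp add: t_def)
  assume so: "soc A Z = rad A Z"
  \<comment> \<open>The socle of Z is Z \<inter> soc Q. For projective Q the socle is rad^2 Q, which
    lies in Z.\<close>
  have socZ: "rad A Z = rad2 Q"
  proof -
    have "soc A Z = a_kernel Q N p \<inter> soc A Q"
      unfolding soc_eq_ann[OF fd_lm[OF fdZ]] soc_eq_ann[OF p.dom.left_module_axioms] unfolding
        Z_def ann_def
      by auto
    thus ?thesis using so projective_soc[OF Q] Z(1) by auto
  qed
  thus sZ: "s i Z = t i N" if "i < r" for i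
    using projective_rad2[OF Q that] tN[OF that] unfolding Z_def by simp
  \<comment> \<open>Compare c(Q) = t(Z) + s(Z) + t(N) + s(N) with c(Q) = 2 t(Q) + the sum with
    \<open>E\<close>. Here s(Z) = t(N) = t(Q), so these terms cancel.\<close>
  show "t i Z + s i N = (\<Sum>k<r. t k N * E k i)" if i: "i < r"
    using c_projective_E[OF Q i] tN[OF i] tN cQ[OF i] c_eq_t[OF i fdZ] c_eq_t[OF i fdN] sZ[OF i]
    by auto

qed

lemma cover_kernel_rad:
  assumes N: "lmod N" and p: "projective_cover K A Q p N"
  shows "a_kernel Q N p \<subseteq> rad A Q"
proof -
  have Q: "lmod Q" using p fd_lm[OF projectiveD] unfolding projective_cover_def by blast
  interpret p: lm_hom A Q N p using p by (intro lm_homI Q N) (simp add: projective_cover_def)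
  have "a_kernel Q N p \<subseteq> W" if W: "maxsub W Q" for W
  proof (rule ccontr)
    assume n: "\<not> a_kernel Q N p \<subseteq> W"
    have Wsub: "lsub W Q" "W \<noteq> carrier Q" using W unfolding maximal_submodule_def by auto
    note up = p.dom.set_add_upper[OF Wsub(1) p.ker_submodule]
    have "W <+>\<^bsub>Q\<^esub> a_kernel Q N p = carrier Q"
      using W up n p.dom.lsub_sum[OF Wsub(1) p.ker_submodule] unfolding maximal_submodule_def
      by blast
    thus False using p Wsub unfolding projective_cover_def by blast
  qed
  thus ?thesis using lsub_subset[OF p.ker_submodule] unfolding rad_def by blast
qed

text \<open>Supplies the two inclusions of \<open>exact_step\<close>: rad^2 Q dies in N because
  rad^2 N = 0, and the kernel of a cover lies in the radical. Indecomposability of Z uses that Q is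
  injective, so that maps from the kernel extend to Q.\<close>

lemma omega_step:
  fixes Q :: "('a, 'k list) module" and N (structure)
  assumes N: "fd N" and ind: "indec N" and z: "rad2 N = {\<zero>}"
    and cov: "projective_cover K A Q p N"
  defines "Z \<equiv> submod Q (a_kernel Q N p)"
  shows "fd Z" "indec Z" "rad2 Z = {\<zero>\<^bsub>Z\<^esub>}"
    "i < r \<Longrightarrow> t i Q = t i N"
    "\<not> simple Z \<Longrightarrow> i < r \<Longrightarrow> s i Z = t i N"
    "\<not> simple Z \<Longrightarrow> i < r \<Longrightarrow> t i Z + s i N = (\<Sum>k<r. t k N * E k i)"
proof -
  have Q: "projective Q" and p: "p \<in> Hom Q N" "p ` carrier Q = carrier N"
    and cover: "\<And>W. lsub W Q \<Longrightarrow> W <+>\<^bsub>Q\<^esub> a_kernel Q N p = carrier Q \<Longrightarrow> W = carrier Q"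
    using cov unfolding projective_cover_def by auto
  note fd = projectiveD[OF Q] and lmN = fd_lm[OF N]
  interpret p: lm_hom A Q N p by (intro lm_homI fd_lm[OF fd] lmN p)
  have Z: "rad2 Q \<subseteq> a_kernel Q N p" "a_kernel Q N p \<subseteq> rad A Q"
    using rad_hom_image(4)[OF p.lm_hom_axioms fd N p(2)] z lsub_subset[OF rad2_submodule[OF
      p.dom.left_module_axioms]] p.ker_iff cover_kernel_rad[OF lmN cov]
    by blast+
  note step = exact_step[OF Q lmN p Z, folded Z_def]
  show fdZ: "fd Z" unfolding Z_def by (rule fd_submod[OF fd p.ker_submodule])
  show zZ: "rad2 Z = {\<zero>\<^bsub>Z\<^esub>}" by (rule step(2))
  show "t i Q = t i N" if "i < r" for i using step(3)[OF that] by simp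
  \<comment> \<open>With zero kernel, rad^2 Q would vanish; then the projective module Q and its
    image N would be zero.\<close>
  have ne: "a_kernel Q N p \<noteq> {\<zero>\<^bsub>Q\<^esub>}"
    using ind Z lsub_zero[OF rad2_submodule[OF p.dom.left_module_axioms]] projective_rad2_zero[OF
      Q] p(2)
    by (force simp: indecomposable_module_def)
  show indZ: "indec Z" unfolding Z_def
  proof (rule indecomposable_kernel[OF fd N ind p cover _ ne])
    fix g assume g: "g \<in> Hom (submod Q (a_kernel Q N p)) Q"
    have 1: "(\<lambda>x. x) \<in> Hom (submod Q (a_kernel Q N p)) Q"
      by (rule mhom_incl[OF lsub_subset[OF p.ker_submodule]])
    show "\<exists>\<theta>\<in>Hom Q Q. \<forall>x\<in>a_kernel Q N p. \<theta> x = g x"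
      using injective_extend[OF projective_injective[OF si Q] fd_submod[OF fd p.ker_submodule] fd 1
        _ g]
      by simp
  qed
  assume "\<not> simple Z"
  hence so: "soc A Z = rad A Z" by (rule indecomposable_soc[OF fdZ indZ zZ])
  show "s i Z = t i N" "t i Z + s i N = (\<Sum>k<r. t k N * E k i)" if "i < r"
    by (rule step(4,5)[OF so that])+
qed

text \<open>Take a map into a projective module whose kernel is as small as possible. A simple
  submodule T of that kernel embeds into some P_i, and this embedding extends to N as P_i is
  injective. Adding it as a further coordinate shrinks the kernel.\<close>

lemma projective_embedding:
  fixes N :: "('a, 'k list) module" (structure)
  assumes N: "fd N"
  shows "\<exists>(I :: ('a, 'k list) module) f. projective I \<and> f \<in> Hom N I \<and> inj_on f (carrier N)"
proof -
  interpret N: left_module A N by (rule fd_lm[OF N])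
  let ?R = "\<lambda>U. \<exists>(I :: ('a, 'k list) module) f. projective I \<and> f \<in> Hom N I \<and> a_kernel N I f = U"
  \<comment> \<open>The zero map provides a starting point; the projective cover only serves as some
    projective module on coordinate lists.\<close>
  have 0: "?R (carrier N)"
  proof -
    obtain I :: "('a, 'k list) module" and p where "projective_cover K A I p N"
      using projective_cover_exists[OF si N] by blast
    hence I: "projective I" unfolding projective_cover_def by blast
    moreover have "(\<lambda>x. \<zero>\<^bsub>I\<^esub>) \<in> Hom N I"
      by (rule zero_hom[OF N.left_module_axioms fd_lm[OF projectiveD[OF I]]])
    ultimately show ?thesis by (intro exI) (auto simp: a_kernel_def')
  qed
  define R where "R = ?R"
  have "R (carrier N)" using 0 by (simp add: R_def)
  from min_dim_submodule[OF N N.lsub_carrier, of R, OF this] obtain U where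
    U: "lsub U N" "R U" and min: "\<And>W. lsub W N \<Longrightarrow> R W \<Longrightarrow> W \<subseteq> U \<Longrightarrow> W = U" by blast
  from U(2)[unfolded R_def] obtain I :: "('a, 'k list) module" and f where I: "projective I" and f: "f \<in> Hom N I"
    and k: "a_kernel N I f = U" by blast
  have lmI: "lmod I" by (rule fd_lm[OF projectiveD[OF I]])
  interpret f: lm_hom A N I f by (intro lm_homI N.left_module_axioms lmI f)
  have "U = {\<zero>}"
  proof (rule ccontr)
    assume "U \<noteq> {\<zero>}"
    then obtain T where T: "lsub T N" "simple (submod N T)" "T \<subseteq> U"
      using simple_submodule_exists[OF N U(1)] by blast
    obtain i g where i: "i < r" and g: "g \<in> Hom (submod N T) (P i)" "inj_on g T"
      using simple_embeds_P[OF T(2)] by auto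
    obtain h where h: "h \<in> Hom N (P i)" "\<And>x. x \<in> T \<Longrightarrow> h x = g x"
      using injective_extend[OF P_injective[OF i] fd_submod[OF N T(1)] N mhom_incl[OF
        lsub_subset[OF T(1)]] _ g(1)]
      by auto
    interpret g: lm_hom A "submod N T" "P i" g by (intro lm_homI P_lm[OF i] N.submod_lm T g)
    interpret h: lm_hom A N "P i" h by (intro lm_homI P_lm[OF i] N.left_module_axioms h)
    have D: "projective (dsum I (P i))" by (rule projective_dsum[OF I P_projective[OF i]])
    obtain I' :: "('a, 'k list) module" and \<phi> where I': "fd I'" and \<phi>: "\<phi> \<in> Hom (dsum I (P i)) I'"
      "bij_betw \<phi> (carrier (dsum I (P i))) (carrier I')" using klist_copy[OF projectiveD[OF D]] by blast
    have pI': "projective I'" by (rule projective_iso[OF D fd_lm[OF I'] \<phi>])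
    let ?k = "\<lambda>x. \<phi> (f x, h x)"
    have k': "?k \<in> Hom N I'" by (rule mhom_comp[OF dsum_pair_hom[OF f h(1)] \<phi>(1)])
    interpret \<phi>: lm_hom A "dsum I (P i)" I' \<phi>
      by (intro lm_homI \<phi> fd_lm[OF I'] fd_lm[OF projectiveD[OF D]])
    have kk: "\<phi> (f x, h x) = \<zero>\<^bsub>I'\<^esub> \<Longrightarrow> f x = \<zero>\<^bsub>I\<^esub> \<and> h x = \<zero>\<^bsub>P i\<^esub>" if "x \<in> carrier N" for x
      using \<phi>.inj_onD'[of "(f x, h x)"] \<phi>(2) that
      by (simp add: bij_betw_def del: lideal_simps)
    have sub: "a_kernel N I' ?k \<subseteq> U"
      unfolding k[symmetric] by (auto simp: a_kernel_def' dest: kk)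
    interpret k: lm_hom A N I' ?k by (intro lm_homI N.left_module_axioms fd_lm[OF I'] k')
    have "a_kernel N I' ?k = U"
      by (rule min[OF k.ker_submodule _ sub]) (use pI' k' in \<open>unfold R_def, blast\<close>)
    hence hz: "h x = \<zero>\<^bsub>P i\<^esub>" if "x \<in> T" for x
      using T(3) kk that k.ker_iff by blast
    have "T \<subseteq> {\<zero>}" using hz h(2) g.inj_onD' g(2) by auto
    thus False using simple_moduleD(2)[OF T(2)] lsub_zero[OF T(1)] by auto
  qed
  thus ?thesis using I f k f.inj_on_ker by blast
qed

text \<open>A projective module of least dimension that contains N is an essential extension. A
  submodule that meets N trivially would contain a simple T whose hull P_i embeds into I as a
  summand, still meeting N trivially; projecting along it embeds N into a smaller projective
  module.\<close>

lemma injective_hull_exists: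
  fixes N :: "('a, 'k list) module" (structure)
  assumes N: "fd N"
  shows "\<exists>(I :: ('a, 'k list) module) f. projective I \<and> f \<in> Hom N I \<and> inj_on f (carrier N) \<and>
    (\<forall>W. lsub W I \<longrightarrow> W \<inter> f ` carrier N = {\<zero>\<^bsub>I\<^esub>} \<longrightarrow> W = {\<zero>\<^bsub>I\<^esub>})"
proof -
  interpret N: left_module A N by (rule fd_lm[OF N])
  let ?R = "\<lambda>If. projective (fst If) \<and> snd If \<in> Hom N (fst If) \<and> inj_on (snd If) (carrier N)"
  from projective_embedding[OF N] obtain If0 :: "('a, 'k list) module \<times> ('k list \<Rightarrow> 'k list)" where "?R If0"
    by auto
  from ex_has_least_nat[of ?R, OF this, of "\<lambda>If. mdim (fst If)"]
  obtain I :: "('a, 'k list) module" and f where I: "projective I" and f: "f \<in> Hom N I" "inj_on f (carrier N)"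
    and min: "\<And>(I' :: ('a, 'k list) module) f'. projective I' \<Longrightarrow> f' \<in> Hom N I' \<Longrightarrow> inj_on f' (carrier N) \<Longrightarrow> mdim I \<le> mdim I'"
    by auto
  note fd = projectiveD[OF I] note lmI = fd_lm[OF fd]
  interpret f: lm_hom A N I f by (intro lm_homI N.left_module_axioms lmI f)
  have "W = {\<zero>\<^bsub>I\<^esub>}" if W: "lsub W I" and 0: "W \<inter> f ` carrier N = {\<zero>\<^bsub>I\<^esub>}" for W
  proof (rule ccontr)
    assume "W \<noteq> {\<zero>\<^bsub>I\<^esub>}"
    then obtain T where T: "lsub T I" "simple (submod I T)" "T \<subseteq> W"
      using simple_submodule_exists[OF fd W] by blast
    have lmT: "lmod (submod I T)" by (rule simple_moduleD(1)[OF T(2)])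
    obtain i where i: "i < r" "isom (submod I T) (S i)" using simple_iso_S[OF T(2)] by blast
    let ?s = "soc A (P i)"
    have s: "lsub ?s (P i)" by (rule left_module.soc_submodule[OF P_lm[OF i(1)]])
    have "isom (submod (P i) ?s) (submod I T)"
      using module_iso_trans[OF P_soc(2)[OF i(1)] module_iso_sym[OF lmT S_lm[OF i(1)] i(2)]] .
    then obtain u where u: "u \<in> Hom (submod (P i) ?s) (submod I T)" "bij_betw u ?s T"
      unfolding module_iso_def by auto
    have u': "u \<in> Hom (submod (P i) ?s) I"
      by (rule mhom_extend_codomain[OF u(1) lsub_subset[OF T(1)]])
    obtain h where h: "h \<in> Hom (P i) I" "\<And>x. x \<in> ?s \<Longrightarrow> h x = u x"
      using injective_extend[OF projective_injective[OF si I] fd_submod[OF P_fd[OF i(1)] s] P_fd[OF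
        i(1)] mhom_incl[OF lsub_subset[OF s]] _ u']
      by auto
    interpret h: lm_hom A "P i" I h by (intro lm_homI P_lm[OF i(1)] lmI h)
    have nos: "\<not> ?s \<subseteq> {x \<in> carrier (P i). h x \<in> f ` carrier N}"
    proof
      assume sub: "?s \<subseteq> {x \<in> carrier (P i). h x \<in> f ` carrier N}"
      have "T \<subseteq> f ` carrier N"
      proof
        fix z assume "z \<in> T" then obtain x where x: "x \<in> ?s" "z = u x"
          using u(2) by (auto simp: bij_betw_def)
        show "z \<in> f ` carrier N" using subsetD[OF sub x(1)] h(2)[OF x(1)] x(2) by simp
      qed
      thus False using simple_moduleD(2)[OF T(2)] T(3) 0 lsub_zero[OF T(1)] by auto
    qed
    have pre: "lsub {x \<in> carrier (P i). h x \<in> f ` carrier N} (P i)"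
      by (rule h.vimage_submodule[OF f.image_submodule[OF N.lsub_carrier]])
    have pre0: "{x \<in> carrier (P i). h x \<in> f ` carrier N} = {\<zero>\<^bsub>P i\<^esub>}"
      using P_essential[OF i(1) pre] nos by blast
    have "x = \<zero>\<^bsub>P i\<^esub>" if "x \<in> carrier (P i)" "h x = \<zero>\<^bsub>I\<^esub>" for x
    proof -
      have "x \<in> {x \<in> carrier (P i). h x \<in> f ` carrier N}" using that by force
      thus ?thesis unfolding pre0 by blast
    qed
    hence hinj: "inj_on h (carrier (P i))" by (rule h.inj_onI')
    obtain g where g: "g \<in> Hom I (P i)" and gh: "\<And>x. x \<in> carrier (P i) \<Longrightarrow> g (h x) = x"
      using injective_extend[OF P_injective[OF i(1)] P_fd[OF i(1)] fd h(1) hinj mhom_id] by blast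
    interpret g: lm_hom A I "P i" g by (intro lm_homI P_lm[OF i(1)] lmI g)
    \<comment> \<open>The projection onto the kernel of g along the copy h(P_i). It stays injective
      on f(N) because h(P_i) meets f(N) only in 0.\<close>
    let ?k = "\<lambda>x. x \<ominus>\<^bsub>I\<^esub> h (g x)" and ?I = "submod I (a_kernel I (P i) g)"
    have k: "?k \<in> Hom I I"
      by (rule f.cod.lm_hom_sub[OF lm_homI[OF lmI lmI mhom_id] lm_homI[OF lmI lmI mhom_comp[OF g
        h(1)]]])
    have kin: "?k x \<in> a_kernel I (P i) g" if "x \<in> carrier I" for x
      using that gh by (simp add: del: lideal_simps)
    have k2: "?k \<in> Hom I ?I" by (rule mhom_corestrict[OF k kin])
    have fdI': "fd ?I" by (rule fd_submod[OF fd g.ker_submodule])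
    have pI: "projective ?I"
    proof (rule projective_retract[OF I fdI' mhom_incl[OF lsub_subset[OF g.ker_submodule]] k2])
      show "?k x = x" if "x \<in> carrier ?I" for x using that h.zero by simp
    qed
    let ?m = "\<lambda>x. ?k (f x)"
    have m: "?m \<in> Hom N ?I" by (rule mhom_comp[OF f(1) k2])
    interpret m: lm_hom A N ?I ?m by (intro lm_homI N.left_module_axioms fd_lm[OF fdI'] m)
    have minj: "inj_on ?m (carrier N)"
    proof (rule m.inj_onI')
      fix x assume x: "x \<in> carrier N" "?m x = \<zero>\<^bsub>?I\<^esub>"
      hence fx: "f x = h (g (f x))"
        using f.cod.minus_eq_zero_iff[OF f.closed h.closed[OF g.closed]] by simp
      hence "g (f x) \<in> {x \<in> carrier (P i). h x \<in> f ` carrier N}"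
        using x(1) by (simp del: lideal_simps)
      hence "g (f x) = \<zero>\<^bsub>P i\<^esub>" unfolding pre0 by blast
      thus "x = \<zero>" using fx h.zero f.inj_onD'[OF f(2) x(1)] by simp
    qed
    have "a_kernel I (P i) g \<noteq> carrier I"
    proof
      assume a: "a_kernel I (P i) g = carrier I"
      have "?s \<subseteq> {\<zero>\<^bsub>P i\<^esub>}"
      proof
        fix x assume "x \<in> ?s"
        hence x: "x \<in> carrier (P i)" by (rule lsub_mem[OF s])
        hence "h x \<in> a_kernel I (P i) g" unfolding a by (rule)
        thus "x \<in> {\<zero>\<^bsub>P i\<^esub>}" using gh[OF x] by simp
      qed
      thus False using simple_moduleD(2)[OF P_soc(1)[OF i(1)]] lsub_zero[OF s] by auto
    qed
    hence "mdim ?I < mdim I" by (rule mdim_mono_carrier(2)[OF fd g.ker_submodule])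
    thus False using min[OF pI m minj] by simp
  qed
  thus ?thesis using I f by blast
qed

text \<open>For the hull I of N the sequence N \<rightarrow> I \<rightarrow> L has the shape of
  \<open>exact_step\<close> with N as kernel, and its formulas are read from N to L. Excluding
  simple N is what makes the socle of the kernel equal to its radical.\<close>

lemma omega_inv_step:
  fixes N :: "('a, 'k list) module" (structure)
  assumes N: "fd N" and ind: "indec N" and z: "rad2 N = {\<zero>}"
    and ns: "\<not> simple N"
  shows "\<exists>L :: ('a, 'k list) module. fd L \<and> indec L \<and> rad2 L = {\<zero>\<^bsub>L\<^esub>} \<and>
    (\<forall>i<r. t i L = s i N \<and> s i L + t i N = (\<Sum>k<r. s k N * E k i))"
proof -
  interpret N: left_module A N by (rule fd_lm[OF N])
  obtain I :: "('a, 'k list) module" and f where I: "projective I" and f: "f \<in> Hom N I" "inj_on f (carrier N)"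
    and ess: "\<And>W. lsub W I \<Longrightarrow> W \<inter> f ` carrier N = {\<zero>\<^bsub>I\<^esub>} \<Longrightarrow> W = {\<zero>\<^bsub>I\<^esub>}"
    using injective_hull_exists[OF N] by blast
  note fd = projectiveD[OF I] note lmI = fd_lm[OF fd]
  interpret f: lm_hom A N I f by (intro lm_homI N.left_module_axioms lmI f)
  let ?V = "f ` carrier N"
  have V: "lsub ?V I" by (rule f.image_submodule[OF N.lsub_carrier])
  obtain L :: "('a, 'k list) module" and p where L: "fd L" and p: "p \<in> Hom I L" "p ` carrier I = carrier L"
    and k: "a_kernel I L p = ?V" using klist_quotient[OF fd V] by blast
  note lmL = fd_lm[OF L]
  have b: "bij_betw f (carrier N) (carrier (submod I ?V))" using f(2) by (simp add: bij_betw_def)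
  have f': "f \<in> Hom N (submod I ?V)" by (rule mhom_corestrict[OF f(1)]) auto
  interpret f': lm_hom A N "submod I ?V" f
    by (intro lm_homI N.left_module_axioms f' f.cod.submod_lm V)
  have indV: "indec (submod I ?V)" by (rule f'.indec_of_bij[OF b ind])
  have nsV: "\<not> simple (submod I ?V)"
  proof
    assume "simple (submod I ?V)"
    moreover have "isom (submod I ?V) N"
      by (rule module_iso_sym[OF N.left_module_axioms f'.cod.left_module_axioms]) (use f' b in
        \<open>auto simp: module_iso_def\<close>)
    ultimately show False using ns module_iso_simple[OF _ N.left_module_axioms] by blast
  qed
  \<comment> \<open>rad^2 I is the socle of I, and every simple submodule meets the essential
    submodule N, hence lies in it. The opposite bound below holds because J^2 N = 0 puts N into the
    second socle of I.\<close>
  have Z1: "rad2 I \<subseteq> a_kernel I L p" unfolding k projective_soc[OF I, symmetric]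
  proof (rule soc_least[OF V])
    fix U assume U: "lsub U I" "simple (submod I U)"
    show "U \<subseteq> ?V"
      using f.cod.simple_Int[OF U V] ess[OF U(1)] simple_moduleD(2)[OF U(2)] by auto
  qed
  have "?V \<subseteq> ann I (soc A I)"
  proof -
    have zz: "b \<odot> (a \<odot> x) = \<zero>" if "a \<in> J" "b \<in> J" "x \<in> carrier N" for a b x
      using rad2_subset_iff[OF N N.lsub_0] z that by (auto simp: ann_def)
    have "b \<odot>\<^bsub>I\<^esub> (a \<odot>\<^bsub>I\<^esub> f x) = \<zero>\<^bsub>I\<^esub>" if "a \<in> J" "b \<in> J" "x \<in> carrier N" for a b x
      using arg_cong[OF zz[OF that], of f] that J_carrier by simp
    thus ?thesis unfolding soc_eq_ann[OF lmI] ann_def using J_carrier by auto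
  qed
  hence Z2: "a_kernel I L p \<subseteq> rad A I" using k projective_ann[OF I] by simp
  note step = exact_step[OF I lmL p Z1 Z2, unfolded k]
  have so: "soc A (submod I ?V) = rad A (submod I ?V)"
    by (rule indecomposable_soc[OF fd_submod[OF fd V] indV step(2) nsV])
  have neL: "carrier L \<noteq> {\<zero>\<^bsub>L\<^esub>}"
  proof
    assume "carrier L = {\<zero>\<^bsub>L\<^esub>}"
    hence "a_kernel I L p = carrier I" using mhom_closed[OF p(1)] by (auto simp: a_kernel_def')
    hence "submod I ?V = I" using k by simp
    hence "rad2 I = {\<zero>\<^bsub>I\<^esub>}" using step(2) by simp
    hence "carrier I = {\<zero>\<^bsub>I\<^esub>}" by (rule projective_rad2_zero[OF I])
    thus False using indV \<open>submod I ?V = I\<close> by (simp add: indecomposable_module_def)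
  qed
  have indL: "indec L"
  proof (rule indecomposable_cokernel[OF fd L p _ _ _ neL])
    show "indec (submod I (a_kernel I L p))" using indV k by simp
    show "W = {\<zero>\<^bsub>I\<^esub>}" if "lsub W I" "W \<inter> a_kernel I L p = {\<zero>\<^bsub>I\<^esub>}" for W
      using ess that k by simp
    show "\<exists>\<theta>\<in>Hom I I. \<forall>x\<in>carrier I. p (\<theta> x) = g x" if "g \<in> Hom I L" for g
      by (rule projective_lift[OF I fd L p that])
  qed
  have "t i L = s i N \<and> s i L + t i N = (\<Sum>k<r. s k N * E k i)" if i: "i < r" for i
  proof -
    have eq: "t j N = t j (submod I ?V)" "s j N = s j (submod I ?V)" if "j < r" for j
      using t_s_iso[OF N f'.cod.left_module_axioms f' b that] by auto
    have tL: "t j L = s j N" if "j < r" for j using step(4)[OF so that] eq(2)[OF that] by simp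
    thus ?thesis
      using step(5)[OF so i] eq(1)[OF i] sum.cong[of "{..<r}" "{..<r}" "\<lambda>k. t k L * E k i"
        "\<lambda>k. s k N * E k i"] tL i
      by simp
  qed
  thus ?thesis using L indL step(1) by blast
qed

end

section \<open>Extension groups\<close>

context fd_algebra begin

lemma precomp_linear:
  assumes M': "lmod M'" and N: "lmod N" and d: "d \<in> Hom M' M"
  shows "(\<lambda>g. \<lambda>x\<in>carrier M'. g (d x)) \<in> module_hom K (hom_space A M N) (hom_space A M' N)"
proof (rule module_homI)
  fix g assume "g \<in> carrier (hom_space A M N)"
  thus "(\<lambda>x\<in>carrier M'. g (d x)) \<in> carrier (hom_space A M' N)"
    using restrict_hom_space[OF M' mhom_comp[OF d]] by (auto simp: hom_space_simps)
qed (use mhom_closed[OF d] in \<open>auto simp: hom_space_simps fun_eq_iff\<close>)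

lemma precomp_lm_hom:
  assumes "lmod M" "lmod M'" "lmod N" "d \<in> Hom M' M"
  shows "lm_hom K (hom_space A M N) (hom_space A M' N) (\<lambda>g. \<lambda>x\<in>carrier M'. g (d x))"
  by (intro lm_homI precomp_linear vs_lm hom_space_vs assms)

lemma hom_cocycles_eq:
  "hom_cocycles A P d N n = hom_set A (P n) N (d n ` carrier (P (Suc n))) (carrier N)"
  by (auto simp: hom_cocycles_def hom_set_def hom_space_simps dest: mhom_closed)

text \<open>The resolution chosen in \<open>ext_space\<close> depends on M alone, so one resolution
  may be fixed for all degrees and all coefficient modules.\<close>

lemma ext_space_resolution:
  assumes ex: "\<exists>P d \<epsilon>. projective_resolution K A M P d \<epsilon>"
  shows "\<exists>P d \<epsilon>. projective_resolution K A M P d \<epsilon> \<and>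
    (\<forall>n (N :: ('a, 'n) module). ext_space K A n M N =
      quot_module (submod (hom_space A (P n) N) (hom_cocycles A P d N n)) (hom_coboundaries A P d N n))"
proof -
  let ?R = "\<lambda>(P, d, \<epsilon>). projective_resolution K A M P d \<epsilon>"
  obtain P d \<epsilon> where eq: "(SOME x. ?R x) = (P, d, \<epsilon>)"
    by (cases "SOME x. ?R x") auto
  have "\<exists>x. ?R x" using ex by auto
  hence "?R (SOME x. ?R x)" by (rule)
  thus ?thesis unfolding ext_space_def eq by auto
qed

lemma coboundaries_subspace:
  fixes n :: nat
  assumes R: "projective_resolution K A M P d \<epsilon>" and N: "lmod N"
  defines "C \<equiv> submod (hom_space A (P (Suc n)) N) (hom_cocycles A P d N (Suc n))"
  shows "left_module K C" "left_submodule K (hom_coboundaries A P d N (Suc n)) C"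
proof -
  have "projective (P k)" for k using R by (simp add: projective_resolution_def)
  hence P: "lmod (P k)" for k by (intro fd_lm[OF projectiveD])
  have d: "d k \<in> Hom (P (Suc k)) (P k)" for k
    using R unfolding projective_resolution_def by blast
  have ex: "d (Suc k) ` carrier (P (Suc (Suc k))) = a_kernel (P (Suc k)) (P k) (d k)" for k
    using R unfolding projective_resolution_def by blast
  interpret H: left_module K "hom_space A (P (Suc n)) N" by (intro vs_lm hom_space_vs P N)
  interpret N: left_module A N by (rule N)
  interpret D: lm_hom A "P (Suc (Suc n))" "P (Suc n)" "d (Suc n)" by (intro lm_homI P d)
  have Csub: "left_submodule K (hom_cocycles A P d N (Suc n)) (hom_space A (P (Suc n)) N)"
    unfolding hom_cocycles_eq by (rule hom_set_subspace[OF P N _ N.lsub_carrier]) auto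
  thus "left_module K C" unfolding C_def by (rule H.submod_lm)
  interpret R: lm_hom K "hom_space A (P n) N" "hom_space A (P (Suc n)) N" "\<lambda>g. \<lambda>x\<in>carrier (P (Suc n)). g (d n x)"
    by (intro precomp_lm_hom P N d)
  have "left_submodule K (hom_coboundaries A P d N (Suc n)) (hom_space A (P (Suc n)) N)"
    using R.image_submodule[OF R.dom.lsub_carrier] by simp
  moreover have "hom_coboundaries A P d N (Suc n) \<subseteq> hom_cocycles A P d N (Suc n)"
  proof
    fix f assume "f \<in> hom_coboundaries A P d N (Suc n)"
    then obtain g where g: "g \<in> carrier (hom_space A (P n) N)" "f = (\<lambda>x\<in>carrier (P (Suc n)). g (d n x))"
      by auto
    interpret g: lm_hom A "P n" N g
      by (intro lm_homI P N) (use g in \<open>simp add: hom_space_simps\<close>)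
    have "f (d (Suc n) x) = \<zero>\<^bsub>N\<^esub>" if "x \<in> carrier (P (Suc (Suc n)))" for x
      using ex[of n] that g(2) by (force simp: a_kernel_def')
    thus "f \<in> hom_cocycles A P d N (Suc n)"
      using R.closed[OF g(1)] unfolding hom_cocycles_def g(2) by blast
  qed
  ultimately show "left_submodule K (hom_coboundaries A P d N (Suc n)) C"
    unfolding C_def by (simp add: lsub_submod_iff[OF Csub])
qed

definition cov :: "('a, 'k list) module \<Rightarrow> ('a, 'k list) module \<times> ('k list \<Rightarrow> 'k list)" where
  "cov N = (SOME Qp. projective_cover K A (fst Qp) (snd Qp) N)"

text \<open>A concrete sequence of iterated syzygies, realised as submodules of chosen covers, in
  place of the relation \<open>is_Omega_pow\<close>.\<close>

primrec syz :: "('a, 'k list) module \<Rightarrow> nat \<Rightarrow> ('a, 'k list) module" where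
  "syz N 0 = N"
| "syz N (Suc n) = submod (fst (cov (syz N n))) (a_kernel (fst (cov (syz N n))) (syz N n) (snd (cov (syz N n))))"

text \<open>The identity of \<open>Y\<close> factors through \<open>Z \<oplus> Q\<close> with \<open>Q\<close> projective.\<close>

definition stable_retract :: "('a, 'k list) module \<Rightarrow> ('a, 'k list) module \<Rightarrow> bool" where
  "stable_retract Z Y \<longleftrightarrow> (\<exists>(Q :: ('a, 'k list) module) \<phi> \<psi> a b. projective Q \<and>
     \<phi> \<in> Hom Z Y \<and> \<psi> \<in> Hom Y Z \<and> a \<in> Hom Y Q \<and> b \<in> Hom Q Y \<and>
     (\<forall>y\<in>carrier Y. \<phi> (\<psi> y) \<oplus>\<^bsub>Y\<^esub> b (a y) = y))"

text \<open>A comparison in the spirit of Schanuel's lemma. The maps between Z and Y lift to P and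
  P', and the map b lifts to b1. The defect of these lifts from the identity of P' has values in the
  kernel over Y; on that kernel it supplies the summand that factors through P'.\<close>

lemma stable_retract_kernel:
  fixes P :: "('a, 'k list) module" and P' :: "('a, 'k list) module"
  assumes Z: "fd Z" and Y: "fd Y" and ret: "stable_retract Z Y"
    and P: "projective P" and p: "p \<in> Hom P Z" "p ` carrier P = carrier Z"
    and P': "projective P'" and p': "p' \<in> Hom P' Y" "p' ` carrier P' = carrier Y"
  shows "stable_retract (submod P (a_kernel P Z p)) (submod P' (a_kernel P' Y p'))"
proof -
  obtain Q :: "('a, 'k list) module" and \<phi> \<psi> a b where Q: "projective Q" and \<phi>: "\<phi> \<in> Hom Z Y"
    and \<psi>: "\<psi> \<in> Hom Y Z" and a: "a \<in> Hom Y Q" and b: "b \<in> Hom Q Y"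
    and id: "\<And>y. y \<in> carrier Y \<Longrightarrow> \<phi> (\<psi> y) \<oplus>\<^bsub>Y\<^esub> b (a y) = y"
    using ret unfolding stable_retract_def by blast
  note fdP = projectiveD[OF P] and fdP' = projectiveD[OF P']
  note lm = fd_lm[OF fdP] fd_lm[OF fdP'] fd_lm[OF Z] fd_lm[OF Y]
    fd_lm[OF projectiveD[OF Q]]
  obtain \<phi>1 where \<phi>1: "\<phi>1 \<in> Hom P P'" "\<And>x. x \<in> carrier P \<Longrightarrow> p' (\<phi>1 x) = \<phi> (p x)"
    using projective_lift[OF P fdP' Y p' mhom_comp[OF p(1) \<phi>]] by blast
  obtain \<psi>1 where \<psi>1: "\<psi>1 \<in> Hom P' P" "\<And>x. x \<in> carrier P' \<Longrightarrow> p (\<psi>1 x) = \<psi> (p' x)"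
    using projective_lift[OF P' fdP Z p mhom_comp[OF p'(1) \<psi>]] by blast
  obtain b1 where b1: "b1 \<in> Hom Q P'" "\<And>x. x \<in> carrier Q \<Longrightarrow> p' (b1 x) = b x"
    using projective_lift[OF Q fdP' Y p' b] by blast
  interpret p: lm_hom A P Z p by (intro lm_homI lm p)
  interpret p': lm_hom A P' Y p' by (intro lm_homI lm p')
  interpret \<phi>1: lm_hom A P P' \<phi>1 by (intro lm_homI lm \<phi>1)
  interpret \<psi>1: lm_hom A P' P \<psi>1 by (intro lm_homI lm \<psi>1)
  interpret \<phi>: lm_hom A Z Y \<phi> by (intro lm_homI lm \<phi>)
  interpret \<psi>: lm_hom A Y Z \<psi> by (intro lm_homI lm \<psi>)
  interpret a: lm_hom A Y Q a by (intro lm_homI lm a)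
  interpret b1: lm_hom A Q P' b1 by (intro lm_homI lm b1)
  let ?Z = "a_kernel P Z p" and ?Y = "a_kernel P' Y p'"
  let ?k = "\<lambda>x. \<phi>1 (\<psi>1 x) \<oplus>\<^bsub>P'\<^esub> b1 (a (p' x))"
  let ?h = "\<lambda>x. x \<ominus>\<^bsub>P'\<^esub> ?k x"
  have k: "?k \<in> Hom P' P'"
    by (rule p'.dom.lm_hom_add[OF lm_homI[OF lm(2,2) mhom_comp[OF \<psi>1(1) \<phi>1(1)]]
      lm_homI[OF lm(2,2) mhom_comp[OF mhom_comp[OF p'(1) a] b1(1)]]])
  have h: "?h \<in> Hom P' P'"
    by (rule p'.dom.lm_hom_sub[OF lm_homI[OF lm(2,2) mhom_id] lm_homI[OF lm(2,2) k]])
  have hY: "?h x \<in> ?Y" if x: "x \<in> carrier P'" for x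
    using \<phi>1(2) \<psi>1(2) b1(2) id x by auto
  have 1: "\<phi>1 \<in> Hom (submod P ?Z) (submod P' ?Y)"
    using \<phi>1 by (intro mhom_corestrict mhom_restrict) auto
  have 2: "\<psi>1 \<in> Hom (submod P' ?Y) (submod P ?Z)"
    using \<psi>1 by (intro mhom_corestrict mhom_restrict) auto
  have 3: "(\<lambda>x. x) \<in> Hom (submod P' ?Y) P'" by (rule mhom_incl) auto
  have 4: "?h \<in> Hom P' (submod P' ?Y)" by (rule mhom_corestrict[OF h hY])
  have 5: "\<phi>1 (\<psi>1 y) \<oplus>\<^bsub>P'\<^esub> ?h y = y" if "y \<in> ?Y" for y
    using that p'.dom.diff_add_cancel by (auto simp: p'.dom.a_comm)
  show ?thesis
    unfolding stable_retract_def
    by (rule, rule exI[of _ \<phi>1], rule exI[of _ \<psi>1], rule exI[of _ "\<lambda>x. x"], rule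
      exI[of _ ?h]) (use P' 1 2 3 4 5 in simp)
qed

end

context rad_cube_zero begin

lemma cov_cover:
  assumes N: "fd N" shows "projective_cover K A (fst (cov N)) (snd (cov N)) N"
proof -
  have "\<exists>Qp :: ('a, 'k list) module \<times> ('k list \<Rightarrow> 'k list). projective_cover K A (fst Qp) (snd Qp) N"
    using projective_cover_exists[OF si N] by auto
  thus ?thesis unfolding cov_def by (rule)
qed

lemma cov_hom:
  assumes "fd N"
  shows "projective (fst (cov N))" "snd (cov N) \<in> Hom (fst (cov N)) N"
    "snd (cov N) ` carrier (fst (cov N)) = carrier N" "lm_hom A (fst (cov N)) N (snd (cov N))"
  using cov_cover[OF assms] fd_lm[OF projectiveD] fd_lm[OF assms]
  by (auto simp: projective_cover_def intro!: lm_homI)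

lemma syz_fd: "fd N \<Longrightarrow> fd (syz N n)"
proof (induction n)
  case (Suc n)
  note c = cov_hom[OF Suc.IH[OF Suc.prems]]
  show ?case using fd_submod[OF projectiveD[OF c(1)] lm_hom.ker_submodule[OF c(4)]] by simp
qed simp

lemma syz_omega:
  assumes "fd N" "isom M N" shows "is_Omega_pow K A n M (syz N n)"
proof (induction n)
  case (Suc n)
  have "isom Z Z" for Z :: "('a, 'k list) module"
    unfolding module_iso_def by (intro bexI[OF _ mhom_id]) (simp add: bij_betw_def)
  hence "is_Omega K A (syz N n) (syz N (Suc n))"
    using cov_cover[OF syz_fd[OF assms(1), of]] syz_fd[OF assms(1), of "Suc n"] unfolding
      is_Omega_def
    by auto
  thus ?case using Suc by (auto simp del: syz.simps)
qed (use assms in simp)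

text \<open>Splices the chosen covers of the iterated syzygies of a copy N of M. It guarantees that
  the choice in \<open>ext_space\<close> picks an actual resolution.\<close>

lemma projective_resolution_exists:
  assumes M: "fd M"
  shows "\<exists>P d \<epsilon>. projective_resolution K A M P d \<epsilon>"
proof -
  obtain N :: "('a, 'k list) module" and \<phi> where N: "fd N" and \<phi>: "\<phi> \<in> Hom M N" "bij_betw \<phi> (carrier M) (carrier N)"
    using klist_copy[OF M] by blast
  interpret \<phi>: lm_hom A M N \<phi> by (intro lm_homI fd_lm[OF M] fd_lm[OF N] \<phi>)
  let ?\<psi> = "inv_into (carrier M) \<phi>"
  interpret \<psi>: lm_hom A N M ?\<psi>
    by (intro lm_homI fd_lm[OF M] fd_lm[OF N] \<phi>.inv_hom[OF \<phi>(2)])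
  let ?P = "\<lambda>n. fst (cov (syz N n))" and ?p = "\<lambda>n. snd (cov (syz N n))"
  note c = cov_hom[OF syz_fd[OF N]]
  note bi = bij_betw_inv_into[OF \<phi>(2)]
  have kz: "?\<psi> y = \<zero>\<^bsub>M\<^esub> \<longleftrightarrow> y = \<zero>\<^bsub>N\<^esub>" if "y \<in> carrier N" for y
    using \<psi>.inj_onD'[OF bij_betw_imp_inj_on[OF bi] that] by auto
  have ep2: "(\<lambda>x. ?\<psi> (?p 0 x)) ` carrier (?P 0) = carrier M"
    unfolding image_image[symmetric, of ?\<psi> "?p 0"] using c(3)[of 0] bi
    by (simp add: bij_betw_def)
  have ker0: "a_kernel (?P 0) M (\<lambda>x. ?\<psi> (?p 0 x)) = a_kernel (?P 0) N (?p 0)"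
    using kz mhom_closed[OF c(2)[of 0]] by (auto simp: a_kernel_def')
  have d: "?p (Suc n) \<in> Hom (?P (Suc n)) (?P n)" for n
    by (rule mhom_extend_codomain) (use c(2)[of "Suc n"] lsub_subset[OF lm_hom.ker_submodule[OF
      c(4)]] in auto)
  have im: "?p (Suc n) ` carrier (?P (Suc n)) = a_kernel (?P n) (syz N n) (?p n)" for n
    using c(3)[of "Suc n"] by simp
  have ker: "a_kernel (?P (Suc n)) (syz N (Suc n)) (?p (Suc n)) = a_kernel (?P (Suc n)) (?P n) (?p (Suc n))" for n
    by (simp add: a_kernel_def')
  have "projective_resolution K A M ?P (\<lambda>n. ?p (Suc n)) (\<lambda>x. ?\<psi> (?p 0 x))"
    unfolding projective_resolution_def using mhom_comp[OF c(2)[of 0] ] \<psi>.hom c(1) ep2 d im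
      ker0 ker
    by (simp del: syz.simps(2))
  thus ?thesis by blast
qed

text \<open>J^2 kills Y, hence also its image in R, which therefore lies in the second socle of R
  and so in rad R. Homomorphisms preserve radicals.\<close>

lemma through_projective_rad:
  fixes Y (structure)
  assumes Y: "fd Y" "rad2 Y = {\<zero>}" and R: "projective R" and M: "fd M"
    and u: "u \<in> Hom Y R" and g: "g \<in> Hom R M" and x: "x \<in> carrier Y"
  shows "g (u x) \<in> rad A M"
proof -
  note lm = fd_lm[OF Y(1)] fd_lm[OF projectiveD[OF R]] fd_lm[OF M]
  interpret u: lm_hom A Y R u by (intro lm_homI lm u)
  interpret g: lm_hom A R M g by (intro lm_homI lm g)
  have zz: "b \<odot> (a \<odot> x) = \<zero>" if "a \<in> J" "b \<in> J" for a b
    using rad2_subset_iff[OF Y(1) u.dom.lsub_0] Y(2) that x by (auto simp: ann_def)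
  have "b \<odot>\<^bsub>R\<^esub> (a \<odot>\<^bsub>R\<^esub> u x) = \<zero>\<^bsub>R\<^esub>" if "a \<in> J" "b \<in> J" for a b
    using arg_cong[OF zz[OF that], of u] that x J_carrier by simp
  hence "u x \<in> ann R (soc A R)" unfolding soc_eq_ann[OF lm(2)] ann_def using J_carrier x by auto
  thus ?thesis
    using projective_ann[OF R] rad_hom_image(1)[OF g.lm_hom_axioms projectiveD[OF R] M] by blast
qed

lemma projective_extend:
  assumes R: "projective R" and Q: "fd Q" and V: "lsub V Q"
    and u: "u \<in> Hom (submod Q V) R"
  shows "\<exists>h\<in>Hom Q R. \<forall>x\<in>V. h x = u x"
  using injective_extend[OF projective_injective[OF si R] fd_submod[OF Q V] Q mhom_incl[OF
    lsub_subset[OF V]] _ u]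
  by simp

text \<open>The resolution behind Ext need not be minimal. Its kernels still contain the minimal
  syzygies as retracts up to maps through projective modules, which is enough to pull factorisations
  back.\<close>

lemma syz_stable_retract:
  fixes P :: "nat \<Rightarrow> ('a, 'k list) module"
  assumes N: "fd N" and P: "\<And>k. projective (P k)"
    and q: "\<And>k. q k \<in> Hom (P k) (Z k)" "\<And>k. q k ` carrier (P k) = carrier (Z k)"
    and Z0: "Z 0 = N" and ZS: "\<And>k. Z (Suc k) = submod (P k) (a_kernel (P k) (Z k) (q k))"
  shows "fd (Z k) \<and> stable_retract (Z k) (syz N k)"
proof (induction k)
  case 0
  interpret N: left_module A N by (rule fd_lm[OF N])
  note c = cov_hom[OF N]
  have Q: "lmod (fst (cov N))" by (rule fd_lm[OF projectiveD[OF c(1)]])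
  have "stable_retract N N"
    unfolding stable_retract_def
    by (rule, rule exI[of _ "\<lambda>x. x"], rule exI[of _ "\<lambda>x. x"], rule, rule exI[of _
      "\<lambda>x. \<zero>\<^bsub>N\<^esub>"]) (use c(1) zero_hom[OF N.left_module_axioms Q]
      zero_hom[OF Q N.left_module_axioms] in \<open>simp add: mhom_id\<close>)
  thus ?case using N Z0 by simp
next
  case (Suc k)
  have lm: "lmod (P k)" "lmod (Z k)" using fd_lm projectiveD P Suc by blast+
  have "lm_hom A (P k) (Z k) (q k)" by (intro lm_homI lm q)
  hence "fd (Z (Suc k))"
    unfolding ZS by (intro fd_submod[OF projectiveD[OF P]] lm_hom.ker_submodule)
  moreover note c = cov_hom[OF syz_fd[OF N, of k]]
  have "stable_retract (Z (Suc k)) (syz N (Suc k))"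
    unfolding ZS syz.simps(2) using Suc by (intro stable_retract_kernel P q c syz_fd N) auto
  ultimately show ?case by simp
qed

text \<open>Factoring through the projective module R \<oplus> R', written as a sum of two
  factorisations so that no direct sum has to be moved to a module on coordinate lists.\<close>

definition projective_sum :: "('a, 'y) module \<Rightarrow> ('a, 'm) module \<Rightarrow> ('y \<Rightarrow> 'm) \<Rightarrow> bool" where
  "projective_sum Y M f \<longleftrightarrow> (\<exists>(R :: ('a, 'k list) module) (R' :: ('a, 'k list) module) u g u' g'.
    projective R \<and> projective R' \<and> u \<in> Hom Y R \<and> g \<in> Hom R M \<and> u' \<in> Hom Y R' \<and> g' \<in> Hom R' M \<and>
    (\<forall>x\<in>carrier Y. f x = g (u x) \<oplus>\<^bsub>M\<^esub> g' (u' x)))"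

text \<open>Vanishing of Ext^k says that every map from the k-th kernel to M extends to the
  projective module that contains this kernel. Writing the identity of \<open>syz N k\<close> as a
  map through the kernel plus a map through a projective module turns this into a factorisation of
  any f.\<close>

lemma ext_finite_factor:
  fixes M (structure)
  assumes M: "fd M" and fin: "ext_finite K A M"
    and N: "fd N" and \<phi>: "\<phi> \<in> Hom M N" "bij_betw \<phi> (carrier M) (carrier N)"
  shows "\<exists>n. \<forall>k>n. \<forall>f\<in>Hom (syz N k) M. projective_sum (syz N k) M f"
proof -
  note lmM = fd_lm[OF M]
  interpret \<phi>: lm_hom A M N \<phi> by (intro lm_homI lmM fd_lm[OF N] \<phi>)
  obtain P d \<epsilon> where res: "projective_resolution K A M P d \<epsilon>" and
    ext: "\<And>n. ext_space K A n M M = quot_module (submod (hom_space A (P n) M) (hom_cocycles A P d M n)) (hom_coboundaries A P d M n)"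
    using ext_space_resolution[OF projective_resolution_exists[OF M]] by blast
  obtain n where n: "\<And>k. k > n \<Longrightarrow> carrier (ext_space K A k M M) = {\<zero>\<^bsub>ext_space K A k M M\<^esub>}"
    using fin unfolding ext_finite_def by blast
  have P: "projective (P k)" and d: "d k \<in> Hom (P (Suc k)) (P k)"
    and ex: "d (Suc k) ` carrier (P (Suc (Suc k))) = a_kernel (P (Suc k)) (P k) (d k)"
    and ep: "\<epsilon> \<in> Hom (P 0) M" "\<epsilon> ` carrier (P 0) = carrier M" "d 0 ` carrier (P 1) = a_kernel (P 0) M \<epsilon>" for k
    using res unfolding projective_resolution_def by auto
  note lmP = fd_lm[OF projectiveD[OF P]]
  \<comment> \<open>\<open>Z (Suc j)\<close> is the image of d_j inside P_j, and \<open>q k\<close>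
    maps P_k onto \<open>Z k\<close>. Degree 0 is occupied by the copy N of M, so the augmentation
    becomes the first of these maps.\<close>
  define q where "q = (\<lambda>k x. case k of 0 \<Rightarrow> \<phi> (\<epsilon> x) | Suc j \<Rightarrow> d j x)"
  define Z where "Z = (\<lambda>k. case k of 0 \<Rightarrow> N | Suc j \<Rightarrow> submod (P j) (d j ` carrier (P (Suc j))))"
  have q: "q k \<in> Hom (P k) (Z k)" for k
  proof (cases k)
    case 0 thus ?thesis using mhom_comp[OF ep(1) \<phi>(1)] by (simp add: q_def Z_def)
  next
    case (Suc j) thus ?thesis
      using mhom_corestrict[OF d[of j], of "d j ` carrier (P (Suc j))"] by (simp add: q_def Z_def)
  qed
  have qs: "q k ` carrier (P k) = carrier (Z k)" for k
  proof (cases k)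
    case 0
    thus ?thesis
      unfolding q_def Z_def using ep(2) \<phi>(2)
      by (simp add: image_image[symmetric, of \<phi> \<epsilon>] bij_betw_def)
  qed (simp add: q_def Z_def)
  have ZS: "Z (Suc k) = submod (P k) (a_kernel (P k) (Z k) (q k))" for k
  proof (cases k)
    case 0
    have "\<phi> y = \<zero>\<^bsub>N\<^esub> \<longleftrightarrow> y = \<zero>" if "y \<in> carrier M" for y
      using \<phi>.inj_onD'[OF bij_betw_imp_inj_on[OF \<phi>(2)] that] by auto
    hence "a_kernel (P 0) N (q 0) = a_kernel (P 0) M \<epsilon>"
      using mhom_closed[OF ep(1)] by (auto simp: a_kernel_def' q_def)
    thus ?thesis using 0 ep(3) by (simp add: Z_def)
  next
    case (Suc j)
    show ?thesis using Suc ex by (simp add: a_kernel_def' q_def Z_def)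
  qed
  have Z0: "Z 0 = N" by (simp add: Z_def)
  have "projective_sum (syz N k) M f"
    if k: "k > n" and f: "f \<in> Hom (syz N k) M" for k f
  proof -
    obtain j where j: "k = Suc j" using k by (cases k) auto
    have fdZ: "fd (Z k)" and "stable_retract (Z k) (syz N k)"
      using syz_stable_retract[of N P q, OF N P q qs Z0 ZS] by auto
    then obtain Q :: "('a, 'k list) module" and \<alpha> \<psi> a b where Q: "projective Q"
      and hom: "\<alpha> \<in> Hom (Z k) (syz N k)" "\<psi> \<in> Hom (syz N k) (Z k)"
        "a \<in> Hom (syz N k) Q" "b \<in> Hom Q (syz N k)"
      and id: "\<And>y. y \<in> carrier (syz N k) \<Longrightarrow> \<alpha> (\<psi> y) \<oplus>\<^bsub>syz N k\<^esub> b (a y) = y"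
      unfolding stable_retract_def by blast
    have h: "(\<lambda>x. f (\<alpha> x)) \<in> Hom (Z k) M" by (rule mhom_comp[OF hom(1) f])
    \<comment> \<open>The pullback of f \<alpha> along P_k \<rightarrow> \<open>Z k\<close> is a
      cocycle. As a coboundary it comes from a map g on P_j, and g agrees with f \<alpha> on the
      submodule \<open>Z k\<close>.\<close>
    let ?w = "\<lambda>x\<in>carrier (P k). f (\<alpha> (d j x))"
    have qk: "q k = d j" by (simp add: q_def j)
    have w: "?w \<in> carrier (hom_space A (P k) M)"
      by (rule restrict_hom_space[OF lmP]) (use mhom_comp[OF q h] qk in simp)
    have "?w \<in> hom_cocycles A P d M k" unfolding hom_cocycles_def
    proof (intro CollectI conjI w ballI)
      fix x assume x: "x \<in> carrier (P (Suc k))"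
      hence 1: "d k x \<in> carrier (P k)" "d j (d k x) = \<zero>\<^bsub>Z k\<^esub>"
        using ex by (auto simp: a_kernel_def' Z_def j)
      interpret h: lm_hom A "Z k" M "\<lambda>x. f (\<alpha> x)"
        by (intro lm_homI h fd_lm[OF fdZ] lmM)
      show "?w (d k x) = \<zero>" using 1 by simp
    qed
    moreover
    have "hom_cocycles A P d M k \<subseteq> hom_coboundaries A P d M k"
    proof
      fix w assume w: "w \<in> hom_cocycles A P d M k"
      note sub = coboundaries_subspace[OF res lmM, of j, folded j]
      note pr = quot_proj[OF sub]
      have "w \<in> a_kernel (submod (hom_space A (P k) M) (hom_cocycles A P d M k)) (ext_space K A k M M) (\<lambda>x. hom_coboundaries A P d M k +>\<^bsub>submod (hom_space A (P k) M) (hom_cocycles A P d M k)\<^esub> x)"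
        using mhom_closed[OF pr(2), of] w n[OF k] unfolding ext by (simp add: a_kernel_def')
      thus "w \<in> hom_coboundaries A P d M k" using pr(4) unfolding ext by blast
    qed
    ultimately have "?w \<in> hom_coboundaries A P d M k" by blast
    then obtain g where g: "g \<in> carrier (hom_space A (P j) M)" "?w = (\<lambda>x\<in>carrier (P k). g (d j x))"
      using j by auto
    have g1: "g \<in> Hom (P j) M" using g(1) by (simp add: hom_space_simps)
    have gZ: "f (\<alpha> z) = g z" if z: "z \<in> carrier (Z k)" for z
    proof -
      have "z \<in> d j ` carrier (P k)" using z qs[of k] qk by simp
      then obtain x where x: "z = d j x" "x \<in> carrier (P k)" by (rule)
      show ?thesis using fun_cong[OF g(2), of x] x by simp
    qed
    have \<psi>': "\<psi> \<in> Hom (syz N k) (P j)"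
      by (rule mhom_extend_codomain) (use hom(2) mhom_closed[OF d] j in \<open>auto simp:
        Z_def\<close>)
    interpret f: lm_hom A "syz N k" M f by (intro lm_homI f lmM fd_lm[OF syz_fd[OF N]])
    have eq: "f x = g (\<psi> x) \<oplus> f (b (a x))" if x: "x \<in> carrier (syz N k)" for x
    proof -
      have cl: "\<psi> x \<in> carrier (Z k)" "\<alpha> (\<psi> x) \<in> carrier (syz N k)" "b (a x) \<in> carrier (syz N k)"
        using x hom mhom_closed by metis+
      show ?thesis using id[OF x] f.add[OF cl(2,3)] gZ[OF cl(1)] by simp
    qed
    show ?thesis
      unfolding projective_sum_def
      by (intro exI[of _ "P j"] exI[of _ Q] exI[of _ \<psi>] exI[of _ g] exI[of _ a] exI[of _
        "\<lambda>x. f (b x)"] conjI ballI P Q \<psi>' g1 hom(3) mhom_comp[OF hom(4) f] eq)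
  qed
  thus ?thesis by blast
qed

text \<open>f(JQ) = J f(Q) lies in J rad M = rad^2 M = 0.\<close>

lemma hom_rad_kills:
  fixes M (structure)
  assumes Q: "fd Q" and M: "fd M" "rad2 M = {\<zero>}"
    and f: "f \<in> Hom Q M" "\<And>x. x \<in> carrier Q \<Longrightarrow> f x \<in> rad A M" and x: "x \<in> rad A Q"
  shows "f x = \<zero>"
proof -
  interpret f: lm_hom A Q M f by (intro lm_homI fd_lm[OF Q] fd_lm[OF M(1)] f)
  have "f ` rad A Q = Jmul M (f ` carrier Q)"
    using rad_eq_Jmul[OF Q] Jmul_image[OF f.lm_hom_axioms, of "carrier Q"] by simp
  also have "\<dots> \<subseteq> rad2 M"
    unfolding rad2_def using f(2)
    by (intro Jmul_mono[OF f.cod.left_module_axioms _ lsub_subset[OF f.cod.rad_submodule]]) auto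
  finally show ?thesis using M(2) x by auto
qed

text \<open>Let P and Q be the covers of the k-th and of the next syzygy, and compose maps P
  \<rightarrow> M with Q \<rightarrow> P. A map in the kernel of this operation factors through the
  k-th syzygy and so has values in rad M; conversely, maps into rad M kill the next syzygy, which
  lies in rad P. The image is all of Hom(Q, rad M): such a map kills rad Q, descends to the next
  syzygy, there factors through projective modules, which are injective, and so extends to P.
  Counting dimensions and cancelling the radical terms gives the relation.\<close>

lemma ext_finite_recursion:
  fixes M (structure)
  assumes M: "fd M" "rad2 M = {\<zero>}" and fin: "ext_finite K A M"
    and N: "fd N" and \<phi>: "\<phi> \<in> Hom M N" "bij_betw \<phi> (carrier M) (carrier N)"
    and syz: "\<And>k. indec (syz N k)" "\<And>k. rad2 (syz N k) = {\<zero>\<^bsub>syz N k\<^esub>}"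
  shows "\<exists>n. \<forall>k>n. (\<Sum>i<r. t i (syz N k) * t i M) = (\<Sum>i<r. t i (syz N (Suc k)) * s i M)"
proof -
  interpret M: left_module A M by (rule fd_lm[OF M(1)])
  obtain n where n: "\<And>k f. k > n \<Longrightarrow> f \<in> Hom (syz N k) M \<Longrightarrow> projective_sum (syz N k) M f"
    using ext_finite_factor[OF M(1) fin N \<phi>] by blast
  have inrad: "f x \<in> rad A M" if k: "k > n" and f: "f \<in> Hom (syz N k) M" and x: "x \<in> carrier (syz N k)" for k f x
  proof -
    obtain R R' :: "('a, 'k list) module" and u g u' g' where
      *: "projective R" "projective R'" "u \<in> Hom (syz N k) R" "g \<in> Hom R M"
        "u' \<in> Hom (syz N k) R'" "g' \<in> Hom R' M" "f x = g (u x) \<oplus> g' (u' x)"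
      using n[OF k f] x unfolding projective_sum_def by blast
    note th = through_projective_rad[OF syz_fd[OF N] syz(2) _ M(1) _ _ x]
    show ?thesis
      unfolding *(7) by (rule lsub_add[OF M.rad_submodule th[OF *(1,3,4)] th[OF *(2,5,6)]])
  qed
  have "(\<Sum>i<r. t i (syz N k) * t i M) = (\<Sum>i<r. t i (syz N (Suc k)) * s i M)" if k: "k > n" for k
  proof -
    let ?Y = "syz N k" and ?Z = "syz N (Suc k)"
    let ?P = "fst (cov ?Y)" and ?p = "snd (cov ?Y)" and ?Q = "fst (cov ?Z)" and ?q = "snd (cov ?Z)"
    note fdY = syz_fd[OF N, of k] and fdZ = syz_fd[OF N, of "Suc k"]
    note c = cov_hom[OF fdY] and c' = cov_hom[OF fdZ]
    note fdP = projectiveD[OF c(1)] and fdQ = projectiveD[OF c'(1)]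
    note lmP = fd_lm[OF fdP] and lmQ = fd_lm[OF fdQ] and lmZ = fd_lm[OF fdZ]
    interpret p: lm_hom A ?P ?Y ?p by (rule c(4))
    interpret q: lm_hom A ?Q ?Z ?q by (rule c'(4))
    define V where "V = a_kernel ?P ?Y ?p"
    have Z: "?Z = submod ?P V" by (simp add: V_def)
    have V: "lsub V ?P" unfolding V_def by (rule p.ker_submodule)
    have qV: "?q ` carrier ?Q = V" using c'(3) by (simp add: V_def)
    have qP: "?q \<in> Hom ?Q ?P"
      by (rule mhom_extend_codomain) (use c'(2) Z lsub_subset[OF V] in simp_all)
    have Vrad: "V \<subseteq> rad A ?P"
      unfolding V_def by (rule cover_kernel_rad[OF fd_lm[OF fdY] cov_cover[OF fdY]])
    let ?R = "\<lambda>g. \<lambda>x\<in>carrier ?Q. g (?q x)"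
    have R: "?R \<in> module_hom K (submod (hom_space A ?P M) (hom_set A ?P M {} (carrier M))) (hom_space A ?Q M)"
      by (rule mhom_restrict[OF precomp_linear[OF lmQ M.left_module_axioms qP]]) (auto simp:
        hom_set_def)
    have ker: "?R f = \<zero>\<^bsub>hom_space A ?Q M\<^esub> \<longleftrightarrow> f \<in> hom_set A ?P M {} (rad A M)"
      if f: "f \<in> hom_set A ?P M {} (carrier M)" for f
    proof -
      have fh: "f \<in> Hom ?P M" using f by (simp add: hom_set_def hom_space_simps)
      interpret f: lm_hom A ?P M f by (intro lm_homI lmP M.left_module_axioms fh)
      have "?R f = \<zero>\<^bsub>hom_space A ?Q M\<^esub> \<longleftrightarrow> (\<forall>x\<in>V. f x = \<zero>)"
        unfolding qV[symmetric] by (auto simp: hom_space_simps fun_eq_iff)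
      also have "\<dots> \<longleftrightarrow> (\<forall>x\<in>carrier ?P. f x \<in> rad A M)"
      proof
        assume "\<forall>x\<in>V. f x = \<zero>"
        hence "a_kernel ?P ?Y ?p \<subseteq> a_kernel ?P M f" unfolding V_def by auto
        then obtain g where g: "g \<in> Hom ?Y M" "\<forall>x\<in>carrier ?P. g (?p x) = f x"
          using p.mhom_factor[OF c(3) f.lm_hom_axioms] by blast
        show "\<forall>x\<in>carrier ?P. f x \<in> rad A M"
          using inrad[OF k g(1)] g(2) p.closed by metis
      next
        assume "\<forall>x\<in>carrier ?P. f x \<in> rad A M"
        thus "\<forall>x\<in>V. f x = \<zero>" using hom_rad_kills[OF fdP M fh] Vrad by blast
      qed
      finally show ?thesis using f by (auto simp: hom_set_def)
    qed
    have im: "?R ` hom_set A ?P M {} (carrier M) = hom_set A ?Q M {} (rad A M)"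
    proof (intro equalityI subsetI)
      fix w assume "w \<in> ?R ` hom_set A ?P M {} (carrier M)"
      then obtain f where f: "f \<in> hom_set A ?P M {} (carrier M)" "w = ?R f" by blast
      have fh: "f \<in> Hom ?P M" using f(1) by (simp add: hom_set_def hom_space_simps)
      have "f \<in> Hom ?Z M" unfolding Z by (rule mhom_restrict[OF fh lsub_subset[OF V]])
      moreover have "Suc k > n" using k by simp
      ultimately have "f (?q x) \<in> rad A M" if "x \<in> carrier ?Q" for x
        using inrad that by blast
      moreover have "w \<in> carrier (hom_space A ?Q M)"
        unfolding f(2) by (rule restrict_hom_space[OF lmQ mhom_comp[OF qP fh]])
      ultimately show "w \<in> hom_set A ?Q M {} (rad A M)" unfolding hom_set_def f(2) by simp
    next
      fix w assume w: "w \<in> hom_set A ?Q M {} (rad A M)"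
      have wh: "w \<in> Hom ?Q M" "w \<in> carrier (hom_space A ?Q M)" "\<And>x. x \<in> carrier ?Q \<Longrightarrow> w x \<in> rad A M"
        using w by (auto simp: hom_set_def hom_space_simps)
      interpret w: lm_hom A ?Q M w by (intro lm_homI lmQ M.left_module_axioms wh)
      have "a_kernel ?Q ?Z ?q \<subseteq> a_kernel ?Q M w"
        using hom_rad_kills[OF fdQ M wh(1,3)] cover_kernel_rad[OF lmZ cov_cover[OF fdZ]]
        by (auto simp del: syz.simps)
      then obtain h where h: "h \<in> Hom ?Z M" "\<And>x. x \<in> carrier ?Q \<Longrightarrow> h (?q x) = w x"
        using q.mhom_factor[OF c'(3) w.lm_hom_axioms] by blast
      have "Suc k > n" using k by simp
      from n[OF this h(1)] obtain R R' :: "('a, 'k list) module" and u g u' g' where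
        R: "projective R" "projective R'" and
        u: "u \<in> Hom (submod ?P V) R" "u' \<in> Hom (submod ?P V) R'" and
        g: "g \<in> Hom R M" "g' \<in> Hom R' M" and
        hx: "\<And>x. x \<in> V \<Longrightarrow> h x = g (u x) \<oplus> g' (u' x)" unfolding Z projective_sum_def by auto
      obtain v where v: "v \<in> Hom ?P R" "\<And>x. x \<in> V \<Longrightarrow> v x = u x"
        using projective_extend[OF R(1) fdP V u(1)] by blast
      obtain v' where v': "v' \<in> Hom ?P R'" "\<And>x. x \<in> V \<Longrightarrow> v' x = u' x"
        using projective_extend[OF R(2) fdP V u(2)] by blast
      let ?F = "\<lambda>x. g (v x) \<oplus> g' (v' x)"
      have F: "?F \<in> Hom ?P M"
        by (rule p.dom.lm_hom_add[OF lm_homI[OF lmP M.left_module_axioms mhom_comp[OF v(1) g(1)]]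
          lm_homI[OF lmP M.left_module_axioms mhom_comp[OF v'(1) g(2)]]])
      let ?f = "\<lambda>x\<in>carrier ?P. ?F x"
      have f: "?f \<in> hom_set A ?P M {} (carrier M)"
        using restrict_hom_space[OF lmP F] mhom_closed[OF F] by (simp add: hom_set_def)
      have "w = ?R ?f"
      proof (rule hom_space_ext[OF wh(2)])
        show "?R ?f \<in> carrier (hom_space A ?Q M)"
          by (rule mhom_closed[OF precomp_linear[OF lmQ M.left_module_axioms qP]
            restrict_hom_space[OF lmP F]])
        show "w x = ?R ?f x" if x: "x \<in> carrier ?Q" for x
          using qV x h(2) hx v(2) v'(2) lsub_mem[OF V] by auto
      qed
      thus "w \<in> ?R ` hom_set A ?P M {} (carrier M)" using f by blast
    qed
    have "hdim ?P M {} (carrier M) = hdim ?P M {} (rad A M) + hdim ?Q M {} (rad A M)"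
      by (rule hdim_rank_nullity[OF fdP M(1) _ M.lsub_carrier hom_space_vs[OF lmQ
        M.left_module_axioms] R ker _ im]) (auto simp: hom_set_def dest: lsub_mem[OF
        M.rad_submodule])
    hence "(\<Sum>i<r. t i ?P * c i M) = (\<Sum>i<r. t i ?P * s i M) + (\<Sum>i<r. t i ?Q * s i M)"
      using projective_hom_count[OF c(1) M(1)] projective_hom_count[OF c'(1) M(1)] M.lsub_carrier
        M.rad_submodule
      by simp
    moreover
    have "t i ?P = t i ?Y" "t i ?Q = t i ?Z" if "i < r" for i
      using omega_step(4)[OF fdY syz(1,2) cov_cover[OF fdY] that] omega_step(4)[OF fdZ syz(1,2)
        cov_cover[OF fdZ] that]
      by auto
    ultimately have "(\<Sum>i<r. t i ?Y * c i M) = (\<Sum>i<r. t i ?Y * s i M) + (\<Sum>i<r. t i ?Z * s i M)"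
      by simp
    moreover have "(\<Sum>i<r. t i ?Y * c i M) = (\<Sum>i<r. t i ?Y * t i M) + (\<Sum>i<r. t i ?Y * s i M)"
      unfolding sum.distrib[symmetric]
      by (rule sum.cong) (use c_eq_t[OF _ M(1)] in \<open>simp_all add: algebra_simps\<close>)
    ultimately show ?thesis by simp
  qed
  thus ?thesis by blast
qed

end

section \<open>Ext^1 between simple modules\<close>

context fd_algebra begin

lemma dim_quot_module:
  fixes V :: "('k, 'v) module"
  assumes V: "vectorspace K V" "fdim V" and U: "left_submodule K U V"
  shows "vdim V = vdim (submod V U) + vdim (quot_module V U)"
proof -
  note q = quot_proj[OF vs_lm[OF V(1)] U]
  show ?thesis using rank_nullity_mhom[OF V(1) lm_vs[OF field_K q(1)] q(2) V(2)] q(3,4) by simp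
qed

end

context rad_cube_zero begin

text \<open>Q need not be the projective cover of S_i, but P_i splits off it: Q is P_i plus some Q',
  and the kernel is rad P_i plus Q'. Relative to the top of Q, one S_i is lost and the middle layer
  of P_i is gained.\<close>

lemma simple_cover_top:
  assumes Q: "projective Q" and i: "i < r" and j: "j < r"
    and p: "p \<in> Hom Q (S i)" "p ` carrier Q = carrier (S i)"
  shows "t j (submod Q (a_kernel Q (S i) p)) + (if i = j then 1 else 0) = t j Q + E i j"
    "rad A Q \<subseteq> a_kernel Q (S i) p"
proof -
  note fd = projectiveD[OF Q] note lm = fd_lm[OF fd] S_lm[OF i] P_lm[OF i]
  interpret p: lm_hom A Q "S i" p by (intro lm_homI lm p)
  let ?N = "a_kernel Q (S i) p"
  show radQ: "rad A Q \<subseteq> ?N"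
    using mhom_rad_simple[OF fd S_simple[OF i] p(1)] lsub_mem[OF p.dom.rad_submodule] by auto
  obtain y where y: "y \<in> efix (e i) (S i)" "y \<noteq> \<zero>\<^bsub>S i\<^esub>"
    by (rule e_S_nonzero[OF i])
  define q where "q = (\<lambda>x. x \<odot>\<^bsub>S i\<^esub> y)"
  have q: "q \<in> Hom (P i) (S i)"
    unfolding q_def by (rule lideal_hom[OF lm(2) e_carrier(1)[OF i] efixD(1)[OF y(1)]])
  have qs: "q ` carrier (P i) = carrier (S i)"
    unfolding q_def by (rule nonzero_smult_hom[OF S_simple[OF i] e_props(1)[OF i] y])
  have qk: "a_kernel (P i) (S i) q = rad A (P i)"
    unfolding q_def by (rule local_idem_ker[OF S_simple[OF i] P_local[OF i] y])
  interpret q: lm_hom A "P i" "S i" q by (intro lm_homI lm q)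
  obtain w where w: "w \<in> Hom Q (P i)" "\<And>x. x \<in> carrier Q \<Longrightarrow> q (w x) = p x"
    using projective_lift[OF Q P_fd[OF i] fd_simple[OF S_simple[OF i]] q qs p(1)] by blast
  interpret w: lm_hom A Q "P i" w by (intro lm_homI lm w)
  have ws: "w ` carrier Q = carrier (P i)"
  proof (rule nakayama[OF P_fd[OF i] w.image_submodule[OF p.dom.lsub_carrier]], rule subset_antisym)
    note im = w.image_submodule[OF p.dom.lsub_carrier] and rd = q.dom.rad_submodule
    show "w ` carrier Q <+>\<^bsub>P i\<^esub> rad A (P i) \<subseteq> carrier (P i)"
      by (rule lsub_subset[OF q.dom.lsub_sum[OF im rd]])
    show "carrier (P i) \<subseteq> w ` carrier Q <+>\<^bsub>P i\<^esub> rad A (P i)"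
    proof
      fix x assume x: "x \<in> carrier (P i)"
      have "q x \<in> p ` carrier Q" unfolding p(2) by (rule q.closed[OF x])
      then obtain z where z: "q x = p z" "z \<in> carrier Q" by (rule)
      have k: "x \<ominus>\<^bsub>P i\<^esub> w z \<in> rad A (P i)"
        using z w(2) q.eq_iff_diff_ker[OF x w.closed[OF z(2)]] qk by simp
      let ?s = "w ` carrier Q <+>\<^bsub>P i\<^esub> rad A (P i)"
      have "w z \<in> ?s" "x \<ominus>\<^bsub>P i\<^esub> w z \<in> ?s"
        using q.dom.set_add_upper[OF im rd] k z(2) by blast+
      thus "x \<in> ?s" by (rule q.dom.lsub_diffD[OF q.dom.lsub_sum[OF im rd] x])
    qed
  qed
  obtain u where u: "u \<in> Hom (P i) Q" "\<And>x. x \<in> carrier (P i) \<Longrightarrow> w (u x) = x"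
    using projective_split[OF P_projective[OF i] fd w(1) ws] by blast
  interpret u: lm_hom A "P i" Q u by (intro lm_homI lm u)
  have wN: "w ` ?N = rad A (P i)"
  proof
    show "w ` ?N \<subseteq> rad A (P i)" using w w.closed qk by auto
    show "rad A (P i) \<subseteq> w ` ?N"
    proof
      fix x assume x: "x \<in> rad A (P i)"
      have xP: "x \<in> carrier (P i)" "q x = \<zero>\<^bsub>S i\<^esub>"
        using x qk q.ker_iff by blast+
      show "x \<in> w ` ?N" using w(2)[OF u.closed] xP u(2) by force
    qed
  qed
  let ?D = "rad A (submod Q ?N)"
  have fdN: "fd (submod Q ?N)" by (rule fd_submod[OF fd p.ker_submodule])
  have D: "?D = Jmul Q ?N"
    using rad_eq_Jmul[OF fdN] Jmul_submod[OF lm(1) p.ker_submodule, of ?N] by simp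
  have Dsub: "lsub ?D Q"
    unfolding D by (rule Jmul_submodule[OF lm(1) lsub_subset[OF p.ker_submodule]])
  have Drad: "?D \<subseteq> rad A Q" by (rule p.dom.rad_submod_subset[OF p.ker_submodule])
  have wD: "w ` ?D = rad2 (P i)"
    unfolding D rad2_def Jmul_image[OF w.lm_hom_axioms lsub_subset[OF p.ker_submodule]] wN ..
  have wR: "w ` rad A Q = rad A (P i)"
    by (rule rad_hom_image(3)[OF w.lm_hom_axioms fd P_fd[OF i] ws])
  have count: "c j (submod Q U) = c j (submod Q {x \<in> U. w x = \<zero>\<^bsub>P i\<^esub>}) + c j (submod (P i) (w ` U))"
    if U: "lsub U Q" for U
  proof -
    have wU: "lsub (w ` U) (P i)" by (rule w.image_submodule[OF U])
    have 1: "w \<in> Hom (submod Q U) (submod (P i) (w ` U))"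
      by (rule mhom_corestrict[OF mhom_restrict[OF w(1) lsub_subset[OF U]]]) simp
    show ?thesis
      using c_surj[OF j fd_submod[OF fd U] q.dom.submod_lm[OF wU] 1] by (auto simp: a_kernel_def')
  qed
  \<comment> \<open>Such a z is fixed by 1 - u w, an endomorphism that maps Q into the kernel of p.
    It therefore carries JQ into J times that kernel, which is its radical.\<close>
  have "z \<in> ?D" if z: "z \<in> rad A Q" "w z = \<zero>\<^bsub>P i\<^esub>" for z
  proof -
    let ?k = "\<lambda>x. x \<ominus>\<^bsub>Q\<^esub> u (w x)"
    have k: "?k \<in> Hom Q Q"
      by (rule p.dom.lm_hom_sub[OF lm_homI[OF lm(1,1) mhom_id] lm_homI[OF lm(1,1) mhom_comp[OF w(1)
        u(1)]]])
    interpret k: lm_hom A Q Q ?k by (intro lm_homI lm k)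
    have kN: "?k x \<in> ?N" if x: "x \<in> carrier Q" for x
      using w(2)[OF u.closed[OF w.closed[OF x]]] u(2)[OF w.closed[OF x]] w(2)[OF x]
        p.eq_iff_diff_ker[OF x u.closed[OF w.closed[OF x]]]
      by auto
    have zQ: "z \<in> carrier Q" by (rule lsub_mem[OF p.dom.rad_submodule z(1)])
    have "z \<in> ?k ` rad A Q" using z(2) zQ imageI[OF z(1), of ?k] by (simp del: lideal_simps)
    also have "?k ` rad A Q = Jmul Q (?k ` carrier Q)"
      using rad_eq_Jmul[OF fd] Jmul_image[OF k.lm_hom_axioms, of "carrier Q"] by simp
    also have "\<dots> \<subseteq> ?D"
      unfolding D using kN by (intro Jmul_mono[OF lm(1) _ lsub_subset[OF p.ker_submodule]]) blast
    finally show ?thesis .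
  qed
  hence "{x \<in> rad A Q. w x = \<zero>\<^bsub>P i\<^esub>} = {x \<in> ?D. w x = \<zero>\<^bsub>P i\<^esub>}"
    using Drad by blast
  hence 1: "c j (submod Q (rad A Q)) = c j (submod Q ?D) + E i j"
    using count[OF p.dom.rad_submodule] count[OF Dsub] wD wR c_E[OF i j] by simp
  show "t j (submod Q ?N) + (if i = j then 1 else 0) = t j Q + E i j"
    using c_surj[OF j fd lm(2) p] c_S[OF j i] 1 c_eq_t[OF j fd] c_eq_t[OF j fdN] by simp
qed

text \<open>The dimension is that of cocycles minus that of coboundaries. With N the kernel of P_0
  \<rightarrow> S_i the former is \<open>t j N\<close> and the latter is \<open>t j (P 0)\<close>
  less one if i = j; \<open>simple_cover_top\<close> evaluates the difference.\<close>

lemma ext_dim: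
  assumes i: "i < r" and j: "j < r"
  shows "vdim (ext_space K A 1 (S i) (S j)) = E i j"
proof -
  obtain P d \<epsilon> where res: "projective_resolution K A (S i) P d \<epsilon>" and
    ext: "ext_space K A 1 (S i) (S j) = quot_module (submod (hom_space A (P 1) (S j)) (hom_cocycles A P d (S j) 1)) (hom_coboundaries A P d (S j) 1)"
    using ext_space_resolution[OF projective_resolution_exists[OF fd_simple[OF S_simple[OF i]]],
      where 'n = 's]
    by blast
  have P: "projective (P k)" and d: "d k \<in> Hom (P (Suc k)) (P k)"
    and ex: "d (Suc k) ` carrier (P (Suc (Suc k))) = a_kernel (P (Suc k)) (P k) (d k)"
    and ep: "\<epsilon> \<in> Hom (P 0) (S i)" "\<epsilon> ` carrier (P 0) = carrier (S i)" "d 0 ` carrier (P 1) = a_kernel (P 0) (S i) \<epsilon>" for k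
    using res unfolding projective_resolution_def by auto
  note fdP = projectiveD[OF P] note lmP = fd_lm[OF fdP]
  note fdS = fd_simple[OF S_simple[OF j]] note lmS = S_lm[OF j]
  interpret S: left_module A "S j" by (rule lmS)
  interpret ep: lm_hom A "P 0" "S i" \<epsilon> by (intro lm_homI lmP S_lm[OF i] ep)
  let ?N = "a_kernel (P 0) (S i) \<epsilon>"
  have N: "lsub ?N (P 0)" by (rule ep.ker_submodule)
  have fdN: "fd (submod (P 0) ?N)" by (rule fd_submod[OF fdP N])
  note lmN = fd_lm[OF fdN]
  have isoS: "isom (S j) (S j)"
    unfolding module_iso_def by (intro bexI[OF _ mhom_id]) (simp add: bij_betw_def)
  let ?H = "hom_space A (P 1) (S j)"
  define C where "C = hom_set A (P 1) (S j) (a_kernel (P 1) (P 0) (d 0)) (carrier (S j))"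
  define B where "B = hom_coboundaries A P d (S j) 1"
  have d0: "d 0 \<in> Hom (P 1) (P 0)" using d by simp
  interpret d: lm_hom A "P 1" "P 0" "d 0" by (intro lm_homI lmP d0)
  have d0N: "d 0 \<in> Hom (P 1) (submod (P 0) ?N)"
    by (rule mhom_corestrict[OF d0]) (use ep(3) in blast)
  have kN: "a_kernel (P 1) (submod (P 0) ?N) (d 0) = a_kernel (P 1) (P 0) (d 0)"
    by (simp add: a_kernel_def')
  interpret n: lm_hom A "P 1" "submod (P 0) ?N" "d 0" by (intro lm_homI lmP lmN d0N)
  have CC: "hom_cocycles A P d (S j) 1 = C" unfolding C_def hom_cocycles_eq using ex by simp
  have kerS: "a_kernel (P 1) (P 0) (d 0) \<subseteq> carrier (P 1)"
    by (rule lsub_subset[OF d.ker_submodule])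
  have Csub: "left_submodule K C ?H"
    unfolding C_def by (rule hom_set_subspace[OF lmP lmS kerS S.lsub_carrier])
  note H = hom_space_vs[OF lmP[of 1] lmS]
  \<comment> \<open>Cocycles in degree 1 are the maps N \<rightarrow> S_j, pulled back along P_1
    \<rightarrow> N.\<close>
  have dimC: "t j (submod (P 0) ?N) = vdim (submod ?H C)"
  proof -
    let ?R = "\<lambda>g. \<lambda>x\<in>carrier (P 1). g (d 0 x)"
    let ?L = "hom_set A (submod (P 0) ?N) (S j)"
    have "hdim (submod (P 0) ?N) (S j) {} (carrier (S j)) =
        hdim (submod (P 0) ?N) (S j) {} {\<zero>\<^bsub>S j\<^esub>} + vdim (submod ?H C)"
    proof (rule hdim_rank_nullity[OF fdN fdS _ S.lsub_carrier H, where R = ?R])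
      show "?R \<in> module_hom K (submod (hom_space A (submod (P 0) ?N) (S j)) (?L {} (carrier (S j)))) ?H"
        by (rule mhom_restrict[OF precomp_linear[OF lmP lmS d0N]]) (auto simp: hom_set_def)
      show "?R f = \<zero>\<^bsub>?H\<^esub> \<longleftrightarrow> f \<in> ?L {} {\<zero>\<^bsub>S j\<^esub>}" if "f \<in> ?L {} (carrier (S j))" for f
      proof -
        have "?R f = \<zero>\<^bsub>?H\<^esub> \<longleftrightarrow> (\<forall>x\<in>?N. f x = \<zero>\<^bsub>S j\<^esub>)"
          unfolding ep(3)[symmetric] by (auto simp: hom_space_simps fun_eq_iff)
        thus ?thesis using that by (auto simp: hom_set_def)
      qed
      show "?L {} {\<zero>\<^bsub>S j\<^esub>} \<subseteq> ?L {} (carrier (S j))"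
        by (auto simp: hom_set_def)
      show "?R ` ?L {} (carrier (S j)) = C"
      proof (intro equalityI subsetI)
        fix f assume "f \<in> ?R ` ?L {} (carrier (S j))"
        then obtain g where g: "g \<in> ?L {} (carrier (S j))" "f = ?R g" by blast
        hence gh: "g \<in> carrier (hom_space A (submod (P 0) ?N) (S j))" by (simp add: hom_set_def)
        have "f \<in> carrier ?H"
          unfolding g(2) by (rule mhom_closed[OF precomp_linear[OF lmP lmS d0N] gh])
        moreover interpret g: lm_hom A "submod (P 0) ?N" "S j" g
          by (intro lm_homI lmN lmS) (use gh in \<open>simp add: hom_space_simps\<close>)
        have "g \<zero>\<^bsub>P 0\<^esub> = \<zero>\<^bsub>S j\<^esub>" using g.zero by simp
        ultimately show "f \<in> C"
          using g(2) unfolding C_def hom_set_def by (auto simp: simp del: One_nat_def)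
      next
        fix f assume f: "f \<in> C"
        hence fh: "f \<in> carrier ?H" "f \<in> Hom (P 1) (S j)"
          by (auto simp: C_def hom_set_def hom_space_simps)
        interpret f: lm_hom A "P 1" "S j" f by (intro lm_homI lmP lmS fh)
        have "a_kernel (P 1) (submod (P 0) ?N) (d 0) \<subseteq> a_kernel (P 1) (S j) f"
          unfolding kN using f by (auto simp: C_def hom_set_def simp del: One_nat_def)
        then obtain g where g: "g \<in> Hom (submod (P 0) ?N) (S j)" "\<And>x. x \<in> carrier (P 1) \<Longrightarrow> g (d 0 x) = f x"
          using n.mhom_factor[OF _ f.lm_hom_axioms] ep(3) by auto
        let ?g = "\<lambda>x\<in>?N. g x"
        have gh: "?g \<in> carrier (hom_space A (submod (P 0) ?N) (S j))"
          using restrict_hom_space[OF lmN g(1)] by simp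
        have "f = ?R ?g"
        proof (rule hom_space_ext[OF fh(1) mhom_closed[OF precomp_linear[OF lmP lmS d0N] gh]])
          show "f x = ?R ?g x" if "x \<in> carrier (P 1)" for x using ep(3) that g(2) by auto
        qed
        moreover have "?g \<in> ?L {} (carrier (S j))"
          using gh mhom_closed[OF g(1)] by (simp add: hom_set_def)
        ultimately show "f \<in> ?R ` ?L {} (carrier (S j))" by blast
      qed
    qed simp
    moreover have "hdim (submod (P 0) ?N) (S j) {} {\<zero>\<^bsub>S j\<^esub>} = 0"
      by (rule hdim_zero[OF fdN fdS _ S.lsub_0]) (auto simp: hom_set_def)
    ultimately show ?thesis
      using hdim_full[of "submod (P 0) ?N" "S j"] hom_top_dim[OF j fdN S_simple[OF j] isoS] by simp
  qed
  note top = simple_cover_top[OF P i j ep(1,2)]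
  \<comment> \<open>Coboundaries are Hom(P_0, S_j) modulo the maps that vanish on N, which are the
    maps from S_i to S_j.\<close>
  have dimB: "t j (P 0) = (if i = j then 1 else 0) + vdim (submod ?H B)"
  proof -
    let ?R = "\<lambda>g. \<lambda>x\<in>carrier (P 1). g (d 0 x)"
    let ?L = "hom_set A (P 0) (S j)"
    have "hdim (P 0) (S j) {} (carrier (S j)) = hdim (P 0) (S j) ?N (carrier (S j)) + vdim (submod ?H B)"
    proof (rule hdim_rank_nullity[OF fdP fdS _ S.lsub_carrier H, where R = ?R])
      show "?R \<in> module_hom K (submod (hom_space A (P 0) (S j)) (?L {} (carrier (S j)))) ?H"
        by (rule mhom_restrict[OF precomp_linear[OF lmP lmS d0]]) (auto simp: hom_set_def)
      show "?R f = \<zero>\<^bsub>?H\<^esub> \<longleftrightarrow> f \<in> ?L ?N (carrier (S j))" if "f \<in> ?L {} (carrier (S j))" for f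
      proof -
        have "?R f = \<zero>\<^bsub>?H\<^esub> \<longleftrightarrow> (\<forall>x\<in>?N. f x = \<zero>\<^bsub>S j\<^esub>)"
          unfolding ep(3)[symmetric] by (auto simp: hom_space_simps fun_eq_iff)
        thus ?thesis using that by (auto simp: hom_set_def)
      qed
      show "?L ?N (carrier (S j)) \<subseteq> ?L {} (carrier (S j))" by (auto simp: hom_set_def)
      have "?L {} (carrier (S j)) = carrier (hom_space A (P 0) (S j))"
        by (auto simp: hom_set_def hom_space_simps dest: mhom_closed)
      thus "?R ` ?L {} (carrier (S j)) = B" unfolding B_def by simp
    qed simp
    moreover have "hdim (P 0) (S j) ?N (carrier (S j)) + c j (submod (P 0) ?N) = c j (P 0)"
      by (rule semisimple_hom_count[OF j fdP S_simple[OF j] isoS N top(2)])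
    moreover have "c j (P 0) = c j (submod (P 0) ?N) + (if i = j then 1 else 0)"
      using c_surj[OF j fdP S_lm[OF i] ep(1,2)] c_S[OF j i] by auto
    ultimately show ?thesis
      using hdim_full[of "P 0" "S j"] hom_top_dim[OF j fdP S_simple[OF j] isoS] by simp
  qed
  have Bsub: "left_submodule K B (submod ?H C)"
    using coboundaries_subspace(2)[OF res lmS, of 0] CC unfolding B_def by simp
  have "vdim (submod ?H C) = vdim (submod ?H B) + vdim (ext_space K A 1 (S i) (S j))"
    using dim_quot_module[OF vectorspace_submod[OF H Csub] submod_fin_dim[OF H hom_space_fin_dim[OF
      fdP fdS] Csub] Bsub] unfolding ext CC B_def
    by simp
  thus ?thesis using dimC dimB top(1) by simp
qed

end

section \<open>Perron vectors\<close>

text \<open>Bolzano-Weierstrass for vectors given as functions on indices below r: the subsequence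
  is refined once per coordinate.\<close>

lemma simultaneous_convergent_subseq:
  fixes x :: "nat \<Rightarrow> nat \<Rightarrow> real"
  assumes "\<And>n i. i < r \<Longrightarrow> \<bar>x n i\<bar> \<le> 1"
  shows "\<exists>\<sigma> l. strict_mono \<sigma> \<and> (\<forall>i<r. (\<lambda>n. x (\<sigma> n) i) \<longlonglongrightarrow> l i)"
  using assms
proof (induction r)
  case 0
  thus ?case by (intro exI) (auto simp: strict_mono_def)
next
  case (Suc r)
  have "\<exists>\<sigma> l. strict_mono \<sigma> \<and> (\<forall>i<r. (\<lambda>n. x (\<sigma> n) i) \<longlonglongrightarrow> l i)"
    by (rule Suc.IH, rule Suc.prems) simp
  then obtain \<sigma> l where \<sigma>: "strict_mono \<sigma>" "\<forall>i<r. (\<lambda>n. x (\<sigma> n) i) \<longlonglongrightarrow> l i"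
    by blast
  let ?y = "\<lambda>n. x (\<sigma> n) r"
  obtain \<tau> where \<tau>: "strict_mono \<tau>" "monoseq (\<lambda>n. ?y (\<tau> n))"
    using seq_monosub[of ?y] by blast
  have "Bseq (\<lambda>n. ?y (\<tau> n))" by (rule BseqI'[where K = 1]) (use Suc.prems in simp)
  then obtain a where a: "(\<lambda>n. ?y (\<tau> n)) \<longlonglongrightarrow> a"
    using Bseq_monoseq_convergent[OF _ \<tau>(2)] by (auto simp: convergent_def)
  have "(\<lambda>n. x ((\<sigma> \<circ> \<tau>) n) i) \<longlonglongrightarrow> (l(r := a)) i" if "i < Suc r" for i
    using that a LIMSEQ_subseq_LIMSEQ[OF \<sigma>(2)[rule_format] \<tau>(1), of]
    by (cases "i = r") (auto simp: o_def)
  thus ?case using strict_mono_o[OF \<sigma>(1) \<tau>(1)] by blast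
qed

lemma linear_dependence:
  fixes z :: "nat \<Rightarrow> nat \<Rightarrow> real"
  shows "\<exists>c. (\<exists>j\<le>d. c j \<noteq> 0) \<and> (\<forall>i<d. (\<Sum>j\<le>d. c j * z j i) = 0)"
proof -
  let ?n = "Suc d"
  \<comment> \<open>The columns are the d + 1 given vectors; the extra row with index d is zero,
    which makes the square matrix singular.\<close>
  let ?B = "mat ?n ?n (\<lambda>(i, j). if i < d then z j i else 0)"
  have B: "?B \<in> carrier_mat ?n ?n" by simp
  moreover have "unit_vec ?n d \<noteq> (0\<^sub>v ?n :: real vec)" by auto
  ultimately have "det ?B = 0"
    using det_0_iff_vec_prod_zero[of "transpose_mat ?B" ?n] unit_vec_carrier det_transpose[OF B]
    by fastforce
  then obtain v where v: "v \<in> carrier_vec ?n" "v \<noteq> 0\<^sub>v ?n" "?B *\<^sub>v v = 0\<^sub>v ?n"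
    using det_0_iff_vec_prod_zero[OF B] by blast
  have "\<exists>j\<le>d. v $ j \<noteq> 0" using v(1,2) by auto
  moreover have "(\<Sum>j\<le>d. v $ j * z j i) = 0" if i: "i < d" for i
  proof -
    have "(?B *\<^sub>v v) $ i = (\<Sum>j\<in>{0..<?n}. z j i * v $ j)"
      using i v(1) by (simp add: scalar_prod_def)
    moreover have "{0..<?n} = {..d}" by auto
    ultimately show ?thesis using v(3) i by (simp add: mult.commute)
  qed
  ultimately show ?thesis by (intro exI[of _ "\<lambda>j. v $ j"]) blast
qed

text \<open>Vectors are functions on all natural numbers, of which \<open>dot\<close> sees only the
  values below r. Requiring \<open>E\<close> to vanish beyond r lets identities of vectors be
  equalities of functions.\<close>

locale perron =
  fixes r :: nat and E :: "nat \<Rightarrow> nat \<Rightarrow> real"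
  assumes r: "r > 0" and sym: "E i j = E j i" and nonneg: "E i j \<ge> 0" and supp: "i \<ge> r \<Longrightarrow> E i j = 0"
    and irr: "\<lbrakk>I \<subseteq> {..<r}; I \<noteq> {}; \<And>i j. i \<in> I \<Longrightarrow> j < r \<Longrightarrow> j \<notin> I \<Longrightarrow> E i j = 0\<rbrakk> \<Longrightarrow> I = {..<r}"
begin

definition dot :: "(nat \<Rightarrow> real) \<Rightarrow> (nat \<Rightarrow> real) \<Rightarrow> real" where "dot x y = (\<Sum>i<r. x i * y i)"

definition ap :: "(nat \<Rightarrow> real) \<Rightarrow> nat \<Rightarrow> real" where "ap x = (\<lambda>i. \<Sum>j<r. E i j * x j)"

lemma dot_comm: "dot x y = dot y x" by (simp add: dot_def mult.commute)

lemma dot_lin [simp]: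
  "dot x (\<lambda>i. y i + z i) = dot x y + dot x z" "dot x (\<lambda>i. y i - z i) = dot x y - dot x z"
  "dot x (\<lambda>i. a * y i) = a * dot x y" "dot x (\<lambda>i. 0) = 0"
  by (simp_all add: dot_def sum.distrib sum_subtractf sum_distrib_left algebra_simps)

lemma dot_lin_left [simp]:
  "dot (\<lambda>i. y i + z i) x = dot y x + dot z x" "dot (\<lambda>i. y i - z i) x = dot y x - dot z x"
  "dot (\<lambda>i. a * y i) x = a * dot y x" by (simp_all add: dot_comm)

lemma ap_lin [simp]:
  "ap (\<lambda>i. y i + z i) = (\<lambda>i. ap y i + ap z i)" "ap (\<lambda>i. y i - z i) = (\<lambda>i. ap y i - ap z i)"
  "ap (\<lambda>i. a * y i) = (\<lambda>i. a * ap y i)" "ap (\<lambda>i. 0) = (\<lambda>i. 0)"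
  by (simp_all add: ap_def sum.distrib sum_subtractf sum_distrib_left algebra_simps)

lemma ap_supp: "i \<ge> r \<Longrightarrow> ap x i = 0" by (simp add: ap_def supp)

lemma dot_ap: "dot x (ap y) = dot (ap x) y"
proof -
  have "dot x (ap y) = (\<Sum>i<r. \<Sum>j<r. E j i * x i * y j)"
    by (simp add: dot_def ap_def sum_distrib_left sym algebra_simps)
  also have "\<dots> = (\<Sum>j<r. \<Sum>i<r. E j i * x i * y j)" by (rule sum.swap)
  also have "\<dots> = dot (ap x) y" by (simp add: dot_def ap_def sum_distrib_right)
  finally show ?thesis .
qed

lemma dot_cong: "(\<And>i. i < r \<Longrightarrow> x i = x' i) \<Longrightarrow> (\<And>i. i < r \<Longrightarrow> y i = y' i) \<Longrightarrow> dot x y = dot x' y'"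
  by (simp add: dot_def)

lemma ap_cong: "(\<And>i. i < r \<Longrightarrow> x i = x' i) \<Longrightarrow> ap x = ap x'" by (simp add: ap_def)

lemma dot_self: "dot x x \<ge> 0" by (simp add: dot_def sum_nonneg)

lemma dot_self_zero: "dot x x = 0 \<longleftrightarrow> (\<forall>i<r. x i = 0)"
  by (auto simp: dot_def sum_nonneg_eq_0_iff)

lemma unit_bound:
  assumes "dot x x = 1" "i < r" shows "\<bar>x i\<bar> \<le> 1"
proof -
  have "x i * x i \<le> dot x x" unfolding dot_def by (rule member_le_sum) (use assms in auto)
  thus ?thesis using assms(1) abs_le_square_iff[of "x i" 1] by (simp add: power2_eq_square)
qed

text \<open>At a zero of x the eigenvalue equation is a vanishing sum of nonnegative terms, so the
  zeros spread along the nonzero entries of \<open>E\<close> and, by irreducibility,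
  everywhere.\<close>

lemma nonneg_eigenvector:
  assumes x: "\<And>i. i < r \<Longrightarrow> x i \<ge> 0" "\<And>i. i < r \<Longrightarrow> ap x i = l * x i" and z: "k < r" "x k = 0" and i: "i < r"
  shows "x i = 0"
proof -
  let ?I = "{i. i < r \<and> x i = 0}"
  have "?I = {..<r}"
  proof (rule irr)
    show "?I \<noteq> {}" using z by blast
    fix i j assume i: "i \<in> ?I" and j: "j < r" "j \<notin> ?I"
    have "(\<Sum>j<r. E i j * x j) = 0" using x(2) i by (simp add: ap_def)
    moreover have "(\<Sum>j<r. E i j * x j) = 0 \<longleftrightarrow> (\<forall>j\<in>{..<r}. E i j * x j = 0)"
      by (rule sum_nonneg_eq_0_iff) (use nonneg x(1) in auto)
    ultimately show "E i j = 0" using j by auto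
  qed auto
  thus ?thesis using i by blast
qed

text \<open>The quadratic form is bounded on the unit sphere; a maximising sequence has a convergent
  subsequence, and the form is continuous. Scaling extends the bound to all vectors.\<close>

lemma rayleigh_maximum: "\<exists>x. dot x x = 1 \<and> (\<forall>y. dot y (ap y) \<le> dot x (ap x) * dot y y)"
proof -
  let ?f = "\<lambda>x. dot x (ap x)" and ?S = "{x. dot x x = 1}"
  have ne: "?S \<noteq> {}"
  proof -
    have "dot (\<lambda>i. if i = 0 then 1 else 0) (\<lambda>i. if i = 0 then 1 else 0) = (\<Sum>i<r. if i = 0 then 1 else 0)"
      unfolding dot_def by (rule sum.cong) auto
    also have "\<dots> = 1" using r by simp
    finally show ?thesis by blast
  qed
  have bd: "?f x \<le> (\<Sum>i<r. \<Sum>j<r. E i j)" if "x \<in> ?S" for x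
  proof -
    have "?f x = (\<Sum>i<r. \<Sum>j<r. E i j * (x i * x j))"
      by (simp add: dot_def ap_def sum_distrib_left algebra_simps)
    also have "\<dots> \<le> (\<Sum>i<r. \<Sum>j<r. E i j)"
    proof (intro sum_mono)
      fix i j assume "i \<in> {..<r}" "j \<in> {..<r}"
      hence "\<bar>x i\<bar> * \<bar>x j\<bar> \<le> 1 * 1"
        using unit_bound that by (intro mult_mono) auto
      thus "E i j * (x i * x j) \<le> E i j"
        using abs_mult[of "x i" "x j"] mult_left_mono[OF _ nonneg, of "x i * x j" 1] by simp
    qed
    finally show ?thesis .
  qed
  hence bdd: "bdd_above (?f ` ?S)" by (intro bdd_aboveI2)
  let ?m = "Sup (?f ` ?S)"
  have "\<exists>x. x \<in> ?S \<and> ?m - 1 / Suc n < ?f x" for n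
    using less_cSup_iff[OF _ bdd, of "?m - 1 / Suc n"] ne by auto
  hence "\<forall>n. \<exists>x. dot x x = 1 \<and> ?m - 1 / Suc n < ?f x" by simp
  from choice[OF this] obtain x where x: "\<And>n. dot (x n) (x n) = 1" "\<And>n. ?m - 1 / Suc n < ?f (x n)"
    by blast
  obtain \<sigma> l where \<sigma>: "strict_mono \<sigma>" and l: "\<And>i. i < r \<Longrightarrow> (\<lambda>n. x (\<sigma> n) i) \<longlonglongrightarrow> l i"
    using simultaneous_convergent_subseq unit_bound[OF x(1)] by blast
  have 1: "(\<lambda>n. dot (x (\<sigma> n)) (x (\<sigma> n))) \<longlonglongrightarrow> dot l l"
    unfolding dot_def by (intro tendsto_sum tendsto_mult l) auto
  have "dot l l = 1" using LIMSEQ_unique[OF 1] x(1) by simp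
  have 2: "(\<lambda>n. ?f (x (\<sigma> n))) \<longlonglongrightarrow> ?f l"
    unfolding dot_def ap_def by (intro tendsto_sum tendsto_mult l) auto
  have 3: "(\<lambda>n. ?m - 1 / Suc (\<sigma> n)) \<longlonglongrightarrow> ?m - 0"
    using LIMSEQ_subseq_LIMSEQ[OF LIMSEQ_inverse_real_of_nat \<sigma>]
    by (intro tendsto_diff tendsto_const) (simp add: o_def inverse_eq_divide)
  have "?m - 0 \<le> ?f l"
    by (rule LIMSEQ_le[OF 3 2]) (use x(2) less_imp_le in \<open>intro exI, blast\<close>)
  hence fl: "?m \<le> ?f l" by simp
  have le: "?f y \<le> ?m * dot y y" for y
  proof (cases "dot y y = 0")
    case True
    hence "?f y = 0" unfolding dot_self_zero by (simp add: dot_def)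
    thus ?thesis using True by simp
  next
    case False
    define c where "c = sqrt (dot y y)"
    have c: "c * c = dot y y" "c \<noteq> 0" using dot_self False by (auto simp: c_def)
    let ?u = "\<lambda>i. (1 / c) * y i"
    have "dot ?u ?u = dot y y / (c * c)" by (simp only: dot_lin dot_lin_left) simp
    hence "?u \<in> ?S" using c False by simp
    hence "?f ?u \<le> ?m" by (intro cSup_upper bdd imageI)
    hence "?f ?u * dot y y \<le> ?m * dot y y" by (rule mult_right_mono[OF _ dot_self])
    moreover have "?f ?u * dot y y = ?f y"
      unfolding c(1)[symmetric] using c(2) by (simp only: dot_lin dot_lin_left ap_lin) simp
    ultimately show ?thesis by simp
  qed
  have "?f y \<le> ?f l * dot y y" for y
    using le[of y] mult_right_mono[OF fl dot_self[of y]] by linarith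
  thus ?thesis using \<open>dot l l = 1\<close> by blast
qed

text \<open>The absolute value of a maximiser is again a maximiser, since the entries of
  \<open>E\<close> are nonnegative. It satisfies the eigenvalue equation because moving from v along
  the residual y = l v - E v would otherwise violate maximality, and irreducibility makes its
  entries positive.\<close>

lemma perron_eigenvector:
  "\<exists>l v. (\<forall>i<r. v i > 0) \<and> dot v v = 1 \<and> (\<forall>i. i < r \<longrightarrow> ap v i = l * v i) \<and> (\<forall>y. dot y (ap y) \<le> l * dot y y)"
proof -
  obtain x where x: "dot x x = 1" and max: "\<And>y. dot y (ap y) \<le> dot x (ap x) * dot y y"
    using rayleigh_maximum by blast
  define l where "l = dot x (ap x)"
  define v where "v = (\<lambda>i. \<bar>x i\<bar>)"
  have v1: "dot v v = 1" using x by (simp add: v_def dot_def)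
  have "l \<le> dot v (ap v)" unfolding l_def dot_def ap_def v_def sum_distrib_left
  proof (intro sum_mono)
    fix i j
    show "x i * (E i j * x j) \<le> \<bar>x i\<bar> * (E i j * \<bar>x j\<bar>)"
      using abs_mult[of "x i" "x j"] mult_left_mono[OF _ nonneg, of "x i * x j"
        "\<bar>x i\<bar> * \<bar>x j\<bar>"]
      by (simp add: mult.left_commute)
  qed
  hence lv: "l = dot v (ap v)" using max[of v] v1 by (simp add: l_def)
  have ev: "ap v i = l * v i" if i: "i < r" for i
  proof -
    define y where "y = (\<lambda>i. l * v i - ap v i)"
    define b where "b = l * dot y y - dot y (ap y)"
    have b: "b \<ge> 0" using max by (simp add: b_def l_def)
    have yy: "dot y (ap v) = l * dot y v - dot y y" by (auto simp: y_def)
    have q: "2 * s * dot y y + s * s * b \<ge> 0" for s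
    proof -
      let ?w = "\<lambda>i. v i + s * y i"
      have "dot ?w (ap ?w) = dot v (ap v) + s * dot y (ap v) + s * (dot v (ap y) + s * dot y (ap y))"
        by (simp only: ap_lin dot_lin dot_lin_left)
      moreover have "dot v (ap y) = dot y (ap v)" using dot_ap dot_comm by simp
      ultimately have 1: "dot ?w (ap ?w) = l + 2 * s * dot y (ap v) + s * s * dot y (ap y)"
        using lv by (simp add: distrib_left)
      have 2: "dot ?w ?w = 1 + 2 * s * dot y v + s * s * dot y y"
        using v1 dot_comm by (simp add: distrib_left)
      hence "l + 2 * s * dot y (ap v) + s * s * dot y (ap y) \<le> l * (1 + 2 * s * dot y v + s * s * dot y y)"
        using max[of ?w] unfolding 1 2 l_def by blast
      thus ?thesis unfolding yy b_def by (simp add: algebra_simps)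
    qed
    have "dot y y = 0"
    proof (rule ccontr)
      assume "dot y y \<noteq> 0"
      hence p: "dot y y > 0" using dot_self[of y] by simp
      define d where "d = dot y y"
      \<comment> \<open>A negative value of s at which the quadratic 2 s d + s^2 b is negative; b +
        1 in place of b avoids a zero denominator.\<close>
      define u where "u = - (d / (b + 1))"
      have u: "u * (b + 1) = - d" using b by (simp add: u_def)
      have "(2 * u * d + u * u * b) * ((b + 1) * (b + 1)) = 2 * (u * (b + 1)) * d * (b + 1) + (u * (b + 1)) * (u * (b + 1)) * b"
        by (simp only: algebra_simps)
      also have "\<dots> = - (d * d * (b + 2))" unfolding u by (simp add: algebra_simps)
      also have "\<dots> < 0" using p b by (simp add: d_def)
      finally show False using q[of u] by (simp add: d_def mult_less_0_iff)
    qed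
    thus ?thesis using i dot_self_zero[of y] by (simp add: y_def)
  qed
  have "v i > 0" if i: "i < r" for i
  proof (rule ccontr)
    assume "\<not> v i > 0"
    hence "v k = 0" if "k < r" for k
      using nonneg_eigenvector[of v l i k] ev i that by (simp add: v_def)
    thus False using v1 dot_self_zero[of v] by simp
  qed
  thus ?thesis using v1 ev max by (auto simp: l_def)
qed

end

locale perron_pair = perron +
  fixes lam :: real and v :: "nat \<Rightarrow> real"
  assumes v_pos: "i < r \<Longrightarrow> v i > 0" and v_unit: "dot v v = 1" and v_eig: "i < r \<Longrightarrow> ap v i = lam * v i"
    and lam_max: "dot y (ap y) \<le> lam * dot y y"
begin

text \<open>Subtract from w the multiple a v with a the least quotient of the entries of w and v.
  The difference is a nonnegative eigenvector with a zero entry, hence zero.\<close>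

lemma eigenspace:
  assumes w: "\<And>i. i < r \<Longrightarrow> ap w i = lam * w i" and i: "i < r"
  shows "w i = dot v w * v i"
proof -
  let ?Q = "(\<lambda>i. w i / v i) ` {..<r}"
  have "Min ?Q \<in> ?Q" using r by (intro Min_in) auto
  then obtain k where k: "k < r" "Min ?Q = w k / v k" by auto
  define a where "a = w k / v k"
  let ?y = "\<lambda>i. w i - a * v i"
  have y0: "?y k = 0" using v_pos[OF k(1)] by (simp add: a_def)
  have "a \<le> w i / v i" if "i < r" for i
    unfolding a_def k(2)[symmetric] using that by (intro Min_le) auto
  hence y1: "?y i \<ge> 0" if "i < r" for i using that v_pos by (simp add: le_divide_eq)
  have y2: "ap ?y i = lam * ?y i" if "i < r" for i
    using w[OF that] v_eig[OF that] by (simp add: algebra_simps)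
  have eq: "w i = a * v i" if "i < r" for i
    using nonneg_eigenvector[of ?y, OF y1 y2 k(1) y0 that] by simp
  have "dot v w = dot v (\<lambda>i. a * v i)" by (rule dot_cong) (simp_all add: eq)
  thus ?thesis using v_unit eq[OF i] by simp
qed

text \<open>The Rayleigh bound shows that no eigenvalue exceeds \<open>lam\<close>. By
  \<open>eigenspace\<close> a positive unit eigenvector for \<open>lam\<close> is a multiple of v,
  and norm and sign fix the factor.\<close>

lemma perron_matrix:
  fixes B :: "real mat"
  assumes B: "B = mat r r (\<lambda>(i, j). E i j)"
  shows "largest_eigenvalue B = lam" "i < r \<Longrightarrow> perron_vector B $ i = v i"
proof -
  have Bc: "B \<in> carrier_mat r r" by (simp add: B)
  have mv: "(B *\<^sub>v u) $ i = ap (\<lambda>i. u $ i) i" if "u \<in> carrier_vec r" "i < r" for u i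
    using that by (simp add: B scalar_prod_def ap_def lessThan_atLeast0)
  have ev_iff: "eigenvector B u l \<longleftrightarrow> u \<in> carrier_vec r \<and> (\<exists>i<r. u $ i \<noteq> 0) \<and> (\<forall>i<r. ap (\<lambda>i. u $ i) i = l * u $ i)" for u l
    using mv Bc by (fastforce simp: vec_eq_iff eigenvector_def)
  have vv: "eigenvector B (vec r v) lam"
    using v_pos r v_eig ap_cong[of "\<lambda>i. vec r v $ i"] by (force simp: ev_iff)
  have le: "l \<le> lam" if l: "eigenvalue B l" for l
  proof -
    obtain u where u: "eigenvector B u l" using l by (auto simp: eigenvalue_def)
    let ?u = "\<lambda>i. u $ i"
    have "dot ?u (ap ?u) = dot ?u (\<lambda>i. l * ?u i)"
      by (rule dot_cong) (use u in \<open>simp_all add: ev_iff\<close>)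
    hence "l * dot ?u ?u \<le> lam * dot ?u ?u" using lam_max[of ?u] by simp
    moreover have "dot ?u ?u > 0"
      using u dot_self dot_self_zero unfolding ev_iff by (metis order_le_less)
    ultimately show ?thesis by simp
  qed
  have fin: "finite {x. eigenvalue B x}"
    using degree_monic_char_poly[OF Bc] poly_roots_finite[of "char_poly B"]
    by (force simp: eigenvalue_root_char_poly[OF Bc])
  show l: "largest_eigenvalue B = lam"
    unfolding largest_eigenvalue_def
    by (rule Max_eqI[OF fin]) (use le vv in \<open>auto simp: eigenvalue_def\<close>)
  have sp: "u \<bullet> u = dot (\<lambda>i. u $ i) (\<lambda>i. u $ i)" if "u \<in> carrier_vec r" for u :: "real vec"
    using that by (simp add: scalar_prod_def dot_def lessThan_atLeast0)
  have "perron_vector B = vec r v" unfolding perron_vector_def l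
  proof (rule the_equality)
    show "eigenvector B (vec r v) lam \<and> vec r v \<bullet> vec r v = 1 \<and> (\<forall>i<dim_vec (vec r v). vec r v $ i > 0)"
      using vv v_pos v_unit dot_cong[of "\<lambda>i. vec r v $ i" v "\<lambda>i. vec r v $ i"] sp
      by simp
    fix u assume u: "eigenvector B u lam \<and> u \<bullet> u = 1 \<and> (\<forall>i<dim_vec u. u $ i > 0)"
    hence uc: "u \<in> carrier_vec r" and ue: "\<And>i. i < r \<Longrightarrow> ap (\<lambda>i. u $ i) i = lam * u $ i"
      by (auto simp: ev_iff)
    define a where "a = dot v (\<lambda>i. u $ i)"
    have eq: "u $ i = a * v i" if "i < r" for i unfolding a_def by (rule eigenspace[OF ue that])
    have "1 = dot (\<lambda>i. u $ i) (\<lambda>i. u $ i)" using u sp[OF uc] by simp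
    also have "\<dots> = dot (\<lambda>i. a * v i) (\<lambda>i. a * v i)"
      by (rule dot_cong) (simp_all add: eq)
    finally have "a * a = 1" using v_unit by simp
    moreover have "a > 0" using u uc r eq v_pos[OF r] by (auto simp: zero_less_mult_iff)
    ultimately show "u = vec r v" using uc eq by (auto simp: square_eq_1_iff)
  qed
  thus "perron_vector B $ i = v i" if "i < r" using that by simp
qed

section \<open>The operator E - \<lambda> and the isolation of the Perron component\<close>

definition F :: "(nat \<Rightarrow> real) \<Rightarrow> nat \<Rightarrow> real" where "F x = (\<lambda>i. ap x i - lam * x i)"

lemma F_lin [simp]:
  "F (\<lambda>i. y i + z i) = (\<lambda>i. F y i + F z i)" "F (\<lambda>i. y i - z i) = (\<lambda>i. F y i - F z i)"
  "F (\<lambda>i. a * y i) = (\<lambda>i. a * F y i)" "F (\<lambda>i. 0) = (\<lambda>i. 0)"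
  by (simp_all add: F_def algebra_simps)

lemma F_sum: "F (\<lambda>i. \<Sum>j\<in>I. y j i) = (\<lambda>i. \<Sum>j\<in>I. F (y j) i)" by (induction rule: infinite_finite_induct) simp_all

lemma dot_sum: "dot x (\<lambda>i. \<Sum>j\<in>I. y j i) = (\<Sum>j\<in>I. dot x (y j))" by (induction rule: infinite_finite_induct) simp_all

lemma Fp_lin [simp]:
  "(F ^^ j) (\<lambda>i. y i + z i) = (\<lambda>i. (F ^^ j) y i + (F ^^ j) z i)"
  "(F ^^ j) (\<lambda>i. y i - z i) = (\<lambda>i. (F ^^ j) y i - (F ^^ j) z i)"
  "(F ^^ j) (\<lambda>i. a * y i) = (\<lambda>i. a * (F ^^ j) y i)" by (induction j) simp_all

lemma Fp_sum: "(F ^^ k) (\<lambda>i. \<Sum>j\<in>I. y j i) = (\<lambda>i. \<Sum>j\<in>I. (F ^^ k) (y j) i)"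
  by (induction k) (simp_all add: F_sum)

lemma F_supp: "(\<And>i. i \<ge> r \<Longrightarrow> x i = 0) \<Longrightarrow> i \<ge> r \<Longrightarrow> (F ^^ j) x i = 0"
  by (induction j arbitrary:) (simp_all add: F_def ap_supp)

lemma dot_F: "dot x (F y) = dot (F x) y" by (simp add: F_def dot_ap)

lemma dot_v_F: "dot v (F y) = 0"
proof -
  have "dot (F v) y = dot (\<lambda>i. 0) y" by (rule dot_cong) (simp_all add: F_def v_eig)
  hence "dot v (F y) = dot (\<lambda>i. 0) y" by (simp add: dot_F)
  thus ?thesis by (simp add: dot_def)
qed

text \<open>F is symmetric, so the square of the norm of F^j y is the product of F^(j-1) y with
  F^(j+1) y. If the latter vanishes, so does F^j y, and the exponent descends to 1.\<close>

lemma kernel_Fp: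
  assumes y: "\<And>i. i \<ge> r \<Longrightarrow> y i = 0" and z: "(F ^^ j) y = (\<lambda>i. 0)"
  shows "F y = (\<lambda>i. 0)" using z
proof (induction j)
  case 0
  thus ?case by simp
next
  case (Suc j)
  show ?case
  proof (cases j)
    case 0 thus ?thesis using Suc by simp
  next
    case j: (Suc k)
    let ?u = "(F ^^ j) y"
    have "dot ?u ?u = dot ((F ^^ k) y) (F ?u)" by (simp add: j dot_F)
    also have "\<dots> = 0" using Suc.prems by simp
    finally have "?u i = 0" for i using F_supp y dot_self_zero by (cases "i < r") auto
    thus ?thesis using Suc.IH by simp
  qed
qed

text \<open>
  Write \<open>t = x\<^sub>1\<close>, \<open>s = x\<^sub>0\<close>. The relation \<open>t \<bullet> x\<^sub>m = s \<bullet> x\<^sub>m\<^sub>+\<^sub>1\<close> persists when a power of \<open>F = E - \<lambda>\<close> is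
  applied to the \<open>x\<close>'s. A shortest linear dependence among the \<open>F\<^sup>j (x\<^sub>m, x\<^sub>m\<^sub>+\<^sub>1)\<close>, divided by its lowest
  power \<open>F\<^sup>k\<close>, is a combination in the kernel of \<open>F\<^sup>k\<close>, which is spanned by \<open>v\<close> as \<open>F\<close> is symmetric; so
  the relation holds for the projections of \<open>x\<^sub>m\<close> and \<open>x\<^sub>m\<^sub>+\<^sub>1\<close> to \<open>v\<close>.
\<close>

lemma recurrence_ratio:
  fixes x :: "nat \<Rightarrow> nat \<Rightarrow> real"
  assumes supp_x: "\<And>m i. i \<ge> r \<Longrightarrow> x m i = 0"
    and rec: "\<And>m i. i < r \<Longrightarrow> x (Suc (Suc m)) i = ap (x (Suc m)) i - x m i"
    and D: "\<And>m. m > n \<Longrightarrow> dot (x 1) (x m) = dot (x 0) (x (Suc m))"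
    and m: "m > n + (2 * r + 2 * r)" and pos: "dot v (x m) \<noteq> 0"
  shows "dot v (x 1) * dot v (x m) = dot v (x 0) * dot v (x (Suc m))"
proof -
  have Fx: "F (x (Suc m)) = (\<lambda>i. x (Suc (Suc m)) i + x m i - lam * x (Suc m) i)" for m
  proof
    fix i show "F (x (Suc m)) i = x (Suc (Suc m)) i + x m i - lam * x (Suc m) i"
      by (cases "i < r") (simp_all add: F_def rec supp_x ap_supp)
  qed
  \<comment> \<open>F x_(m+1) is a combination of x_m, x_(m+1) and x_(m+2), so each application of F
    moves the range of validity by one.\<close>
  have DF: "m > n + j \<Longrightarrow> dot (x 1) ((F ^^ j) (x m)) = dot (x 0) ((F ^^ j) (x (Suc m)))" for j m
  proof (induction j arbitrary: m)
    case 0 thus ?case using D by simp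
  next
    case (Suc j)
    obtain k where k: "m = Suc k" using Suc.prems by (cases m) auto
    have "dot (x 1) ((F ^^ j) (x a)) = dot (x 0) ((F ^^ j) (x (Suc a)))" if "a \<in> {k, Suc k, Suc (Suc k)}" for a
      using Suc.IH Suc.prems that k by auto
    thus ?case unfolding k funpow_Suc_right o_def Fx by simp
  qed
  let ?d = "2 * r"
  \<comment> \<open>x_m and x_(m+1) are concatenated to one vector of length 2r, so that a single
    dependence among 2r + 1 powers of F annihilates both.\<close>
  define z where "z = (\<lambda>j i. if i < r then (F ^^ j) (x m) i else (F ^^ j) (x (Suc m)) (i - r))"
  obtain c where c: "\<exists>j\<le>?d. c j \<noteq> 0" "\<And>i. i < ?d \<Longrightarrow> (\<Sum>j\<le>?d. c j * z j i) = 0"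
    using linear_dependence by blast
  have dep: "(\<Sum>j\<le>?d. c j * (F ^^ j) (x a) i) = 0" if "a \<in> {m, Suc m}" for a i
  proof (cases "i < r")
    case True
    thus ?thesis using that c(2)[of i] c(2)[of "r + i"] by (auto simp: z_def)
  next
    case False
    thus ?thesis using F_supp supp_x by simp
  qed
  \<comment> \<open>The lowest power that occurs. Dividing by it leaves a combination whose constant
    term \<open>c k\<close> is nonzero; as v is orthogonal to the range of F, only that term is seen
    by v.\<close>
  define k where "k = (LEAST j. c j \<noteq> 0)"
  have ck: "c k \<noteq> 0" unfolding k_def by (rule LeastI_ex) (use c(1) in blast)
  have c0: "c j = 0" if "j < k" for j using not_less_Least that by (auto simp: k_def)
  have kd: "k \<le> ?d" using c(1) c0 by (meson not_le order_le_less_trans)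
  define y where "y = (\<lambda>a i. \<Sum>j\<in>{k..?d}. c j * (F ^^ (j - k)) (x a) i)"
  have Ik: "{..?d} = {..<k} \<union> {k..?d}" using kd by auto
  have Fy: "(F ^^ k) (y a) = (\<lambda>i. 0)" if a: "a \<in> {m, Suc m}" for a
  proof
    fix i
    have "(F ^^ k) (y a) i = (\<Sum>j\<in>{k..?d}. c j * (F ^^ j) (x a) i)"
    proof -
      have "(F ^^ k) ((F ^^ (j - k)) (x a)) = (F ^^ j) (x a)" if "j \<in> {k..?d}" for j
        using that by (simp add: funpow_add[THEN fun_cong, unfolded o_def, symmetric])
      thus ?thesis unfolding y_def Fp_sum by (intro sum.cong) simp_all
    qed
    also have "\<dots> = (\<Sum>j\<le>?d. c j * (F ^^ j) (x a) i)"
      unfolding Ik by (subst sum.union_disjoint) (auto simp: c0)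
    finally show "(F ^^ k) (y a) i = 0" using dep[OF a] by simp
  qed
  have yv: "y a i = dot v (y a) * v i" if a: "a \<in> {m, Suc m}" and i: "i < r" for a i
  proof (rule eigenspace[OF _ i])
    have "y a i = 0" if "i \<ge> r" for i using F_supp[OF supp_x that] by (simp add: y_def)
    hence "F (y a) = (\<lambda>i. 0)" by (rule kernel_Fp[OF _ Fy[OF a]])
    thus "ap (y a) j = lam * y a j" for j by (simp add: F_def fun_eq_iff)
  qed
  have vy: "dot v (y a) = c k * dot v (x a)" for a
  proof -
    have "dot v (y a) = (\<Sum>j\<in>{k..?d}. c j * dot v ((F ^^ (j - k)) (x a)))"
      by (simp add: y_def dot_sum)
    also have "\<dots> = (\<Sum>j\<in>{k..?d}. if j = k then c k * dot v (x a) else 0)"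
    proof (rule sum.cong)
      fix j assume "j \<in> {k..?d}"
      thus "c j * dot v ((F ^^ (j - k)) (x a)) = (if j = k then c k * dot v (x a) else 0)"
        by (cases "j - k") (auto simp: dot_v_F)
    qed simp
    also have "\<dots> = c k * dot v (x a)" using kd by simp
    finally show ?thesis .
  qed
  have "dot (x 1) (y m) = dot (x 0) (y (Suc m))"
    unfolding y_def dot_sum by (rule sum.cong) (use DF m in auto)
  moreover have "dot (x b) (y a) = dot (x b) (\<lambda>i. (c k * dot v (x a)) * v i)" if "a \<in> {m, Suc m}" for a b
    by (rule dot_cong) (simp_all add: yv[OF that] vy)
  ultimately have "c k * dot v (x m) * dot (x 1) v = c k * dot v (x (Suc m)) * dot (x 0) v" by simp
  thus ?thesis using ck by (simp add: dot_comm mult.commute)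
qed

end

text \<open>q is a root of the characteristic polynomial of the recurrence and the first two values
  have ratio q; the induction carries two consecutive values.\<close>

lemma geometric_recurrence:
  fixes u :: "nat \<Rightarrow> real"
  assumes "u 1 = q * u 0" "\<And>k. u (Suc (Suc k)) = l * u (Suc k) - u k" "q * q - l * q + 1 = 0"
  shows "u k = u 0 * q ^ k \<and> u (Suc k) = u 0 * q ^ Suc k"
proof (induction k)
  case (Suc k)
  have "u (Suc (Suc k)) = u 0 * q ^ k * (l * q - 1)"
    using assms(2)[of k] Suc by (simp add: algebra_simps)
  also have "l * q - 1 = q * q" using assms(3) by simp
  finally show ?case using Suc by simp
qed (use assms in simp)

lemma ratio_ge_one:
  fixes a q \<epsilon> :: real
  assumes "\<epsilon> > 0" "q > 0" "\<And>k. k > n \<Longrightarrow> \<epsilon> \<le> a * q ^ k" shows "q \<ge> 1"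
proof (rule ccontr)
  assume "\<not> q \<ge> 1"
  hence "(\<lambda>k. a * q ^ k) \<longlonglongrightarrow> a * 0"
    using assms(2) by (intro tendsto_mult LIMSEQ_power_zero) auto
  hence "\<epsilon> \<le> a * 0"
    by (rule LIMSEQ_le_const) (use assms(3) in \<open>auto intro!: exI[of _ "Suc n"]\<close>)
  thus False using assms(1) by simp
qed

section \<open>Multiplicities and the main theorem\<close>

context left_module begin

lemma finsum_lessThan_Suc:
  fixes U :: "nat \<Rightarrow> 'm set"
  assumes u: "u \<in> Pi\<^sub>E {..<Suc n} U" and U: "\<And>k. k \<le> n \<Longrightarrow> left_submodule A (U k) M"
  shows "finsum M u {..<Suc n} = u n \<oplus>\<^bsub>M\<^esub> finsum M (restrict u {..<n}) {..<n}" "restrict u {..<n} \<in> Pi\<^sub>E {..<n} U" "u n \<in> U n"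
proof -
  have uM: "u k \<in> carrier M" if "k \<le> n" for k using u U that lsub_mem by fastforce
  have "finsum M u {..<Suc n} = u n \<oplus>\<^bsub>M\<^esub> finsum M u {..<n}"
    unfolding lessThan_Suc by (rule finsum_insert) (use uM in auto)
  also have "finsum M u {..<n} = finsum M (restrict u {..<n}) {..<n}"
    by (rule finsum_cong') (use uM in auto)
  finally show "finsum M u {..<Suc n} = u n \<oplus>\<^bsub>M\<^esub> finsum M (restrict u {..<n}) {..<n}" .
  show "restrict u {..<n} \<in> Pi\<^sub>E {..<n} U" "u n \<in> U n" using u by (auto simp: PiE_iff)
qed

lemma finsum_upd:
  fixes U :: "nat \<Rightarrow> 'm set"
  assumes u: "u \<in> Pi\<^sub>E {..<n} U" and x: "x \<in> U n" and U: "\<And>k. k \<le> n \<Longrightarrow> left_submodule A (U k) M"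
  shows "u(n := x) \<in> Pi\<^sub>E {..<Suc n} U" "finsum M (u(n := x)) {..<Suc n} = x \<oplus>\<^bsub>M\<^esub> finsum M u {..<n}"
proof -
  show w: "u(n := x) \<in> Pi\<^sub>E {..<Suc n} U"
    using u x by (auto simp: PiE_iff extensional_def)
  show "finsum M (u(n := x)) {..<Suc n} = x \<oplus>\<^bsub>M\<^esub> finsum M u {..<n}"
    using u finsum_lessThan_Suc(1)[OF w U] by simp
qed

lemma finsum_image:
  fixes U :: "nat \<Rightarrow> 'm set"
  assumes U: "\<And>k. k < n \<Longrightarrow> left_submodule A (U k) M"
  shows "left_submodule A ((\<lambda>u. finsum M u {..<n}) ` Pi\<^sub>E {..<n} U) M"
    "\<And>m. n = Suc m \<Longrightarrow> (\<lambda>u. finsum M u {..<n}) ` Pi\<^sub>E {..<n} U = ((\<lambda>u. finsum M u {..<m}) ` Pi\<^sub>E {..<m} U) <+>\<^bsub>M\<^esub> U m"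
proof -
  have step: "(\<lambda>u. finsum M u {..<Suc m}) ` Pi\<^sub>E {..<Suc m} U = ((\<lambda>u. finsum M u {..<m}) ` Pi\<^sub>E {..<m} U) <+>\<^bsub>M\<^esub> U m"
    if U: "\<And>k. k \<le> m \<Longrightarrow> left_submodule A (U k) M" and T: "left_submodule A ((\<lambda>u. finsum M u {..<m}) ` Pi\<^sub>E {..<m} U) M" for m
  proof (intro equalityI subsetI)
    let ?T = "(\<lambda>u. finsum M u {..<m}) ` Pi\<^sub>E {..<m} U"
    fix z assume "z \<in> (\<lambda>u. finsum M u {..<Suc m}) ` Pi\<^sub>E {..<Suc m} U"
    then obtain u where u: "u \<in> Pi\<^sub>E {..<Suc m} U" "z = finsum M u {..<Suc m}" by blast
    note f = finsum_lessThan_Suc[OF u(1) U]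
    have 1: "finsum M (restrict u {..<m}) {..<m} \<in> ?T <+>\<^bsub>M\<^esub> U m" "u m \<in> ?T <+>\<^bsub>M\<^esub> U m"
      using f(2,3) set_add_upper[OF T U] by blast+
    show "z \<in> ?T <+>\<^bsub>M\<^esub> U m"
      using lsub_add[OF lsub_sum[OF T U] 1(2,1)] u(2) f(1) by simp
  next
    fix z assume "z \<in> ((\<lambda>u. finsum M u {..<m}) ` Pi\<^sub>E {..<m} U) <+>\<^bsub>M\<^esub> U m"
    then obtain a x where ax: "a \<in> (\<lambda>u. finsum M u {..<m}) ` Pi\<^sub>E {..<m} U" "x \<in> U m" "z = a \<oplus>\<^bsub>M\<^esub> x"
      by (rule set_addE)
    obtain u where u: "u \<in> Pi\<^sub>E {..<m} U" "a = finsum M u {..<m}" using ax(1) by blast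
    have "z = finsum M (u(m := x)) {..<Suc m}"
      using ax lsub_mem[OF T] lsub_mem[OF U ax(2)] finsum_upd(2)[where U = U, OF u(1) ax(2) U] u(2)
      by (simp add: a_comm)
    thus "z \<in> (\<lambda>u. finsum M u {..<Suc m}) ` Pi\<^sub>E {..<Suc m} U"
      using finsum_upd(1)[where U = U, OF u(1) ax(2) U] by blast
  qed
  show T: "left_submodule A ((\<lambda>u. finsum M u {..<n}) ` Pi\<^sub>E {..<n} U) M" using U
  proof (induction n)
    case 0
    thus ?case using lsub_0 by simp
  next
    case (Suc n)
    thus ?case using step lsub_sum by simp
  qed
  show "(\<lambda>u. finsum M u {..<n}) ` Pi\<^sub>E {..<n} U = ((\<lambda>u. finsum M u {..<m}) ` Pi\<^sub>E {..<m} U) <+>\<^bsub>M\<^esub> U m"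
    if n: "n = Suc m" for m
  proof -
    have "left_submodule A ((\<lambda>u. finsum M u {..<m}) ` Pi\<^sub>E {..<m} U) M"
      using U unfolding n
    proof (induction m)
      case (Suc m)
      thus ?case using step lsub_sum by simp
    qed (use lsub_0 in simp)
    thus ?thesis using step U n by simp
  qed
qed

text \<open>Two representations of one element differ by \<open>u n\<close> - \<open>w n\<close> in
  the last summand and by the opposite amount in the sum of the others. Trivial intersection makes
  both differences zero, so directness can be checked one summand at a time.\<close>

lemma inj_finsum_Suc:
  fixes U :: "nat \<Rightarrow> 'm set"
  assumes U: "\<And>k. k \<le> n \<Longrightarrow> left_submodule A (U k) M"
  shows "inj_on (\<lambda>u. finsum M u {..<Suc n}) (Pi\<^sub>E {..<Suc n} U) \<longleftrightarrow>
    inj_on (\<lambda>u. finsum M u {..<n}) (Pi\<^sub>E {..<n} U) \<and>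
    ((\<lambda>u. finsum M u {..<n}) ` Pi\<^sub>E {..<n} U) \<inter> U n = {\<zero>\<^bsub>M\<^esub>}" (is "?l \<longleftrightarrow> ?i \<and> ?T \<inter> U n = _")
proof -
  have T: "left_submodule A ?T M" by (rule finsum_image(1)) (use U in simp)
  note Un = U[OF order_refl]
  have zero: "\<zero>\<^bsub>M\<^esub> \<in> U n" by (rule lsub_zero[OF Un])
  show ?thesis
  proof (intro iffI conjI)
    assume inj: ?l
    show ?i
    proof (rule inj_onI)
      fix u w assume uw: "u \<in> Pi\<^sub>E {..<n} U" "w \<in> Pi\<^sub>E {..<n} U" "finsum M u {..<n} = finsum M w {..<n}"
      hence eq: "u(n := \<zero>\<^bsub>M\<^esub>) = w(n := \<zero>\<^bsub>M\<^esub>)"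
        using inj_onD[OF inj _ finsum_upd(1)[where U = U, OF uw(1) zero U] finsum_upd(1)[where U =
          U, OF uw(2) zero U]] finsum_upd(2)[where U = U, OF uw(1) zero U] finsum_upd(2)[where U =
          U, OF uw(2) zero U]
        by simp
      show "u = w"
      proof
        fix k show "u k = w k"
          using fun_cong[OF eq, of k] uw(1,2)
          by (cases "k = n") (auto simp: PiE_iff extensional_def)
      qed
    qed
    show "?T \<inter> U n = {\<zero>\<^bsub>M\<^esub>}"
    proof (intro equalityI subsetI)
      fix x assume x: "x \<in> ?T \<inter> U n"
      then obtain u where u: "u \<in> Pi\<^sub>E {..<n} U" "x = finsum M u {..<n}" by blast
      let ?z = "\<lambda>k\<in>{..<n}. \<zero>\<^bsub>M\<^esub>"
      have z: "?z \<in> Pi\<^sub>E {..<n} U" using lsub_zero[OF U] by auto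
      have xU: "x \<in> U n" "x \<in> carrier M" using x lsub_mem[OF Un] by auto
      have "u(n := \<zero>\<^bsub>M\<^esub>) = ?z(n := x)"
        using finsum_cong'[of "{..<n}" "{..<n}" "\<lambda>_. \<zero>\<^bsub>M\<^esub>" ?z]
          inj_onD[OF inj _ finsum_upd(1)[where U = U, OF u(1) zero U] finsum_upd(1)[where U = U, OF
          z xU(1) U]] finsum_upd(2)[where U = U, OF u(1) zero U] finsum_upd(2)[where U = U, OF z
          xU(1) U] u(2) xU(2)
        by simp
      from fun_cong[OF this, of n] show "x \<in> {\<zero>\<^bsub>M\<^esub>}" by simp
    qed (use zero lsub_zero[OF T] in blast)
  next
    assume "?i \<and> ?T \<inter> U n = {\<zero>\<^bsub>M\<^esub>}"
    hence i: ?i and int: "?T \<inter> U n = {\<zero>\<^bsub>M\<^esub>}" by auto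
    show ?l
    proof (rule inj_onI)
      fix u w assume uw: "u \<in> Pi\<^sub>E {..<Suc n} U" "w \<in> Pi\<^sub>E {..<Suc n} U" and eq: "finsum M u {..<Suc n} = finsum M w {..<Suc n}"
      note fu = finsum_lessThan_Suc[OF uw(1) U] and fw = finsum_lessThan_Suc[OF uw(2) U]
      let ?a = "finsum M (restrict u {..<n}) {..<n}" and ?b = "finsum M (restrict w {..<n}) {..<n}"
      have ab: "?a \<in> ?T" "?b \<in> ?T" using fu fw by blast+
      have cl: "?a \<in> carrier M" "?b \<in> carrier M" "u n \<in> carrier M" "w n \<in> carrier M"
        using ab lsub_mem[OF T] fu(3) fw(3) lsub_mem[OF Un] by auto
      have "u n \<ominus>\<^bsub>M\<^esub> w n = ?b \<ominus>\<^bsub>M\<^esub> ?a"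
      proof -
        have "u n \<ominus>\<^bsub>M\<^esub> w n = ((w n \<oplus>\<^bsub>M\<^esub> ?b) \<oplus>\<^bsub>M\<^esub> \<ominus>\<^bsub>M\<^esub> ?a) \<oplus>\<^bsub>M\<^esub> \<ominus>\<^bsub>M\<^esub> w n"
          using eq fu(1) fw(1) add_diff_cancel[OF cl(3,1)] by (simp only: a_minus_def)
        also have "\<dots> = (w n \<oplus>\<^bsub>M\<^esub> \<ominus>\<^bsub>M\<^esub> w n) \<oplus>\<^bsub>M\<^esub> (?b \<oplus>\<^bsub>M\<^esub> \<ominus>\<^bsub>M\<^esub> ?a)"
          using cl by (simp only: a_assoc a_comm a_lcomm a_closed a_inv_closed)
        also have "\<dots> = ?b \<ominus>\<^bsub>M\<^esub> ?a"
          using cl by (simp add: r_neg a_minus_def)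
        finally show ?thesis .
      qed
      moreover have "u n \<ominus>\<^bsub>M\<^esub> w n \<in> U n"
        by (rule lsub_diff[OF Un fu(3) fw(3)])
      moreover have "?b \<ominus>\<^bsub>M\<^esub> ?a \<in> ?T" by (rule lsub_diff[OF T ab(2,1)])
      ultimately have "u n \<ominus>\<^bsub>M\<^esub> w n = \<zero>\<^bsub>M\<^esub>" "?b \<ominus>\<^bsub>M\<^esub> ?a = \<zero>\<^bsub>M\<^esub>"
        using int by auto
      hence n: "u n = w n" and "?b = ?a" using minus_eq_zero_iff cl by blast+
      hence r: "restrict u {..<n} = restrict w {..<n}"
        using inj_onD[OF i, of "restrict u {..<n}" "restrict w {..<n}"] fu(2) fw(2) by simp
      show "u = w"
      proof
        fix k show "u k = w k"
          using fun_cong[OF r, of k] n uw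
          by (cases "k < n"; cases "k = n") (auto simp: PiE_iff extensional_def)
      qed
    qed
  qed
qed

end

context rad_cube_zero begin

lemma c_direct_sum:
  fixes M (structure)
  assumes j: "j < r" and M: "fd M" and U: "lsub U M" and V: "lsub V M"
    and 0: "U \<inter> V = {\<zero>}"
  shows "c j (submod M (U <+>\<^bsub>M\<^esub> V)) = c j (submod M U) + c j (submod M V)"
proof -
  interpret M: left_module A M by (rule fd_lm[OF M])
  let ?W = "U <+>\<^bsub>M\<^esub> V"
  have W: "lsub ?W M" by (rule M.lsub_sum[OF U V])
  interpret W: left_module A "submod M ?W" by (rule M.submod_lm[OF W])
  note up = M.set_add_upper[OF U V]
  have UV: "lsub U (submod M ?W)" "lsub V (submod M ?W)"
    using U V up by (simp_all add: lsub_submod_iff[OF W])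
  obtain p where p: "p \<in> Hom (submod M ?W) (submod M ?W)" "\<And>x. x \<in> U \<Longrightarrow> p x = x" "\<And>x. x \<in> V \<Longrightarrow> p x = \<zero>"
    "\<And>x. x \<in> ?W \<Longrightarrow> p x \<in> U" "\<And>x. x \<in> ?W \<Longrightarrow> x \<ominus>\<^bsub>submod M ?W\<^esub> p x \<in> V"
    using direct_sum_projection[OF W.left_module_axioms UV] 0 by auto
  have im: "p ` ?W = U" using p(4) p(2) up(1) by force
  have "a_kernel (submod M ?W) (submod M ?W) p = V"
  proof (intro equalityI subsetI)
    show "x \<in> V" if "x \<in> a_kernel (submod M ?W) (submod M ?W) p" for x
      using that p(5)[of x] W.diff_zero by (simp add: a_kernel_def')
    show "x \<in> a_kernel (submod M ?W) (submod M ?W) p" if "x \<in> V" for x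
      using that p(3) up(2) by (auto simp: a_kernel_def')
  qed
  thus ?thesis
    using cdim_hom[OF e_props(1)[OF j] fd_submod[OF M W] W.left_module_axioms p(1)] im by simp
qed

lemma c_finsum:
  fixes U :: "nat \<Rightarrow> 'm set"
  assumes j: "j < r" and M: "fd M"
  shows "(\<And>k. k < n \<Longrightarrow> lsub (U k) M) \<Longrightarrow> inj_on (\<lambda>u. finsum M u {..<n}) (Pi\<^sub>E {..<n} U) \<Longrightarrow>
    c j (submod M ((\<lambda>u. finsum M u {..<n}) ` Pi\<^sub>E {..<n} U)) = (\<Sum>k<n. c j (submod M (U k)))"
proof (induction n)
  case 0
  interpret M: left_module A M by (rule fd_lm[OF M])
  show ?case using cdim_zero_module[OF e_carrier(1)[OF j] fd_submod[OF M M.lsub_0]] by simp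
next
  case (Suc n)
  interpret M: left_module A M by (rule fd_lm[OF M])
  have U: "lsub (U k) M" if "k \<le> n" for k using Suc.prems(1) that by simp
  have inj: "inj_on (\<lambda>u. finsum M u {..<n}) (Pi\<^sub>E {..<n} U)"
    and int: "((\<lambda>u. finsum M u {..<n}) ` Pi\<^sub>E {..<n} U) \<inter> U n = {\<zero>\<^bsub>M\<^esub>}"
    using Suc.prems(2) M.inj_finsum_Suc[of, OF U] by auto
  have T: "lsub ((\<lambda>u. finsum M u {..<n}) ` Pi\<^sub>E {..<n} U) M"
    by (rule M.finsum_image(1)) (use U in simp)
  have eq: "(\<lambda>u. finsum M u {..<Suc n}) ` Pi\<^sub>E {..<Suc n} U = ((\<lambda>u. finsum M u {..<n}) ` Pi\<^sub>E {..<n} U) <+>\<^bsub>M\<^esub> U n"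
    by (rule M.finsum_image(2)) (use U in simp_all)
  have "c j (submod M ((\<lambda>u. finsum M u {..<n}) ` Pi\<^sub>E {..<n} U)) = (\<Sum>k<n. c j (submod M (U k)))"
    by (rule Suc.IH[OF _ inj]) (use U in simp)
  thus ?case unfolding eq using c_direct_sum[OF j M T U int] by simp
qed

text \<open>Take a direct sum of simple submodules of greatest dimension. If it were proper, a
  simple submodule of a complement could be added.\<close>

lemma simple_decomposition_exists:
  fixes M (structure)
  assumes M: "fd M" and ss: "soc A M = carrier M"
  shows "\<exists>n U. simple_decomposition A M n U"
proof -
  interpret M: left_module A M by (rule fd_lm[OF M])
  let ?T = "\<lambda>n U. (\<lambda>u. finsum M u {..<n}) ` Pi\<^sub>E {..<n} U"
  define R where "R = (\<lambda>W. \<exists>(n :: nat) U. (\<forall>k<n. lsub (U k) M \<and> simple (submod M (U k))) \<and>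
    inj_on (\<lambda>u. finsum M u {..<n}) (Pi\<^sub>E {..<n} U) \<and> ?T n U = W)"
  have "R {\<zero>}" unfolding R_def by (rule exI[of _ 0]) simp
  from max_dim_submodule[of M _ R, OF M M.lsub_0 this] obtain W where W: "lsub W M" "R W"
    and max: "\<And>W'. lsub W' M \<Longrightarrow> R W' \<Longrightarrow> W \<subseteq> W' \<Longrightarrow> W' = W" by blast
  from W(2) obtain n :: nat and U where U: "\<And>k. k < n \<Longrightarrow> lsub (U k) M" "\<And>k. k < n \<Longrightarrow> simple (submod M (U k))"
    and inj: "inj_on (\<lambda>u. finsum M u {..<n}) (Pi\<^sub>E {..<n} U)" and T: "?T n U = W" unfolding R_def by blast
  have "W = carrier M"
  proof (rule ccontr)
    assume ne: "W \<noteq> carrier M"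
    obtain V where V: "lsub V M" "W \<inter> V = {\<zero>}" "W <+>\<^bsub>M\<^esub> V = carrier M"
      using semisimple_complement[OF M ss W(1)] by blast
    have "V \<noteq> {\<zero>}"
    proof
      assume v: "V = {\<zero>}"
      have "W <+>\<^bsub>M\<^esub> V \<subseteq> W"
        by (rule M.set_add_least[OF W(1)]) (use v lsub_zero[OF W(1)] in auto)
      thus False using V(3) ne lsub_subset[OF W(1)] by auto
    qed
    then obtain Y where Y: "lsub Y M" "simple (submod M Y)" "Y \<subseteq> V"
      using simple_submodule_exists[OF M V(1)] by blast
    have 0: "W \<inter> Y = {\<zero>}" using V(2) Y(3) lsub_zero[OF Y(1)] by blast
    let ?U = "U(n := Y)"
    have sub: "lsub (?U k) M" "simple (submod M (?U k))" if "k \<le> n" for k using U Y that by auto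
    have eq: "Pi\<^sub>E {..<n} ?U = Pi\<^sub>E {..<n} U" by (rule PiE_cong) auto
    have "inj_on (\<lambda>u. finsum M u {..<Suc n}) (Pi\<^sub>E {..<Suc n} ?U)"
      by (rule iffD2[OF M.inj_finsum_Suc[of n ?U, OF sub(1)]]) (use inj T 0 in \<open>simp_all add:
        eq\<close>)
    moreover have TS: "?T (Suc n) ?U = W <+>\<^bsub>M\<^esub> Y"
      using M.finsum_image(2) sub(1) eq T by simp
    ultimately have "R (W <+>\<^bsub>M\<^esub> Y)"
      unfolding R_def
      by (intro exI[of _ "Suc n"] exI) (use sub in \<open>auto simp: less_Suc_eq_le simp del:
        fun_upd_apply\<close>)
    hence "W <+>\<^bsub>M\<^esub> Y = W"
      by (rule max[OF M.lsub_sum[OF W(1) Y(1)] _ M.set_add_upper(1)[OF W(1) Y(1)]])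
    thus False using M.set_add_upper(2)[OF W(1) Y(1)] 0 simple_moduleD(2)[OF Y(2)] by auto
  qed
  thus ?thesis unfolding simple_decomposition_def bij_betw_def using U inj T by blast
qed

text \<open>The definite description is legitimate because every decomposition gives the same
  number: c_i is additive and takes the value 1 on the summands isomorphic to S_i and 0 on the
  others.\<close>

lemma simple_multiplicity_eq:
  assumes i: "i < r" and M: "fd M" and ss: "soc A M = carrier M"
  shows "simple_multiplicity A (S i) M = c i M"
proof -
  have eq: "card {k. k < n \<and> isom (submod M (U k)) (S i)} = c i M" if d: "simple_decomposition A M n U" for n U
  proof -
    have U: "\<And>k. k < n \<Longrightarrow> lsub (U k) M" "\<And>k. k < n \<Longrightarrow> simple (submod M (U k))"
      and b: "inj_on (\<lambda>u. finsum M u {..<n}) (Pi\<^sub>E {..<n} U)" "(\<lambda>u. finsum M u {..<n}) ` Pi\<^sub>E {..<n} U = carrier M"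
      using d unfolding simple_decomposition_def bij_betw_def by blast+
    have "c i M = (\<Sum>k<n. c i (submod M (U k)))"
      using c_finsum[OF i M U(1) b(1)] unfolding b(2) by simp
    also have "\<dots> = (\<Sum>k<n. if isom (submod M (U k)) (S i) then 1 else 0)"
      by (rule sum.cong) (use c_simple_iff[OF i U(2)] in auto)
    also have "\<dots> = card {k. k < n \<and> isom (submod M (U k)) (S i)}"
      by (simp add: sum.If_cases Int_def)
    finally show ?thesis by simp
  qed
  obtain n U where d: "simple_decomposition A M n U"
    using simple_decomposition_exists[OF M ss] by blast
  show ?thesis unfolding simple_multiplicity_def
  proof (rule the_equality)
    show "\<exists>n U. simple_decomposition A M n U \<and> c i M = card {k. k < n \<and> isom (submod M (U k)) (S i)}"
      by (intro exI[of _ n] exI[of _ U] conjI d eq[OF, symmetric])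
  qed (use eq in auto)
qed

lemma c_top:
  assumes M: "fd M"
  shows "fd (top_module A M)" "i < r \<Longrightarrow> c i (top_module A M) = t i M" "soc A (top_module A M) = carrier (top_module A M)"
proof -
  interpret M: left_module A M by (rule fd_lm[OF M])
  note q = quot_proj[OF M.left_module_axioms M.rad_submodule]
  show fd: "fd (top_module A M)" unfolding top_module_def by (rule fd_quot[OF M M.rad_submodule])
  show "c i (top_module A M) = t i M" if "i < r"
    using c_surj[OF that M q(1,2,3)] q(4) unfolding top_module_def t_def by simp
  interpret q: lm_hom A M "top_module A M" "\<lambda>x. rad A M +>\<^bsub>M\<^esub> x"
    unfolding top_module_def by (intro lm_homI M.left_module_axioms q)
  have "rad A (top_module A M) = (\<lambda>x. rad A M +>\<^bsub>M\<^esub> x) ` a_kernel M (top_module A M) (\<lambda>x. rad A M +>\<^bsub>M\<^esub> x)"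
    using rad_hom_image(3)[OF q.lm_hom_axioms M fd] q(3,4) unfolding top_module_def by simp
  thus "soc A (top_module A M) = carrier (top_module A M)"
    using rad_zero_semisimple[OF fd] q.ker_image by simp
qed

lemma c_soc_semisimple:
  assumes M: "lmod M"
  shows "soc A (submod M (soc A M)) = soc A M"
  using soc_eq_ann[OF left_module.submod_lm[OF M left_module.soc_submodule[OF M]]] soc_eq_ann[OF M]
  by (auto simp: ann_def)

lemma top_nonzero:
  fixes M (structure)
  assumes M: "fd M" and ne: "carrier M \<noteq> {\<zero>}"
  shows "\<exists>i<r. t i M > 0"
proof -
  interpret M: left_module A M by (rule fd_lm[OF M])
  have "carrier (top_module A M) \<noteq> {\<zero>\<^bsub>top_module A M\<^esub>}"
  proof
    note q = quot_proj[OF M.left_module_axioms M.rad_submodule, folded top_module_def]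
    assume "carrier (top_module A M) = {\<zero>\<^bsub>top_module A M\<^esub>}"
    hence R: "rad A M = carrier M" using q(4) mhom_closed[OF q(2)] by (auto simp: a_kernel_def')
    show False
      using R M.set_add_upper(2)[OF M.lsub_0 M.lsub_carrier] lsub_subset[OF M.lsub_sum[OF M.lsub_0
        M.lsub_carrier]] nakayama[OF M M.lsub_0] ne
      by simp
  qed
  thus ?thesis using c_nonzero[OF c_top(1)[OF M]] c_top(2)[OF M] by auto
qed

lemma simple_rad_count:
  assumes M: "simple M" and i: "i < r" shows "s i M = 0"
proof -
  interpret M: left_module A M by (rule simple_moduleD(1)[OF M])
  note fd = fd_simple[OF M]
  have "rad A M = {\<zero>\<^bsub>M\<^esub>}"
    using mhom_rad_simple[OF fd M mhom_id] lsub_zero[OF M.rad_submodule] by blast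
  thus ?thesis using cdim_zero_module[OF e_carrier(1)[OF i] fd_submod[OF fd M.lsub_0]] by simp
qed

section \<open>Top and socle vectors against the Perron vector\<close>

definition Er :: "nat \<Rightarrow> nat \<Rightarrow> real" where "Er i j = (if i < r \<and> j < r then real (E i j) else 0)"

definition tv :: "('a, 'm) module \<Rightarrow> nat \<Rightarrow> real" where "tv M i = (if i < r then real (t i M) else 0)"

definition sv :: "('a, 'm) module \<Rightarrow> nat \<Rightarrow> real" where "sv M i = (if i < r then real (s i M) else 0)"

lemma perron_Er: "perron r Er"
proof
  show "r > 0" by (rule r_pos)
  show "Er i j = Er j i" for i j using E_symmetric by (auto simp: Er_def)
  fix I assume "I \<subseteq> {..<r}" "I \<noteq> {}" "\<And>i j. i \<in> I \<Longrightarrow> j < r \<Longrightarrow> j \<notin> I \<Longrightarrow> Er i j = 0"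
  thus "I = {..<r}" by (intro E_irreducible) (auto simp: Er_def subset_iff)
qed (auto simp: Er_def)

theorem ext_finite_perron:
  fixes lam :: real
  assumes M: "fd M" and ind: "indec M" and np: "\<not> projective M"
    and ns: "\<And>l N. is_Omega_pow K A l M N \<Longrightarrow> \<not> simple N" and fin: "ext_finite K A M"
    and pp: "perron_pair r Er lam v"
  shows "perron.dot r v (sv M) = perron.dot r v (tv M)" "lam = 2" "soc A M = rad A M"
proof -
  interpret pp: perron_pair r Er lam v by (rule pp)
  have zM: "rad2 M = {\<zero>\<^bsub>M\<^esub>}" by (rule nonprojective_rad2[OF M ind np])
  obtain N :: "('a, 'k list) module" and \<phi> where N: "fd N" and \<phi>: "\<phi> \<in> Hom M N" "bij_betw \<phi> (carrier M) (carrier N)"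
    using klist_copy[OF M] by blast
  interpret \<phi>: lm_hom A M N \<phi> by (intro lm_homI fd_lm[OF M] fd_lm[OF N] \<phi>)
  have iso: "isom M N" using \<phi> by (auto simp: module_iso_def)
  have sur: "\<phi> ` carrier M = carrier N" using \<phi>(2) by (simp add: bij_betw_def)
  have zN: "rad2 N = {\<zero>\<^bsub>N\<^esub>}"
    using rad_hom_image(4)[OF \<phi>.lm_hom_axioms M N sur] zM \<phi> by simp
  have indN: "indec N" by (rule \<phi>.indec_of_bij[OF \<phi>(2) ind])
  have nsM: "\<not> simple M"
    using ns[of 0] N iso module_iso_simple[OF iso \<phi>.cod.left_module_axioms] by auto
  show "soc A M = rad A M" by (rule indecomposable_soc[OF M ind zM nsM])
  note ts = t_s_iso[OF M \<phi>.cod.left_module_axioms \<phi>]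
  have tsv: "tv N = tv M" "sv N = sv M" using ts by (auto simp: tv_def sv_def)
  have fdZ: "fd (syz N k)" for k by (rule syz_fd[OF N])
  have Z: "indec (syz N k) \<and> rad2 (syz N k) = {\<zero>\<^bsub>syz N k\<^esub>}" for k
  proof (induction k)
    case (Suc k)
    thus ?case using omega_step(2,3)[OF fdZ _ _ cov_cover[OF fdZ]] by simp
  qed (use indN zN in simp)
  have nsZ: "\<not> simple (syz N k)" for k by (rule ns[OF syz_omega[OF N iso]])
  have om: "sv (syz N (Suc k)) = tv (syz N k)"
    "i < r \<Longrightarrow> tv (syz N (Suc k)) i = pp.ap (tv (syz N k)) i - sv (syz N k) i" for k i
  proof -
    note o = omega_step(5,6)[OF fdZ[of k] conjunct1[OF Z] conjunct2[OF Z] cov_cover[OF fdZ[of k]], folded syz.simps(2), OF nsZ]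
    show "sv (syz N (Suc k)) = tv (syz N k)" using o(1) by (simp add: sv_def tv_def fun_eq_iff)
    assume i: "i < r"
    have "real (t i (syz N (Suc k))) + real (s i (syz N k)) = (\<Sum>j<r. real (t j (syz N k)) * real (E j i))"
      using arg_cong[OF o(2)[OF i], of real] by simp
    also have "\<dots> = pp.ap (tv (syz N k)) i"
      unfolding pp.ap_def
      by (rule sum.cong) (use i E_symmetric in \<open>simp_all add: Er_def tv_def\<close>)
    finally show "tv (syz N (Suc k)) i = pp.ap (tv (syz N k)) i - sv (syz N k) i"
      using i by (simp add: tv_def sv_def)
  qed
  define \<epsilon> where "\<epsilon> = Min (v ` {..<r})"
  have "v ` {..<r} \<noteq> {}" using pp.r by auto
  hence eps: "\<epsilon> > 0" "\<And>i. i < r \<Longrightarrow> \<epsilon> \<le> v i"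
    using pp.v_pos unfolding \<epsilon>_def by auto
  \<comment> \<open>A nonzero module has a nonzero top, whose multiplicities are integers; so some
    entry is at least 1 and the bound does not depend on the module.\<close>
  have lower: "\<epsilon> \<le> pp.dot v (tv L)" if L: "fd L" "indec L" for L :: "('a, 'k list) module"
  proof -
    obtain i where i: "i < r" "t i L > 0"
      using top_nonzero[OF L(1)] L(2) by (auto simp: indecomposable_module_def)
    have "\<epsilon> * 1 \<le> v i * tv L i"
      using i eps pp.v_pos[OF i(1)] by (intro mult_mono) (auto simp: tv_def)
    also have "\<dots> \<le> pp.dot v (tv L)"
      unfolding pp.dot_def
      by (rule member_le_sum) (use i less_imp_le[OF pp.v_pos] in \<open>auto simp: tv_def\<close>)
    finally show ?thesis by simp
  qed
  \<comment> \<open>Indices are shifted by one: \<open>x 0\<close> is the socle vector of N and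
    \<open>x (Suc k)\<close> the top vector of the k-th syzygy. The recurrence then holds from the
    start, because each socle vector is the preceding top vector. The same shift turns the bound n
    into \<open>Suc n\<close> below.\<close>
  define x where "x = (\<lambda>m. case m of 0 \<Rightarrow> sv N | Suc k \<Rightarrow> tv (syz N k))"
  have x: "x 0 = sv N" "\<And>k. x (Suc k) = tv (syz N k)" by (simp_all add: x_def)
  define b where "b = (\<lambda>m. pp.dot v (x m))"
  have b_pos: "\<epsilon> \<le> b (Suc k)" for k unfolding b_def x using lower[OF fdZ] Z by blast
  have supp: "x m i = 0" if "i \<ge> r" for m i
    using that by (cases m) (auto simp: x_def sv_def tv_def)
  have rec: "x (Suc (Suc m)) i = pp.ap (x (Suc m)) i - x m i" if "i < r" for m i
    using om(2)[OF that, of m] om(1) by (cases m) (auto simp: x_def)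
  have v_ap: "pp.dot v (pp.ap w) = lam * pp.dot v w" for w
  proof -
    have "pp.dot v (pp.ap w) = pp.dot (\<lambda>i. lam * v i) w"
      unfolding pp.dot_ap by (rule pp.dot_cong) (simp_all add: pp.v_eig)
    thus ?thesis by simp
  qed
  have b_rec: "b (Suc (Suc m)) = lam * b (Suc m) - b m" for m
  proof -
    have "b (Suc (Suc m)) = pp.dot v (\<lambda>i. pp.ap (x (Suc m)) i - x m i)"
      unfolding b_def by (rule pp.dot_cong) (simp_all add: rec)
    thus ?thesis by (simp add: v_ap b_def)
  qed
  obtain n where n: "\<And>k. k > n \<Longrightarrow> (\<Sum>i<r. t i (syz N k) * t i M) = (\<Sum>i<r. t i (syz N (Suc k)) * s i M)"
    using ext_finite_recursion[OF M zM fin N \<phi>] Z by blast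
  have D: "pp.dot (x 1) (x m) = pp.dot (x 0) (x (Suc m))" if m: "m > Suc n" for m
  proof -
    obtain k where k: "m = Suc k" "k > n" using m by (cases m) auto
    have dots: "pp.dot (tv M) (tv L) = real (\<Sum>i<r. t i L * t i M)" "pp.dot (sv M) (tv L) = real (\<Sum>i<r. t i L * s i M)"
      for L :: "('a, 'k list) module" by (simp_all add: pp.dot_def tv_def sv_def mult.commute)
    have "x 1 = tv M" "x 0 = sv M" using x tsv by simp_all
    thus ?thesis using n[OF k(2)] unfolding k(1) by (simp only: x(2) dots)
  qed
  have ratio: "b 1 * b m = b 0 * b (Suc m)" if "m > Suc n + (2 * r + 2 * r)" for m
    using b_pos[of "m - 1"] eps(1) that pp.recurrence_ratio[of x "Suc n", OF supp rec D]
    by (auto simp: b_def)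
  \<comment> \<open>Far enough for the ratio to hold at m and at m + 1. Three consecutive terms in
    geometric progression then turn the recurrence into a quadratic equation for q.\<close>
  define m where "m = Suc (Suc n + (2 * r + 2 * r))"
  have bm: "b m > 0" "b (Suc m) > 0" "b 1 > 0"
    using b_pos[of "m - 1"] b_pos[of m] b_pos[of 0] eps(1) by (auto simp: m_def)
  have r1: "b 1 * b m = b 0 * b (Suc m)" "b 1 * b (Suc m) = b 0 * b (Suc (Suc m))"
    by (rule ratio; simp add: m_def)+
  have "b 0 * b (Suc m) > 0" unfolding r1(1)[symmetric] using bm by simp
  hence b0: "b 0 > 0" using bm(2) by (simp add: zero_less_mult_iff)
  define q where "q = b 1 / b 0"
  have q: "q > 0" "b 1 = q * b 0" using bm b0 by (auto simp: q_def)
  have s1: "b (Suc m) = q * b m" "b (Suc (Suc m)) = q * b (Suc m)" using r1 q(2) b0 by auto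
  have "(q * q - lam * q + 1) * b m = 0"
    using b_rec[of m] unfolding s1(2) s1(1) by (simp add: algebra_simps)
  hence quad: "q * q - lam * q + 1 = 0" using bm by simp
  have bk: "b k = b 0 * q ^ k" for k
    using geometric_recurrence[of b q lam k, OF q(2) b_rec quad] by simp
  have "\<epsilon> \<le> b 0 * q ^ k" if "k > 0" for k
    using that b_pos[of "k - 1"] unfolding bk[of, symmetric] by simp
  hence q1: "q \<ge> 1" by (rule ratio_ge_one[where a = "b 0" and n = 0, OF eps(1) q(1)])
  \<comment> \<open>The quadratic equation is reciprocal, so 1/q is its other root and governs the
    cosyzygies.\<close>
  define p where "p = 1 / q"
  have p: "p > 0" "p * q = 1" using q by (auto simp: p_def)
  have "(p * p - lam * p + 1) * (q * q) = (p * q) * (p * q) - lam * q * (p * q) + q * q"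
    by (simp add: algebra_simps)
  also have "\<dots> = 0" using p quad by simp
  finally have quad': "p * p - lam * p + 1 = 0" using q(1) by simp
  \<comment> \<open>Carrying the product of v with the socle vector along serves two purposes: its
    positivity excludes simple modules, whose radical count is zero, and it becomes the product with
    the top vector at the next step.\<close>
  have inverse_chain: "\<exists>L :: ('a, 'k list) module. fd L \<and> indec L \<and> rad2 L = {\<zero>\<^bsub>L\<^esub>} \<and>
    pp.dot v (tv L) = b 1 * p ^ k \<and> pp.dot v (sv L) = b 1 * p ^ Suc k" for k
  proof (induction k)
    case 0
    show ?case using q(2) p(2) N indN zN by (fastforce simp: ac_simps b_def x)
  next
    case (Suc k)
    then obtain L :: "('a, 'k list) module" where L: "fd L" "indec L" "rad2 L = {\<zero>\<^bsub>L\<^esub>}"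
      and dL: "pp.dot v (tv L) = b 1 * p ^ k" "pp.dot v (sv L) = b 1 * p ^ Suc k" by blast
    have nsL: "\<not> simple L"
    proof
      assume sL: "simple L"
      have "pp.dot v (sv L) = pp.dot v (\<lambda>i. 0)"
        by (rule pp.dot_cong) (simp_all add: sv_def simple_rad_count[OF sL])
      thus False using dL(2) bm(3) p(1) by simp
    qed
    obtain L' :: "('a, 'k list) module" where L': "fd L'" "indec L'" "rad2 L' = {\<zero>\<^bsub>L'\<^esub>}"
      and st: "\<And>i. i < r \<Longrightarrow> t i L' = s i L" "\<And>i. i < r \<Longrightarrow> s i L' + t i L = (\<Sum>k<r. s k L * E k i)"
      using omega_inv_step[OF L nsL] by blast
    have tL: "pp.dot v (tv L') = b 1 * p ^ Suc k"
      unfolding dL(2)[symmetric] by (rule pp.dot_cong) (simp_all add: tv_def sv_def st(1))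
    have "sv L' i = pp.ap (sv L) i - tv L i" if i: "i < r" for i
    proof -
      have "real (s i L') + real (t i L) = (\<Sum>j<r. real (s j L) * real (E j i))"
        using arg_cong[OF st(2)[OF i], of real] by simp
      also have "\<dots> = pp.ap (sv L) i"
        unfolding pp.ap_def
        by (rule sum.cong) (use i E_symmetric in \<open>simp_all add: Er_def sv_def\<close>)
      finally show ?thesis using i by (simp add: tv_def sv_def)
    qed
    hence "pp.dot v (sv L') = pp.dot v (\<lambda>i. pp.ap (sv L) i - tv L i)"
      by (intro pp.dot_cong) simp_all
    also have "\<dots> = b 1 * p ^ k * (lam * p - 1)" by (simp add: v_ap dL algebra_simps)
    also have "lam * p - 1 = p * p" using quad' by simp
    finally show ?case using L' tL by fastforce
  qed
  have "\<epsilon> \<le> b 1 * p ^ k" for k using inverse_chain lower by metis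
  hence "p \<ge> 1" by (intro ratio_ge_one[OF eps(1) p(1), of])
  hence "q = 1" using q1 by (simp add: p_def)
  thus "lam = 2" "pp.dot v (sv M) = pp.dot v (tv M)" using quad q(2) tsv by (simp_all add: b_def x)
qed

end

theorem proposition3p7:
  fixes K :: "'k ring"
    and A :: "('k, 'a) module"
    and r :: nat
    and S :: "nat \<Rightarrow> ('a, 's) module"
    and M :: "('a, 'm) module"
  assumes "algebraically_closed K"
    and "fd_algebra K A"
    and "weakly_symmetric K A"
    and "indecomposable_algebra K A"
    and "ideal_prod A (ideal_prod A (jacobson_radical A) (jacobson_radical A)) (jacobson_radical A)
           = {\<zero>\<^bsub>A\<^esub>}"
    and "ideal_prod A (jacobson_radical A) (jacobson_radical A) \<noteq> {\<zero>\<^bsub>A\<^esub>}"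
    and "simple_representatives K A r S"
    and "fd_module K A M"
    and "indecomposable_module A M"
    and "\<not> projective_module K A M"
    and "\<And>l N. is_Omega_pow K A l M N \<Longrightarrow> \<not> simple_module A N"
    and "ext_finite K A M"
  shows "alpha1 K A r S M = beta1 K A r S M \<and> largest_eigenvalue (ext_matrix K A r S) = 2"
proof -
  interpret fd_algebra K A by (rule assms(2))
  interpret rad_cube_zero K A r S
  proof (intro rad_cube_zero.intro rad_cube_zero_axioms.intro)
    show "a \<otimes>\<^bsub>A\<^esub> b \<otimes>\<^bsub>A\<^esub> c = \<zero>\<^bsub>A\<^esub>" if "a \<in> J" "b \<in> J" "c \<in> J" for a b c
      using ideal_prod.prod[OF ideal_prod.prod[OF that(1,2)] that(3), of] assms(5) by blast
    show "\<exists>a\<in>J. \<exists>b\<in>J. a \<otimes>\<^bsub>A\<^esub> b \<noteq> \<zero>\<^bsub>A\<^esub>"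
    proof (rule ccontr)
      assume no: "\<not> ?thesis"
      have "x = \<zero>\<^bsub>A\<^esub>" if "x \<in> ideal_prod A J J" for x
        using that by (induction rule: ideal_prod.induct) (use no in auto)
      moreover have "\<zero>\<^bsub>A\<^esub> \<in> ideal_prod A J J"
        using lsub_zero[OF J_left_submodule] ideal_prod.prod[of "\<zero>\<^bsub>A\<^esub>" J
          "\<zero>\<^bsub>A\<^esub>" J A]
        by simp
      ultimately show False using assms(6) by blast
    qed
  qed (fact assms)+
  interpret p: perron r Er by (rule perron_Er)
  obtain lam v where "(\<forall>i<r. v i > 0) \<and> p.dot v v = 1 \<and> (\<forall>i. i < r \<longrightarrow> p.ap v i = lam * v i) \<and> (\<forall>y. p.dot y (p.ap y) \<le> lam * p.dot y y)"
    using p.perron_eigenvector by blast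
  hence pp: "perron_pair r Er lam v" by unfold_locales auto
  note main = ext_finite_perron[OF assms(8-10) assms(11) assms(12) pp]
  \<comment> \<open>Only here do the entries defined through radical layers meet the dimensions of
    Ext^1 in the claim.\<close>
  have E: "ext_matrix K A r S = mat r r (\<lambda>(i, j). Er i j)"
    unfolding ext_matrix_def by (rule) (auto simp: ext_dim[unfolded One_nat_def] Er_def)
  note pm = perron_pair.perron_matrix[OF pp E]
  note M = assms(8)
  note lmM = fd_lm[OF M]
  \<comment> \<open>The multiplicity in the socle is the radical count \<open>s\<close>, since socle
    and radical of M coincide.\<close>
  have "simple_multiplicity A (S i) (submod M (soc A M)) = s i M" if "i < r" for i
    using simple_multiplicity_eq[OF that fd_submod[OF M left_module.soc_submodule[OF lmM]]]
      c_soc_semisimple[OF lmM] main(3)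
    by simp
  hence "alpha1 K A r S M = p.dot v (sv M)"
    unfolding alpha1_def p.dot_def by (intro sum.cong) (simp_all add: pm sv_def)
  moreover have "simple_multiplicity A (S i) (top_module A M) = t i M" if "i < r" for i
    using simple_multiplicity_eq[OF that c_top(1,3)[OF M]] c_top(2)[OF M that] by simp
  hence "beta1 K A r S M = p.dot v (tv M)"
    unfolding beta1_def p.dot_def by (intro sum.cong) (simp_all add: pm tv_def)
  ultimately show ?thesis using main(1,2) pm(1) by simp
qed

end
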